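(* Let Assumption 1 hold, let $f\in L^1((0,\infty);L^2(\Omega))$, $u_0\in L^2(\Omega)$ and let $u$ be the unique weak solution of (P). Then $\lim_{t\to\infty}\|u(t)\|_{L^2(\Omega)}=0$.
   Context: All functions are complex-valued; $\Omega\subseteq\mathbb{R}^N$ nonempty open. $C(m)=\{z\in\mathbb{C}:\Im z>0,\ 2\sqrt m\,\Im z\ge(1-m)|\Re z|\}$; for $0<m<1$, $D(m)=\{z:\Im z>0,\ 2\sqrt m\,\Im z=(1-m)\Re z\}$, $C_{\mathrm{int}}(m)=C(m)\setminus D(m)$. Assumption 1: $0\le m\le 1$; $|\Omega|<\infty$ if $m=0$; $a\in C(m)$ if $m\in\{0,1\}$, $a\in C_{\mathrm{int}}(m)$ if $0<m<1$; $V\in L^\infty(\Omega;\mathbb{R})+L^{p_V}(\Omega;\mathbb{R})$ with $p_V=2$ if $N=1$, $2+\beta$ ($\beta>0$) if $N=2$, $N$ if $N\ge3$. Problem (P): $\mathrm{i}u_t+\Delta u+Vu+a|u|^{-(1-m)}u=f$, $u=0$ on $\partial\Omega$, $u(0)=u_0$ ($|z|^{-(1-m)}z:=0$ at $0$ for $m>0$; for $m=0$ the term $|u|^{-1}u$ is replaced by some $U\in L^\infty$, $\|U\|_\infty\le1$, $U=u/|u|$ where $u\neq0$). A weak solution is the limit in $C([0,T];L^2(\Omega))$, for every $T>0$, of $H^2$-solutions $u_n$ (solutions with $u_n\in L^{m+1}_{\mathrm{loc}}([0,\infty);H^1_0\cap L^{m+1})\cap W^{1,\frac{m+1}{m}}_{\mathrm{loc}}([0,\infty);L^2+L^{\frac{m+1}{m}})$,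 $\Delta u_n(t)\in L^2$ a.e., satisfying the equation in $\mathscr D'$) with right-hand sides $f_n\to f$ in $L^1((0,T);L^2)$, and with $u(0)=u_0$; it exists and is unique. *)

theory Defs
  imports "HOL-Analysis.Analysis"
begin

definition pd :: "'b::euclidean_space \<Rightarrow> ('b \<Rightarrow> complex) \<Rightarrow> 'b \<Rightarrow> complex" where
  "pd b g x = vector_derivative (\<lambda>s. g (x + s *\<^sub>R b)) (at 0)"

coinductive smooth :: "('b::euclidean_space \<Rightarrow> complex) \<Rightarrow> bool" where
  "continuous_on UNIV g \<Longrightarrow>
   (\<And>b x. b \<in> Basis \<Longrightarrow> ((\<lambda>s. g (x + s *\<^sub>R b)) has_vector_derivative pd b g x) (at 0)) \<Longrightarrow>
   (\<And>b. b \<in> Basis \<Longrightarrow> smooth (pd b g)) \<Longrightarrow> smooth g"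

definition tsupport :: "('b::euclidean_space \<Rightarrow> complex) \<Rightarrow> 'b set" where
  "tsupport g = closure {x. g x \<noteq> 0}"

definition test_fun :: "'b::euclidean_space set \<Rightarrow> ('b \<Rightarrow> complex) \<Rightarrow> bool" where
  "test_fun S \<phi> \<longleftrightarrow> smooth \<phi> \<and> compact (tsupport \<phi>) \<and> tsupport \<phi> \<subseteq> S"

definition lap :: "('a::euclidean_space \<Rightarrow> complex) \<Rightarrow> 'a \<Rightarrow> complex" where
  "lap \<phi> x = (\<Sum>b\<in>Basis. pd b (pd b \<phi>) x)"

definition dt :: "(real \<times> 'a::euclidean_space \<Rightarrow> complex) \<Rightarrow> real \<times> 'a \<Rightarrow> complex" where
  "dt \<Phi> = pd (1, 0) \<Phi>"

definition lapx :: "(real \<times> 'a::euclidean_space \<Rightarrow> complex) \<Rightarrow> real \<times> 'a \<Rightarrow> complex" where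
  "lapx \<Phi> p = (\<Sum>b\<in>Basis. pd (0, b) (pd (0, b) \<Phi>) p)"

section \<open>Lebesgue spaces on \<Omega> (functions, equality a.e. not quotiented)\<close>

definition memLp :: "real \<Rightarrow> 'a::euclidean_space set \<Rightarrow> ('a \<Rightarrow> complex) \<Rightarrow> bool" where
  "memLp p \<Omega> g \<longleftrightarrow> g \<in> borel_measurable (lebesgue_on \<Omega>) \<and>
     (\<integral>\<^sup>+ x. ennreal (cmod (g x) powr p) \<partial>(lebesgue_on \<Omega>)) < \<infinity>"

definition Lpn :: "real \<Rightarrow> 'a::euclidean_space set \<Rightarrow> ('a \<Rightarrow> complex) \<Rightarrow> real" where
  "Lpn p \<Omega> g = (enn2real (\<integral>\<^sup>+ x. ennreal (cmod (g x) powr p) \<partial>(lebesgue_on \<Omega>))) powr (1 / p)"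

definition memLinf :: "'a::euclidean_space set \<Rightarrow> ('a \<Rightarrow> complex) \<Rightarrow> bool" where
  "memLinf \<Omega> g \<longleftrightarrow> g \<in> borel_measurable (lebesgue_on \<Omega>) \<and>
     (\<exists>C. AE x in lebesgue_on \<Omega>. cmod (g x) \<le> C)"

definition Linfn :: "'a::euclidean_space set \<Rightarrow> ('a \<Rightarrow> complex) \<Rightarrow> real" where
  "Linfn \<Omega> g = Inf {C. 0 \<le> C \<and> (AE x in lebesgue_on \<Omega>. cmod (g x) \<le> C)}"

text \<open>exponent q in (0, infinity] \<close>
definition memLq :: "ereal \<Rightarrow> 'a::euclidean_space set \<Rightarrow> ('a \<Rightarrow> complex) \<Rightarrow> bool" where
  "memLq q \<Omega> g = (if q = \<infinity> then memLinf \<Omega> g else memLp (real_of_ereal q) \<Omega> g)"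

definition Lqn :: "ereal \<Rightarrow> 'a::euclidean_space set \<Rightarrow> ('a \<Rightarrow> complex) \<Rightarrow> real" where
  "Lqn q \<Omega> g = (if q = \<infinity> then Linfn \<Omega> g else Lpn (real_of_ereal q) \<Omega> g)"

text \<open>A nonnegative function of time belongs to L^q(0,T).\<close>
definition in_time_Lq :: "ereal \<Rightarrow> real \<Rightarrow> (real \<Rightarrow> real) \<Rightarrow> bool" where
  "in_time_Lq q T F \<longleftrightarrow> F \<in> borel_measurable (lebesgue_on {0<..<T}) \<and>
     (if q = \<infinity> then (\<exists>C. AE t in lebesgue_on {0<..<T}. F t \<le> C)
      else (\<integral>\<^sup>+ t. ennreal (F t powr real_of_ereal q) \<partial>(lebesgue_on {0<..<T})) < \<infinity>)"

definition weak_grad :: "'a::euclidean_space set \<Rightarrow> ('a \<Rightarrow> complex) \<Rightarrow> ('a \<Rightarrow> 'a \<Rightarrow> complex) \<Rightarrow> bool" where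
  "weak_grad \<Omega> g G \<longleftrightarrow> (\<forall>b\<in>Basis. \<forall>\<phi>. test_fun \<Omega> \<phi> \<longrightarrow>
      integrable (lebesgue_on \<Omega>) (\<lambda>x. g x * pd b \<phi> x) \<and>
      integrable (lebesgue_on \<Omega>) (\<lambda>x. G x b * \<phi> x) \<and>
      integral\<^sup>L (lebesgue_on \<Omega>) (\<lambda>x. g x * pd b \<phi> x) = - integral\<^sup>L (lebesgue_on \<Omega>) (\<lambda>x. G x b * \<phi> x))"

definition H10 :: "'a::euclidean_space set \<Rightarrow> ('a \<Rightarrow> complex) \<Rightarrow> bool" where
  "H10 \<Omega> g \<longleftrightarrow> memLp 2 \<Omega> g \<and> (\<exists>G. weak_grad \<Omega> g G \<and> (\<forall>b\<in>Basis. memLp 2 \<Omega> (\<lambda>x. G x b)) \<and>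
      (\<forall>e>0. \<exists>\<phi>. test_fun \<Omega> \<phi> \<and>
          Lpn 2 \<Omega> (\<lambda>x. g x - \<phi> x) + (\<Sum>b\<in>Basis. Lpn 2 \<Omega> (\<lambda>x. G x b - pd b \<phi> x)) < e))"

definition Cset :: "real \<Rightarrow> complex set" where
  "Cset m = {z. Im z > 0 \<and> 2 * sqrt m * Im z \<ge> (1 - m) * \<bar>Re z\<bar>}"

definition Dset :: "real \<Rightarrow> complex set" where
  "Dset m = {z. Im z > 0 \<and> 2 * sqrt m * Im z = (1 - m) * Re z}"

definition Cint :: "real \<Rightarrow> complex set" where
  "Cint m = Cset m - Dset m"

definition pot_ok :: "'a::euclidean_space set \<Rightarrow> ('a \<Rightarrow> real) \<Rightarrow> bool" where
  "pot_ok \<Omega> V \<longleftrightarrow> (\<exists>V1 V2. (\<forall>x\<in>\<Omega>. V x = V1 x + V2 x) \<and>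
      memLinf \<Omega> (\<lambda>x. complex_of_real (V1 x)) \<and>
      (\<exists>pV. (if DIM('a) = 1 then pV = 2 else if DIM('a) = 2 then (\<exists>\<beta>>0. pV = 2 + \<beta>)
             else pV = real DIM('a)) \<and> memLp pV \<Omega> (\<lambda>x. complex_of_real (V2 x))))"

definition assumption1 :: "'a::euclidean_space set \<Rightarrow> real \<Rightarrow> complex \<Rightarrow> ('a \<Rightarrow> real) \<Rightarrow> bool" where
  "assumption1 \<Omega> m a V \<longleftrightarrow> open \<Omega> \<and> \<Omega> \<noteq> {} \<and> 0 \<le> m \<and> m \<le> 1 \<and>
     (m = 0 \<longrightarrow> emeasure lebesgue \<Omega> < \<infinity>) \<and>
     (if m = 0 \<or> m = 1 then a \<in> Cset m else a \<in> Cint m) \<and> pot_ok \<Omega> V"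

definition gm :: "real \<Rightarrow> complex \<Rightarrow> complex" where
  "gm m z = (if z = 0 then 0 else complex_of_real (cmod z powr (m - 1)) * z)"

text \<open>conjugate exponent (m+1)/m, = infinity for m = 0\<close>
definition qexp :: "real \<Rightarrow> ereal" where
  "qexp m = (if m = 0 then \<infinity> else ereal ((m + 1) / m))"

definition jmeas :: "'a::euclidean_space set \<Rightarrow> (real \<Rightarrow> 'a \<Rightarrow> complex) \<Rightarrow> bool" where
  "jmeas \<Omega> u \<longleftrightarrow> (\<lambda>(t, x). u t x) \<in> borel_measurable (lebesgue_on ({0<..} \<times> \<Omega>))"

definition L1loc_L2 :: "'a::euclidean_space set \<Rightarrow> (real \<Rightarrow> 'a \<Rightarrow> complex) \<Rightarrow> bool" where
  "L1loc_L2 \<Omega> f \<longleftrightarrow> jmeas \<Omega> f \<and> (AE t in lebesgue_on {0<..}. memLp 2 \<Omega> (f t)) \<and>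
     (\<forall>T>0. (\<integral>\<^sup>+ t. ennreal (Lpn 2 \<Omega> (f t)) \<partial>(lebesgue_on {0<..<T})) < \<infinity>)"

definition L1_L2 :: "'a::euclidean_space set \<Rightarrow> (real \<Rightarrow> 'a \<Rightarrow> complex) \<Rightarrow> bool" where
  "L1_L2 \<Omega> f \<longleftrightarrow> jmeas \<Omega> f \<and> (AE t in lebesgue_on {0<..}. memLp 2 \<Omega> (f t)) \<and>
     (\<integral>\<^sup>+ t. ennreal (Lpn 2 \<Omega> (f t)) \<partial>(lebesgue_on {0<..})) < \<infinity>"

definition C_L2 :: "'a::euclidean_space set \<Rightarrow> (real \<Rightarrow> 'a \<Rightarrow> complex) \<Rightarrow> bool" where
  "C_L2 \<Omega> u \<longleftrightarrow> (\<forall>t\<ge>0. memLp 2 \<Omega> (u t)) \<and>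
     (\<forall>t\<ge>0. ((\<lambda>s. Lpn 2 \<Omega> (\<lambda>x. u s x - u t x)) \<longlongrightarrow> 0) (at t within {0..}))"

text \<open>H^2-solution of (P) with right-hand side f (initial value not prescribed).\<close>
definition H2sol :: "'a::euclidean_space set \<Rightarrow> real \<Rightarrow> ('a \<Rightarrow> real) \<Rightarrow> complex \<Rightarrow>
    (real \<Rightarrow> 'a \<Rightarrow> complex) \<Rightarrow> (real \<Rightarrow> 'a \<Rightarrow> complex) \<Rightarrow> bool" where
  "H2sol \<Omega> m V a f u \<longleftrightarrow>
   (\<exists>G U w w1 w2 u1 u2.
     jmeas \<Omega> u \<and> (\<forall>b\<in>Basis. jmeas \<Omega> (\<lambda>t x. G t x b)) \<and>
     jmeas \<Omega> w \<and> jmeas \<Omega> w1 \<and> jmeas \<Omega> w2 \<and> jmeas \<Omega> u1 \<and> jmeas \<Omega> u2 \<and>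
     \<comment> \<open>u in L^{m+1}_loc([0,infinity); H^1_0 \<inter> L^{m+1})\<close>
     (AE t in lebesgue_on {0<..}. H10 \<Omega> (u t) \<and> weak_grad \<Omega> (u t) (G t) \<and>
        (\<forall>b\<in>Basis. memLp 2 \<Omega> (\<lambda>x. G t x b)) \<and> memLp (m + 1) \<Omega> (u t)) \<and>
     (\<forall>T>0. in_time_Lq (ereal (m + 1)) T
        (\<lambda>t. Lpn 2 \<Omega> (u t) + (\<Sum>b\<in>Basis. Lpn 2 \<Omega> (\<lambda>x. G t x b)) + Lpn (m + 1) \<Omega> (u t))) \<and>
     \<comment> \<open>u in W^{1,q}_loc([0,infinity); L^2 + L^q), q = (m+1)/m, with time derivative w\<close>
     (\<forall>t>0. \<forall>x\<in>\<Omega>. u t x = u1 t x + u2 t x \<and> w t x = w1 t x + w2 t x) \<and>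
     (AE t in lebesgue_on {0<..}. memLp 2 \<Omega> (u1 t) \<and> memLq (qexp m) \<Omega> (u2 t) \<and>
                                  memLp 2 \<Omega> (w1 t) \<and> memLq (qexp m) \<Omega> (w2 t)) \<and>
     (\<forall>T>0. in_time_Lq (qexp m) T (\<lambda>t. Lpn 2 \<Omega> (u1 t) + Lqn (qexp m) \<Omega> (u2 t)) \<and>
            in_time_Lq (qexp m) T (\<lambda>t. Lpn 2 \<Omega> (w1 t) + Lqn (qexp m) \<Omega> (w2 t))) \<and>
     (\<forall>\<Phi>. test_fun ({0<..} \<times> \<Omega>) \<Phi> \<longrightarrow>
        integrable (lebesgue_on ({0<..} \<times> \<Omega>)) (\<lambda>(t, x). u t x * dt \<Phi> (t, x)) \<and>
        integrable (lebesgue_on ({0<..} \<times> \<Omega>)) (\<lambda>(t, x). w t x * \<Phi> (t, x)) \<and>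
        integral\<^sup>L (lebesgue_on ({0<..} \<times> \<Omega>)) (\<lambda>(t, x). u t x * dt \<Phi> (t, x)) =
          - integral\<^sup>L (lebesgue_on ({0<..} \<times> \<Omega>)) (\<lambda>(t, x). w t x * \<Phi> (t, x))) \<and>
     \<comment> \<open>Delta u(t) in L^2 for a.e. t\<close>
     (AE t in lebesgue_on {0<..}. \<exists>h. memLp 2 \<Omega> h \<and> (\<forall>\<phi>. test_fun \<Omega> \<phi> \<longrightarrow>
        integrable (lebesgue_on \<Omega>) (\<lambda>x. u t x * lap \<phi> x) \<and>
        integrable (lebesgue_on \<Omega>) (\<lambda>x. h x * \<phi> x) \<and>
        integral\<^sup>L (lebesgue_on \<Omega>) (\<lambda>x. u t x * lap \<phi> x) = integral\<^sup>L (lebesgue_on \<Omega>) (\<lambda>x. h x * \<phi> x))) \<and>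
     \<comment> \<open>selection U of the sign for m = 0\<close>
     (m = 0 \<longrightarrow> jmeas \<Omega> U \<and> (\<forall>t>0. \<forall>x\<in>\<Omega>. cmod (U t x) \<le> 1 \<and>
                   (u t x \<noteq> 0 \<longrightarrow> U t x = u t x / complex_of_real (cmod (u t x))))) \<and>
     \<comment> \<open>the equation in the sense of distributions on (0,infinity) x \<Omega>\<close>
     (\<forall>\<Phi>. test_fun ({0<..} \<times> \<Omega>) \<Phi> \<longrightarrow>
        (let N = (\<lambda>t x. if m = 0 then U t x else gm m (u t x));
             E = (\<lambda>(t, x). - \<i> * u t x * dt \<Phi> (t, x) + u t x * lapx \<Phi> (t, x)
                    + complex_of_real (V x) * u t x * \<Phi> (t, x) + a * N t x * \<Phi> (t, x)
                    - f t x * \<Phi> (t, x))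
         in integrable (lebesgue_on ({0<..} \<times> \<Omega>)) E \<and> integral\<^sup>L (lebesgue_on ({0<..} \<times> \<Omega>)) E = 0)))"

definition weak_sol :: "'a::euclidean_space set \<Rightarrow> real \<Rightarrow> ('a \<Rightarrow> real) \<Rightarrow> complex \<Rightarrow>
    (real \<Rightarrow> 'a \<Rightarrow> complex) \<Rightarrow> ('a \<Rightarrow> complex) \<Rightarrow> (real \<Rightarrow> 'a \<Rightarrow> complex) \<Rightarrow> bool" where
  "weak_sol \<Omega> m V a f u0 u \<longleftrightarrow>
     C_L2 \<Omega> u \<and> (AE x in lebesgue_on \<Omega>. u 0 x = u0 x) \<and>
     (\<exists>us fs. (\<forall>n. H2sol \<Omega> m V a (fs n) (us n) \<and> L1loc_L2 \<Omega> (fs n) \<and> C_L2 \<Omega> (us n)) \<and>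
        (\<forall>T>0. ((\<lambda>n. \<integral>\<^sup>+ t. ennreal (Lpn 2 \<Omega> (\<lambda>x. fs n t x - f t x)) \<partial>(lebesgue_on {0<..<T}))
                  \<longlongrightarrow> 0) sequentially) \<and>
        (\<forall>T>0. ((\<lambda>n. SUP t\<in>{0..T}. ennreal (Lpn 2 \<Omega> (\<lambda>x. us n t x - u t x))) \<longlongrightarrow> 0) sequentially))"

end

(* The dissipation Im a * int |u|^(m+1) is integrable in time, so some window of fixed length h carries
   arbitrarily little of it. Testing the equation, averaged over such a window, with its own average bounds
   the gradient of the average (the potential is form bounded by a Morrey type argument), and a Poincare
   inequality on small balls turns small dissipation plus bounded gradient into smallness in L^2 of the average,
   without any boundedness of the domain. By monotonicity of the nonlinearity, differences of time translates
   contract up to the forcing, so late solutions oscillate little over time h and are themselves small at some time;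
   contraction keeps them small. All estimates are uniform over the approximating H^2 solutions. *)
theory Submission
  imports Defs
begin

text \<open>Two obstacles shape the argument. An approximating solution lies in H^1_0 only for
  almost every time, and its time derivative is not known to be square integrable, so it is no
  admissible test function for its own equation. The mean over a window of length h, by contrast,
  has the difference quotient of the solution as its time derivative, which is square integrable;
  even the energy inequality is obtained from windows, with h tending to 0. Secondly, the nonlinear
  term is bounded by a multiple of 1 + |u|, hence square integrable on bounded sets; this forces a
  radial cut-off in every identity and a final passage R to infinity.

  One identity serves two ends: its imaginary part loses the gradient and the real potential and
  yields the energy balance, its real part isolates the gradient. A gradient bound is called for
  because the dissipation controls |u|^2 only where |u| <= 1.

  The window length is taken from the modulus of continuity of the limit u on a compact time
  interval. The time by which smallness is reached is therefore fixed before an approximating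
  solution is selected.\<close>

abbreviation lint :: "('a::euclidean_space => 'b::{banach, second_countable_topology}) => 'b"
 where "lint f \<equiv> integral\<^sup>L lborel f"

abbreviation nint :: "('a::euclidean_space => ennreal) => ennreal" where "nint f \<equiv> integral\<^sup>N lborel f"

abbreviation intl :: "('a::euclidean_space => 'b::{banach, second_countable_topology}) => bool"
 where "intl f \<equiv> integrable lborel f"

abbreviation bm :: "('a::topological_space => 'b::topological_space) set" where "bm \<equiv> borel_measurable borel"

abbreviation cor :: "real => complex" where "cor \<equiv> of_real"

lemmas BI_integrable_add = Bochner_Integration.integrable_add
lemmas BI_integrable_bound = Bochner_Integration.integrable_bound
lemmas BI_integrable_diff = Bochner_Integration.integrable_diff
lemmas BI_integrable_minus = Bochner_Integration.integrable_minus
lemmas BI_integrable_sum = Bochner_Integration.integrable_sum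
lemmas BI_integral_add = Bochner_Integration.integral_add
lemmas BI_integral_cnj = Bochner_Integration.integral_cnj
lemmas BI_integral_cong = Bochner_Integration.integral_cong
lemmas BI_integral_diff = Bochner_Integration.integral_diff
lemmas BI_integral_nonneg = Bochner_Integration.integral_nonneg
lemmas BI_integral_sum = Bochner_Integration.integral_sum

section \<open>Calculus of smooth functions under the coinductive definition\<close>

lemma smooth_continuous: "smooth g ==> continuous_on UNIV g"
 by (erule smooth.cases) simp

lemma smooth_has_pd:
 "smooth g ==> b \<in> Basis ==> ((%s. g (x + s *\<^sub>R b)) has_vector_derivative pd b g x) (at 0)"
 by (erule smooth.cases) simp

lemma smooth_pd: "smooth g ==> b \<in> Basis ==> smooth (pd b g)"
 by (erule smooth.cases) simp

lemma pd_eqI: "((%s. g (x + s *\<^sub>R b)) has_vector_derivative D) (at 0) ==> pd b g x = D"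
 unfolding pd_def by (rule vector_derivative_at)

text \<open>Coinduction up to a witness: \<open>pd\<close> is a chosen derivative, so it suffices
  that the invariant contains some pointwise derivative, which uniqueness of derivatives identifies
  with \<open>pd b g\<close>. The design of \<open>X\<close> thus reduces to closure under
  differentiation.\<close>

lemma smoothI:
 assumes "X g"
  and "!!g. X g ==> continuous_on UNIV g"
  and "!!g b. X g ==> b \<in> Basis ==>
   \<exists>g'. X g' & (\<forall>x. ((%s. g (x + s *\<^sub>R b)) has_vector_derivative g' x) (at 0))"
 shows "smooth g"
 using assms(1)
proof (coinduction arbitrary: g)
 case (smooth g)
 have "\<exists>g'. X g' & pd b g = g' & (\<forall>x. ((%s. g (x + s *\<^sub>R b)) has_vector_derivative pd b g x) (at 0))"
  if b: "b \<in> Basis" for b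
 proof -
  obtain g' where g': "X g'" "!!x. ((%s. g (x + s *\<^sub>R b)) has_vector_derivative g' x) (at 0)"
   using assms(3)[OF smooth b] by blast
  then have "pd b g = g'" by (intro ext pd_eqI) simp
  with g' show ?thesis by auto
 qed
 then show ?case using assms(2)[OF smooth] by metis
qed

lemma smooth_const: "smooth (%x. c)"
proof (rule smoothI[where X = "%g. \<exists>c. g = (%x. c)"], goal_cases)
 case (3 g b)
 then show ?case by (auto intro!: exI[of _ "%x. 0"] derivative_eq_intros)
qed (auto)

lemma has_vector_derivative_sum_list:
 assumes "!!i. i \<in> set l ==> (f i has_vector_derivative f' i) F"
 shows "((%s. \<Sum>i\<leftarrow>l. f i s) has_vector_derivative (\<Sum>i\<leftarrow>l. f' i)) F"
 using assms by (induction l) (auto intro!: derivative_eq_intros)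

lemma continuous_on_sum_list:
 fixes f :: "'i => 'b::topological_space => 'c::real_normed_vector"
 assumes "!!i. i \<in> set l ==> continuous_on S (f i)"
 shows "continuous_on S (%s. \<Sum>i\<leftarrow>l. f i s)"
 using assms by (induction l) (auto intro!: continuous_intros)

text \<open>Products are not closed under partial derivatives, but finite sums of products are.\<close>
lemma smooth_sum_list_mult:
 assumes "\<forall>p\<in>set l. smooth (fst p) & smooth (snd p)"
 shows "smooth (%x. \<Sum>p\<leftarrow>l. fst p x * snd p x)"
proof (rule smoothI[where X = "%g. \<exists>l. (\<forall>p\<in>set l. smooth (fst p) & smooth (snd p)) &
  g = (%x. \<Sum>p\<leftarrow>l. fst p x * snd p x)"], goal_cases)
 case 1 then show ?case using assms by blast
next
 case (2 g)
 then show ?case by (auto intro!: continuous_on_sum_list continuous_on_mult intro: smooth_continuous)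
next
 case (3 g b)
 then obtain l where l: "\<forall>p\<in>set l. smooth (fst p) & smooth (snd p)"
  and g: "g = (%x. \<Sum>p\<leftarrow>l. fst p x * snd p x)" by blast
 define l' where "l' = map (%p. (fst p, pd b (snd p))) l @ map (%p. (pd b (fst p), snd p)) l"
 have "((%s. g (x + s *\<^sub>R b)) has_vector_derivative
   (\<Sum>p\<leftarrow>l. fst p x * pd b (snd p) x + pd b (fst p) x * snd p x)) (at 0)" for x
  unfolding g
 proof (rule has_vector_derivative_sum_list, goal_cases)
  case (1 p)
  have "((%s. fst p (x + s *\<^sub>R b) * snd p (x + s *\<^sub>R b)) has_vector_derivative
   (fst p (x + 0 *\<^sub>R b) * pd b (snd p) x + pd b (fst p) x * snd p (x + 0 *\<^sub>R b))) (at 0)"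
   using 1 l 3(2) by (intro has_vector_derivative_mult smooth_has_pd) auto
  then show ?case by simp
 qed
 moreover have "(\<Sum>p\<leftarrow>l. fst p x * pd b (snd p) x + pd b (fst p) x * snd p x) =
   (\<Sum>p\<leftarrow>l'. fst p x * snd p x)" for x
  by (simp add: l'_def sum_list_addf comp_def)
 moreover have "\<forall>p\<in>set l'. smooth (fst p) & smooth (snd p)"
  unfolding l'_def set_append set_map ball_Un ball_simps fst_conv snd_conv
  using l smooth_pd[OF _ 3(2)] by blast
 ultimately show ?case
  by (intro exI[of _ "%x. \<Sum>p\<leftarrow>l'. fst p x * snd p x"] conjI exI[of _ l']) simp_all
qed

lemma smooth_mult: "smooth f ==> smooth g ==> smooth (%x. f x * g x)"
 using smooth_sum_list_mult[of "[(f, g)]"] by simp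

lemma smooth_add: "smooth f ==> smooth g ==> smooth (%x. f x + g x)"
 using smooth_sum_list_mult[of "[(f, %x. 1), (g, %x. 1)]"] by (simp add: smooth_const)

lemma smooth_cmult: "smooth f ==> smooth (%x. c * f x)"
 by (intro smooth_mult smooth_const)

lemma smooth_prod: "finite I ==> (!!i. i \<in> I ==> smooth (f i)) ==> smooth (%x. \<Prod>i\<in>I. f i x)"
 by (induction rule: finite_induct) (auto intro: smooth_const smooth_mult)

lemma pd_mult:
 assumes "smooth f" "smooth g" "b \<in> Basis"
 shows "pd b (%x. f x * g x) x = pd b f x * g x + f x * pd b g x"
proof (rule pd_eqI)
 have "((%s. f (x + s *\<^sub>R b) * g (x + s *\<^sub>R b)) has_vector_derivative
   (f (x + 0 *\<^sub>R b) * pd b g x + pd b f x * g (x + 0 *\<^sub>R b))) (at 0)"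
  using assms by (intro has_vector_derivative_mult smooth_has_pd)
 then show "((%s. f (x + s *\<^sub>R b) * g (x + s *\<^sub>R b)) has_vector_derivative
   (pd b f x * g x + f x * pd b g x)) (at 0)" by (simp add: add.commute)
qed

lemma pd_add:
 assumes "smooth f" "smooth g" "b \<in> Basis"
 shows "pd b (%x. f x + g x) x = pd b f x + pd b g x"
 using assms by (intro pd_eqI has_vector_derivative_add smooth_has_pd)

lemma pd_cmult:
 assumes "smooth f" "b \<in> Basis"
 shows "pd b (%x. c * f x) x = c * pd b f x"
 using assms by (intro pd_eqI has_vector_derivative_mult_right smooth_has_pd)

lemma smooth_has_pd_cnj:
 assumes "smooth f" "b \<in> Basis"
 shows "((%s. cnj (f (x + s *\<^sub>R b))) has_vector_derivative cnj (pd b f x)) (at 0)"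
 using smooth_has_pd[OF assms]
 by (rule bounded_linear.has_vector_derivative[OF bounded_linear_cnj])

lemma pd_cnj:
 assumes "smooth f" "b \<in> Basis"
 shows "pd b (%x. cnj (f x)) x = cnj (pd b f x)"
 by (intro pd_eqI smooth_has_pd_cnj assms)

lemma smooth_cnj: "smooth f ==> smooth (%x. cnj (f x))"
proof (rule smoothI[where X = "%g. \<exists>f. smooth f & g = (%x. cnj (f x))"], goal_cases)
 case (2 g)
 then show ?case by (auto intro!: continuous_on_cnj intro: smooth_continuous)
next
 case (3 g b)
 then obtain f where f: "smooth f" "g = (%x. cnj (f x))" by blast
 then show ?case using smooth_has_pd_cnj[OF f(1) 3(3)] smooth_pd[OF f(1) 3(3)]
  by (intro exI[of _ "%x. cnj (pd b f x)"] conjI exI[of _ "pd b f"]) auto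
qed blast

lemma smooth_real_deriv:
 fixes th :: "real => complex"
 assumes "smooth th"
 shows "(th has_vector_derivative pd 1 th x) (at x)"
proof -
 have "((%s. th (x + s *\<^sub>R 1)) has_vector_derivative pd 1 th x) (at 0)"
  by (rule smooth_has_pd[OF assms]) simp
 then have "((%s. th (x + s *\<^sub>R 1)) \<circ> (%y. y - x) has_vector_derivative 1 *\<^sub>R pd 1 th x) (at x)"
  by (intro vector_diff_chain_at) (auto intro!: derivative_eq_intros)
 then show ?thesis by (simp add: o_def)
qed

lemma smooth_comp_real_deriv:
 fixes th :: "real => complex"
 assumes "smooth th" "(q has_real_derivative q') (at s)"
 shows "((%s. th (q s)) has_vector_derivative q' *\<^sub>R pd 1 th (q s)) (at s)"
 using vector_diff_chain_at[of q q' s th, OF _ smooth_real_deriv[OF assms(1)]] assms(2)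
 by (simp add: o_def has_real_derivative_iff_has_vector_derivative)

lemma smooth_inner: "smooth (%x. cor (x \<bullet> c))"
proof (rule smoothI[where X = "%g. g = (%x. cor (x \<bullet> c)) \<or> (\<exists>k. g = (%x. k))"], goal_cases)
 case (2 g)
 then show ?case by (auto intro!: continuous_intros)
next
 case (3 g b)
 then consider "g = (%x. cor (x \<bullet> c))" | k where "g = (%x. k)" by blast
 then show ?case
 proof cases
  case 1
  have "((%s. cor ((x + s *\<^sub>R b) \<bullet> c)) has_vector_derivative cor (b \<bullet> c)) (at 0)" for x
   by (intro has_vector_derivative_of_real) (auto intro!: derivative_eq_intros simp: inner_simps)
  then show ?thesis unfolding 1 by (intro exI[of _ "%x. cor (b \<bullet> c)"]) auto
 next
  case 2
  then show ?thesis by (intro exI[of _ "%x. 0"]) (auto intro!: derivative_eq_intros)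
 qed
qed auto

text \<open>Smooth functions of the quadratic form x . x, again closed up under finite sums.\<close>
lemma smooth_radial:
 fixes th :: "real => complex"
 assumes "smooth th"
 shows "smooth (%x::'a::euclidean_space. th ((x - c) \<bullet> (x - c)))"
proof (rule smoothI[where X = "%g. \<exists>l. (\<forall>p\<in>set l. smooth (fst p) & smooth (snd p)) &
  g = (%x::'a. \<Sum>p\<leftarrow>l. fst p ((x - c) \<bullet> (x - c)) * snd p x)"], goal_cases)
 case 1
 then show ?case using assms by (intro exI[of _ "[(th, %x. 1)]"]) (auto intro: smooth_const)
next
 case (2 g)
 have "continuous_on UNIV (%x::'a. th ((x - c) \<bullet> (x - c)))" if "smooth th" for th :: "real => complex"
  by (rule continuous_on_compose2[OF smooth_continuous[OF that]]) (auto intro!: continuous_intros)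
 with 2 show ?case by (auto intro!: continuous_on_sum_list continuous_on_mult intro: smooth_continuous)
next
 case (3 g b)
 then obtain l where l: "\<forall>p\<in>set l. smooth (fst p) & smooth (snd p)"
  and g: "g = (%x::'a. \<Sum>p\<leftarrow>l. fst p ((x - c) \<bullet> (x - c)) * snd p x)" by blast
 let ?q = "%x. cor (2 * ((x - c) \<bullet> b))"
 have q: "?q = (%x. 2 * (cor (x \<bullet> b) + cor (- (c \<bullet> b))))"
  by (auto simp: inner_simps)
 have sq: "smooth ?q" unfolding q by (intro smooth_cmult smooth_add smooth_inner smooth_const)
 define l' where "l' = map (%p. (fst p, pd b (snd p))) l @ map (%p. (pd 1 (fst p), %x. ?q x * snd p x)) l"
 have "((%s. g (x + s *\<^sub>R b)) has_vector_derivative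
   (\<Sum>p\<leftarrow>l. fst p ((x - c) \<bullet> (x - c)) * pd b (snd p) x + pd 1 (fst p) ((x - c) \<bullet> (x - c)) * (?q x * snd p x))) (at 0)" for x
  unfolding g
 proof (rule has_vector_derivative_sum_list, goal_cases)
  case (1 p)
  have d: "((%s. ((x + s *\<^sub>R b) - c) \<bullet> ((x + s *\<^sub>R b) - c)) has_real_derivative 2 * ((x - c) \<bullet> b)) (at 0)"
  proof -
   have e: "((x + s *\<^sub>R b) - c) \<bullet> ((x + s *\<^sub>R b) - c) = (x - c) \<bullet> (x - c) + 2 * s * ((x - c) \<bullet> b) + s^2 * (b \<bullet> b)" for s
    by (simp add: inner_simps power2_eq_square algebra_simps inner_commute)
   show ?thesis unfolding e by (auto intro!: derivative_eq_intros)
  qed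
  have "((%s. fst p (((x + s *\<^sub>R b) - c) \<bullet> ((x + s *\<^sub>R b) - c)) * snd p (x + s *\<^sub>R b)) has_vector_derivative
   (fst p (((x + 0 *\<^sub>R b) - c) \<bullet> ((x + 0 *\<^sub>R b) - c)) * pd b (snd p) x +
    ((2 * ((x - c) \<bullet> b)) *\<^sub>R pd 1 (fst p) (((x + 0 *\<^sub>R b) - c) \<bullet> ((x + 0 *\<^sub>R b) - c))) * snd p (x + 0 *\<^sub>R b))) (at 0)"
   using 1 l 3(2) d by (intro has_vector_derivative_mult smooth_has_pd smooth_comp_real_deriv) auto
  then show ?case by (simp add: scaleR_conv_of_real mult_ac)
 qed
 moreover have "(\<Sum>p\<leftarrow>l. fst p ((x - c) \<bullet> (x - c)) * pd b (snd p) x + pd 1 (fst p) ((x - c) \<bullet> (x - c)) * (?q x * snd p x)) =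
   (\<Sum>p\<leftarrow>l'. fst p ((x - c) \<bullet> (x - c)) * snd p x)" for x
  by (simp add: l'_def sum_list_addf comp_def)
 moreover have "\<forall>p\<in>set l'. smooth (fst p) & smooth (snd p)"
  unfolding l'_def set_append set_map ball_Un ball_simps fst_conv snd_conv
  using l smooth_pd[OF _ 3(2)] smooth_pd[where b = "1::real"] smooth_mult[OF sq] by auto
 ultimately show ?case
  by (intro exI[of _ "%x. \<Sum>p\<leftarrow>l'. fst p ((x - c) \<bullet> (x - c)) * snd p x"] conjI exI[of _ l']) simp_all
qed

lemma pd_radial:
 fixes th :: "real => complex" and x :: "'a::euclidean_space"
 assumes "smooth th"
 shows "pd b (%x. th ((x - c) \<bullet> (x - c))) x = (2 * ((x - c) \<bullet> b)) *\<^sub>R pd 1 th ((x - c) \<bullet> (x - c))"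
proof (rule pd_eqI)
 have e: "((x + s *\<^sub>R b) - c) \<bullet> ((x + s *\<^sub>R b) - c) = (x - c) \<bullet> (x - c) + 2 * s * ((x - c) \<bullet> b) + s^2 * (b \<bullet> b)" for s
  by (simp add: inner_simps power2_eq_square algebra_simps inner_commute)
 have "((%s. (x - c) \<bullet> (x - c) + 2 * s * ((x - c) \<bullet> b) + s^2 * (b \<bullet> b)) has_real_derivative 2 * ((x - c) \<bullet> b)) (at 0)"
  by (auto intro!: derivative_eq_intros)
 from smooth_comp_real_deriv[OF assms this]
 show "((%s. th (((x + s *\<^sub>R b) - c) \<bullet> ((x + s *\<^sub>R b) - c))) has_vector_derivative
  (2 * ((x - c) \<bullet> b)) *\<^sub>R pd 1 th ((x - c) \<bullet> (x - c))) (at 0)"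
  unfolding e by simp
qed

text \<open>Every derivative contributes a factor \<open>k\<close>, hence the scalar
  \<open>c\<close> in the invariant.\<close>

lemma smooth_affine:
 fixes th :: "real => complex"
 assumes "smooth th"
 shows "smooth (%x. th (k * x + d))"
proof (rule smoothI[where X = "%g. \<exists>th c. smooth th & g = (%x. c * th (k * x + d))"], goal_cases)
 case 1
 show ?case by (intro exI[of _ th] exI[of _ 1]) (simp add: assms)
next
 case (2 g)
 then obtain th c where t: "smooth th" and g: "g = (%x. c * th (k * x + d))" by blast
 have "continuous_on UNIV (%x. th (k * x + d))"
  by (rule continuous_on_compose2[OF smooth_continuous[OF t]]) (auto intro!: continuous_intros)
 then show ?case unfolding g by (rule continuous_on_mult_left)
next
 case (3 g b)
 then obtain th c where t: "smooth th" and g: "g = (%x. c * th (k * x + d))" by blast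
 have "((%s. g (x + s *\<^sub>R b)) has_vector_derivative (c * of_real k) * pd 1 th (k * x + d)) (at 0)" for x
 proof -
  have "((%s. k * (x + s) + d) has_real_derivative k) (at 0)"
   by (auto intro!: derivative_eq_intros)
  from has_vector_derivative_mult_right[OF smooth_comp_real_deriv[OF t this], of c]
  show ?thesis using 3(2) unfolding g by (simp add: scaleR_conv_of_real mult_ac)
 qed
 then show ?case using smooth_pd[OF t, of 1] by (intro exI[of _ "%x. (c * of_real k) * pd 1 th (k * x + d)"]) auto
qed

lemma pd_affine:
 fixes th :: "real => complex"
 assumes "smooth th"
 shows "pd 1 (%x. th (k * x + d)) x = of_real k * pd 1 th (k * x + d)"
proof (rule pd_eqI)
 have "((%s. k * (x + s) + d) has_real_derivative k) (at 0)"
  by (auto intro!: derivative_eq_intros)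
 from smooth_comp_real_deriv[OF assms this]
 show "((%s. th (k * (x + s *\<^sub>R 1) + d)) has_vector_derivative of_real k * pd 1 th (k * x + d)) (at 0)"
  by (simp add: scaleR_conv_of_real)
qed

text \<open>For a function given as a primitive, smoothness is read off from its derivative; this is
  how \<open>step\<close> becomes smooth.\<close>

lemma smooth_real_intro:
 fixes th :: "real => complex"
 assumes "!!x. (th has_vector_derivative th' x) (at x)" "smooth th'"
 shows "smooth th & pd 1 th = th'"
proof -
 have d: "((%s. th (x + s *\<^sub>R 1)) has_vector_derivative th' x) (at 0)" for x
 proof -
  have "(th \<circ> (%s. x + s) has_vector_derivative 1 *\<^sub>R th' (x + 0)) (at 0)"
   by (intro vector_diff_chain_at) (use assms(1)[of x] in \<open>auto intro!: derivative_eq_intros\<close>)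
  then show ?thesis by (simp add: o_def)
 qed
 then have p: "pd 1 th = th'" by (intro ext pd_eqI)
 have "smooth th"
 proof (rule smooth.intros)
  show "continuous_on UNIV th"
   using assms(1) by (meson continuous_at_imp_continuous_on has_vector_derivative_continuous)
 qed (use d p assms(2) in auto)
 with p show ?thesis by simp
qed

section \<open>Cutoff functions\<close>

text \<open>The functions P(1/x) exp(-1/x), extended by zero to x <= 0. Letting P vary makes the
  family closed under differentiation, so that one coinduction covers the classical flat function,
  the case P = 1.\<close>

definition flatf :: "real poly => real => real" where
 "flatf P x = (if 0 < x then poly P (inverse x) * exp (- inverse x) else 0)"

lemma poly_exp_tendsto_0: "((%y. poly P y * exp (- y)) \<longlongrightarrow> (0::real)) at_top"
proof -
 have "((%y. coeff P i * (y ^ i / exp y)) \<longlongrightarrow> coeff P i * (0::real)) at_top" for i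
  by (intro tendsto_intros tendsto_power_div_exp_0)
 then have "((%y. \<Sum>i\<le>degree P. coeff P i * (y ^ i / exp y)) \<longlongrightarrow> (\<Sum>i\<le>degree P. coeff P i * 0)) at_top"
  by (intro tendsto_sum)
 moreover have "(\<Sum>i\<le>degree P. coeff P i * (y ^ i / exp y)) = poly P y * exp (- y)" for y
  by (simp add: poly_altdef sum_distrib_left sum_distrib_right exp_minus divide_inverse mult_ac)
 ultimately show ?thesis by simp
qed

lemma flatf_right_tendsto_0: "(flatf P \<longlongrightarrow> 0) (at_right 0)"
proof -
 have "((%x. poly P (inverse x) * exp (- inverse x)) \<longlongrightarrow> 0) (at_right 0)"
  by (rule filterlim_compose[OF poly_exp_tendsto_0 filterlim_inverse_at_top_right])
 moreover have "eventually (%x. poly P (inverse x) * exp (- inverse x) = flatf P x) (at_right 0)"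
  unfolding eventually_at_right_field by (auto simp: flatf_def intro!: exI[of _ 1])
 ultimately show ?thesis by (rule Lim_transform_eventually)
qed

text \<open>With y = 1/x one has d/dx = - y^2 d/dy, which turns P(y) exp(-y) into y^2 (P - P')(y)
  exp(-y); \<open>monom 1 2\<close> is the factor y^2.\<close>

lemma flatf_deriv: "(flatf P has_real_derivative flatf (monom 1 2 * (P - pderiv P)) x) (at x)"
proof (cases x "0::real" rule: linorder_cases)
 case less
 have "((%x. 0) has_real_derivative 0) (at x)" by simp
 then have "(flatf P has_real_derivative 0) (at x)"
  by (rule DERIV_cong_ev[THEN iffD1, rotated -1])
   (use less in \<open>auto simp: flatf_def eventually_nhds intro!: exI[of _ "{..<0}"]\<close>)
 then show ?thesis using less by (simp add: flatf_def)
next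
 case greater
 have "((%x. poly P (inverse x) * exp (- inverse x)) has_real_derivative
  flatf (monom 1 2 * (P - pderiv P)) x) (at x)"
  using greater by (auto intro!: derivative_eq_intros DERIV_chain2[OF poly_DERIV]
    simp: flatf_def poly_monom power2_eq_square field_simps)
 then show ?thesis
  by (rule DERIV_cong_ev[THEN iffD1, rotated -1])
   (use greater in \<open>auto simp: flatf_def eventually_nhds intro!: exI[of _ "{0<..}"]\<close>)
next
 case equal
 have "((%y. (flatf P y - flatf P 0) / (y - 0)) \<longlongrightarrow> 0) (at 0)"
 proof (rule filterlim_split_at_real)
  show "((%y. (flatf P y - flatf P 0) / (y - 0)) \<longlongrightarrow> 0) (at_left 0)"
   by (rule tendsto_eventually) (auto simp: flatf_def eventually_at_left_field intro!: exI[of _ "-1"])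
  \<comment> \<open>Dividing by y raises the polynomial in 1/y by one degree, so the difference
    quotient at 0 is again a member of the family and tends to 0.\<close>
  have "eventually (%y. flatf (monom 1 1 * P) y = (flatf P y - flatf P 0) / (y - 0)) (at_right 0)"
   unfolding eventually_at_right_field
   by (auto simp: flatf_def poly_monom field_simps intro!: exI[of _ 1])
  then show "((%y. (flatf P y - flatf P 0) / (y - 0)) \<longlongrightarrow> 0) (at_right 0)"
   by (rule Lim_transform_eventually[OF flatf_right_tendsto_0])
 qed
 then show ?thesis using equal by (simp add: has_field_derivative_iff flatf_def)
qed

lemma smooth_flatf: "smooth (%x. cor (flatf P x))"
proof (rule smoothI[where X = "%g. \<exists>P. g = (%x. cor (flatf P x))"], goal_cases)
 case 1 show ?case by blast
next
 case (2 g)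
 have "continuous_on UNIV (flatf P)" for P
  by (meson flatf_deriv DERIV_isCont continuous_at_imp_continuous_on)
 then show ?case using 2 by (auto intro!: continuous_intros)
next
 case (3 g b)
 then obtain P where g: "g = (%x. cor (flatf P x))" by blast
 have "((%s. g (x + s *\<^sub>R b)) has_vector_derivative cor (flatf (monom 1 2 * (P - pderiv P)) x)) (at 0)" for x
  unfolding g
 proof (rule has_vector_derivative_of_real)
  have "((%s. flatf P (x + s)) has_real_derivative flatf (monom 1 2 * (P - pderiv P)) (x + 0) * 1) (at 0)"
   by (rule DERIV_chain2[OF flatf_deriv]) (auto intro!: derivative_eq_intros)
  then show "((%s. flatf P (x + s *\<^sub>R b)) has_real_derivative flatf (monom 1 2 * (P - pderiv P)) x) (at 0)"
   using 3(2) by simp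
 qed
 then show ?case by blast
qed

definition bump :: "real => real" where
 "bump x = flatf 1 x * flatf 1 (1 - x)"

lemma smooth_bump: "smooth (%x. cor (bump x))"
proof -
 have "smooth (%x. cor (flatf 1 ((-1) * x + 1)))"
  by (rule smooth_affine[OF smooth_flatf])
 from smooth_mult[OF smooth_flatf this] show ?thesis by (simp add: bump_def algebra_simps)
qed

lemma bump_nonneg: "0 <= bump x"
 unfolding bump_def flatf_def by simp

lemma bump_pos: "0 < x ==> x < 1 ==> 0 < bump x"
 unfolding bump_def flatf_def by simp

lemma bump_eq_0: "x <= 0 \<or> 1 <= x ==> bump x = 0"
 unfolding bump_def flatf_def by (elim disjE) simp_all

lemma continuous_bump: "continuous_on S bump"
 using continuous_on_subset[OF continuous_on_Re[OF smooth_continuous[OF smooth_bump]], of S] by simp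

definition bumpI :: real where "bumpI = integral {0..1} bump"

lemma bumpI_pos: "0 < bumpI"
proof -
 have "integral {0..1} bump ~= 0"
 proof
  assume "integral {0..1} bump = 0"
  then have "bump (1/2) = 0"
   using integral_eq_0_iff[of 0 1 bump] bump_nonneg continuous_bump[of "{0..1}"] by simp
  with bump_pos[of "1/2"] show False by simp
 qed
 moreover have "0 <= integral {0..1} bump"
  by (rule integral_nonneg) (auto simp: bump_nonneg intro: integrable_continuous_real continuous_bump)
 ultimately show ?thesis by (simp add: bumpI_def)
qed

text \<open>The primitive of \<open>bump\<close> normalised to total mass 1, a smooth transition
  from 0 at x <= 0 to 1 at x >= 1. The cut-offs in space and in time are all built from it.\<close>

definition step :: "real => real" where
 "step x = integral {0..x} bump / bumpI"

lemma step_0: "x <= 0 ==> step x = 0"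
 by (cases "x = 0") (auto simp: step_def)

lemma integrable_bump: "bump integrable_on {a..b}"
 by (intro integrable_continuous_real continuous_bump)

lemma step_1: "1 <= x ==> step x = 1"
proof -
 assume x: "1 <= x"
 have "integral {0..x} bump = integral {0..1} bump + integral {1..x} bump"
  using x by (intro Henstock_Kurzweil_Integration.integral_combine[symmetric] integrable_bump) auto
 moreover have "integral {1..x} bump = integral {1..x} (%x. 0)"
  by (intro Henstock_Kurzweil_Integration.integral_cong) (auto simp: bump_eq_0)
 ultimately show ?thesis using bumpI_pos by (simp add: step_def bumpI_def)
qed

lemma step_deriv: "(step has_real_derivative bump x / bumpI) (at x)"
proof -
 \<comment> \<open>For negative x the interval {0..x} is empty. A base point below both 0 and x
   leaves the integral unchanged near x, since \<open>bump\<close> vanishes to the left of 0, and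
   makes x an interior point.\<close>
 define n where "n = -1 - \<bar>x\<bar>"
 define m where "m = 1 + \<bar>x\<bar>"
 have e: "integral {0..y} bump = integral {n..y} bump" if "n < y" for y
 proof (cases "0 <= y")
  case True
  have "integral {n..y} bump = integral {n..0} bump + integral {0..y} bump"
   using True by (intro Henstock_Kurzweil_Integration.integral_combine[symmetric] integrable_bump) (auto simp: n_def)
  moreover have "integral {n..0} bump = integral {n..0} (%x. 0)"
   by (intro Henstock_Kurzweil_Integration.integral_cong) (auto simp: bump_eq_0)
  ultimately show ?thesis by simp
 next
  case False
  have "integral {n..y} bump = integral {n..y} (%x. 0)"
   using False by (intro Henstock_Kurzweil_Integration.integral_cong) (auto simp: bump_eq_0)
  then show ?thesis using False by simp
 qed
 have "((%u. integral {n..u} bump) has_real_derivative bump x) (at x within {n..m})"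
  by (rule integral_has_real_derivative) (auto simp: n_def m_def continuous_bump)
 then have "((%u. integral {n..u} bump) has_real_derivative bump x) (at x)"
  by (subst (asm) at_within_Icc_at) (auto simp: n_def m_def)
 then have "((%u. integral {n..u} bump / bumpI) has_real_derivative bump x / bumpI) (at x)"
  by (rule DERIV_cdivide)
 then show ?thesis
  by (rule DERIV_cong_ev[THEN iffD1, rotated -1])
   (auto simp: step_def e eventually_nhds n_def intro!: exI[of _ "{n<..}"])
qed

lemma step_mono: "x <= y ==> step x <= step y"
 using bumpI_pos bump_nonneg
 by (intro DERIV_nonneg_imp_nondecreasing[of x y step]) (auto intro!: exI step_deriv)

lemma step_range: "0 <= step x" "step x <= 1"
 using step_mono[of x "max x 1"] step_1[of "max x 1"] step_mono[of "min x 0" x] step_0[of "min x 0"] by auto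

lemma smooth_step: "smooth (%x. cor (step x))"
 and pd_step: "pd 1 (%x. cor (step x)) x = cor (bump x / bumpI)"
proof -
 have "smooth (%x. cor (inverse bumpI) * cor (bump x))"
  by (rule smooth_cmult[OF smooth_bump])
 then have "smooth (%x. cor (bump x / bumpI))" by (simp add: field_simps)
 from smooth_real_intro[OF has_vector_derivative_of_real[OF step_deriv] this]
 show "smooth (%x. cor (step x))" "pd 1 (%x. cor (step x)) x = cor (bump x / bumpI)"
  by auto
qed

lemma bump_bounded: "\<exists>C. \<forall>x. bump x <= C"
proof -
 have "compact (bump ` {0..1})" by (intro compact_continuous_image continuous_bump) simp
 then have "bdd_above (bump ` {0..1})" by (intro bounded_imp_bdd_above compact_imp_bounded)
 then obtain C where C: "!!x. x \<in> {0..1} ==> bump x <= C"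
  unfolding bdd_above_def by blast
 have "bump x <= max C 0" for x
  using C[of x] bump_eq_0[of x] by (cases "x \<in> {0..1}") auto
 then show ?thesis by blast
qed

section \<open>Test functions\<close>

lemma tsupport_0: "x \<notin> tsupport g ==> g x = 0"
 unfolding tsupport_def using subsetD[OF closure_subset, of x "{x. g x ~= 0}"] by auto

lemma in_tsupport: "g x ~= 0 ==> x \<in> tsupport g"
 using tsupport_0 by blast

lemma tsupport_subsetI: "closed K ==> (!!x. x \<notin> K ==> g x = 0) ==> tsupport g \<subseteq> K"
 unfolding tsupport_def by (rule closure_minimal) auto

lemma closed_tsupport: "closed (tsupport g)"
 by (simp add: tsupport_def)

lemma test_funI:
 assumes "smooth g" "compact K" "K \<subseteq> S" "!!x. x \<notin> K ==> g x = 0"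
 shows "test_fun S g"
proof -
 have "tsupport g \<subseteq> K" by (rule tsupport_subsetI) (use assms compact_imp_closed in auto)
 moreover from this have "compact (tsupport g)"
  using compact_Int_closed[OF assms(2) closed_tsupport, of g] by (simp add: Int_absorb1)
 ultimately show ?thesis using assms by (auto simp: test_fun_def)
qed

lemma test_fun_smooth: "test_fun S g ==> smooth g"
 by (simp add: test_fun_def)

lemma test_fun_outside: "test_fun S g ==> x \<notin> S ==> g x = 0"
 using tsupport_0[of x g] by (auto simp: test_fun_def)

lemma test_fun_add:
 assumes "test_fun S f" "test_fun S g"
 shows "test_fun S (%x. f x + g x)"
proof (rule test_funI)
 show "compact (tsupport f \<union> tsupport g)" using assms by (auto simp: test_fun_def)
qed (use assms tsupport_0[of _ f] tsupport_0[of _ g] in \<open>auto simp: test_fun_def intro: smooth_add\<close>)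

lemma test_fun_mult:
 assumes "smooth f" "test_fun S g"
 shows "test_fun S (%x. f x * g x)"
 by (rule test_funI[where K = "tsupport g"])
  (use assms in \<open>auto simp: test_fun_def intro: smooth_mult dest: tsupport_0\<close>)

lemma test_fun_cmult: "test_fun S g ==> test_fun S (%x. c * g x)"
 by (rule test_fun_mult[OF smooth_const])

lemma test_fun_cnj:
 assumes "test_fun S g"
 shows "test_fun S (%x. cnj (g x))"
 by (rule test_funI[where K = "tsupport g"])
  (use assms in \<open>auto simp: test_fun_def intro: smooth_cnj dest: tsupport_0\<close>)

lemma pd_0_outside:
 assumes "x \<notin> tsupport g"
 shows "pd b g x = 0"
proof (rule pd_eqI)
 have o: "open ((%s. x + s *\<^sub>R b) -` (- tsupport g))"
  by (intro open_vimage) (auto simp: closed_tsupport intro!: continuous_intros)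
 have "((%s::real. 0::complex) has_vector_derivative 0) (at 0)" by simp
 then show "((%s. g (x + s *\<^sub>R b)) has_vector_derivative 0) (at 0)"
  by (rule has_vector_derivative_transform_within_open[OF _ o])
   (use assms in \<open>auto dest: tsupport_0\<close>)
qed

lemma test_fun_pd:
 assumes "test_fun S g" "b \<in> Basis"
 shows "test_fun S (pd b g)"
 by (rule test_funI[where K = "tsupport g"])
  (use assms in \<open>auto simp: test_fun_def intro: smooth_pd pd_0_outside\<close>)

lemma smooth_fst:
 fixes th :: "real => complex"
 assumes "smooth th"
 shows "smooth (%p::real \<times> 'a::euclidean_space. th (fst p))"
proof (rule smoothI[where X = "%g. \<exists>th. smooth th & g = (%p::real \<times> 'a. th (fst p))"], goal_cases)
 case 1 then show ?case using assms by blast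
next
 case (2 g)
 then obtain th where t: "smooth th" and g: "g = (%p::real \<times> 'a. th (fst p))" by blast
 show ?case unfolding g
  by (rule continuous_on_compose2[OF smooth_continuous[OF t]]) (auto intro!: continuous_intros)
next
 case (3 g b)
 then obtain th where t: "smooth th" and g: "g = (%p::real \<times> 'a. th (fst p))" by blast
 consider "b = (1, 0)" | c where "b = (0, c)" using 3(2) by (auto simp: Basis_prod_def)
 then show ?case
 proof cases
  case 1
  show ?thesis using smooth_has_pd[OF t, of 1] smooth_pd[OF t, of 1] unfolding g 1
   by (intro exI[of _ "%p. pd 1 th (fst p)"]) auto
 next
  case 2
  show ?thesis unfolding g 2 by (intro exI[of _ "%p. 0"]) (auto intro!: exI[of _ "%p. 0"] smooth_const)
 qed
qed

lemma smooth_snd: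
 fixes ph :: "'a::euclidean_space => complex"
 assumes "smooth ph"
 shows "smooth (%p::real \<times> 'a. ph (snd p))"
proof (rule smoothI[where X = "%g. \<exists>th. smooth th & g = (%p::real \<times> 'a. th (snd p))"], goal_cases)
 case 1 then show ?case using assms by blast
next
 case (2 g)
 then obtain th where t: "smooth th" and g: "g = (%p::real \<times> 'a. th (snd p))" by blast
 show ?case unfolding g
  by (rule continuous_on_compose2[OF smooth_continuous[OF t]]) (auto intro!: continuous_intros)
next
 case (3 g b)
 then obtain th where t: "smooth th" and g: "g = (%p::real \<times> 'a. th (snd p))" by blast
 consider "b = (1, 0)" | c where "b = (0, c)" "c \<in> Basis" using 3(2) by (auto simp: Basis_prod_def)
 then show ?case
 proof cases
  case 2
  show ?thesis using smooth_has_pd[OF t 2(2)] smooth_pd[OF t 2(2)] unfolding g 2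
   by (intro exI[of _ "%p. pd c th (snd p)"]) auto
 next
  case 1
  show ?thesis unfolding g 1 by (intro exI[of _ "%p. 0"]) (auto intro!: exI[of _ "%p. 0"] smooth_const)
 qed
qed

lemma test_fun_tensor:
 fixes th :: "real => complex"
 assumes "test_fun S th" "test_fun \<Omega> ph"
 shows "test_fun (S \<times> \<Omega>) (%p. th (fst p) * ph (snd p))"
proof (rule test_funI[where K = "tsupport th \<times> tsupport ph"])
 show "compact (tsupport th \<times> tsupport ph)"
  using assms by (auto simp: test_fun_def intro: compact_Times)
 show "smooth (%p. th (fst p) * ph (snd p))"
  using assms by (intro smooth_mult smooth_fst smooth_snd) (auto simp: test_fun_def)
qed (use assms in_tsupport[of th] in_tsupport[of ph] in \<open>auto simp: test_fun_def\<close>)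

lemma pd_tensor_fst:
 fixes th :: "real => complex"
 assumes "smooth th"
 shows "pd (1, 0) (%p. th (fst p) * ph (snd p)) p = pd 1 th (fst p) * ph (snd p)"
proof (rule pd_eqI)
 show "((%s. th (fst (p + s *\<^sub>R (1, 0))) * ph (snd (p + s *\<^sub>R (1, 0)))) has_vector_derivative
   pd 1 th (fst p) * ph (snd p)) (at 0)"
  using has_vector_derivative_mult_left[OF smooth_has_pd[OF assms, of 1 "fst p"], of "ph (snd p)"]
by simp
qed

lemma pd_tensor_snd:
 assumes "smooth ph" "b \<in> Basis"
 shows "pd (0, b) (%p. th (fst p) * ph (snd p)) p = th (fst p) * pd b ph (snd p)"
proof (rule pd_eqI)
 show "((%s. th (fst (p + s *\<^sub>R (0, b))) * ph (snd (p + s *\<^sub>R (0, b)))) has_vector_derivative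
   th (fst p) * pd b ph (snd p)) (at 0)"
  using has_vector_derivative_mult_right[OF smooth_has_pd[OF assms, of "snd p"], of "th (fst p)"] by simp
qed

text \<open>Continuous partial derivatives: move one coordinate at a time.\<close>
lemma smooth_has_derivative:
 assumes "smooth g"
 shows "(g has_derivative (%h. \<Sum>b\<in>Basis. (h \<bullet> b) *\<^sub>R pd b g x)) (at x)"
 unfolding has_derivative_at_alt
proof (intro conjI allI impI)
 show "bounded_linear (%h. \<Sum>b\<in>Basis. (h \<bullet> b) *\<^sub>R pd b g x)"
  by (intro bounded_linear_sum bounded_linear_scaleR_const bounded_linear_inner_left)
 fix e :: real assume e: "0 < e"
 define e' where "e' = e / DIM('a)"
 have e': "0 < e'" using e by (simp add: e'_def)
 have "\<exists>d>0. \<forall>y. dist y x < d --> dist (pd b g y) (pd b g x) < e'" if "b \<in> Basis" for b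
  using smooth_continuous[OF smooth_pd[OF assms that]] e' unfolding continuous_on_iff by (auto dest!: bspec[of _ _ x])
 then obtain d where d: "!!b. b \<in> Basis ==> d b > 0"
  "!!b y. b \<in> Basis ==> dist y x < d b ==> dist (pd b g y) (pd b g x) < e'" by metis
 define de where "de = Min (d ` Basis)"
 have de: "de > 0" using d(1) by (simp add: de_def)
 have ded: "de <= d b" if "b \<in> Basis" for b using that by (simp add: de_def)
 show "\<exists>d>0. \<forall>y. norm (y - x) < d -->
   norm (g y - g x - (\<Sum>b\<in>Basis. ((y - x) \<bullet> b) *\<^sub>R pd b g x)) <= e * norm (y - x)"
 proof (intro exI[of _ de] conjI allI impI de)
  fix y assume y: "norm (y - x) < de"
  define h where "h = y - x"
  define hh where "hh S = (\<Sum>b\<in>S. (h \<bullet> b) *\<^sub>R b)" for S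
  have "norm (g (x + hh S) - g x - (\<Sum>b\<in>S. (h \<bullet> b) *\<^sub>R pd b g x)) <= (\<Sum>b\<in>S. e' * \<bar>h \<bullet> b\<bar>)"
   if "finite S" "S \<subseteq> Basis" for S
   using that
  proof (induction S rule: finite_induct)
   case empty then show ?case by (simp add: hh_def)
  next
   case (insert c S)
   then have c: "c \<in> Basis" and S: "S \<subseteq> Basis" "c \<notin> S" "finite S" by auto
   define k where "k = h \<bullet> c"
   define f where "f s = g (x + hh S + s *\<^sub>R c) - s *\<^sub>R pd c g x" for s
   define I where "I = closed_segment 0 k"
   have f': "(f has_derivative (%r. r *\<^sub>R (pd c g (x + hh S + s *\<^sub>R c) - pd c g x))) (at s within I)" for s
   proof -
    have a: "((%r. g ((x + hh S + s *\<^sub>R c) + r *\<^sub>R c)) has_vector_derivative pd c g (x + hh S + s *\<^sub>R c)) (at 0)"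
     by (rule smooth_has_pd[OF assms c])
    have "((%r. g ((x + hh S + s *\<^sub>R c) + r *\<^sub>R c)) \<circ> (%y. y - s) has_vector_derivative
      1 *\<^sub>R pd c g (x + hh S + s *\<^sub>R c)) (at s)"
     by (rule vector_diff_chain_at) (use a in \<open>auto intro!: derivative_eq_intros\<close>)
    then have "((%r. g (x + hh S + r *\<^sub>R c)) has_vector_derivative pd c g (x + hh S + s *\<^sub>R c)) (at s)"
     by (simp add: o_def algebra_simps)
    then have "(f has_vector_derivative (pd c g (x + hh S + s *\<^sub>R c) - pd c g x)) (at s)"
     unfolding f_def by (auto intro!: derivative_eq_intros)
    then show ?thesis unfolding has_vector_derivative_def by (rule has_derivative_at_withinI)
   qed
   have "norm (f k - f 0) <= e' * norm (k - 0)"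
   proof (rule differentiable_bound[OF _ f'])
    show "convex I" "k \<in> I" "0 \<in> I" by (auto simp: I_def)
    fix s assume "s \<in> I"
    then have sk: "\<bar>s\<bar> <= \<bar>k\<bar>" by (auto simp: I_def closed_segment_eq_real_ivl split: if_splits)
    \<comment> \<open>Each coordinate of the intermediate point has modulus at most that of h, so
      the segments never leave the ball on which the partial derivatives are within e' of their
      values at x.\<close>
    have "norm (hh S + s *\<^sub>R c) <= norm h"
    proof (rule norm_le_componentwise)
     fix b :: 'a assume b: "b \<in> Basis"
     have "hh S \<bullet> b = (if b \<in> S then h \<bullet> b else 0)"
     proof -
      have "hh S \<bullet> b = (\<Sum>i\<in>S. if i = b then h \<bullet> b else 0)"
       unfolding hh_def inner_sum_left using S b by (intro sum.cong) (auto simp: inner_Basis)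
      then show ?thesis using S by simp
     qed
     then show "\<bar>(hh S + s *\<^sub>R c) \<bullet> b\<bar> <= \<bar>h \<bullet> b\<bar>"
      using S(2) b c sk by (auto simp: inner_simps inner_Basis k_def)
    qed
    then have "dist (x + hh S + s *\<^sub>R c) x < d c"
     using y ded[OF c] by (simp add: dist_norm h_def add.assoc)
    from d(2)[OF c this] have "norm (pd c g (x + hh S + s *\<^sub>R c) - pd c g x) <= e'" by (simp add: dist_norm)
    then show "onorm (%r. r *\<^sub>R (pd c g (x + hh S + s *\<^sub>R c) - pd c g x)) <= e'"
     by (intro onorm_le) (simp add: mult.commute[of "\<bar>_\<bar>"] mult_right_mono)
   qed
   then have "norm (g (x + hh (insert c S)) - g (x + hh S) - k *\<^sub>R pd c g x) <= e' * \<bar>h \<bullet> c\<bar>"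
    using S by (simp add: f_def hh_def k_def algebra_simps)
   moreover have "g (x + hh (insert c S)) - g x - (\<Sum>b\<in>insert c S. (h \<bullet> b) *\<^sub>R pd b g x) =
    (g (x + hh (insert c S)) - g (x + hh S) - k *\<^sub>R pd c g x) + (g (x + hh S) - g x - (\<Sum>b\<in>S. (h \<bullet> b) *\<^sub>R pd b g x))"
    using S by (simp add: k_def)
   moreover have "norm (g (x + hh S) - g x - (\<Sum>b\<in>S. (h \<bullet> b) *\<^sub>R pd b g x)) <= (\<Sum>b\<in>S. e' * \<bar>h \<bullet> b\<bar>)"
    using insert.IH S by blast
   ultimately have "norm (g (x + hh (insert c S)) - g x - (\<Sum>b\<in>insert c S. (h \<bullet> b) *\<^sub>R pd b g x)) <=
     e' * \<bar>h \<bullet> c\<bar> + (\<Sum>b\<in>S. e' * \<bar>h \<bullet> b\<bar>)"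
    by (simp only:) (rule norm_triangle_le, rule add_mono)
   then show ?case using S by simp
  qed
  from this[of Basis] have "norm (g (x + h) - g x - (\<Sum>b\<in>Basis. (h \<bullet> b) *\<^sub>R pd b g x)) <= (\<Sum>b\<in>Basis. e' * \<bar>h \<bullet> b\<bar>)"
   by (simp add: hh_def euclidean_representation)
  also have "... <= (\<Sum>b\<in>(Basis::'a set). e' * norm h)"
   using e' by (intro sum_mono mult_left_mono) (auto simp: Basis_le_norm)
  also have "... = e * norm h" by (simp add: e'_def)
  finally show "norm (g y - g x - (\<Sum>b\<in>Basis. ((y - x) \<bullet> b) *\<^sub>R pd b g x)) <= e * norm (y - x)"
   by (simp add: h_def)
 qed
qed

section \<open>Square-integrable functions\<close>

text \<open>The analysis takes place on the whole space, with Borel functions and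
  \<open>lborel\<close>; functions on \<Omega> enter later through representatives that vanish
  outside. This keeps restricted and completed measures out of every Fubini argument.\<close>

definition sqi :: "('a::euclidean_space => complex) => bool" where
 "sqi g \<longleftrightarrow> g \<in> bm & intl (%x. (cmod (g x))\<^sup>2)"

definition nrm :: "('a::euclidean_space => complex) => real" where
 "nrm g = sqrt (lint (%x. (cmod (g x))\<^sup>2))"

lemma sqi_measurable [measurable_dest]: "sqi g ==> g \<in> bm"
 by (simp add: sqi_def)

lemma nrm_nonneg [simp]: "0 <= nrm g"
 by (simp add: nrm_def)

lemma nrm_sq: "(nrm g)\<^sup>2 = (lint (%x. (cmod (g x))\<^sup>2))"
 by (simp add: nrm_def)

lemma nn_nrm_sq: "sqi g ==> (nint (%x. ennreal ((cmod (g x))\<^sup>2))) = ennreal ((nrm g)\<^sup>2)"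
 unfolding nrm_sq by (intro nn_integral_eq_integral) (auto simp: sqi_def)

lemma sqi_iff_nn:
 "sqi g \<longleftrightarrow> g \<in> bm & (nint (%x. ennreal ((cmod (g x))\<^sup>2))) < \<infinity>"
 unfolding sqi_def by (auto simp: integrable_iff_bounded)

lemma sqiI_le:
 assumes "f \<in> bm" "(nint (%x. ennreal ((cmod (f x))\<^sup>2))) <= ennreal (C\<^sup>2)" "0 <= C"
 shows "sqi f" "nrm f <= C"
proof -
 show s: "sqi f" using assms unfolding sqi_iff_nn by (auto intro: le_less_trans)
 have "ennreal ((nrm f)\<^sup>2) <= ennreal (C\<^sup>2)" using assms(2) nn_nrm_sq[OF s] by simp
 then have "(nrm f)\<^sup>2 <= C\<^sup>2" by simp
 then show "nrm f <= C" using assms(3) by (simp add: power2_le_iff_abs_le)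
qed

lemma sqi_dom:
 assumes "f \<in> bm" "sqi g" "AE x in lborel. cmod (f x) <= C * cmod (g x)" "0 <= C"
 shows "sqi f" "nrm f <= C * nrm g"
proof -
 have "(nint (%x. ennreal ((cmod (f x))\<^sup>2))) <= (nint (%x. ennreal (C\<^sup>2) * ennreal ((cmod (g x))\<^sup>2)))"
 proof (rule nn_integral_mono_AE)
  show "AE x in lborel. ennreal ((cmod (f x))\<^sup>2) <= ennreal (C\<^sup>2) * ennreal ((cmod (g x))\<^sup>2)"
   using assms(3)
  proof eventually_elim
   case (elim x)
   then have "(cmod (f x))\<^sup>2 <= (C * cmod (g x))\<^sup>2" by (intro power_mono) auto
   then show ?case by (simp add: power_mult_distrib flip: ennreal_mult)
  qed
 qed
 also have "... = ennreal ((C * nrm g)\<^sup>2)"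
  using assms(2) by (subst nn_integral_cmult) (auto simp: nn_nrm_sq power_mult_distrib sqi_def simp flip: ennreal_mult)
 finally have *: "(nint (%x. ennreal ((cmod (f x))\<^sup>2))) <= ennreal ((C * nrm g)\<^sup>2)" .
 show "sqi f" "nrm f <= C * nrm g"
  using sqiI_le[OF assms(1) *] assms(4) by auto
qed

lemma nn_cauchy_schwarz:
 assumes f: "sqi f" and g: "sqi g"
 shows "(nint (%x. ennreal (cmod (f x) * cmod (g x)))) <= ennreal (nrm f * nrm g)"
proof -
 note [measurable] = sqi_measurable[OF f] sqi_measurable[OF g]
 let ?I = "nint (%x. ennreal (cmod (f x)) * ennreal (cmod (g x)))"
 have "?I\<^sup>2 <= (nint (%x. ennreal (cmod (f x)) ^ 2)) * (nint (%x. ennreal (cmod (g x)) ^ 2))"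
  by (rule Cauchy_Schwarz_nn_integral) auto
 also have "... = ennreal ((nrm f * nrm g)\<^sup>2)"
  using f g by (simp add: ennreal_power nn_nrm_sq power_mult_distrib flip: ennreal_mult)
 finally have 1: "?I\<^sup>2 <= ennreal ((nrm f * nrm g)\<^sup>2)" .
 then have "?I ~= top" by (auto simp: top_unique)
 then obtain r where r: "?I = ennreal r" "0 <= r" by (cases "?I" rule: ennreal_cases) auto
 then have "r\<^sup>2 <= (nrm f * nrm g)\<^sup>2" using 1 by (simp add: ennreal_power)
 then have "r <= nrm f * nrm g" by (rule power2_le_imp_le) simp
 then show ?thesis using r by (simp flip: ennreal_mult)
qed

lemma cauchy_schwarz:
 assumes f: "sqi f" and g: "sqi g"
 shows "intl (%x. f x * g x)"
  and "(lint (%x. cmod (f x) * cmod (g x))) <= nrm f * nrm g"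
  and "cmod (lint (%x. f x * g x)) <= nrm f * nrm g"
proof -
 note [measurable] = sqi_measurable[OF f] sqi_measurable[OF g]
 show i: "intl (%x. f x * g x)"
  using nn_cauchy_schwarz[OF f g] unfolding integrable_iff_bounded
  by (auto simp: norm_mult intro: le_less_trans)
 have "ennreal (lint (%x. cmod (f x) * cmod (g x))) = (nint (%x. ennreal (cmod (f x) * cmod (g x))))"
  using integrable_norm[OF i] by (intro nn_integral_eq_integral[symmetric]) (auto simp: norm_mult)
 then have "ennreal (lint (%x. cmod (f x) * cmod (g x))) <= ennreal (nrm f * nrm g)"
  using nn_cauchy_schwarz[OF f g] by simp
 then show j: "(lint (%x. cmod (f x) * cmod (g x))) <= nrm f * nrm g"
  by (subst (asm) ennreal_le_iff) auto
 have "cmod (lint (%x. f x * g x)) <= (lint (%x. cmod (f x * g x)))"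
  by (rule integral_norm_bound)
 with j show "cmod (lint (%x. f x * g x)) <= nrm f * nrm g" by (simp add: norm_mult)
qed

lemma sqi_add:
 assumes f: "sqi f" and g: "sqi g"
 shows "sqi (%x. f x + g x)" and "nrm (%x. f x + g x) <= nrm f + nrm g"
proof -
 note [measurable] = sqi_measurable[OF f] sqi_measurable[OF g]
 have "(nint (%x. ennreal ((cmod (f x + g x))\<^sup>2))) <=
  (nint (%x. ennreal ((cmod (f x))\<^sup>2) + (2 * ennreal (cmod (f x) * cmod (g x)) + ennreal ((cmod (g x))\<^sup>2))))"
 proof (intro nn_integral_mono)
  fix x
  have "(cmod (f x + g x))\<^sup>2 <= (cmod (f x) + cmod (g x))\<^sup>2" by (intro power_mono norm_triangle_ineq) auto
  also have "... = (cmod (f x))\<^sup>2 + (2 * (cmod (f x) * cmod (g x)) + (cmod (g x))\<^sup>2)"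
   by (simp add: power2_sum)
  finally show "ennreal ((cmod (f x + g x))\<^sup>2) <=
   ennreal ((cmod (f x))\<^sup>2) + (2 * ennreal (cmod (f x) * cmod (g x)) + ennreal ((cmod (g x))\<^sup>2))"
   by (simp add: ennreal_leI flip: ennreal_plus ennreal_mult'' ennreal_numeral)
 qed
 also have "... = ennreal ((nrm f)\<^sup>2) + (2 * (nint (%x. ennreal (cmod (f x) * cmod (g x)))) + ennreal ((nrm g)\<^sup>2))"
  by (simp add: nn_integral_add nn_integral_cmult nn_nrm_sq f g)
 also have "... <= ennreal ((nrm f)\<^sup>2) + (2 * ennreal (nrm f * nrm g) + ennreal ((nrm g)\<^sup>2))"
  by (intro add_mono mult_left_mono nn_cauchy_schwarz f g) auto
 also have "... = ennreal ((nrm f + nrm g)\<^sup>2)"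
  by (simp add: power2_sum flip: ennreal_plus ennreal_mult'' ennreal_numeral)
 finally have *: "(nint (%x. ennreal ((cmod (f x + g x))\<^sup>2))) <= ennreal ((nrm f + nrm g)\<^sup>2)" .
 show "sqi (%x. f x + g x)" "nrm (%x. f x + g x) <= nrm f + nrm g"
  using sqiI_le[OF _ *] by auto
qed

lemma sqi_cmult: "sqi f ==> sqi (%x. c * f x)"
 using sqi_dom(1)[of "%x. c * f x" f "cmod c"] by (auto simp: norm_mult sqi_def)

lemma nrm_cmult: "nrm (%x. c * f x) = cmod c * nrm f"
 by (simp add: nrm_def norm_mult power_mult_distrib real_sqrt_mult)

lemma borel_measurable_cnj [measurable (raw)]:
 "f \<in> borel_measurable M ==> (%x. cnj (f x)) \<in> borel_measurable M"
 by (rule measurable_compose[OF _ borel_measurable_continuous_onI]) (auto intro!: continuous_intros)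

lemma sqi_cnj [simp]: "sqi (%x. cnj (f x)) \<longleftrightarrow> sqi f"
 using borel_measurable_cnj[of f borel] borel_measurable_cnj[of "%x. cnj (f x)" borel]
 unfolding sqi_def complex_cnj_cnj complex_mod_cnj by iprover

lemma nrm_cnj [simp]: "nrm (%x. cnj (f x)) = nrm f"
 by (simp add: nrm_def)

lemma nrm_minus_commute: "nrm (%x. f x - g x) = nrm (%x. g x - f x)"
 by (simp add: nrm_def norm_minus_commute)

lemma sqi_diff:
 assumes f: "sqi f" and g: "sqi g"
 shows "sqi (%x. f x - g x)" and "nrm (%x. f x - g x) <= nrm f + nrm g"
 using sqi_add[OF f sqi_cmult[OF g, of "-1"]] nrm_cmult[of "-1" g] by auto

lemma nrm_triangle:
 assumes "sqi f" "sqi g" "sqi h"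
 shows "nrm (%x. f x - h x) <= nrm (%x. f x - g x) + nrm (%x. g x - h x)"
 using sqi_add(2)[OF sqi_diff(1)[OF assms(1,2)] sqi_diff(1)[OF assms(2,3)]] by simp

lemma nrm_diff_le:
 assumes "sqi f" "sqi g"
 shows "nrm f <= nrm g + nrm (%x. f x - g x)"
 using sqi_add(2)[OF assms(2) sqi_diff(1)[OF assms]] by simp

lemma sqi_0 [simp]: "sqi (%x. 0)" and nrm_0 [simp]: "nrm (%x. 0) = 0"
 by (auto simp: sqi_def nrm_def)

lemma nrm_cong_AE: "AE x in lborel. f x = g x ==> f \<in> bm ==> g \<in> bm ==> nrm f = nrm g"
 unfolding nrm_def by (intro arg_cong[of _ _ sqrt] integral_cong_AE) auto

lemma test_fun_bounded:
 assumes "test_fun S g"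
 obtains C where "0 < C" "!!x. cmod (g x) <= C"
proof -
 have "compact (g ` tsupport g)"
  using assms by (intro compact_continuous_image)
   (auto simp: test_fun_def intro: continuous_on_subset[OF smooth_continuous])
 from compact_imp_bounded[OF this] obtain C where "\<forall>y\<in>g ` tsupport g. norm y <= C"
  unfolding bounded_iff by blast
 then have C: "!!x. x \<in> tsupport g ==> cmod (g x) <= C" by simp
 show ?thesis
 proof
  show "cmod (g x) <= max C 1" for x
   using C[of x] tsupport_0[of x g] by (cases "x \<in> tsupport g") auto
 qed simp
qed

lemma smooth_measurable: "smooth g ==> g \<in> bm"
 by (intro borel_measurable_continuous_onI smooth_continuous)

lemma sqi_bounded_support:
 assumes "g \<in> bm" "bounded K" "!!x. cmod (g x) <= C" "!!x. x \<notin> K ==> g x = 0"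
 shows "sqi g"
 unfolding sqi_def
proof
 obtain r where "\<forall>x\<in>K. norm x <= r" using assms(2) unfolding bounded_iff by blast
 then have r: "K \<subseteq> cball 0 r" by auto
 have "intl (%x. indicator (cball 0 r) x * C\<^sup>2)"
  by (intro integrable_mult_left integrable_real_indicator) (auto intro!: emeasure_bounded_finite[unfolded infinity_ennreal_def])
 then show "intl (%x. (cmod (g x))\<^sup>2)"
 proof (rule BI_integrable_bound)
  show "AE x in lborel. norm ((cmod (g x))\<^sup>2) <= norm (indicator (cball 0 r) x * C\<^sup>2)"
  proof (rule AE_I2)
   fix x show "norm ((cmod (g x))\<^sup>2) <= norm (indicator (cball 0 r) x * C\<^sup>2)"
    using power_mono[OF assms(3)[of x], of 2] assms(4)[of x] r
    by (cases "x \<in> K") (auto simp: indicator_def)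
  qed
 qed (use assms(1) in measurable)
qed fact

lemma test_fun_sqi: "test_fun S g ==> sqi g"
proof -
 assume t: "test_fun S g"
 obtain C where C: "0 < C" "!!x. cmod (g x) <= C" by (rule test_fun_bounded[OF t]) (rule that)
 show "sqi g"
 proof (rule sqi_bounded_support[where K = "tsupport g"])
  show "g \<in> bm" "bounded (tsupport g)"
   using t by (auto simp: test_fun_def intro: smooth_measurable compact_imp_bounded)
 qed (use C tsupport_0 in auto)
qed

section \<open>Radial cutoffs and the fundamental lemma\<close>

text \<open>A function of x . x rather than of the norm, so that it is smooth at the origin. The
  argument of \<open>step\<close> is at least 1 for |x| <= R and nonpositive from |x| = sqrt 2 R
  on.\<close>

definition chi :: "real => 'a::euclidean_space => real" where
 "chi R x = step (2 - (x \<bullet> x) / R\<^sup>2)"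

lemma chi_range [simp]: "0 <= chi R x" "chi R x <= 1"
 by (auto simp: chi_def step_range)

lemma chi_1: "0 < R ==> norm x <= R ==> chi R x = 1"
 unfolding chi_def by (rule step_1) (simp add: dot_square_norm divide_le_eq_1 power_mono)

lemma chi_0: "0 < R ==> 2 * R <= norm x ==> chi R x = 0"
 unfolding chi_def
proof (rule step_0)
 assume "0 < R" "2 * R <= norm x"
 then have "(2 * R)\<^sup>2 <= (norm x)\<^sup>2" by (intro power_mono) auto
 then have "2 * R\<^sup>2 <= x \<bullet> x"
  using zero_le_power2[of R] unfolding power_mult_distrib dot_square_norm by (simp del: zero_le_power2; linarith)
 then show "2 - x \<bullet> x / R\<^sup>2 <= 0" using \<open>0 < R\<close> by (simp add: field_simps)
qed

lemma smooth_step_radial: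
 "smooth (%x::'a::euclidean_space. cor (step (k * ((x - c) \<bullet> (x - c)) + d)))"
 by (rule smooth_radial[OF smooth_affine[OF smooth_step]])

lemma chi_eq: "(%x. cor (chi R x)) = (%x. cor (step ((- 1 / R\<^sup>2) * ((x - 0) \<bullet> (x - 0)) + 2)))"
 by (simp add: chi_def fun_eq_iff)

lemma smooth_chi: "smooth (%x. cor (chi R x))"
 unfolding chi_eq by (rule smooth_step_radial)

lemma chi_measurable [measurable]: "chi R \<in> bm"
proof -
 have "(%x. Re (cor (chi R x))) \<in> bm"
  using smooth_measurable[OF smooth_chi[of R]] by measurable
 then show ?thesis by simp
qed

text \<open>On the support of the derivative |x| <= 2 R, so the factor 2 (x . b) / R^2 from the
  quadratic form is at most 4 / R. The decay in R removes the commutator of the gradient with the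
  cut-off in the limit; the added 1 makes the constant positive.\<close>

lemma pd_chi_bound: "\<exists>C>0. \<forall>R\<ge>1. \<forall>b\<in>Basis. \<forall>x::'a::euclidean_space. cmod (pd b (%x. cor (chi R x)) x) <= C / R"
proof -
 obtain B where B: "!!x. bump x <= B" using bump_bounded by blast
 have B0: "0 <= B" using B[of 0] bump_nonneg[of 0] by linarith
 define C where "C = 4 * (B / bumpI) + 1"
 have C: "C > 0" using B0 bumpI_pos by (simp add: C_def add_nonneg_pos)
 have "cmod (pd b (%x. cor (chi R x)) x) <= C / R" if R: "R >= 1" and b: "b \<in> Basis" for R b and x :: 'a
 proof -
  let ?q = "(- 1 / R\<^sup>2) * ((x - 0) \<bullet> (x - 0)) + 2"
  have "pd b (%x. cor (chi R x)) x =
   (2 * ((x - 0) \<bullet> b)) *\<^sub>R (of_real (- 1 / R\<^sup>2) * cor (bump ?q / bumpI))"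
   unfolding chi_eq
   by (subst pd_radial[OF smooth_affine[OF smooth_step]], subst pd_affine[OF smooth_step], subst pd_step) simp
  then have e: "cmod (pd b (%x. cor (chi R x)) x) = 2 * \<bar>x \<bullet> b\<bar> / R\<^sup>2 * (bump ?q / bumpI)"
   using bump_nonneg[of ?q] bumpI_pos by (simp add: norm_mult norm_divide norm_power abs_mult)
  show ?thesis
  proof (cases "norm x <= 2 * R")
   case True
   have "\<bar>x \<bullet> b\<bar> <= 2 * R" using Basis_le_norm[OF b, of x] True by linarith
   then have "2 * \<bar>x \<bullet> b\<bar> / R\<^sup>2 <= 2 * (2 * R) / R\<^sup>2" using R by (intro divide_right_mono) auto
   also have "... = 4 / R" using R by (simp add: power2_eq_square)
   finally have "2 * \<bar>x \<bullet> b\<bar> / R\<^sup>2 * (bump ?q / bumpI) <= 4 / R * (B / bumpI)"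
    using B[of ?q] R bumpI_pos bump_nonneg[of ?q] by (intro mult_mono divide_right_mono) auto
   also have "... <= C / R" using R by (simp add: C_def field_simps)
   finally show ?thesis using e by simp
  next
   case False
   have "(2 * R)\<^sup>2 <= (norm x)\<^sup>2" using False R by (intro power_mono) auto
   then have "2 * R\<^sup>2 <= x \<bullet> x"
  using zero_le_power2[of R] unfolding power_mult_distrib dot_square_norm by (simp del: zero_le_power2; linarith)
   then have "?q <= 0" using R by (simp add: field_simps)
   then show ?thesis using e C R bump_eq_0[of ?q] by simp
  qed
 qed
 with C show ?thesis by blast
qed

text \<open>Lindelof supplies countably many balls whose closures lie in U and whose union is U.
  With one smooth bump s n i per ball, 1 - prod (1 - s n i) over i <= n equals 1 as soon as one
  factor vanishes, and it is supported in finitely many closed balls.\<close>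

lemma open_exhaust_test_fun:
 fixes U :: "'a::euclidean_space set"
 assumes "open U"
 obtains \<psi> :: "nat => 'a => real" where
  "!!n. test_fun U (%x. cor (\<psi> n x))" "!!n x. 0 <= \<psi> n x" "!!n x. \<psi> n x <= 1"
  "!!x. (%n. \<psi> n x) \<longlonglongrightarrow> indicator U x"
proof (cases "U = {}")
 case True
 show ?thesis
  by (rule that[of "%n x. 0"]) (auto simp: True intro!: test_funI[where K = "{}"] smooth_const)
next
 case False
 define F where "F = {ball c r |c r. 0 < r & cball c r \<subseteq> U}"
 have FU: "\<Union>F = U"
 proof
  show "U \<subseteq> \<Union>F"
  proof
   fix x assume "x \<in> U"
   then obtain e where "0 < e" "cball x e \<subseteq> U" using assms open_contains_cball by blast
   then show "x \<in> \<Union>F" unfolding F_def by (intro UnionI[of "ball x e"]) auto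
  qed
 qed (auto simp: F_def subset_iff)
 obtain F' where F': "F' \<subseteq> F" "countable F'" "\<Union>F' = \<Union>F"
  using Lindelof[of F] by (auto simp: F_def)
 have ne: "F' ~= {}" using F' FU False by auto
 have "\<exists>c r. 0 < r & cball c r \<subseteq> U & from_nat_into F' n = ball c r" for n
 proof -
  have "from_nat_into F' n \<in> F" using from_nat_into[OF ne, of n] F'(1) by blast
  then show ?thesis unfolding F_def by blast
 qed
 then obtain c r where cr: "!!n. 0 < r n" "!!n. cball (c n) (r n) \<subseteq> U" "!!n. from_nat_into F' n = ball (c n) (r n)"
  by metis
 \<comment> \<open>The slope n makes the bump equal to 1 once n (r^2 - |x - c|^2) >= 1, hence
   eventually at each point of the open ball, while it stays 0 outside the ball for every n.\<close>
 define s where "s n i x = step (- real n * ((x - c i) \<bullet> (x - c i)) + real n * (r i)\<^sup>2)" for n i x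
 define \<psi> where "\<psi> n x = 1 - (\<Prod>i\<le>n. 1 - s n i x)" for n x
 have s01: "0 <= 1 - s n i x" "1 - s n i x <= 1" for n i x using step_range by (auto simp: s_def)
 have s0: "s n i x = 0" if "x \<notin> cball (c i) (r i)" for n i x
 proof -
  have "(r i)\<^sup>2 <= (norm (x - c i))\<^sup>2"
   using that cr(1)[of i] by (intro power_mono) (auto simp: dist_norm norm_minus_commute)
  then show ?thesis unfolding s_def
   by (intro step_0) (simp add: dot_square_norm mult_left_mono)
 qed
 show ?thesis
 proof (rule that[of \<psi>])
  fix n
  show "test_fun U (%x. cor (\<psi> n x))"
  proof (rule test_funI[where K = "\<Union>i\<le>n. cball (c i) (r i)"])
   have sm: "smooth (%x. cor (s n i x))" for i
    unfolding s_def by (rule smooth_step_radial)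
   have eq: "(%x. cor (\<psi> n x)) = (%x. 1 + (- 1) * (\<Prod>i\<le>n. 1 + (- 1) * cor (s n i x)))"
    by (simp add: \<psi>_def fun_eq_iff)
   show "smooth (%x. cor (\<psi> n x))" unfolding eq
    by (intro smooth_add smooth_const smooth_cmult smooth_prod sm) auto
   show "compact (\<Union>i\<le>n. cball (c i) (r i))" by (intro compact_UN) auto
   show "(\<Union>i\<le>n. cball (c i) (r i)) \<subseteq> U" using cr(2) by auto
   fix x assume "x \<notin> (\<Union>i\<le>n. cball (c i) (r i))"
   then have "(\<Prod>i\<le>n. 1 - s n i x) = (\<Prod>i\<le>n. 1)" by (intro prod.cong) (auto simp: s0)
   then show "cor (\<psi> n x) = 0" by (simp add: \<psi>_def)
  qed
  fix x
  show "0 <= \<psi> n x" unfolding \<psi>_def using prod_le_1[of "{..n}" "%i. 1 - s n i x"] s01 by auto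
  show "\<psi> n x <= 1" unfolding \<psi>_def using prod_nonneg[of "{..n}" "%i. 1 - s n i x"] s01 by auto
 next
  fix x
  show "(%n. \<psi> n x) \<longlonglongrightarrow> indicator U x"
  proof (cases "x \<in> U")
   case True
   then obtain A where "A \<in> F'" "x \<in> A" using F'(3) FU by blast
   then obtain i where i: "x \<in> ball (c i) (r i)"
    using from_nat_into_surj[OF F'(2)] cr(3) by metis
   define d where "d = (r i)\<^sup>2 - (x - c i) \<bullet> (x - c i)"
   have "(norm (x - c i))\<^sup>2 < (r i)\<^sup>2"
    using i by (intro power_strict_mono) (auto simp: dist_norm norm_minus_commute)
   then have d: "0 < d" by (simp add: d_def dot_square_norm)
   obtain N :: nat where N: "1 / d <= real N" using real_arch_simple by blast
   have "\<psi> n x = 1" if "n >= max N i" for n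
   proof -
    have "1 / d <= real n" using N that by linarith
    then have "1 <= real n * d" using d by (simp add: field_simps)
    then have "s n i x = 1" unfolding s_def by (intro step_1) (simp add: d_def algebra_simps)
    then have "(\<Prod>i\<le>n. 1 - s n i x) = 0" using that by (intro prod_zero) auto
    then show ?thesis by (simp add: \<psi>_def)
   qed
   then have "eventually (%n. \<psi> n x = indicator U x) sequentially"
    unfolding eventually_sequentially using True by (metis indicator_simps(1))
   then show ?thesis by (rule tendsto_eventually)
  next
   case False
   have "s n i x = 0" for n i using False cr(2)[of i] by (intro s0) auto
   then show ?thesis using False by (simp add: \<psi>_def)
  qed
 qed
qed

lemma AE_zero_of_set_integrals:
 fixes h :: "'a::euclidean_space => real"
 assumes h: "intl h" and z: "!!A. A \<in> sets borel ==> (lint (%x. indicator A x * h x)) = 0"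
 shows "AE x in lborel. h x = 0"
proof -
 have *: "AE x in lborel. g x <= 0"
  if g: "intl g" and zg: "!!A. A \<in> sets borel ==> (lint (%x. indicator A x * g x)) = 0"
  for g :: "'a => real"
 proof -
  have [measurable]: "g \<in> bm" using borel_measurable_integrable[OF g] by simp
  let ?A = "{x. 0 < g x}"
  have A: "?A \<in> sets borel" by measurable
  have "intl (%x. indicator ?A x *\<^sub>R g x)" using A by (intro integrable_mult_indicator g) auto
  moreover have "AE x in lborel. 0 <= indicator ?A x * g x" by (auto simp: indicator_def)
  ultimately have "AE x in lborel. indicator ?A x * g x = 0"
   by (intro integral_nonneg_eq_0_iff_AE[THEN iffD1, OF _ _ zg[OF A]]) (simp_all add: real_scaleR_def)
  then show ?thesis by eventually_elim (auto simp: indicator_def not_less split: if_splits)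
 qed
 have "AE x in lborel. h x <= 0" "AE x in lborel. - h x <= 0"
  using *[of h] *[of "%x. - h x"] h z by auto
 then show ?thesis by eventually_elim auto
qed

text \<open>Intersecting with a ball makes g integrable. Integrals of g over open sets vanish by
  dominated convergence along the exhausting test functions, those over Borel sets by the pi-lambda
  argument, and so the real and imaginary parts are zero almost everywhere.\<close>

lemma fundamental_lemma:
 fixes g :: "'a::euclidean_space => complex"
 assumes "open \<Omega>" "sqi g" and z: "!!ph. test_fun \<Omega> ph ==> (lint (%x. g x * ph x)) = 0"
 shows "AE x in lborel. x \<in> \<Omega> --> g x = 0"
proof -
 have [measurable]: "g \<in> bm" using assms(2) by (rule sqi_measurable)
 have "AE x in lborel. x \<in> \<Omega> \<inter> ball 0 (real n) --> g x = 0" for n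
 proof -
  define W where "W = \<Omega> \<inter> ball 0 (real n)"
  have W: "open W" "bounded W" "W \<subseteq> \<Omega>" using assms(1) by (auto simp: W_def)
  have iW: "intl (%x. g x * indicator W x)"
  proof (rule cauchy_schwarz(1)[OF assms(2)])
   show "sqi (indicator W)"
    by (rule sqi_bounded_support[where C = 1 and K = W]) (use W in \<open>auto simp: indicator_def\<close>)
  qed
  have open0: "(lint (%x. indicator U x *\<^sub>R (g x * indicator W x))) = 0" if U: "open U" for U
  proof -
   obtain \<psi> where \<psi>: "!!n. test_fun (U \<inter> W) (%x. cor (\<psi> n x))" "!!n x. 0 <= \<psi> n x" "!!n x. \<psi> n x <= 1"
    "!!x. (%n. \<psi> n x) \<longlonglongrightarrow> indicator (U \<inter> W) x"
    using open_exhaust_test_fun[of "U \<inter> W"] U W by blast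
   have t: "test_fun \<Omega> (%x. cor (\<psi> n x))" for n
    using \<psi>(1)[of n] W by (auto simp: test_fun_def)
   have [measurable]: "\<psi> n \<in> bm" for n
   proof -
    have "(%x. Re (cor (\<psi> n x))) \<in> bm"
     using smooth_measurable[OF test_fun_smooth[OF \<psi>(1)[of n]]] by measurable
    then show ?thesis by simp
   qed
   have [measurable]: "U \<in> sets borel" "W \<in> sets borel" using U W by auto
   have b: "cmod (g x * of_real (\<psi> n x)) <= cmod (g x * indicator W x)" for n x
    using \<psi>(2)[of n x] \<psi>(3)[of n x] test_fun_outside[OF \<psi>(1)[of n], of x]
    by (cases "x \<in> W") (auto simp: norm_mult mult_left_le)
   have "(%n. lint (%x. g x * of_real (\<psi> n x))) \<longlonglongrightarrow> (lint (%x. g x * of_real (indicator (U \<inter> W) x)))"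
   proof (rule integral_dominated_convergence[where w = "%x. cmod (g x * indicator W x)"])
    show "AE x in lborel. (%n. g x * of_real (\<psi> n x)) \<longlonglongrightarrow> g x * of_real (indicator (U \<inter> W) x)"
     using \<psi>(4) by (intro AE_I2 tendsto_intros) auto
   qed (use iW b U W in \<open>auto intro: integrable_norm\<close>)
   then have "(lint (%x. g x * of_real (indicator (U \<inter> W) x))) = 0"
    using z[OF t] by (simp add: LIMSEQ_const_iff)
   moreover have "g x * of_real (indicator (U \<inter> W) x) = indicator U x *\<^sub>R (g x * indicator W x)" for x
    by (auto simp: indicator_def)
   ultimately show ?thesis by simp
  qed
  have borel0: "(lint (%x. indicator A x *\<^sub>R (g x * indicator W x))) = 0" if "A \<in> sets borel" for A
  proof -
   have 1: "Int_stable {S::'a set. open S}" "{S::'a set. open S} \<subseteq> Pow UNIV" by (auto simp: Int_stable_def)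
   have 2: "A \<in> sigma_sets UNIV {S. open S}" using that by (simp add: borel_def)
   show ?thesis
    using 1 2
   proof (induction rule: sigma_sets_induct_disjoint)
    case (compl A)
    then have A: "A \<in> sets borel" unfolding borel_def by (simp add: sets_measure_of)
    have "(lint (%x. indicator (UNIV - A) x *\<^sub>R (g x * indicator W x))) =
     (lint (%x. indicator UNIV x *\<^sub>R (g x * indicator W x) - indicator A x *\<^sub>R (g x * indicator W x)))"
     by (intro BI_integral_cong) (auto simp: indicator_def)
    also have "... = (lint (%x. indicator UNIV x *\<^sub>R (g x * indicator W x))) - (lint (%x. indicator A x *\<^sub>R (g x * indicator W x)))"
     using A iW by (intro BI_integral_diff integrable_mult_indicator) auto
    finally show ?case using open0[of UNIV] compl by simp
   next
    case (union A)
    then have A: "A i \<in> sets borel" for i unfolding borel_def by (auto simp: sets_measure_of)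
    have "set_lebesgue_integral lborel (\<Union>(range A)) (%x. g x * indicator W x) =
     (\<Sum>i. set_lebesgue_integral lborel (A i) (%x. g x * indicator W x))"
    proof (rule lebesgue_integral_countable_add)
     show "set_integrable lborel (\<Union>(range A)) (%x. g x * indicator W x)"
      unfolding set_integrable_def using A by (intro integrable_mult_indicator iW) auto
    qed (use A union(1) in \<open>auto simp: disjoint_family_on_def\<close>)
    then show ?case using union by (simp add: set_lebesgue_integral_def)
   qed (auto simp: open0)
  qed
  have "AE x in lborel. Re (g x * indicator W x) = 0"
  proof (rule AE_zero_of_set_integrals)
   fix A :: "'a set" assume A: "A \<in> sets borel"
   have "(lint (%x. indicator A x * Re (g x * indicator W x))) = (lint (%x. Re (indicator A x *\<^sub>R (g x * indicator W x))))"
    by simp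
   also have "... = Re (lint (%x. indicator A x *\<^sub>R (g x * indicator W x)))"
    using A by (intro integral_Re integrable_mult_indicator iW) auto
   finally show "(lint (%x. indicator A x * Re (g x * indicator W x))) = 0" using borel0[OF A] by simp
  qed (use iW in \<open>rule integrable_Re\<close>)
  moreover have "AE x in lborel. Im (g x * indicator W x) = 0"
  proof (rule AE_zero_of_set_integrals)
   fix A :: "'a set" assume A: "A \<in> sets borel"
   have "(lint (%x. indicator A x * Im (g x * indicator W x))) = (lint (%x. Im (indicator A x *\<^sub>R (g x * indicator W x))))"
    by simp
   also have "... = Im (lint (%x. indicator A x *\<^sub>R (g x * indicator W x)))"
    using A by (intro integral_Im integrable_mult_indicator iW) auto
   finally show "(lint (%x. indicator A x * Im (g x * indicator W x))) = 0" using borel0[OF A] by simp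
  qed (use iW in \<open>rule integrable_Im\<close>)
  ultimately show ?thesis unfolding W_def[symmetric]
   by eventually_elim (auto simp: indicator_def complex_eq_iff)
 qed
 then have "AE x in lborel. \<forall>n. x \<in> \<Omega> \<inter> ball 0 (real n) --> g x = 0" by (subst AE_all_countable) simp
 then show ?thesis
 proof eventually_elim
  case (elim x)
  obtain n :: nat where "norm x < real n" using reals_Archimedean2 by blast
  with elim show ?case by auto
 qed
qed

section \<open>Time averages of square-integrable functions\<close>

text \<open>Taken pointwise in x. Where s -> v s x fails to be integrable the value is the default
  0; under the assumptions of \<open>time_avg\<close> this concerns only a null set of x.\<close>

definition avg :: "real measure => (real => 'a => complex) => 'a => complex" where
 "avg \<mu> v x = (\<integral>s. v s x \<partial>\<mu>)"

locale time_avg = finite_measure \<mu> for \<mu> :: "real measure" +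
 fixes v :: "real => 'a::euclidean_space => complex"
 assumes sets_mu [measurable_cong]: "sets \<mu> = sets borel"
  and meas: "(%(s, x). v s x) \<in> bm"
  and AE_sqi: "AE s in \<mu>. sqi (v s)"
  and int_nrm: "integrable \<mu> (%s. nrm (v s))"
begin

sublocale P: pair_sigma_finite \<mu> "lborel :: 'a measure" ..

lemma meas_pair [measurable]: "(%(s, x). v s x) \<in> borel_measurable (\<mu> \<Otimes>\<^sub>M borel)"
 using meas by (simp add: borel_prod[symmetric] measurable_cong_sets[OF sets_pair_measure_cong[OF sets_mu refl] refl])

lemma meas2 [measurable]: "(%p. v (fst p) (snd p)) \<in> borel_measurable (\<mu> \<Otimes>\<^sub>M borel)"
 using meas_pair by (simp add: split_beta')

lemma measurable_section [measurable]: "v s \<in> bm"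
 using measurable_Pair2[OF meas_pair, of s] sets_eq_imp_space_eq[OF sets_mu] by simp

lemma nn_int_nrm: "(\<integral>\<^sup>+s. ennreal (nrm (v s)) \<partial>\<mu>) = ennreal (\<integral>s. nrm (v s) \<partial>\<mu>)"
 by (rule nn_integral_eq_integral[OF int_nrm]) simp

lemma avg_measurable [measurable]: "avg \<mu> v \<in> bm"
 unfolding avg_def[abs_def] by measurable

text \<open>Minkowski's integral inequality in L^2, for extended nonnegative integrals so that no
  integrability has to be known beforehand: the square becomes a double integral over (s, r), and
  Cauchy-Schwarz in x bounds the integrand by the product of the norms.\<close>

lemma nn_sq: "(nint (%x. (\<integral>\<^sup>+s. ennreal (cmod (v s x)) \<partial>\<mu>)\<^sup>2)) <= ennreal ((\<integral>s. nrm (v s) \<partial>\<mu>)\<^sup>2)"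
proof -
 let ?p = "%s x. ennreal (cmod (v s x))" and ?P = "%x. \<integral>\<^sup>+s. ennreal (cmod (v s x)) \<partial>\<mu>"
 have "(nint (%x. (?P x)\<^sup>2)) = (nint (%x. \<integral>\<^sup>+s. ?p s x * ?P x \<partial>\<mu>))"
  by (simp add: power2_eq_square nn_integral_multc)
 also have "... = (\<integral>\<^sup>+s. nint (%x. ?p s x * ?P x) \<partial>\<mu>)"
  by (rule P.Fubini') measurable
 also have "... = (\<integral>\<^sup>+s. nint (%x. \<integral>\<^sup>+r. ?p s x * ?p r x \<partial>\<mu>) \<partial>\<mu>)"
  by (simp add: nn_integral_cmult)
 also have "... = (\<integral>\<^sup>+s. \<integral>\<^sup>+r. nint (%x. ?p s x * ?p r x) \<partial>\<mu> \<partial>\<mu>)"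
  by (intro nn_integral_cong P.Fubini') measurable
 also have "... <= (\<integral>\<^sup>+s. \<integral>\<^sup>+r. ennreal (nrm (v s)) * ennreal (nrm (v r)) \<partial>\<mu> \<partial>\<mu>)"
 proof (rule nn_integral_mono_AE)
  show "AE s in \<mu>. (\<integral>\<^sup>+r. nint (%x. ?p s x * ?p r x) \<partial>\<mu>) <= (\<integral>\<^sup>+r. ennreal (nrm (v s)) * ennreal (nrm (v r)) \<partial>\<mu>)"
   using AE_sqi
  proof eventually_elim
   case (elim s)
   show ?case
   proof (rule nn_integral_mono_AE)
    show "AE r in \<mu>. (nint (%x. ?p s x * ?p r x)) <= ennreal (nrm (v s)) * ennreal (nrm (v r))"
     using AE_sqi
    proof eventually_elim
     case r: (elim r)
     show ?case using nn_cauchy_schwarz[OF elim r] by (simp add: ennreal_mult)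
    qed
   qed
  qed
 qed
 also have "... = ennreal ((\<integral>s. nrm (v s) \<partial>\<mu>)\<^sup>2)"
  using borel_measurable_integrable[OF int_nrm]
  by (simp add: nn_integral_cmult nn_integral_multc nn_int_nrm power2_eq_square ennreal_mult)
 finally show ?thesis .
qed

lemma avg_le: "ennreal (cmod (avg \<mu> v x)) <= (\<integral>\<^sup>+s. ennreal (cmod (v s x)) \<partial>\<mu>)"
proof (cases "integrable \<mu> (%s. v s x)")
 case True
 then show ?thesis unfolding avg_def by (rule integral_norm_bound_ennreal)
qed (simp add: avg_def not_integrable_integral_eq)

lemma sqi_avg: "sqi (avg \<mu> v)" and nrm_avg: "nrm (avg \<mu> v) <= (\<integral>s. nrm (v s) \<partial>\<mu>)"
proof -
 have "(nint (%x. ennreal ((cmod (avg \<mu> v x))\<^sup>2))) <= (nint (%x. (\<integral>\<^sup>+s. ennreal (cmod (v s x)) \<partial>\<mu>)\<^sup>2))"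
  using power_mono[OF avg_le, where n = 2] by (intro nn_integral_mono) (simp add: ennreal_power)
 also note nn_sq
 finally have *: "(nint (%x. ennreal ((cmod (avg \<mu> v x))\<^sup>2))) <= ennreal ((\<integral>s. nrm (v s) \<partial>\<mu>)\<^sup>2)" .
 show "sqi (avg \<mu> v)" "nrm (avg \<mu> v) <= (\<integral>s. nrm (v s) \<partial>\<mu>)"
  using sqiI_le[OF avg_measurable *] by (auto intro: integral_nonneg)
qed

lemma AE_integrable: "AE x in lborel. integrable \<mu> (%s. v s x)"
proof -
 have "(nint (%x. (\<integral>\<^sup>+s. ennreal (cmod (v s x)) \<partial>\<mu>)\<^sup>2)) ~= \<infinity>"
  using nn_sq by (auto simp: top_unique)
 then have "AE x in lborel. (\<integral>\<^sup>+s. ennreal (cmod (v s x)) \<partial>\<mu>)\<^sup>2 ~= \<infinity>"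
  by (intro nn_integral_PInf_AE) auto
 then show ?thesis
 proof eventually_elim
  case (elim x)
  then have "(\<integral>\<^sup>+s. ennreal (cmod (v s x)) \<partial>\<mu>) < \<infinity>"
   by (auto simp: power2_eq_square less_top ennreal_mult_eq_top_iff)
  moreover have "(%s. v s x) \<in> borel_measurable \<mu>" by measurable
  ultimately show ?case by (simp add: integrable_iff_bounded)
 qed
qed

text \<open>Fubini under a bare finiteness condition, since g is not always square integrable: the
  potential enters with g = V * ph, where finiteness comes from the form bound.\<close>

lemma pair_gen:
 assumes g [measurable]: "g \<in> bm"
  and fin: "(\<integral>\<^sup>+s. nint (%x. ennreal (cmod (v s x) * cmod (g x))) \<partial>\<mu>) < \<infinity>"
 shows "integrable \<mu> (%s. lint (%x. v s x * g x))"
  and "(lint (%x. avg \<mu> v x * g x)) = (\<integral>s. lint (%x. v s x * g x) \<partial>\<mu>)"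
  and "intl (%x. avg \<mu> v x * g x)"
proof -
 have int: "integrable (\<mu> \<Otimes>\<^sub>M lborel) (%(s, x). v s x * g x)"
  unfolding integrable_iff_bounded
 proof
  show "(%(s, x). v s x * g x) \<in> borel_measurable (\<mu> \<Otimes>\<^sub>M lborel)" by measurable
  have "(\<integral>\<^sup>+p. ennreal (norm (case p of (s, x) => v s x * g x)) \<partial>(\<mu> \<Otimes>\<^sub>M lborel)) =
   (\<integral>\<^sup>+s. nint (%x. ennreal (norm (v s x * g x))) \<partial>\<mu>)"
   by (subst lborel.nn_integral_fst[symmetric]) (auto simp: split_beta')
  with fin show "(\<integral>\<^sup>+p. ennreal (norm (case p of (s, x) => v s x * g x)) \<partial>(\<mu> \<Otimes>\<^sub>M lborel)) < \<infinity>"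
   by (simp add: norm_mult)
 qed
 show "integrable \<mu> (%s. lint (%x. v s x * g x))"
  using P.integrable_fst[OF int] by simp
 have eq: "(\<integral>s. v s x * g x \<partial>\<mu>) = avg \<mu> v x * g x" for x
  by (simp add: avg_def)
 show "intl (%x. avg \<mu> v x * g x)"
  using P.integrable_snd[OF int] by (simp add: avg_def)
 show "(lint (%x. avg \<mu> v x * g x)) = (\<integral>s. lint (%x. v s x * g x) \<partial>\<mu>)"
  using P.Fubini_integral[OF int] by (simp add: avg_def)
qed

lemma pair:
 assumes g: "sqi g"
 shows "integrable \<mu> (%s. lint (%x. v s x * g x))"
  and "(lint (%x. avg \<mu> v x * g x)) = (\<integral>s. lint (%x. v s x * g x) \<partial>\<mu>)"
proof -
 have "(\<integral>\<^sup>+s. nint (%x. ennreal (cmod (v s x) * cmod (g x))) \<partial>\<mu>) <= (\<integral>\<^sup>+s. ennreal (nrm (v s)) * ennreal (nrm g) \<partial>\<mu>)"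
 proof (rule nn_integral_mono_AE)
  show "AE s in \<mu>. (nint (%x. ennreal (cmod (v s x) * cmod (g x)))) <= ennreal (nrm (v s)) * ennreal (nrm g)"
   using AE_sqi by eventually_elim (use nn_cauchy_schwarz[OF _ g] in \<open>simp add: ennreal_mult\<close>)
 qed
 also have "... < \<infinity>"
  using borel_measurable_integrable[OF int_nrm]
  by (simp add: nn_integral_multc nn_int_nrm ennreal_mult_less_top)
 finally have fin: "(\<integral>\<^sup>+s. nint (%x. ennreal (cmod (v s x) * cmod (g x))) \<partial>\<mu>) < \<infinity>" .
 show "integrable \<mu> (%s. lint (%x. v s x * g x))"
  "(lint (%x. avg \<mu> v x * g x)) = (\<integral>s. lint (%x. v s x * g x) \<partial>\<mu>)"
  using pair_gen[OF sqi_measurable[OF g] fin] by auto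
qed

end

section \<open>The closure of test functions in the first-order Sobolev norm\<close>

text \<open>A first-order jet is indexed by \<open>idx\<close>: index 0 carries the function, b in Basis its b-th derivative.\<close>
definition idx :: "'a::euclidean_space set" where "idx = insert 0 Basis"

definition jet :: "('a::euclidean_space => complex) => 'a => 'a => complex" where
 "jet ph i = (if i = 0 then ph else pd i ph)"

text \<open>H^1_0 together with the gradient, as the closure of the test functions. When such a jet
  is to be used in place of a test function, a limit of test functions suffices and no further
  integration by parts arises.\<close>

definition H1 :: "'a::euclidean_space set => ('a => 'a => complex) => bool" where
 "H1 \<Omega> H \<longleftrightarrow> (\<forall>i\<in>idx. sqi (H i)) &
  (\<forall>e>0. \<exists>ph. test_fun \<Omega> ph & (\<forall>i\<in>idx. nrm (%x. H i x - jet ph i x) < e))"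

definition jn :: "('a::euclidean_space => 'a => complex) => real" where
 "jn H = (\<Sum>i\<in>idx. nrm (H i))"

lemma finite_idx [simp]: "finite idx" and zero_idx [simp]: "0 \<in> idx" and Basis_idx [simp]: "b \<in> Basis ==> b \<in> idx"
 by (auto simp: idx_def)

lemma sum_idx: "(\<Sum>i\<in>idx. f i) = f 0 + (\<Sum>b\<in>Basis. f b)"
 unfolding idx_def by (subst sum.insert) auto

lemma jet_0 [simp]: "jet ph 0 = ph" and jet_Basis [simp]: "b \<in> Basis ==> jet ph b = pd b ph"
 by (auto simp: jet_def)

lemma jn_nonneg [simp]: "0 <= jn H"
 by (auto simp: jn_def intro: sum_nonneg)

lemma nrm_le_jn: "i \<in> idx ==> nrm (H i) <= jn H"
 unfolding jn_def by (rule member_le_sum) auto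

lemma H1_sqi: "H1 \<Omega> H ==> i \<in> idx ==> sqi (H i)"
 by (simp add: H1_def)

lemma test_fun_jet: "test_fun \<Omega> ph ==> i \<in> idx ==> test_fun \<Omega> (jet ph i)"
 by (auto simp: jet_def idx_def intro: test_fun_pd)

lemma sqi_jet: "test_fun \<Omega> ph ==> i \<in> idx ==> sqi (jet ph i)"
 by (rule test_fun_sqi[OF test_fun_jet])

lemma H1_jet: "test_fun \<Omega> ph ==> H1 \<Omega> (jet ph)"
 unfolding H1_def by (auto intro: sqi_jet)

lemma jet_add: "smooth ph ==> smooth \<psi> ==> i \<in> idx ==> jet (%x. ph x + \<psi> x) i x = jet ph i x + jet \<psi> i x"
 by (auto simp: jet_def idx_def pd_add)

lemma jet_cmult: "smooth ph ==> i \<in> idx ==> jet (%x. c * ph x) i x = c * jet ph i x"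
 by (auto simp: jet_def idx_def pd_cmult)

lemma jet_add_cmult: "smooth ph ==> smooth \<psi> ==> i \<in> idx ==>
  jet (%x. ph x + c * \<psi> x) i x = jet ph i x + c * jet \<psi> i x"
 by (simp add: jet_add smooth_cmult jet_cmult)

lemma jet_cnj: "smooth ph ==> i \<in> idx ==> jet (%x. cnj (ph x)) i x = cnj (jet ph i x)"
 by (auto simp: jet_def idx_def pd_cnj)

lemma H1_seq:
 assumes "H1 \<Omega> H"
 obtains ph where "!!n::nat. test_fun \<Omega> (ph n)"
  "!!i. i \<in> idx ==> (%n. nrm (%x. H i x - jet (ph n) i x)) \<longlonglongrightarrow> 0"
  "!!i. i \<in> idx ==> (%n. nrm (jet (ph n) i)) \<longlonglongrightarrow> nrm (H i)"
proof -
 have "\<exists>ph. test_fun \<Omega> ph & (\<forall>i\<in>idx. nrm (%x. H i x - jet ph i x) < inverse (real (Suc n)))" for n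
  using assms unfolding H1_def by auto
 then obtain ph where ph: "!!n. test_fun \<Omega> (ph n)"
  "!!n i. i \<in> idx ==> nrm (%x. H i x - jet (ph n) i x) < inverse (real (Suc n))" by metis
 have t0: "(%n. nrm (%x. H i x - jet (ph n) i x)) \<longlonglongrightarrow> 0" if "i \<in> idx" for i
  by (rule tendsto_sandwich[OF _ _ tendsto_const LIMSEQ_inverse_real_of_nat])
   (use ph(2)[OF that] in \<open>auto intro!: always_eventually less_imp_le\<close>)
 show ?thesis
 proof (rule that[of ph])
  fix i :: 'a assume i: "i \<in> idx"
  have "norm (nrm (jet (ph n) i) - nrm (H i)) <= nrm (%x. H i x - jet (ph n) i x)" for n
   using nrm_diff_le[OF H1_sqi[OF assms i] sqi_jet[OF ph(1) i], of n]
    nrm_diff_le[OF sqi_jet[OF ph(1) i] H1_sqi[OF assms i], of n]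
    nrm_minus_commute[of "H i" "jet (ph n) i"] by simp
  then have "(%n. nrm (jet (ph n) i) - nrm (H i)) \<longlonglongrightarrow> 0"
   by (intro Lim_null_comparison[OF _ t0[OF i]] always_eventually allI)
  then show "(%n. nrm (jet (ph n) i)) \<longlonglongrightarrow> nrm (H i)" by (simp add: LIM_zero_iff)
 qed (use ph(1) t0 in auto)
qed

lemma H1_diff:
 assumes "H1 \<Omega> H" "H1 \<Omega> K"
 shows "H1 \<Omega> (%i x. H i x - K i x)"
 unfolding H1_def
proof (intro conjI ballI allI impI)
 show "sqi (%x. H i x - K i x)" if "i \<in> idx" for i
  using assms that by (auto intro: sqi_diff H1_sqi)
 fix e :: real assume "0 < e"
 then have e2: "0 < e / 2" by simp
 obtain ph where ph: "test_fun \<Omega> ph" "!!i. i \<in> idx ==> nrm (%x. H i x - jet ph i x) < e / 2"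
  using assms(1) e2 unfolding H1_def by blast
 obtain \<psi> where \<psi>: "test_fun \<Omega> \<psi>" "!!i. i \<in> idx ==> nrm (%x. K i x - jet \<psi> i x) < e / 2"
  using assms(2) e2 unfolding H1_def by blast
 let ?th = "%x. ph x + (- 1) * \<psi> x"
 have "nrm (%x. H i x - K i x - jet ?th i x) < e" if i: "i \<in> idx" for i
 proof -
  have "(%x. H i x - K i x - jet ?th i x) = (%x. (H i x - jet ph i x) - (K i x - jet \<psi> i x))"
   using jet_add_cmult[OF test_fun_smooth[OF ph(1)] test_fun_smooth[OF \<psi>(1)] i, of "- 1"]
   by (simp add: fun_eq_iff)
  then show ?thesis
   using sqi_diff(2)[OF sqi_diff(1)[OF H1_sqi[OF assms(1) i] sqi_jet[OF ph(1) i]]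
     sqi_diff(1)[OF H1_sqi[OF assms(2) i] sqi_jet[OF \<psi>(1) i]]] ph(2)[OF i] \<psi>(2)[OF i] by simp
 qed
 moreover have "test_fun \<Omega> ?th" by (intro test_fun_add test_fun_cmult ph \<psi>)
 ultimately show "\<exists>ph. test_fun \<Omega> ph & (\<forall>i\<in>idx. nrm (%x. H i x - K i x - jet ph i x) < e)" by blast
qed

text \<open>The real Hilbert space structure behind the minimisation argument for averages;
  \<open>jn\<close> is the sum norm, handy for estimates.\<close>

definition jip :: "('a::euclidean_space => 'a => complex) => ('a => 'a => complex) => real" where
 "jip F H = (\<Sum>i\<in>idx. Re (lint (%x. H i x * cnj (F i x))))"

lemma jip_self: "jip F F = (\<Sum>i\<in>idx. (nrm (F i))\<^sup>2)"
 unfolding jip_def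
proof (rule sum.cong[OF refl])
 fix i
 have "(lint (%x. F i x * cnj (F i x))) = (lint (%x. cor ((cmod (F i x))\<^sup>2)))"
  by (simp only: complex_norm_square)
 then show "Re (lint (%x. F i x * cnj (F i x))) = (nrm (F i))\<^sup>2"
  by (simp only: integral_complex_of_real nrm_sq Re_complex_of_real)
qed

lemma jip_le:
 assumes "!!i. i \<in> idx ==> sqi (F i)" "!!i. i \<in> idx ==> sqi (H i)"
 shows "\<bar>jip F H\<bar> <= jn F * jn H"
proof -
 have "\<bar>jip F H\<bar> <= (\<Sum>i\<in>idx. nrm (H i) * nrm (F i))"
  unfolding jip_def
 proof (rule order_trans[OF sum_abs sum_mono])
  fix i :: 'a assume i: "i \<in> idx"
  show "\<bar>Re (lint (%x. H i x * cnj (F i x)))\<bar> <= nrm (H i) * nrm (F i)"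
   using cauchy_schwarz(3)[of "H i" "%x. cnj (F i x)"] assms i abs_Re_le_cmod order_trans by fastforce
 qed
 also have "... <= (\<Sum>i\<in>idx. nrm (H i) * jn F)"
  by (intro sum_mono mult_left_mono nrm_le_jn) auto
 also have "... = jn F * jn H" by (simp add: jn_def[of H] sum_distrib_left mult.commute)
 finally show ?thesis .
qed

lemma jip_diff:
 assumes "!!i. i \<in> idx ==> sqi (F i)" "!!i. i \<in> idx ==> sqi (H i)" "!!i. i \<in> idx ==> sqi (K i)"
 shows "jip F (%i x. H i x - K i x) = jip F H - jip F K"
 unfolding jip_def sum_subtractf[symmetric]
proof (rule sum.cong[OF refl])
 fix i :: 'a assume i: "i \<in> idx"
 have "(lint (%x. H i x * cnj (F i x) - K i x * cnj (F i x))) = (lint (%x. H i x * cnj (F i x))) - (lint (%x. K i x * cnj (F i x)))"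
  using assms i by (intro BI_integral_diff cauchy_schwarz(1)) auto
 then show "Re (lint (%x. (H i x - K i x) * cnj (F i x))) = Re (lint (%x. H i x * cnj (F i x))) - Re (lint (%x. K i x * cnj (F i x)))"
  by (simp add: left_diff_distrib)
qed

lemma jn_diff_le:
 assumes "!!i. i \<in> idx ==> sqi (F i)" "!!i. i \<in> idx ==> sqi (H i)"
 shows "jn (%i x. F i x - H i x) <= jn F + jn H"
 unfolding jn_def sum.distrib[symmetric] using assms by (intro sum_mono sqi_diff) auto

lemma jip_add_scaled:
 assumes F: "!!i. i \<in> idx ==> sqi (F i)" and H: "!!i. i \<in> idx ==> sqi (H i)"
 shows "jip (%i x. F i x - of_real t * H i x) (%i x. F i x - of_real t * H i x) = jip F F - 2 * t * jip F H + t\<^sup>2 * jip H H"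
proof -
 have "Re (lint (%x. (F i x - of_real t * H i x) * cnj (F i x - of_real t * H i x))) =
  Re (lint (%x. F i x * cnj (F i x))) - 2 * t * Re (lint (%x. H i x * cnj (F i x))) + t\<^sup>2 * Re (lint (%x. H i x * cnj (H i x)))"
  if i: "i \<in> idx" for i
 proof -
  have 1: "intl (%x. F i x * cnj (F i x))" "intl (%x. H i x * cnj (F i x))"
    "intl (%x. H i x * cnj (H i x))"
   using F H i by (auto intro!: cauchy_schwarz(1))
  have "Re (lint (%x. (F i x - of_real t * H i x) * cnj (F i x - of_real t * H i x))) =
    (lint (%x. Re ((F i x - of_real t * H i x) * cnj (F i x - of_real t * H i x))))"
  proof (rule integral_Re[symmetric])
   show "intl (%x. (F i x - of_real t * H i x) * cnj (F i x - of_real t * H i x))"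
    using F H i by (intro cauchy_schwarz(1)) (auto simp del: complex_cnj_diff intro!: sqi_diff sqi_cmult)
  qed
  also have "... = (lint (%x. Re (F i x * cnj (F i x)) - 2 * t * Re (H i x * cnj (F i x)) + t\<^sup>2 * Re (H i x * cnj (H i x))))"
   by (intro BI_integral_cong refl) (simp add: algebra_simps power2_eq_square)
  also have "... = (lint (%x. Re (F i x * cnj (F i x)))) - 2 * t * (lint (%x. Re (H i x * cnj (F i x)))) + t\<^sup>2 * (lint (%x. Re (H i x * cnj (H i x))))"
   using 1[THEN integrable_Re] by simp
  finally show ?thesis using 1[THEN integral_Re] by simp
 qed
 then show ?thesis unfolding jip_def by (simp add: sum.distrib sum_subtractf sum_distrib_left)
qed

text \<open>The closure of the test functions is stable under averaging because a near-minimiser of the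
 distance to the test functions is nearly orthogonal to all of them, hence to the average itself.\<close>
lemma H1_avg:
 fixes H :: "'a::euclidean_space => real => 'a => complex"
 assumes ta: "!!i. i \<in> idx ==> time_avg \<mu> (H i)"
  and ae: "AE s in \<mu>. H1 \<Omega> (%i. H i s)"
 shows "H1 \<Omega> (%i. avg \<mu> (H i))"
proof -
 define W where "W i = avg \<mu> (H i)" for i
 have sW: "sqi (W i)" if "i \<in> idx" for i using time_avg.sqi_avg[OF ta[OF that]] by (simp add: W_def)
 define T where "T = {ph. test_fun \<Omega> ph}"
 define D where "D ph i x = W i x - jet ph i x" for ph i x
 define q where "q ph = jip (D ph) (D ph)" for ph
 have sD: "sqi (D ph i)" if "i \<in> idx" "ph \<in> T" for ph i
  unfolding D_def[abs_def] using that by (auto simp: T_def intro: sqi_diff sW sqi_jet)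
 have q0: "0 <= q ph" for ph by (simp add: q_def jip_self sum_nonneg)
 define d where "d = Inf (q ` T)"
 have z: "(%x. 0) \<in> T" by (auto simp: T_def intro!: test_funI[where K = "{}"] smooth_const)
 have bdd: "bdd_below (q ` T)" using q0 by (intro bdd_belowI[of _ 0]) auto
 have dle: "d <= q ph" if "ph \<in> T" for ph unfolding d_def using that bdd by (intro cInf_lower) auto
 define K where "K = (\<integral>s. jn (%i. H i s) \<partial>\<mu>)"
 have Kint: "integrable \<mu> (%s. jn (%i. H i s))"
  unfolding jn_def using time_avg.int_nrm[OF ta] by (intro BI_integrable_sum) auto
 define L where "L = K + jn W + sqrt (d + 1)"
 have small: "\<exists>ph\<in>T. q ph <= ep * (K + jn W + jn (%i. D ph i)) & q ph <= d + 1" if e: "0 < ep" "ep <= 1" for ep :: real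
 proof -
  have "\<exists>ph\<in>T. q ph < d + ep\<^sup>2"
   using cInf_lessD[of "q ` T" "d + ep\<^sup>2"] z e by (auto simp: d_def)
  then obtain ph where ph: "ph \<in> T" "q ph < d + ep\<^sup>2" by blast
  have orth: "\<bar>jip (D ph) (jet \<psi>)\<bar> <= ep * jn (jet \<psi>)" if \<psi>: "\<psi> \<in> T" for \<psi>
  proof -
   let ?p = "jip (D ph) (jet \<psi>)" and ?Q = "jip (jet \<psi>) (jet \<psi>)"
   have s\<psi>: "!!i. i \<in> idx ==> sqi (jet \<psi> i)" using \<psi> by (auto simp: T_def intro: sqi_jet)
   \<comment> \<open>Comparison with the competitor ph + t psi: the infimum d is missed by less than
     ep^2, so this quadratic polynomial in t is nonnegative and its discriminant bounds the
     pairing.\<close>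
   have "0 <= ep\<^sup>2 - 2 * t * ?p + t\<^sup>2 * ?Q" for t
   proof -
    let ?th = "%x. ph x + of_real t * \<psi> x"
    have "?th \<in> T" using ph \<psi> by (auto simp: T_def intro!: test_fun_add test_fun_cmult)
    then have "d <= q ?th" by (rule dle)
    also have "q ?th = jip (%i x. D ph i x - of_real t * jet \<psi> i x) (%i x. D ph i x - of_real t * jet \<psi> i x)"
     unfolding q_def jip_def using ph(1) \<psi>
     by (intro sum.cong refl) (simp add: D_def T_def jet_add jet_cmult smooth_cmult test_fun_smooth algebra_simps)
    also have "... = q ph - 2 * t * ?p + t\<^sup>2 * ?Q"
     unfolding q_def by (rule jip_add_scaled) (use sD[OF _ ph(1)] s\<psi> in auto)
    finally show ?thesis using ph(2) by linarith
   qed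
   note * = this
   have Q: "0 <= ?Q" by (simp add: jip_self sum_nonneg)
   have "?p\<^sup>2 <= ep\<^sup>2 * ?Q"
   proof (cases "?Q = 0")
    case True
    have "?p = 0"
    proof (rule ccontr)
     assume "?p ~= 0"
     \<comment> \<open>For Q = 0 the polynomial is affine in t, and at t = ep^2 / p it takes the
       value - ep^2.\<close>
     then show False using *[of "ep\<^sup>2 / ?p"] True e by (simp add: field_simps)
    qed
    then show ?thesis using Q by simp
   next
    case False
    have "0 <= ep\<^sup>2 - 2 * (?p / ?Q) * ?p + (?p / ?Q)\<^sup>2 * ?Q" by (rule *)
    also have "... = ep\<^sup>2 - ?p\<^sup>2 / ?Q" using False by (simp add: field_simps power2_eq_square)
    finally show ?thesis using False Q by (simp add: field_simps)
   qed
   also have "?Q <= (jn (jet \<psi>))\<^sup>2"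
    using jip_le[of "jet \<psi>" "jet \<psi>"] s\<psi> by (simp add: power2_eq_square)
   finally have "?p\<^sup>2 <= (ep * jn (jet \<psi>))\<^sup>2" by (simp add: power_mult_distrib mult_left_mono)
   then show ?thesis using e by (simp add: abs_le_square_iff[symmetric] abs_mult)
  qed
  have orthH: "\<bar>jip (D ph) F\<bar> <= ep * jn F" if F: "H1 \<Omega> F" for F
  proof -
   obtain \<psi> where \<psi>: "!!n::nat. test_fun \<Omega> (\<psi> n)"
    "!!i. i \<in> idx ==> (%n. nrm (%x. F i x - jet (\<psi> n) i x)) \<longlonglongrightarrow> 0"
    "!!i. i \<in> idx ==> (%n. nrm (jet (\<psi> n) i)) \<longlonglongrightarrow> nrm (F i)"
    using H1_seq[OF F] by blast
   have "(%n. jn (%i x. F i x - jet (\<psi> n) i x)) \<longlonglongrightarrow> (\<Sum>i\<in>(idx::'a set). 0)"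
    unfolding jn_def by (intro tendsto_sum \<psi>)
   then have 1: "(%n. jn (%i x. F i x - jet (\<psi> n) i x)) \<longlonglongrightarrow> 0" by simp
   have 2: "(%n. jn (jet (\<psi> n))) \<longlonglongrightarrow> jn F"
    unfolding jn_def by (intro tendsto_sum \<psi>)
   have "\<bar>jip (D ph) F\<bar> <= jn (D ph) * jn (%i x. F i x - jet (\<psi> n) i x) + ep * jn (jet (\<psi> n))" for n
   proof -
    have "jip (D ph) (%i x. F i x - jet (\<psi> n) i x) = jip (D ph) F - jip (D ph) (jet (\<psi> n))"
     by (rule jip_diff) (use sD[OF _ ph(1)] H1_sqi[OF F] sqi_jet[OF \<psi>(1)] in auto)
    moreover have "\<bar>jip (D ph) (%i x. F i x - jet (\<psi> n) i x)\<bar> <= jn (D ph) * jn (%i x. F i x - jet (\<psi> n) i x)"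
     by (rule jip_le) (use sD[OF _ ph(1)] H1_sqi[OF F] sqi_jet[OF \<psi>(1)] in \<open>auto intro: sqi_diff\<close>)
    moreover have "\<bar>jip (D ph) (jet (\<psi> n))\<bar> <= ep * jn (jet (\<psi> n))" using \<psi>(1)[of n] by (intro orth) (simp add: T_def)
    ultimately show ?thesis by linarith
   qed
   moreover have "(%n. jn (D ph) * jn (%i x. F i x - jet (\<psi> n) i x) + ep * jn (jet (\<psi> n))) \<longlonglongrightarrow> jn (D ph) * 0 + ep * jn F"
    by (intro tendsto_intros 1 2)
   ultimately show ?thesis using LIMSEQ_le_const[of _ _ "\<bar>jip (D ph) F\<bar>"] by auto
  qed
  \<comment> \<open>Pairing with a fixed jet commutes with the average, so near-orthogonality to
    almost every jet being averaged carries over to \<open>W\<close>, with the integral of the jet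
    norms on the right.\<close>
  have orthW: "\<bar>jip (D ph) W\<bar> <= ep * K"
  proof -
   have p: "integrable \<mu> (%s. lint (%x. H i s x * cnj (D ph i x)))"
     "(lint (%x. W i x * cnj (D ph i x))) = (\<integral>s. lint (%x. H i s x * cnj (D ph i x)) \<partial>\<mu>)" if "i \<in> idx" for i
    using time_avg.pair[OF ta[OF that], of "%x. cnj (D ph i x)"] sD[OF that ph(1)] by (auto simp: W_def)
   have j: "integrable \<mu> (%s. jip (D ph) (%i. H i s))"
    unfolding jip_def by (intro BI_integrable_sum integrable_Re p) auto
   have "jip (D ph) W = (\<integral>s. jip (D ph) (%i. H i s) \<partial>\<mu>)"
    unfolding jip_def using p by (simp add: BI_integral_sum integrable_Re)
   also have "\<bar>...\<bar> <= (\<integral>s. ep * jn (%i. H i s) \<partial>\<mu>)"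
   proof (rule order_trans[OF integral_abs_bound integral_mono_AE])
    show "AE s in \<mu>. \<bar>jip (D ph) (%i. H i s)\<bar> <= ep * jn (%i. H i s)"
     using ae by eventually_elim (rule orthH)
   qed (use j Kint in auto)
   finally show ?thesis by (simp add: K_def)
  qed
  \<comment> \<open>The squared distance is the pairing of D = W - jet with itself. Both halves are
    of order ep, because D is nearly orthogonal to the average and to the test function; since q is
    at most d + 1, the factor multiplying ep stays bounded as ep shrinks.\<close>
  have "q ph = jip (D ph) W - jip (D ph) (jet ph)"
   unfolding q_def using jip_diff[of "D ph" W "jet ph"] sD[OF _ ph(1)] sW ph(1)
   by (simp add: D_def[abs_def] T_def sqi_jet)
  also have "... <= ep * K + ep * jn (jet ph)"
   using orthW orth[OF ph(1)] by linarith
  also have "jn (jet ph) <= jn W + jn (D ph)"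
  proof -
   have "jet ph = (%i x. W i x - D ph i x)" by (simp add: D_def fun_eq_iff)
   then show ?thesis using jn_diff_le[of W "D ph"] sW sD[OF _ ph(1)] by simp
  qed
  finally have "q ph <= ep * (K + jn W + jn (D ph))" using e by (simp add: algebra_simps)
  moreover have "ep\<^sup>2 <= 1" using e by (simp add: power_le_one)
  ultimately show ?thesis using ph by (intro bexI[of _ ph]) auto
 qed
 have nq: "nrm (D ph i) <= sqrt (q ph)" if "i \<in> idx" for ph i
 proof -
  have "(nrm (D ph i))\<^sup>2 <= q ph" unfolding q_def jip_self by (rule member_le_sum) (use that in auto)
  then show ?thesis by (simp add: real_le_rsqrt)
 qed
 define M where "M = K + jn W + real (card (idx :: 'a set)) * sqrt (d + 1)"
 have K0: "0 <= K" unfolding K_def by (intro BI_integral_nonneg) auto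
 have d0: "0 <= d" unfolding d_def using z q0 by (intro cInf_greatest) auto
 have M0: "0 <= M" unfolding M_def using K0 d0 by (intro add_nonneg_nonneg mult_nonneg_nonneg) auto
 have fin: "\<exists>ph. test_fun \<Omega> ph & (\<forall>i\<in>idx. nrm (%x. W i x - jet ph i x) < e)" if e: "0 < e" for e
 proof -
  define ep where "ep = min 1 (e\<^sup>2 / (2 * (M + 1)))"
  have ep: "0 < ep" "ep <= 1" using e M0 by (auto simp: ep_def)
  from small[OF ep] obtain ph where ph: "ph \<in> T" "q ph <= ep * (K + jn W + jn (%i. D ph i))" "q ph <= d + 1" by blast
  have "jn (%i. D ph i) <= (\<Sum>i\<in>(idx::'a set). sqrt (d + 1))"
   unfolding jn_def using nq ph(3) by (intro sum_mono order_trans[OF nq]) auto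
  then have "K + jn W + jn (%i. D ph i) <= M" by (simp add: M_def)
  then have "q ph <= ep * M" using ph(2) ep by (meson mult_left_mono order_trans less_imp_le)
  also have "... <= e\<^sup>2 / (2 * (M + 1)) * (M + 1)" using M0 e by (intro mult_mono) (auto simp: ep_def)
  also have "... < e\<^sup>2" using M0 e by (simp add: field_simps add_pos_nonneg)
  finally have "sqrt (q ph) < e" using e by (simp add: real_sqrt_less_iff real_less_lsqrt)
  then have "nrm (D ph i) < e" if "i \<in> idx" for i using nq[OF that, of ph] by linarith
  then show ?thesis using ph(1) by (auto simp: T_def D_def[abs_def])
 qed
 show ?thesis unfolding H1_def using sW fin by (auto simp: W_def[abs_def])
qed

section \<open>A form bound for potentials\<close>

lemma nn_integral_lborel_shift:
 fixes f :: "'a::euclidean_space => ennreal"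
 assumes [measurable]: "f \<in> bm"
 shows "(nint (%x. f (x + w))) = (nint (%x. f x))"
proof -
 have "(nint (%x. f x)) = (\<integral>\<^sup>+x. f x \<partial>(distr lborel borel ((+) w)))"
  by (simp add: lborel_distr_plus)
 also have "... = (nint (%x. f (w + x)))"
  by (subst nn_integral_distr) auto
 finally show ?thesis by (simp add: add.commute)
qed

text \<open>An average over the ball of radius r around z, rescaled to the unit ball and not divided
  by its volume \<open>bvol\<close>. The fixed domain of integration lets r vary under
  Fubini.\<close>

definition bavg :: "('a::euclidean_space => ennreal) => real => 'a => ennreal" where
 "bavg V r z = (nint (%y. indicator (ball 0 1) y * V (z - r *\<^sub>R y)))"

text \<open>For fixed y the substitution z = x + r y moves the shift from F to V; the averaging then
  falls on V alone.\<close>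

lemma ball_avg_swap:
 fixes V F :: "'a::euclidean_space => ennreal"
 assumes [measurable]: "V \<in> bm" "F \<in> bm"
 shows "(nint (%x. V x * (nint (%y. indicator (ball 0 1) y * F (x + r *\<^sub>R y))))) = (nint (%z. F z * bavg V r z))"
proof -
 have [measurable]: "ball (0::'a) 1 \<in> sets borel" by simp
 have "(nint (%x. V x * (nint (%y. indicator (ball 0 1) y * F (x + r *\<^sub>R y))))) =
  (nint (%x. nint (%y. V x * (indicator (ball 0 1) y * F (x + r *\<^sub>R y)))))"
 proof -
  have "(%y. indicator (ball 0 1) y * F (x + r *\<^sub>R y)) \<in> bm" for x by measurable
  then show ?thesis by (simp add: nn_integral_cmult)
 qed
 also have "... = (nint (%y. nint (%x. V x * (indicator (ball 0 1) y * F (x + r *\<^sub>R y)))))"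
  by (rule lborel_pair.Fubini') measurable
 also have "... = (nint (%y. nint (%z. F z * (indicator (ball 0 1) y * V (z - r *\<^sub>R y)))))"
 proof (rule nn_integral_cong)
  fix y :: 'a
  have "(nint (%x. V x * (indicator (ball 0 1) y * F (x + r *\<^sub>R y)))) =
   (nint (%x. F (x + r *\<^sub>R y) * (indicator (ball 0 1) y * V ((x + r *\<^sub>R y) - r *\<^sub>R y))))"
   by (simp add: mult_ac)
  also have "... = (nint (%z. F z * (indicator (ball 0 1) y * V (z - r *\<^sub>R y))))"
   by (rule nn_integral_lborel_shift[where f = "%z. F z * (indicator (ball 0 1) y * V (z - r *\<^sub>R y))"]) measurable
  finally show "(nint (%x. V x * (indicator (ball 0 1) y * F (x + r *\<^sub>R y)))) =
   (nint (%z. F z * (indicator (ball 0 1) y * V (z - r *\<^sub>R y))))" .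
 qed
 also have "... = (nint (%z. nint (%y. F z * (indicator (ball 0 1) y * V (z - r *\<^sub>R y)))))"
  by (rule lborel_pair.Fubini'[symmetric]) measurable
 also have "... = (nint (%z. F z * bavg V r z))"
 proof -
  have "(%y. indicator (ball 0 1) y * V (z - r *\<^sub>R y)) \<in> bm" for z by measurable
  then show ?thesis by (simp add: nn_integral_cmult bavg_def)
 qed
 finally show ?thesis .
qed

lemma cauchy_schwarz_unit_interval:
 fixes h :: "real => ennreal"
 assumes [measurable]: "h \<in> bm"
 shows "(nint (%t. indicator {0..1} t * h t))\<^sup>2 <= (nint (%t. indicator {0..1} t * (h t)\<^sup>2))"
proof -
 have "(nint (%t. indicator {0..1} t * (indicator {0..1} t * h t)))\<^sup>2 <=
  (nint (%t. (indicator {0..1::real} t)\<^sup>2)) * (nint (%t. (indicator {0..1} t * h t)\<^sup>2))"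
  by (rule Cauchy_Schwarz_nn_integral) auto
 moreover have "(indicator {0..1::real} t :: ennreal)\<^sup>2 = indicator {0..1} t" for t
  by (simp add: indicator_def)
 moreover have "indicator {0..1} t * (indicator {0..1} t * h t) = indicator {0..1} t * h t"
   "(indicator {0..1} t * h t)\<^sup>2 = indicator {0..1} t * (h t)\<^sup>2" for t
  by (auto simp: indicator_def)
 ultimately show ?thesis by simp
qed

text \<open>The substitution \<open>s = t\<^sup>2\<close> on the segment from x to x + z tames the factor \<open>1/s\<close> that
 the Morrey condition on the potential produces below.\<close>
lemma segment_increment:
 fixes ph :: "'a::euclidean_space => complex"
 assumes sm: "smooth ph"
 shows "ennreal ((cmod (ph (x + z) - ph x))\<^sup>2) <=
  (nint (%t. indicator {0..1} t * ennreal (4 * t\<^sup>2 * (norm z)\<^sup>2 * (\<Sum>b\<in>Basis. (cmod (pd b ph (x + t\<^sup>2 *\<^sub>R z)))\<^sup>2))))"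
proof -
 define D where "D w = (\<Sum>b\<in>Basis. (z \<bullet> b) *\<^sub>R pd b ph w)" for w
 have cpd: "continuous_on UNIV (pd b ph)" if "b \<in> Basis" for b
  by (rule smooth_continuous[OF smooth_pd[OF sm that]])
 have cD: "continuous_on UNIV D"
  unfolding D_def[abs_def] by (intro continuous_intros cpd) auto
 define h where "h t = (2 * t) *\<^sub>R D (x + t\<^sup>2 *\<^sub>R z)" for t :: real
 have ch: "continuous_on S h" for S
  unfolding h_def[abs_def]
  by (intro continuous_intros continuous_on_compose2[OF cD]) auto
 have der: "((%t. ph (x + t\<^sup>2 *\<^sub>R z)) has_vector_derivative h t) (at t)" for t
 proof -
  have "((%t. x + t\<^sup>2 *\<^sub>R z) has_derivative (%s. (s * (2 * t)) *\<^sub>R z)) (at t)"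
   by (auto intro!: derivative_eq_intros simp: fun_eq_iff)
  from diff_chain_at[OF this smooth_has_derivative[OF sm]]
  have "((%t. ph (x + t\<^sup>2 *\<^sub>R z)) has_derivative (%s. \<Sum>b\<in>Basis. (((s * (2 * t)) *\<^sub>R z) \<bullet> b) *\<^sub>R pd b ph (x + t\<^sup>2 *\<^sub>R z))) (at t)"
   by (simp add: o_def)
  then show ?thesis unfolding has_vector_derivative_def h_def D_def
   by (rule has_derivative_eq_rhs) (simp add: fun_eq_iff scaleR_sum_right mult_ac)
 qed
 have "has_bochner_integral lborel (%t. indicator {0..1} t *\<^sub>R h t) (ph (x + 1\<^sup>2 *\<^sub>R z) - ph (x + 0\<^sup>2 *\<^sub>R z))"
  by (rule has_bochner_integral_FTC_Icc) (auto intro: has_vector_derivative_at_within der ch)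
 then have "ennreal (cmod (ph (x + z) - ph x)) <= (nint (%t. ennreal (norm (indicator {0..1} t *\<^sub>R h t))))"
  using integral_norm_bound_ennreal[of lborel "%t. indicator {0..1} t *\<^sub>R h t"]
  by (auto simp: has_bochner_integral_iff)
 also have "... = (nint (%t. indicator {0..1} t * ennreal (norm (h t))))"
  by (intro nn_integral_cong) (auto simp: indicator_def)
 finally have "(ennreal (cmod (ph (x + z) - ph x)))\<^sup>2 <= (nint (%t. indicator {0..1} t * ennreal (norm (h t))))\<^sup>2"
  by (rule power_mono) simp
 also have "... <= (nint (%t. indicator {0..1} t * (ennreal (norm (h t)))\<^sup>2))"
  using ch[of UNIV] by (intro cauchy_schwarz_unit_interval) (auto intro!: borel_measurable_continuous_onI continuous_intros measurable_compose[OF _ measurable_ennreal])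
 also have "... <= (nint (%t. indicator {0..1} t * ennreal (4 * t\<^sup>2 * (norm z)\<^sup>2 * (\<Sum>b\<in>Basis. (cmod (pd b ph (x + t\<^sup>2 *\<^sub>R z)))\<^sup>2))))"
 proof (intro nn_integral_mono mult_left_mono)
  fix t :: real
  let ?w = "x + t\<^sup>2 *\<^sub>R z"
  have "cmod (D ?w) <= (\<Sum>b\<in>Basis. \<bar>z \<bullet> b\<bar> * cmod (pd b ph ?w))"
   unfolding D_def by (rule order_trans[OF norm_sum]) simp
  then have "(cmod (D ?w))\<^sup>2 <= (\<Sum>b\<in>Basis. \<bar>z \<bullet> b\<bar> * cmod (pd b ph ?w))\<^sup>2" by (intro power_mono) auto
  also have "... <= (\<Sum>b\<in>Basis. \<bar>z \<bullet> b\<bar>\<^sup>2) * (\<Sum>b\<in>Basis. (cmod (pd b ph ?w))\<^sup>2)"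
   by (rule Cauchy_Schwarz_ineq_sum)
  also have "(\<Sum>b\<in>Basis. \<bar>z \<bullet> b\<bar>\<^sup>2) = (norm z)\<^sup>2"
   unfolding power2_norm_eq_inner by (simp add: euclidean_inner[of z z] power2_eq_square)
  finally have "(2 * t)\<^sup>2 * (cmod (D ?w))\<^sup>2 <= (2 * t)\<^sup>2 * ((norm z)\<^sup>2 * (\<Sum>b\<in>Basis. (cmod (pd b ph ?w))\<^sup>2))"
   by (intro mult_left_mono) auto
  then have "(norm (h t))\<^sup>2 <= 4 * t\<^sup>2 * (norm z)\<^sup>2 * (\<Sum>b\<in>Basis. (cmod (pd b ph ?w))\<^sup>2)"
   by (simp add: h_def power_mult_distrib mult_ac)
  then show "(ennreal (norm (h t)))\<^sup>2 <= ennreal (4 * t\<^sup>2 * (norm z)\<^sup>2 * (\<Sum>b\<in>Basis. (cmod (pd b ph ?w))\<^sup>2))"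
   by (simp add: ennreal_power ennreal_leI)
 qed simp
 finally show ?thesis by (simp add: ennreal_power)
qed

definition bvol :: "'a::euclidean_space itself => real" where
 "bvol _ = measure lborel (ball (0::'a) 1)"

lemma bvol_pos: "0 < bvol TYPE('a::euclidean_space)"
 unfolding bvol_def by (rule content_ball_pos) simp

lemma emeasure_unit_ball: "emeasure lborel (ball (0::'a::euclidean_space) 1) = ennreal (bvol TYPE('a))"
 unfolding bvol_def by (rule emeasure_eq_ennreal_measure) (use emeasure_bounded_finite[of "ball (0::'a) 1"] in auto)

text \<open>Compare \<open>\<phi>(x)\<close> with \<open>\<phi>(x + \<delta>y)\<close>, average over y in the unit ball, and move the averages onto V.\<close>
lemma form_bound_test:
 fixes ph :: "'a::euclidean_space => complex" and V :: "'a => ennreal"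
 assumes t: "test_fun S ph" and V [measurable]: "V \<in> bm"
  and d: "0 < de" and "0 <= \<kappa>" "0 <= A0"
  and A0: "!!z. bavg V de z <= ennreal A0"
  and \<kappa>: "!!r z. 0 < r ==> r <= de ==> bavg V r z <= ennreal (\<kappa> / r)"
 shows "ennreal (bvol TYPE('a)) * (nint (%x. V x * ennreal ((cmod (ph x))\<^sup>2))) <=
  ennreal (2 * A0 * (nrm ph)\<^sup>2 + 8 * \<kappa> * de * (\<Sum>b\<in>Basis. (nrm (pd b ph))\<^sup>2))"
proof -
 have sm: "smooth ph" using t by (rule test_fun_smooth)
 have [measurable]: "ph \<in> bm" by (rule smooth_measurable[OF sm])
 have [measurable]: "b \<in> Basis ==> pd b ph \<in> bm" for b
  by (rule smooth_measurable[OF smooth_pd[OF sm]])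
 define F where "F x = ennreal ((cmod (ph x))\<^sup>2)" for x
 define g where "g x = (\<Sum>b\<in>Basis. (cmod (pd b ph x))\<^sup>2)" for x
 have [measurable]: "F \<in> bm" "g \<in> bm"
  unfolding F_def[abs_def] g_def[abs_def] by measurable
 have g0: "0 <= g x" for x by (simp add: g_def sum_nonneg)
 define B where "B = (%y::'a. indicator (ball 0 1) y :: ennreal)"
 have [measurable]: "ball (0::'a) 1 \<in> sets borel" by simp
 have [measurable]: "B \<in> bm" unfolding B_def by measurable
 define h where "h t x = ennreal (t\<^sup>2) * ennreal (g x)" for t :: real and x
 have [measurable]: "(%p. h (fst p) (snd p)) \<in> borel_measurable (borel \<Otimes>\<^sub>M borel)"
  unfolding h_def by measurable
 \<comment> \<open>From |p|^2 <= 2 |q|^2 + 2 |q - p|^2 with q the value at x + de y; the 8 is 2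
   times the 4 of \<open>segment_increment\<close>, and |de y|^2 <= de^2 on the unit ball.\<close>
 have pw: "B y * F x <= 2 * (B y * F (x + de *\<^sub>R y)) + ennreal (8 * de\<^sup>2) * (B y * (nint (%t. indicator {0..1} t * h t (x + (t\<^sup>2 * de) *\<^sub>R y))))" for x y
 proof (cases "y \<in> ball 0 1")
  case True
  then have ny: "(norm y)\<^sup>2 <= 1" by (simp add: power_le_one)
  let ?z = "de *\<^sub>R y"
  have "(cmod (ph x))\<^sup>2 <= 2 * (cmod (ph (x + ?z)))\<^sup>2 + 2 * (cmod (ph (x + ?z) - ph x))\<^sup>2"
  proof -
   have "cmod (ph x) <= cmod (ph (x + ?z)) + cmod (ph (x + ?z) - ph x)"
    using norm_triangle_ineq4[of "ph (x + ?z)" "ph (x + ?z) - ph x"] by simp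
   then have "(cmod (ph x))\<^sup>2 <= (cmod (ph (x + ?z)) + cmod (ph (x + ?z) - ph x))\<^sup>2" by (intro power_mono) auto
   also have "... <= 2 * (cmod (ph (x + ?z)))\<^sup>2 + 2 * (cmod (ph (x + ?z) - ph x))\<^sup>2"
    using sum_squares_bound[of "cmod (ph (x + ?z))" "cmod (ph (x + ?z) - ph x)"] by (simp add: power2_sum)
   finally show ?thesis .
  qed
  then have "F x <= ennreal (2 * (cmod (ph (x + ?z)))\<^sup>2 + 2 * (cmod (ph (x + ?z) - ph x))\<^sup>2)"
   unfolding F_def by (rule ennreal_leI)
  also have "... = 2 * F (x + ?z) + 2 * ennreal ((cmod (ph (x + ?z) - ph x))\<^sup>2)"
   by (simp add: F_def ennreal_mult)
  also have "ennreal ((cmod (ph (x + ?z) - ph x))\<^sup>2) <=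
   (nint (%t. indicator {0..1} t * ennreal (4 * t\<^sup>2 * (norm ?z)\<^sup>2 * g (x + t\<^sup>2 *\<^sub>R ?z))))"
   unfolding g_def by (rule segment_increment[OF sm])
  also have "... <= (nint (%t. ennreal (4 * de\<^sup>2) * (indicator {0..1} t * h t (x + (t\<^sup>2 * de) *\<^sub>R y))))"
  proof (intro nn_integral_mono)
   fix t :: real
   have "(norm ?z)\<^sup>2 = de\<^sup>2 * (norm y)\<^sup>2" using d by (simp add: power_mult_distrib)
   also have "... <= de\<^sup>2" using ny by (simp add: mult_left_le)
   finally have "4 * t\<^sup>2 * (norm ?z)\<^sup>2 * g (x + t\<^sup>2 *\<^sub>R ?z) <= 4 * t\<^sup>2 * de\<^sup>2 * g (x + t\<^sup>2 *\<^sub>R ?z)"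
    using g0 by (intro mult_right_mono mult_left_mono) auto
   then have "ennreal (4 * t\<^sup>2 * (norm ?z)\<^sup>2 * g (x + t\<^sup>2 *\<^sub>R ?z)) <= ennreal (4 * de\<^sup>2) * h t (x + (t\<^sup>2 * de) *\<^sub>R y)"
    unfolding h_def using g0 by (simp add: ennreal_leI mult_ac flip: ennreal_mult)
   then show "indicator {0..1} t * ennreal (4 * t\<^sup>2 * (norm ?z)\<^sup>2 * g (x + t\<^sup>2 *\<^sub>R ?z)) <=
    ennreal (4 * de\<^sup>2) * (indicator {0..1} t * h t (x + (t\<^sup>2 * de) *\<^sub>R y))"
    by (auto simp: indicator_def)
  qed
  also have "... = ennreal (4 * de\<^sup>2) * (nint (%t. indicator {0..1} t * h t (x + (t\<^sup>2 * de) *\<^sub>R y)))"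
   by (rule nn_integral_cmult) (simp add: h_def)
  finally have "F x <= 2 * F (x + ?z) + 2 * (ennreal (4 * de\<^sup>2) * (nint (%t. indicator {0..1} t * h t (x + (t\<^sup>2 * de) *\<^sub>R y))))"
   by (simp add: add_left_mono mult_left_mono)
  moreover have "2 * (ennreal (4 * de\<^sup>2) * X) = ennreal (8 * de\<^sup>2) * X" for X
  proof -
   have "2 * ennreal (4 * de\<^sup>2) = ennreal (8 * de\<^sup>2)" by (simp flip: ennreal_numeral ennreal_mult)
   then show ?thesis by (simp add: mult.assoc[symmetric])
  qed
  ultimately show ?thesis using True by (simp add: B_def)
 qed (simp add: B_def)
 have mh [measurable]: "(%p. h (fst (snd p)) (fst p + ((fst (snd p))\<^sup>2 * de) *\<^sub>R snd (snd p))) \<in> borel_measurable (borel \<Otimes>\<^sub>M (borel \<Otimes>\<^sub>M borel))"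
  unfolding h_def by measurable
 have "ennreal (bvol TYPE('a)) * (nint (%x. V x * F x)) = (nint (%x. V x * (nint (%y. B y * F x))))"
 proof -
  have "(nint (%y. B y * F x)) = ennreal (bvol TYPE('a)) * F x" for x
   by (simp add: nn_integral_multc B_def emeasure_unit_ball)
  then have "(nint (%x. V x * (nint (%y. B y * F x)))) = (nint (%x. ennreal (bvol TYPE('a)) * (V x * F x)))"
   by (simp add: mult_ac)
  then show ?thesis by (simp add: nn_integral_cmult)
 qed
 also have "... <= (nint (%x. V x * (nint (%y. 2 * (B y * F (x + de *\<^sub>R y)) +
   ennreal (8 * de\<^sup>2) * (B y * (nint (%t. indicator {0..1} t * h t (x + (t\<^sup>2 * de) *\<^sub>R y))))))))"
  by (intro nn_integral_mono mult_left_mono pw) auto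
 also have "... = (nint (%x. 2 * (V x * (nint (%y. B y * F (x + de *\<^sub>R y)))) +
   ennreal (8 * de\<^sup>2) * (V x * (nint (%y. B y * (nint (%t. indicator {0..1} t * h t (x + (t\<^sup>2 * de) *\<^sub>R y))))))))"
 proof (rule nn_integral_cong)
  fix x
  have "(nint (%y. 2 * (B y * F (x + de *\<^sub>R y)) +
   ennreal (8 * de\<^sup>2) * (B y * (nint (%t. indicator {0..1} t * h t (x + (t\<^sup>2 * de) *\<^sub>R y)))))) =
   2 * (nint (%y. B y * F (x + de *\<^sub>R y))) + ennreal (8 * de\<^sup>2) * (nint (%y. B y * (nint (%t. indicator {0..1} t * h t (x + (t\<^sup>2 * de) *\<^sub>R y)))))"
   unfolding h_def by (simp add: nn_integral_add nn_integral_cmult)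
  then show "V x * (nint (%y. 2 * (B y * F (x + de *\<^sub>R y)) +
   ennreal (8 * de\<^sup>2) * (B y * (nint (%t. indicator {0..1} t * h t (x + (t\<^sup>2 * de) *\<^sub>R y)))))) =
   2 * (V x * (nint (%y. B y * F (x + de *\<^sub>R y)))) +
   ennreal (8 * de\<^sup>2) * (V x * (nint (%y. B y * (nint (%t. indicator {0..1} t * h t (x + (t\<^sup>2 * de) *\<^sub>R y))))))"
   by (simp add: distrib_left mult_ac)
 qed
 also have "... = 2 * (nint (%x. V x * (nint (%y. B y * F (x + de *\<^sub>R y))))) +
   ennreal (8 * de\<^sup>2) * (nint (%x. V x * (nint (%y. B y * (nint (%t. indicator {0..1} t * h t (x + (t\<^sup>2 * de) *\<^sub>R y)))))))"
  unfolding h_def by (simp add: nn_integral_add nn_integral_cmult)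
 also have "(nint (%x. V x * (nint (%y. B y * F (x + de *\<^sub>R y))))) <= ennreal A0 * ennreal ((nrm ph)\<^sup>2)"
 proof -
  have "(nint (%x. V x * (nint (%y. B y * F (x + de *\<^sub>R y))))) = (nint (%z. F z * bavg V de z))"
   unfolding B_def by (rule ball_avg_swap) measurable
  also have "... <= (nint (%z. F z * ennreal A0))"
   by (intro nn_integral_mono mult_left_mono A0) auto
  also have "... = ennreal A0 * ennreal ((nrm ph)\<^sup>2)"
   by (subst nn_integral_multc) (auto simp: F_def[abs_def] nn_nrm_sq[OF test_fun_sqi[OF t]] mult.commute)
  finally show ?thesis .
 qed
 also have "(nint (%x. V x * (nint (%y. B y * (nint (%t. indicator {0..1} t * h t (x + (t\<^sup>2 * de) *\<^sub>R y))))))) <=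
  ennreal (\<kappa> / de) * ennreal (\<Sum>b\<in>Basis. (nrm (pd b ph))\<^sup>2)"
 proof -
  have "(nint (%x. V x * (nint (%y. B y * (nint (%t. indicator {0..1} t * h t (x + (t\<^sup>2 * de) *\<^sub>R y))))))) =
   (nint (%x. V x * (nint (%t. nint (%y. B y * (indicator {0..1} t * h t (x + (t\<^sup>2 * de) *\<^sub>R y)))))))"
  proof (intro nn_integral_cong arg_cong2[where f = "(*)"] refl)
   fix x
   have "(nint (%y. B y * (nint (%t. indicator {0..1} t * h t (x + (t\<^sup>2 * de) *\<^sub>R y))))) =
    (nint (%y. nint (%t. B y * (indicator {0..1} t * h t (x + (t\<^sup>2 * de) *\<^sub>R y)))))"
    unfolding h_def by (simp add: nn_integral_cmult)
   also have "... = (nint (%t. nint (%y. B y * (indicator {0..1} t * h t (x + (t\<^sup>2 * de) *\<^sub>R y)))))"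
    unfolding h_def by (rule lborel_pair.Fubini'[symmetric]) measurable
   finally show "(nint (%y. B y * (nint (%t. indicator {0..1} t * h t (x + (t\<^sup>2 * de) *\<^sub>R y))))) = ..." .
  qed
  also have "... = (nint (%x. nint (%t. V x * (nint (%y. B y * (indicator {0..1} t * h t (x + (t\<^sup>2 * de) *\<^sub>R y)))))))"
   unfolding h_def by (simp add: nn_integral_cmult)
  also have "... = (nint (%t. nint (%x. V x * (nint (%y. B y * (indicator {0..1} t * h t (x + (t\<^sup>2 * de) *\<^sub>R y)))))))"
   unfolding h_def by (rule lborel_pair.Fubini'[symmetric]) measurable
  also have "... = (nint (%t. nint (%z. (indicator {0..1} t * h t z) * bavg V (t\<^sup>2 * de) z)))"
   unfolding B_def by (intro nn_integral_cong ball_avg_swap) (auto simp: h_def)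
  also have "... <= (nint (%t. nint (%z. indicator {0..1::real} t * (ennreal (\<kappa> / de) * ennreal (g z)))))"
  proof (intro nn_integral_mono)
   fix t :: real and z :: 'a
   show "(indicator {0..1} t * h t z) * bavg V (t\<^sup>2 * de) z <= indicator {0..1} t * (ennreal (\<kappa> / de) * ennreal (g z))"
   \<comment> \<open>At radius t^2 de the Morrey bound is \<kappa> / (t^2 de), and the weight t^2
     inside h cancels the singularity; at t = 0 that weight makes the left side vanish.\<close>
   proof (cases "t \<in> {0..1} & t ~= 0")
    case True
    then have "t\<^sup>2 <= 1" by (simp add: power_le_one)
    then have "bavg V (t\<^sup>2 * de) z <= ennreal (\<kappa> / (t\<^sup>2 * de))"
     using True d by (intro \<kappa>) (auto simp: mult_le_one)
    then have "h t z * bavg V (t\<^sup>2 * de) z <= h t z * ennreal (\<kappa> / (t\<^sup>2 * de))" by (intro mult_left_mono) auto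
    also have "... = ennreal (\<kappa> / de) * ennreal (g z)"
     using True d \<open>0 <= \<kappa>\<close> g0[of z] by (simp add: h_def mult_ac flip: ennreal_mult)
    finally show ?thesis using True by simp
   next
    case False
    then show ?thesis by (auto simp: h_def indicator_def)
   qed
  qed
  also have "... = ennreal (\<kappa> / de) * (nint (%z. ennreal (g z)))"
   by (simp add: nn_integral_cmult nn_integral_multc)
  also have "(nint (%z. ennreal (g z))) = (\<Sum>b\<in>Basis. ennreal ((nrm (pd b ph))\<^sup>2))"
   unfolding g_def by (simp add: sum_ennreal[symmetric] nn_integral_sum nn_nrm_sq test_fun_sqi[OF test_fun_pd[OF t]] del: sum_ennreal)
  finally show ?thesis by (simp add: sum_ennreal)
 qed
 finally have "ennreal (bvol TYPE('a)) * (nint (%x. V x * F x)) <= 2 * (ennreal A0 * ennreal ((nrm ph)\<^sup>2)) +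
   ennreal (8 * de\<^sup>2) * (ennreal (\<kappa> / de) * ennreal (\<Sum>b\<in>Basis. (nrm (pd b ph))\<^sup>2))"
  by (simp add: add_mono mult_left_mono)
 also have "... = ennreal (2 * (A0 * (nrm ph)\<^sup>2) + (8 * de\<^sup>2) * ((\<kappa> / de) * (\<Sum>b\<in>Basis. (nrm (pd b ph))\<^sup>2)))"
  using d \<open>0 <= \<kappa>\<close> \<open>0 <= A0\<close> by (simp add: sum_nonneg flip: ennreal_mult ennreal_plus ennreal_numeral)
 also have "(8 * de\<^sup>2) * ((\<kappa> / de) * X) = 8 * \<kappa> * de * X" for X
  using d by (simp add: power2_eq_square)
 finally show ?thesis by (simp add: F_def mult.assoc)
qed

lemma bavg_mono: "(!!x. V x <= W x) ==> bavg V r z <= bavg W r z"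
 unfolding bavg_def by (intro nn_integral_mono mult_left_mono) auto

lemma bavg_scale:
 fixes V :: "'a::euclidean_space => ennreal"
 assumes [measurable]: "V \<in> bm" and r: "0 < r"
 shows "ennreal (r ^ DIM('a)) * bavg V r z = (nint (%w. indicator (ball z r) w * V w))"
proof -
 have [measurable]: "ball (0::'a) 1 \<in> sets borel" "ball z r \<in> sets borel" by simp_all
 have "(nint (%w. indicator (ball z r) w * V w)) =
  (\<integral>\<^sup>+w. indicator (ball z r) w * V w \<partial>(density (distr lborel borel (%x. z + (- r) *\<^sub>R x)) (%_. \<bar>- r\<bar> ^ DIM('a))))"
  using r by (subst lborel_affine[of "- r" z]) auto
 also have "... = (nint (%y. ennreal (r ^ DIM('a)) * (indicator (ball z r) (z - r *\<^sub>R y) * V (z - r *\<^sub>R y))))"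
  using r by (subst nn_integral_density, simp, simp, subst nn_integral_distr) auto
 also have "... = (nint (%y. ennreal (r ^ DIM('a)) * (indicator (ball 0 1) y * V (z - r *\<^sub>R y))))"
  using r by (intro nn_integral_cong) (auto simp: indicator_def dist_norm)
 also have "... = ennreal (r ^ DIM('a)) * bavg V r z"
  unfolding bavg_def by (rule nn_integral_cmult) measurable
 finally show ?thesis by simp
qed

lemma bavg_le_integral:
 fixes V :: "'a::euclidean_space => ennreal"
 assumes [measurable]: "V \<in> bm" and r: "0 < r"
  and I: "(nint (%w. indicator (ball z r) w * V w)) <= ennreal (r ^ DIM('a) * B)" and "0 <= B"
 shows "bavg V r z <= ennreal B"
proof -
 have "ennreal (r ^ DIM('a)) * bavg V r z <= ennreal (r ^ DIM('a)) * ennreal B"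
  using I r assms(4) by (simp add: bavg_scale[OF assms(1) r] flip: ennreal_mult)
 then show ?thesis
  using r by (subst (asm) ennreal_mult_le_mult_iff) auto
qed

text \<open>Equivalent to a bound \<kappa> r^(N-1) for the integral of V over every ball of radius r
  <= 1, N being the dimension.\<close>

definition morrey :: "('a::euclidean_space => ennreal) => real => bool" where
 "morrey V \<kappa> \<longleftrightarrow> 0 <= \<kappa> & (\<forall>r z. 0 < r --> r <= 1 --> bavg V r z <= ennreal (\<kappa> / r))"

lemma emeasure_ball_scale:
 assumes r: "0 < r"
 shows "emeasure lborel (ball (z::'a::euclidean_space) r) = ennreal (r ^ DIM('a) * bvol TYPE('a))"
proof -
 have [measurable]: "ball (z::'a) r \<in> sets borel" by simp
 have "ennreal (r ^ DIM('a)) * bavg (%x. 1) r z = emeasure lborel (ball (z::'a) r)"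
  using r by (subst bavg_scale) auto
 moreover have "bavg (%x::'a. 1) r z = ennreal (bvol TYPE('a))"
  by (simp add: bavg_def emeasure_unit_ball)
 ultimately show ?thesis using r bvol_pos[where 'a = 'a] by (simp add: ennreal_mult)
qed

text \<open>Only \<open>p \<ge> DIM\<close> is used: split \<open>V2\<close> at height \<open>1/r\<close> on a ball of radius r.\<close>
lemma morrey_Lp:
 fixes V :: "'a::euclidean_space => ennreal" and V2 :: "'a => real"
 assumes [measurable]: "V \<in> bm" "V2 \<in> bm"
  and le: "AE x in lborel. V x <= ennreal (C + \<bar>V2 x\<bar>)" and C: "0 <= C"
  and p: "p >= real DIM('a)" "p >= 1" and fin: "(nint (%x. ennreal (\<bar>V2 x\<bar> powr p))) < \<infinity>"
 shows "\<exists>\<kappa>. morrey V \<kappa>"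
proof -
 define L where "L = enn2real (nint (%x. ennreal (\<bar>V2 x\<bar> powr p)))"
 have L: "(nint (%x. ennreal (\<bar>V2 x\<bar> powr p))) = ennreal L" "0 <= L"
  using fin by (auto simp: L_def)
 let ?c = "bvol TYPE('a)"
 define \<kappa> where "\<kappa> = ?c * (C + 1) + L"
 have \<kappa>: "0 <= \<kappa>" using C L bvol_pos[where 'a = 'a] by (simp add: \<kappa>_def)
 have "bavg V r z <= ennreal (\<kappa> / r)" if r: "0 < r" "r <= 1" for r z
 proof (rule bavg_le_integral[OF _ r(1)])
  have [measurable]: "ball z r \<in> sets borel" by simp
  have "(nint (%w. indicator (ball z r) w * V w)) <=
   (nint (%w. ennreal (C + 1 / r) * indicator (ball z r) w + ennreal (r powr (p - 1)) * ennreal (\<bar>V2 w\<bar> powr p)))"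
  proof (rule nn_integral_mono_AE)
   show "AE w in lborel. indicator (ball z r) w * V w <=
    ennreal (C + 1 / r) * indicator (ball z r) w + ennreal (r powr (p - 1)) * ennreal (\<bar>V2 w\<bar> powr p)"
    using le
   proof eventually_elim
    case (elim w)
    \<comment> \<open>Where |V2| exceeds 1/r the number r |V2| is at least 1, and so is its power
      with exponent p - 1; multiplying |V2| by that power gives the second summand. Below that
      height the first summand is enough.\<close>
    have "\<bar>V2 w\<bar> <= 1 / r + r powr (p - 1) * \<bar>V2 w\<bar> powr p"
    proof (cases "\<bar>V2 w\<bar> <= 1 / r")
     case False
     then have "1 <= r * \<bar>V2 w\<bar>" using r by (simp add: field_simps)
     then have "1 <= (r * \<bar>V2 w\<bar>) powr (p - 1)" using p by (intro ge_one_powr_ge_zero) auto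
     also have "... = r powr (p - 1) * \<bar>V2 w\<bar> powr (p - 1)" using r by (simp add: powr_mult)
     finally have "\<bar>V2 w\<bar> <= r powr (p - 1) * \<bar>V2 w\<bar> powr (p - 1) * \<bar>V2 w\<bar>"
      using mult_right_mono[of 1 "r powr (p - 1) * \<bar>V2 w\<bar> powr (p - 1)" "\<bar>V2 w\<bar>"] by simp
     also have "\<bar>V2 w\<bar> powr (p - 1) * \<bar>V2 w\<bar> = \<bar>V2 w\<bar> powr p"
      using powr_mult_base[of "\<bar>V2 w\<bar>" "p - 1"] by (simp add: mult.commute)
     then have "r powr (p - 1) * \<bar>V2 w\<bar> powr (p - 1) * \<bar>V2 w\<bar> = r powr (p - 1) * \<bar>V2 w\<bar> powr p"
      by (simp add: mult.assoc)
     finally show ?thesis using r by (simp add: add_increasing)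
    next
     case True
     then show ?thesis by (simp add: add_increasing2)
    qed
    then have "ennreal (C + \<bar>V2 w\<bar>) <= ennreal ((C + 1 / r) + r powr (p - 1) * \<bar>V2 w\<bar> powr p)"
     by (intro ennreal_leI) simp
    also have "... = ennreal (C + 1 / r) + ennreal (r powr (p - 1)) * ennreal (\<bar>V2 w\<bar> powr p)"
     using C r by (simp add: ennreal_mult)
    finally show ?case using elim by (auto simp: indicator_def intro: order_trans)
   qed
  qed
  also have "... = ennreal (C + 1 / r) * ennreal (r ^ DIM('a) * ?c) + ennreal (r powr (p - 1)) * ennreal L"
   using r by (simp add: nn_integral_add nn_integral_cmult L emeasure_ball_scale)
  also have "... = ennreal ((C + 1 / r) * (r ^ DIM('a) * ?c) + r powr (p - 1) * L)"
   using C r L bvol_pos[where 'a = 'a] by (simp flip: ennreal_mult ennreal_plus)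
  also have "... <= ennreal (r ^ DIM('a) * (\<kappa> / r))"
  proof (rule ennreal_leI)
   \<comment> \<open>Here p >= N and r <= 1 bound r^(p-1) by r^(N-1), the growth that a Morrey
     condition permits.\<close>
   have "r powr (p - 1) <= r powr (real DIM('a) - 1)" using r p by (intro powr_mono') auto
   also have "... = r ^ DIM('a) / r" using r by (simp add: powr_diff powr_realpow)
   finally have 1: "r powr (p - 1) * L <= r ^ DIM('a) / r * L" using L by (intro mult_right_mono) auto
   have "C <= C / r" using r C by (simp add: pos_le_divide_eq mult_left_le)
   then have "C + 1 / r <= (C + 1) / r" by (simp add: add_divide_distrib)
   then have "(C + 1 / r) * (r ^ DIM('a) * ?c) <= (C + 1) / r * (r ^ DIM('a) * ?c)"
    using r bvol_pos[where 'a = 'a] by (intro mult_right_mono) auto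
   moreover have "r ^ DIM('a) * (\<kappa> / r) = (C + 1) / r * (r ^ DIM('a) * ?c) + r ^ DIM('a) / r * L"
    using r by (simp add: \<kappa>_def field_simps)
   ultimately show "(C + 1 / r) * (r ^ DIM('a) * ?c) + r powr (p - 1) * L <= r ^ DIM('a) * (\<kappa> / r)"
    using 1 by linarith
  qed
  finally show "(nint (%w. indicator (ball z r) w * V w)) <= ennreal (r ^ DIM('a) * (\<kappa> / r))" .
 qed (use \<kappa> r in auto)
 then show ?thesis using \<kappa> unfolding morrey_def by blast
qed

text \<open>Density alone does not suffice, because the form on the left need not be continuous on
  L^2. Truncating V at height K makes multiplication by its root a bounded operator, so the bound
  passes from test functions to the limit; then K increases to infinity by monotone
  convergence.\<close>

lemma form_bound:
 fixes V :: "'a::euclidean_space => ennreal"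
 assumes H: "H1 \<Omega> H" and V [measurable]: "V \<in> bm"
  and d: "0 < de" and k0: "0 <= \<kappa>" "0 <= A0"
  and A0: "!!z. bavg V de z <= ennreal A0"
  and \<kappa>: "!!r z. 0 < r ==> r <= de ==> bavg V r z <= ennreal (\<kappa> / r)"
 shows "(nint (%x. V x * ennreal ((cmod (H 0 x))\<^sup>2))) <=
  ennreal ((2 * A0 * (nrm (H 0))\<^sup>2 + 8 * \<kappa> * de * (\<Sum>b\<in>Basis. (nrm (H b))\<^sup>2)) / bvol TYPE('a))"
proof -
 let ?c = "bvol TYPE('a)"
 have c: "0 < ?c" by (rule bvol_pos)
 define R where "R K = (2 * A0 * (nrm (K 0))\<^sup>2 + 8 * \<kappa> * de * (\<Sum>b\<in>Basis. (nrm (K b))\<^sup>2)) / ?c" for K :: "'a => 'a => complex"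
 have R0: "0 <= R K" for K
  unfolding R_def using c d k0 by (intro divide_nonneg_pos add_nonneg_nonneg mult_nonneg_nonneg sum_nonneg) auto
 have [measurable]: "H 0 \<in> bm" using H1_sqi[OF H] by (simp add: sqi_measurable)
 obtain ph where ph: "!!n::nat. test_fun \<Omega> (ph n)"
  "!!i. i \<in> idx ==> (%n. nrm (%x. H i x - jet (ph n) i x)) \<longlonglongrightarrow> 0"
  "!!i. i \<in> idx ==> (%n. nrm (jet (ph n) i)) \<longlonglongrightarrow> nrm (H i)"
  using H1_seq[OF H] by blast
 have trunc: "(nint (%x. min (V x) (of_nat K) * ennreal ((cmod (H 0 x))\<^sup>2))) <= ennreal (R H)" for K :: nat
 proof -
  define VK where "VK x = min (V x) (of_nat K)" for x
  have VKfin: "VK x < \<infinity>" for x by (auto simp: VK_def min_less_iff_disj of_nat_less_top)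
  have [measurable]: "VK \<in> bm" unfolding VK_def[abs_def] by measurable
  define w where "w x = sqrt (enn2real (VK x))" for x
  have [measurable]: "w \<in> bm" unfolding w_def[abs_def] by measurable
  have w2: "VK x * ennreal ((cmod y)\<^sup>2) = ennreal ((cmod (cor (w x) * y))\<^sup>2)" for x y
   using VKfin[of x] by (simp add: w_def norm_mult power_mult_distrib ennreal_mult)
  have wle: "cmod (cor (w x) * y) <= sqrt (real K) * cmod y" for x y
  proof -
   have "enn2real (VK x) <= enn2real (of_nat K)" by (rule enn2real_mono) (auto simp: VK_def of_nat_less_top)
   then have "w x <= sqrt (real K)" by (simp add: w_def)
   then show ?thesis by (simp add: norm_mult w_def mult_right_mono)
  qed
  have swsq: "sqi (%x. cor (w x) * f x)" "nrm (%x. cor (w x) * f x) <= sqrt (real K) * nrm f"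
   if f: "sqi f" for f
   using sqi_dom[of "%x. cor (w x) * f x" f "sqrt (real K)"] wle f by (auto simp: sqi_def)
  have sH: "sqi (H 0)" and sph: "sqi (ph n)" for n using H1_sqi[OF H, of 0] test_fun_sqi[OF ph(1)] by auto
  have *: "nrm (%x. cor (w x) * ph n x) <= sqrt (R (jet (ph n)))" for n
  proof -
   have "ennreal ?c * (nint (%x. VK x * ennreal ((cmod (ph n x))\<^sup>2))) <= ennreal (2 * A0 * (nrm (ph n))\<^sup>2 + 8 * \<kappa> * de * (\<Sum>b\<in>Basis. (nrm (pd b (ph n)))\<^sup>2))"
   proof (rule form_bound_test[OF ph(1) _ d k0])
    show "bavg VK de z <= ennreal A0" for z
     using A0[of z] bavg_mono[of VK V de z] by (auto simp: VK_def)
    show "bavg VK r z <= ennreal (\<kappa> / r)" if "0 < r" "r <= de" for r z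
     using \<kappa>[OF that, of z] bavg_mono[of VK V r z] by (auto simp: VK_def)
   qed measurable
   also have "... = ennreal (?c * R (jet (ph n)))" using c by (simp add: R_def)
   finally have "ennreal ?c * ennreal ((nrm (%x. cor (w x) * ph n x))\<^sup>2) <= ennreal (?c * R (jet (ph n)))"
    by (simp add: w2 nn_nrm_sq swsq sph)
   then have "?c * (nrm (%x. cor (w x) * ph n x))\<^sup>2 <= ?c * R (jet (ph n))"
    using c R0 by (simp flip: ennreal_mult)
   then show ?thesis using c by (intro real_le_rsqrt) simp
  qed
  have "nrm (%x. cor (w x) * H 0 x) <= sqrt (R (jet (ph n))) + sqrt (real K) * nrm (%x. H 0 x - ph n x)" for n
  proof -
   have "nrm (%x. cor (w x) * H 0 x) <= nrm (%x. cor (w x) * ph n x) +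
    nrm (%x. cor (w x) * H 0 x - cor (w x) * ph n x)"
    by (rule nrm_diff_le) (intro swsq sH sph)+
   also have "(%x. cor (w x) * H 0 x - cor (w x) * ph n x) = (%x. cor (w x) * (H 0 x - ph n x))"
    by (simp add: algebra_simps)
   finally show ?thesis using *[of n] swsq(2)[OF sqi_diff(1)[OF sH sph[of n]]] by linarith
  qed
  moreover have "(%n. sqrt (R (jet (ph n))) + sqrt (real K) * nrm (%x. H 0 x - ph n x)) \<longlonglongrightarrow> sqrt (R H) + sqrt (real K) * 0"
   unfolding R_def using ph(2)[of 0] c by (intro tendsto_intros ph(3)) auto
  ultimately have "nrm (%x. cor (w x) * H 0 x) <= sqrt (R H) + sqrt (real K) * 0"
   by (intro LIMSEQ_le_const) auto
  then have "(nrm (%x. cor (w x) * H 0 x))\<^sup>2 <= (sqrt (R H))\<^sup>2" by (intro power_mono) auto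
  then have "ennreal ((nrm (%x. cor (w x) * H 0 x))\<^sup>2) <= ennreal (R H)"
   using R0[of H] by (intro ennreal_leI) simp
  then show ?thesis by (simp add: w2[unfolded VK_def] nn_nrm_sq[symmetric] swsq sH)
 qed
 have "(nint (%x. V x * ennreal ((cmod (H 0 x))\<^sup>2))) = (nint (%x. (SUP K. min (V x) (of_nat K) * ennreal ((cmod (H 0 x))\<^sup>2))))"
 proof (rule nn_integral_cong)
  fix x
  have "(SUP K. min (V x) (of_nat K)) = V x"
  proof (rule antisym)
   show "V x <= (SUP K. min (V x) (of_nat K))"
   proof (cases "V x = \<infinity>")
    case True
    have "(SUP K. min (V x) (of_nat K)) = (SUP K. of_nat K :: ennreal)" using True by simp
    then show ?thesis by (simp only: ennreal_SUP_of_nat_eq_top top_greatest)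
   next
    case False
    then obtain n where "V x < of_nat n" using ennreal_Ex_less_of_nat[of "V x"] by (auto simp: top.not_eq_extremum)
    then have "V x <= min (V x) (of_nat n)" by simp
    then show ?thesis by (rule order_trans[OF _ SUP_upper]) simp
   qed
  qed (rule SUP_least, simp)
  then show "V x * ennreal ((cmod (H 0 x))\<^sup>2) = (SUP K. min (V x) (of_nat K) * ennreal ((cmod (H 0 x))\<^sup>2))"
   by (simp add: SUP_mult_right_ennreal[symmetric])
 qed
 also have "... = (SUP K. nint (%x. min (V x) (of_nat K) * ennreal ((cmod (H 0 x))\<^sup>2)))"
 proof (rule nn_integral_monotone_convergence_SUP)
  show "incseq (%K x. min (V x) (of_nat K) * ennreal ((cmod (H 0 x))\<^sup>2))"
   by (intro incseq_SucI le_funI mult_right_mono min.mono) auto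
 qed measurable
 also have "... <= ennreal (R H)" by (rule SUP_least) (rule trunc)
 finally show ?thesis by (simp add: R_def)
qed

text \<open>\<open>vw V * f\<close> is square integrable exactly when the form of \<open>\<bar>V\<bar>\<close> is finite at f.\<close>
definition vw :: "('a::euclidean_space => real) => 'a => complex" where
 "vw V x = cor (sqrt \<bar>V x\<bar>)"

text \<open>A small radius de makes the coefficient 8 \<kappa> de / c of the gradient at most 1/2,
  at the price of a factor 1/de before the L^2 norm. A coefficient below 1 is what later allows the
  potential to be absorbed by the gradient.\<close>

lemma potential_form_bound:
 fixes V :: "'a::euclidean_space => real"
 assumes [measurable]: "V \<in> bm" and V: "morrey (%x. ennreal \<bar>V x\<bar>) \<kappa>"
 shows "\<exists>C\<ge>0. \<forall>\<Omega> H. H1 \<Omega> H --> sqi (%x. vw V x * H 0 x) &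
  (nrm (%x. vw V x * H 0 x))\<^sup>2 <= C * (nrm (H 0))\<^sup>2 + (\<Sum>b\<in>Basis. (nrm (H b))\<^sup>2) / 2"
proof -
 let ?c = "bvol TYPE('a)"
 have c: "0 < ?c" by (rule bvol_pos)
 have \<kappa>0: "0 <= \<kappa>" using V by (simp add: morrey_def)
 define de where "de = min 1 (?c / (16 * (\<kappa> + 1)))"
 have de: "0 < de" "de <= 1" "8 * \<kappa> * de / ?c <= 1 / 2"
 proof -
  show "0 < de" "de <= 1" using c \<kappa>0 by (auto simp: de_def)
  have "8 * \<kappa> * de <= 8 * (\<kappa> + 1) * (?c / (16 * (\<kappa> + 1)))" using c \<kappa>0 by (intro mult_mono) (auto simp: de_def)
  also have "... = ?c / 2" using \<kappa>0 by (simp add: field_simps)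
  finally show "8 * \<kappa> * de / ?c <= 1 / 2" using c by (simp add: pos_divide_le_eq)
 qed
 define C where "C = 2 * (\<kappa> / de) / ?c"
 have C0: "0 <= C" using c \<kappa>0 de by (simp add: C_def)
 have "sqi (%x. vw V x * H 0 x) &
  (nrm (%x. vw V x * H 0 x))\<^sup>2 <= C * (nrm (H 0))\<^sup>2 + (\<Sum>b\<in>Basis. (nrm (H b))\<^sup>2) / 2" if H: "H1 \<Omega> H" for \<Omega> H
 proof -
  have [measurable]: "H 0 \<in> bm" using H1_sqi[OF H] by (simp add: sqi_measurable)
  have mvw: "(%x. vw V x * H 0 x) \<in> bm" unfolding vw_def by measurable
  define Q where "Q = C * (nrm (H 0))\<^sup>2 + (\<Sum>b\<in>Basis. (nrm (H b))\<^sup>2) / 2"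
  have Q0: "0 <= Q" unfolding Q_def using C0 by (intro add_nonneg_nonneg mult_nonneg_nonneg divide_nonneg_nonneg sum_nonneg) auto
  have "(nint (%x. ennreal ((cmod (vw V x * H 0 x))\<^sup>2))) = (nint (%x. ennreal \<bar>V x\<bar> * ennreal ((cmod (H 0 x))\<^sup>2)))"
   by (simp add: vw_def norm_mult power_mult_distrib ennreal_mult)
  also have "... <= ennreal ((2 * (\<kappa> / de) * (nrm (H 0))\<^sup>2 + 8 * \<kappa> * de * (\<Sum>b\<in>Basis. (nrm (H b))\<^sup>2)) / ?c)"
   by (rule form_bound[OF H]) (use V de \<kappa>0 in \<open>auto simp: morrey_def\<close>)
  also have "... <= ennreal Q"
  proof (rule ennreal_leI)
   have "8 * \<kappa> * de / ?c * (\<Sum>b\<in>Basis. (nrm (H b))\<^sup>2) <= 1 / 2 * (\<Sum>b\<in>Basis. (nrm (H b))\<^sup>2)"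
    by (intro mult_right_mono de sum_nonneg) auto
   then show "(2 * (\<kappa> / de) * (nrm (H 0))\<^sup>2 + 8 * \<kappa> * de * (\<Sum>b\<in>Basis. (nrm (H b))\<^sup>2)) / ?c <= Q"
    by (simp add: Q_def C_def add_divide_distrib)
  qed
  also have "... = ennreal ((sqrt Q)\<^sup>2)" using Q0 by simp
  finally have *: "(nint (%x. ennreal ((cmod (vw V x * H 0 x))\<^sup>2))) <= ennreal ((sqrt Q)\<^sup>2)" .
  have "nrm (%x. vw V x * H 0 x) <= sqrt Q" "sqi (%x. vw V x * H 0 x)"
   using sqiI_le[OF mvw *] Q0 by auto
  then show ?thesis using Q0 power_mono[of "nrm (%x. vw V x * H 0 x)" "sqrt Q" 2] by (simp add: Q_def)
 qed
 with C0 show ?thesis by blast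
qed

section \<open>Weak evolution equations tested with their own time averages\<close>

text \<open>The uniform probability distribution on (t, t + h], so that constants are their own
  averages and norm estimates for averages carry no extra factor.\<close>

definition win :: "real => real => real measure" where
 "win t h = density lborel (%s. ennreal (indicator {t<..t + h} s / h))"

lemma sets_win [simp, measurable_cong]: "sets (win t h) = sets borel"
 by (simp add: win_def)

lemma AE_win:
 assumes "0 < h" "AE s in lborel. t < s & s <= t + h --> Q s"
 shows "AE s in win t h. Q s"
 unfolding win_def using assms(2)
 by (subst AE_density) (auto simp: indicator_def elim!: eventually_mono split: if_splits)

lemma emeasure_win: "0 < h ==> emeasure (win t h) (space (win t h)) = 1"
proof -
 assume h: "0 < h"
 have "emeasure (win t h) (space (win t h)) = (nint (%s. ennreal (1 / h) * indicator {t<..t + h} s))"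
  unfolding win_def using h by (subst emeasure_density) (auto intro!: nn_integral_cong simp: indicator_def)
 also have "... = 1" using h by (simp add: nn_integral_cmult flip: ennreal_mult)
 finally show ?thesis .
qed

lemma finite_measure_win: "0 < h ==> finite_measure (win t h)"
 by (rule finite_measureI) (simp add: emeasure_win)

lemma integral_win_const: "0 < h ==> integral\<^sup>L (win t h) (%s. c::complex) = c"
 by (simp add: measure_def emeasure_win)

lemma integral_win_constr: "0 < h ==> integral\<^sup>L (win t h) (%s. c::real) = c"
 by (simp add: measure_def emeasure_win)

lemma integrable_win:
 fixes f :: "real => 'b::{banach, second_countable_topology}"
 assumes [measurable]: "f \<in> bm" and h: "0 < h"
 shows "integrable (win t h) f \<longleftrightarrow> intl (%s. indicator {t<..t + h} s *\<^sub>R f s)"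
proof -
 have "integrable (win t h) f \<longleftrightarrow> intl (%s. (indicator {t<..t + h} s / h) *\<^sub>R f s)"
  unfolding win_def using h by (subst integrable_density) auto
 also have "(%s. (indicator {t<..t + h} s / h) *\<^sub>R f s) = (%s. (1 / h) *\<^sub>R (indicator {t<..t + h} s *\<^sub>R f s))"
  by auto
 also have "intl ... \<longleftrightarrow> intl (%s. indicator {t<..t + h} s *\<^sub>R f s)"
  using h integrable_scaleR_right[of h lborel "%s. (1 / h) *\<^sub>R (indicator {t<..t + h} s *\<^sub>R f s)"]
   integrable_scaleR_right[of "1 / h" lborel "%s. indicator {t<..t + h} s *\<^sub>R f s"] by auto
 finally show ?thesis .
qed

lemma integral_win:
 fixes f :: "real => 'b::{banach, second_countable_topology}"
 assumes [measurable]: "f \<in> bm" and h: "0 < h"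
 shows "integral\<^sup>L (win t h) f = (1 / h) *\<^sub>R (lint (%s. indicator {t<..t + h} s *\<^sub>R f s))"
proof -
 have "integral\<^sup>L (win t h) f = (lint (%s. (indicator {t<..t + h} s / h) *\<^sub>R f s))"
  unfolding win_def using h by (subst integral_density) auto
 also have "(%s. (indicator {t<..t + h} s / h) *\<^sub>R f s) = (%s. (1 / h) *\<^sub>R (indicator {t<..t + h} s *\<^sub>R f s))"
  by auto
 finally show ?thesis by (simp only: integral_scaleR_right)
qed

lemma nrm_measurable [measurable (raw)]:
 fixes v :: "real => 'a::euclidean_space => complex"
 assumes "(%(s, x). v s x) \<in> bm"
 shows "(%s. nrm (v s)) \<in> bm"
proof -
 have [measurable]: "(%(s, x). v s x) \<in> borel_measurable (borel \<Otimes>\<^sub>M borel)"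
  using assms by (simp add: borel_prod)
 show ?thesis unfolding nrm_def by measurable
qed

lemma section_measurable:
 fixes v :: "real => 'a::euclidean_space => complex"
 assumes "(%(s, x). v s x) \<in> bm"
 shows "v s \<in> bm" and "(%s. v s x) \<in> bm"
proof -
 have m: "(%(s, x). v s x) \<in> borel_measurable (borel \<Otimes>\<^sub>M borel)"
  using assms by (simp add: borel_prod)
 show "v s \<in> bm" using measurable_Pair2[OF m, of s] by simp
 show "(%s. v s x) \<in> bm" using measurable_Pair1[OF m, of x] by simp
qed

lemma pair_tendsto:
 assumes g: "sqi g" and f: "!!n. sqi (f n)" "sqi f'" and lim: "(%n. nrm (%x. f' x - f n x)) \<longlonglongrightarrow> 0"
 shows "(%n. lint (%x. g x * f n x)) \<longlonglongrightarrow> (lint (%x. g x * f' x))"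
proof (rule LIM_zero_cancel, rule Lim_null_comparison)
 show "(%n. nrm g * nrm (%x. f' x - f n x)) \<longlonglongrightarrow> 0" using tendsto_mult_right_zero[OF lim] by simp
 have "norm ((lint (%x. g x * f n x)) - (lint (%x. g x * f' x))) <= nrm g * nrm (%x. f' x - f n x)" for n
 proof -
  have "(lint (%x. g x * f n x)) - (lint (%x. g x * f' x)) = (lint (%x. g x * (f n x - f' x)))"
   using cauchy_schwarz(1)[OF g f(1)] cauchy_schwarz(1)[OF g f(2)]
   by (simp add: right_diff_distrib)
  then show ?thesis
   using cauchy_schwarz(3)[OF g sqi_diff(1)[OF f(1)[of n] f(2)]] by (simp add: nrm_minus_commute[of f'])
 qed
 then show "\<forall>\<^sub>F n in sequentially. norm ((lint (%x. g x * f n x)) - (lint (%x. g x * f' x))) <= nrm g * nrm (%x. f' x - f n x)"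
  by simp
qed

lemma sqi_chi:
 assumes "sqi f"
 shows "sqi (%x. cor (chi R x) * f x)" "nrm (%x. cor (chi R x) * f x) <= nrm f"
proof -
 have [measurable]: "f \<in> bm" using assms by (rule sqi_measurable)
 have "(%x. cor (chi R x) * f x) \<in> bm" by measurable
 from sqi_dom[OF this assms, of 1]
 show "sqi (%x. cor (chi R x) * f x)" "nrm (%x. cor (chi R x) * f x) <= nrm f"
  by (auto simp: norm_mult mult_left_le_one_le)
qed

definition chid :: "real => 'a::euclidean_space => 'a => complex" where
 "chid R b = pd b (%x. cor (chi R x))"

lemma chid_measurable [measurable]: "b \<in> Basis ==> chid R b \<in> bm"
 unfolding chid_def by (rule smooth_measurable[OF smooth_pd[OF smooth_chi]])

text \<open>Depends on the space only; fixing it by choice keeps it out of the parameter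
  lists.\<close>

definition cchi :: "'a::euclidean_space itself => real" where
 "cchi _ = (SOME C. C > 0 & (\<forall>R\<ge>1. \<forall>b\<in>Basis. \<forall>x::'a. cmod (chid R b x) <= C / R))"

lemma cchi: "cchi TYPE('a::euclidean_space) > 0"
 "R >= 1 ==> b \<in> Basis ==> cmod (chid R b (x::'a)) <= cchi TYPE('a) / R"
proof -
 have "\<exists>C>0. \<forall>R\<ge>1. \<forall>b\<in>Basis. \<forall>x::'a. cmod (chid R b x) <= C / R"
  unfolding chid_def by (rule pd_chi_bound)
 from someI_ex[OF this[simplified Bex_def]]
 show "cchi TYPE('a) > 0" "R >= 1 ==> b \<in> Basis ==> cmod (chid R b (x::'a)) <= cchi TYPE('a) / R"
  unfolding cchi_def by blast+
qed

lemma sqi_chid: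
 assumes "sqi f" "R >= 1" "b \<in> Basis"
 shows "sqi (%x. chid R b x * f x)" "nrm (%x. chid R b x * f (x::'a::euclidean_space)) <= cchi TYPE('a) / R * nrm f"
proof -
 have [measurable]: "f \<in> bm" using assms by (simp add: sqi_measurable)
 have "(%x. chid R b x * f x) \<in> bm" using assms by measurable
 moreover have "AE x in lborel. cmod (chid R b x * f x) <= cchi TYPE('a) / R * cmod (f x)"
  unfolding norm_mult by (intro AE_I2 mult_right_mono cchi assms) auto
 moreover have "0 <= cchi TYPE('a) / R" using cchi(1)[where 'a = 'a] assms(2) by simp
 ultimately show "sqi (%x. chid R b x * f x)" "nrm (%x. chid R b x * f x) <= cchi TYPE('a) / R * nrm f"
  using sqi_dom[OF _ assms(1)] by blast+
qed

lemma H1_cnj: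
 assumes "H1 \<Omega> H"
 shows "H1 \<Omega> (%i x. cnj (H i x))"
 unfolding H1_def
proof (intro conjI ballI allI impI)
 show "sqi (%x. cnj (H i x))" if "i \<in> idx" for i using H1_sqi[OF assms that] by simp
 fix e :: real assume "0 < e"
 then obtain ph where ph: "test_fun \<Omega> ph" "!!i. i \<in> idx ==> nrm (%x. H i x - jet ph i x) < e"
  using assms unfolding H1_def by blast
 have "nrm (%x. cnj (H i x) - jet (%x. cnj (ph x)) i x) < e" if "i \<in> idx" for i
  using ph(2)[OF that] nrm_cnj[of "%x. H i x - jet ph i x"] by (simp add: jet_cnj[OF test_fun_smooth[OF ph(1)] that])
 then show "\<exists>ph. test_fun \<Omega> ph & (\<forall>i\<in>idx. nrm (%x. cnj (H i x) - jet ph i x) < e)"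
  using test_fun_cnj[OF ph(1)] by blast
qed

text \<open>Abstract form of i u_t + Lap u + V u + P = F, integrated in time and tested bilinearly,
  without conjugation. \<open>H 0\<close> is the solution, \<open>H b\<close> its partial
  derivatives, and \<open>A\<close> a set of full measure of good times. The nonlinear term is an
  arbitrary locally square integrable P, because the same theory is applied both to a solution and
  to the difference of a solution and its time translate, where P is not a function of
  \<open>H 0\<close>.\<close>

locale evo =
 fixes \<Omega> :: "'a::euclidean_space set" and V :: "'a => real" and \<kappa> :: real and A :: "real set"
  and H :: "'a => real => 'a => complex" and P F :: "real => 'a => complex"
 assumes V_meas [measurable]: "V \<in> bm"
  and V_morrey: "morrey (%x. ennreal \<bar>V x\<bar>) \<kappa>"
  and A_pos: "A \<subseteq> {0<..}" and A_AE: "AE t in lborel. 0 < t --> t \<in> A"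
  and H_meas: "i \<in> idx ==> (%(s, x). H i s x) \<in> bm"
  and P_meas: "(%(s, x). P s x) \<in> bm"
  and F_meas: "(%(s, x). F s x) \<in> bm"
  and H_H1: "t \<in> A ==> H1 \<Omega> (%i. H i t)"
  and F_sqi: "t \<in> A ==> sqi (F t)"
  and H_int: "i \<in> idx ==> set_integrable lborel {0..T} (%t. nrm (H i t))"
  and F_int: "set_integrable lborel {0..T} (%t. nrm (F t))"
  and ucont: "0 < e ==> \<exists>d>0. \<forall>s\<in>A. \<forall>t\<in>A. s <= T --> t <= T --> \<bar>s - t\<bar> <= d --> nrm (%x. H 0 s x - H 0 t x) <= e"
  and P_loc: "\<exists>C\<ge>0. \<forall>t\<in>A. t <= T --> sqi (%x. indicator (cball 0 R) x * P t x) & nrm (%x. indicator (cball 0 R) x * P t x) <= C"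
  and eqn: "s \<in> A ==> t \<in> A ==> s < t ==> test_fun \<Omega> ph ==>
   \<i> * (lint (%x. (H 0 t x - H 0 s x) * ph x)) =
   (lint (%r. indicator {s<..t} r *\<^sub>R ((\<Sum>b\<in>Basis. lint (%x. H b r x * pd b ph x))
    - (lint (%x. V x * H 0 r x * ph x)) - (lint (%x. P r x * ph x)) + (lint (%x. F r x * ph x)))))"
begin

lemma AE_win_A: "0 <= t ==> 0 < h ==> AE s in win t h. s \<in> A"
 by (rule AE_win) (use A_AE in \<open>auto elim!: eventually_mono\<close>)

lemma integrable_win_sub:
 fixes f :: "real => real"
 assumes "set_integrable lborel {0..t + h} f" "f \<in> bm" "0 <= t" "0 < h"
 shows "integrable (win t h) f"
proof -
 have "set_integrable lborel {t<..t + h} f"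
  by (rule set_integrable_subset[OF assms(1)]) (use assms(3) in auto)
 then show ?thesis using assms by (simp add: integrable_win set_integrable_def)
qed

lemma nrmH_measurable [measurable]: "i \<in> idx ==> (%s. nrm (H i s)) \<in> bm"
 by (rule nrm_measurable[OF H_meas])

lemma ta_H: "i \<in> idx ==> 0 <= t ==> 0 < h ==> time_avg (win t h) (H i)"
proof -
 assume a: "i \<in> idx" "0 <= t" "0 < h"
 interpret finite_measure "win t h" by (rule finite_measure_win[OF a(3)])
 show ?thesis
 proof
  show "AE s in win t h. sqi (H i s)" using AE_win_A[OF a(2,3)] by eventually_elim (use H1_sqi[OF H_H1] a in auto)
  show "integrable (win t h) (%s. nrm (H i s))" using a by (intro integrable_win_sub H_int) auto
 qed (use a H_meas in auto)
qed

lemma ta_F: "0 <= t ==> 0 < h ==> time_avg (win t h) F"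
proof -
 assume a: "0 <= t" "0 < h"
 interpret finite_measure "win t h" by (rule finite_measure_win[OF a(2)])
 show ?thesis
 proof
  show "AE s in win t h. sqi (F s)" using AE_win_A[OF a] by eventually_elim (rule F_sqi)
  show "integrable (win t h) (%s. nrm (F s))" using a by (intro integrable_win_sub F_int nrm_measurable F_meas) auto
 qed (use F_meas in auto)
qed

text \<open>The averaging results require square integrable slices, which P has after restriction to
  a ball.\<close>

definition PR :: "real => real => 'a => complex" where
 "PR R s x = indicator (cball 0 R) x * P s x"

lemma PR_meas: "(%(s, x). PR R s x) \<in> bm"
proof -
 have [measurable]: "(%(s, x). P s x) \<in> borel_measurable (borel \<Otimes>\<^sub>M borel)" "cball (0::'a) R \<in> sets borel"
  using P_meas by (auto simp: borel_prod)
 have "(%(s, x). PR R s x) \<in> borel_measurable (borel \<Otimes>\<^sub>M borel)" unfolding PR_def by measurable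
 then show ?thesis by (simp add: borel_prod)
qed

lemma ta_P: "0 <= t ==> 0 < h ==> time_avg (win t h) (PR R)"
proof -
 assume a: "0 <= t" "0 < h"
 interpret finite_measure "win t h" by (rule finite_measure_win[OF a(2)])
 obtain C where C: "!!s. s \<in> A ==> s <= t + h ==> sqi (PR R s) & nrm (PR R s) <= C"
  using P_loc[of "t + h" R] unfolding PR_def[abs_def] by blast
 have ae: "AE s in win t h. s \<in> A & s <= t + h"
  using AE_win_A[OF a] AE_win[OF a(2), of t "%s. s <= t + h"] by auto
 show ?thesis
 proof
  show "AE s in win t h. sqi (PR R s)" using ae by eventually_elim (use C in auto)
  have "(%s. nrm (PR R s)) \<in> bm" by (rule nrm_measurable[OF PR_meas])
  moreover have "AE s in win t h. norm (nrm (PR R s)) <= C"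
   using ae by eventually_elim (use C in auto)
  ultimately show "integrable (win t h) (%s. nrm (PR R s))"
   by (intro integrable_const_bound[where B = C]) auto
 qed (use PR_meas in auto)
qed

lemma avg_PR: "avg (win t h) (PR R) x = indicator (cball 0 R) x * avg (win t h) P x"
 by (simp add: avg_def PR_def)

lemma H1_w: "0 <= t ==> 0 < h ==> H1 \<Omega> (%i. avg (win t h) (H i))"
 by (rule H1_avg[OF ta_H], assumption+) (use AE_win_A H_H1 in \<open>blast intro: eventually_mono\<close>)

text \<open>Constants of the form bound for \<open>\<bar>V\<bar>\<close>.\<close>
definition CV :: real where
 "CV = (SOME C. C >= 0 & (\<forall>\<Omega> H. H1 \<Omega> H --> sqi (%x. vw V x * H 0 x) &
  (nrm (%x. vw V x * H 0 x))\<^sup>2 <= C * (nrm (H 0))\<^sup>2 + (\<Sum>b\<in>Basis. (nrm (H b))\<^sup>2) / 2))"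

lemma CV: "0 <= CV" "H1 \<Omega>' K ==> sqi (%x. vw V x * K 0 x)"
 "H1 \<Omega>' K ==> (nrm (%x. vw V x * K 0 x))\<^sup>2 <= CV * (nrm (K 0))\<^sup>2 + (\<Sum>b\<in>Basis. (nrm (K b))\<^sup>2) / 2"
proof -
 from potential_form_bound[OF V_meas V_morrey]
 have "\<exists>C. C >= 0 & (\<forall>\<Omega> H. H1 \<Omega> H --> sqi (%x. vw V x * H 0 x) &
  (nrm (%x. vw V x * H 0 x))\<^sup>2 <= C * (nrm (H 0))\<^sup>2 + (\<Sum>b\<in>Basis. (nrm (H b))\<^sup>2) / 2)"
  by blast
 from someI_ex[OF this]
 have *: "CV >= 0 & (\<forall>\<Omega> H. H1 \<Omega> H --> sqi (%x. vw V x * H 0 x) &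
  (nrm (%x. vw V x * H 0 x))\<^sup>2 <= CV * (nrm (H 0))\<^sup>2 + (\<Sum>b\<in>Basis. (nrm (H b))\<^sup>2) / 2)"
  unfolding CV_def .
 show "0 <= CV" using * by blast
 show "H1 \<Omega>' K ==> sqi (%x. vw V x * K 0 x)" using * by blast
 show "H1 \<Omega>' K ==> (nrm (%x. vw V x * K 0 x))\<^sup>2 <= CV * (nrm (K 0))\<^sup>2 + (\<Sum>b\<in>Basis. (nrm (K b))\<^sup>2) / 2"
  using * by blast
qed

lemma nrm_vw_le: assumes "H1 \<Omega>' K" shows "nrm (%x. vw V x * K 0 x) <= sqrt (CV + 1) * jn K"
proof -
 have "(\<Sum>b\<in>Basis. (nrm (K b))\<^sup>2) <= (\<Sum>b\<in>Basis. nrm (K b) * jn K)"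
  by (intro sum_mono) (simp add: power2_eq_square mult_left_mono nrm_le_jn)
 also have "... <= jn K * jn K"
  unfolding sum_distrib_right[symmetric] by (intro mult_right_mono jn_nonneg) (simp add: jn_def sum_idx)
 finally have "(\<Sum>b\<in>Basis. (nrm (K b))\<^sup>2) <= (jn K)\<^sup>2" by (simp add: power2_eq_square)
 moreover have "CV * (nrm (K 0))\<^sup>2 <= CV * (jn K)\<^sup>2" using CV(1) by (intro mult_left_mono power_mono nrm_le_jn) auto
 moreover have "0 <= (\<Sum>b\<in>Basis. (nrm (K b))\<^sup>2)" by (intro sum_nonneg) auto
 ultimately have "(nrm (%x. vw V x * K 0 x))\<^sup>2 <= (CV + 1) * (jn K)\<^sup>2"
  using CV(3)[OF assms] by (simp add: algebra_simps)
 also have "... = (sqrt (CV + 1) * jn K)\<^sup>2" using CV(1) by (simp add: power_mult_distrib)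
 finally show ?thesis by (rule power2_le_imp_le) (use CV(1) in simp)
qed

text \<open>Gives one factor sqrt |V| to each argument, so that the pairing with V becomes one of
  two square integrable functions whenever both have finite form.\<close>

lemma V_split: "cor (V x) * a * b = (cor (sgn (V x)) * (vw V x * a)) * (vw V x * b)"
proof -
 have "cor (V x) = cor (sgn (V x)) * (vw V x * vw V x)"
  unfolding vw_def of_real_mult[symmetric] by (simp add: mult_sgn_abs)
 then show ?thesis by (simp only: mult_ac)
qed

lemma sqi_sgn:
 assumes "sqi f" shows "sqi (%x. cor (sgn (V x)) * f x)" "nrm (%x. cor (sgn (V x)) * f x) <= nrm f"
proof -
 have [measurable]: "f \<in> bm" using assms by (rule sqi_measurable)
 have m: "(%x. cor (sgn (V x)) * f x) \<in> bm" by measurable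
 have ae: "AE x in lborel. cmod (cor (sgn (V x)) * f x) <= 1 * cmod (f x)"
  by (rule AE_I2) (simp add: norm_mult sgn_real_def)
 show "sqi (%x. cor (sgn (V x)) * f x)"
  by (rule sqi_dom(1)[OF m assms ae zero_le_one])
 show "nrm (%x. cor (sgn (V x)) * f x) <= nrm f"
  using sqi_dom(2)[OF m assms ae zero_le_one] by (simp only: mult_1)
qed

text \<open>Fubini term by term. The potential term is the delicate one: its integrability over the
  window comes from Cauchy-Schwarz for the form of |V|, with a multiple of the jet norm, integrable
  in time, as majorant.\<close>

lemma window_rhs:
 assumes t0: "0 <= t" and h: "0 < h" and ph: "test_fun \<Omega> ph"
 defines "f s \<equiv> (\<Sum>b\<in>Basis. lint (%x. H b s x * pd b ph x))
    - (lint (%x. V x * H 0 s x * ph x)) - (lint (%x. P s x * ph x)) + (lint (%x. F s x * ph x))"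
 shows "integrable (win t h) f" and "integral\<^sup>L (win t h) f = (\<Sum>b\<in>Basis. lint (%x. avg (win t h) (H b) x * pd b ph x))
    - (lint (%x. V x * avg (win t h) (H 0) x * ph x))
    - (lint (%x. avg (win t h) P x * ph x)) + (lint (%x. avg (win t h) F x * ph x))"
proof -
 let ?\<mu> = "win t h"
 have sm: "smooth ph" using ph by (rule test_fun_smooth)
 have sph: "sqi ph" using ph by (rule test_fun_sqi)
 have [measurable]: "ph \<in> bm" using sph by (rule sqi_measurable)
 have pH: "integrable ?\<mu> (%s. lint (%x. H b s x * pd b ph x))"
  "(lint (%x. avg ?\<mu> (H b) x * pd b ph x)) = (\<integral>s. lint (%x. H b s x * pd b ph x) \<partial>?\<mu>)" if b: "b \<in> Basis" for b
  using time_avg.pair[OF ta_H[OF _ t0 h] test_fun_sqi[OF test_fun_pd[OF ph b]]] b by auto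
 have pF: "integrable ?\<mu> (%s. lint (%x. F s x * ph x))"
  "(lint (%x. avg ?\<mu> F x * ph x)) = (\<integral>s. lint (%x. F s x * ph x) \<partial>?\<mu>)"
  using time_avg.pair[OF ta_F[OF t0 h] sph] by auto
 obtain R where "\<forall>x\<in>tsupport ph. norm x <= R"
  using compact_imp_bounded[of "tsupport ph"] ph unfolding bounded_iff test_fun_def by blast
 then have PR: "PR R s x * ph x = P s x * ph x" "indicator (cball 0 R) x * y * ph x = y * ph x" for s x y
  using tsupport_0[of x ph] by (auto simp: PR_def indicator_def)
 have pP: "integrable ?\<mu> (%s. lint (%x. P s x * ph x))"
  "(lint (%x. avg ?\<mu> P x * ph x)) = (\<integral>s. lint (%x. P s x * ph x) \<partial>?\<mu>)"
  using time_avg.pair[OF ta_P[OF t0 h] sph, of R] by (auto simp: PR avg_PR)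
 have pV: "integrable ?\<mu> (%s. lint (%x. V x * H 0 s x * ph x))"
  "(lint (%x. V x * avg ?\<mu> (H 0) x * ph x)) = (\<integral>s. lint (%x. V x * H 0 s x * ph x) \<partial>?\<mu>)"
 proof -
  have j: "H1 \<Omega> (jet ph)" by (rule H1_jet[OF ph])
  have jint: "integrable ?\<mu> (%s. jn (%i. H i s))"
   unfolding jn_def using time_avg.int_nrm[OF ta_H[OF _ t0 h]] by (intro BI_integrable_sum) auto
  have "(\<integral>\<^sup>+s. nint (%x. ennreal (cmod (H 0 s x) * cmod (V x * ph x))) \<partial>?\<mu>) <=
   (\<integral>\<^sup>+s. ennreal (sqrt (CV + 1) * nrm (%x. vw V x * ph x) * jn (%i. H i s)) \<partial>?\<mu>)"
  proof (rule nn_integral_mono_AE)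
   show "AE s in ?\<mu>. (nint (%x. ennreal (cmod (H 0 s x) * cmod (V x * ph x)))) <=
    ennreal (sqrt (CV + 1) * nrm (%x. vw V x * ph x) * jn (%i. H i s))"
    using AE_win_A[OF t0 h]
   proof eventually_elim
    case (elim s)
    have "(nint (%x. ennreal (cmod (H 0 s x) * cmod (V x * ph x)))) =
     (nint (%x. ennreal (cmod (vw V x * H 0 s x) * cmod (vw V x * ph x))))"
    proof (intro nn_integral_cong arg_cong[where f = ennreal])
     fix x
     have "cmod (vw V x) * cmod (vw V x) = \<bar>V x\<bar>" by (simp add: vw_def)
     then show "cmod (H 0 s x) * cmod (V x * ph x) = cmod (vw V x * H 0 s x) * cmod (vw V x * ph x)"
     proof -
      have "cmod (vw V x * H 0 s x) * cmod (vw V x * ph x) = (cmod (vw V x) * cmod (vw V x)) * (cmod (H 0 s x) * cmod (ph x))"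
       by (simp only: norm_mult mult_ac)
      then show ?thesis using \<open>cmod (vw V x) * cmod (vw V x) = \<bar>V x\<bar>\<close> by (simp add: norm_mult mult_ac)
     qed
    qed
    also have "... <= ennreal (nrm (%x. vw V x * H 0 s x) * nrm (%x. vw V x * ph x))"
     using CV(2)[OF H_H1[OF elim]] CV(2)[OF j] by (intro nn_cauchy_schwarz) auto
    also have "... <= ennreal (sqrt (CV + 1) * jn (%i. H i s) * nrm (%x. vw V x * ph x))"
     using nrm_vw_le[OF H_H1[OF elim]] by (intro ennreal_leI mult_right_mono) auto
    finally show ?case by (simp add: mult_ac)
   qed
  qed
  also have "... < \<infinity>"
   using integrable_mult_right[OF jint, of "sqrt (CV + 1) * nrm (%x. vw V x * ph x)"] CV(1)
   by (subst nn_integral_eq_integral) auto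
  finally have fin: "(\<integral>\<^sup>+s. nint (%x. ennreal (cmod (H 0 s x) * cmod (V x * ph x))) \<partial>?\<mu>) < \<infinity>" .
  show "integrable ?\<mu> (%s. lint (%x. V x * H 0 s x * ph x))"
  "(lint (%x. V x * avg ?\<mu> (H 0) x * ph x)) = (\<integral>s. lint (%x. V x * H 0 s x * ph x) \<partial>?\<mu>)"
   using time_avg.pair_gen(1,2)[OF ta_H[OF zero_idx t0 h] _ fin] by (auto simp: mult_ac)
 qed
 show "integrable (win t h) f" "integral\<^sup>L (win t h) f = (\<Sum>b\<in>Basis. lint (%x. avg (win t h) (H b) x * pd b ph x))
    - (lint (%x. V x * avg (win t h) (H 0) x * ph x))
    - (lint (%x. avg (win t h) P x * ph x)) + (lint (%x. avg (win t h) F x * ph x))"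
  unfolding f_def[abs_def] using pH pF pP pV by (auto simp: BI_integral_sum)
qed

text \<open>Divided by h, the integrated equation becomes a stationary equation for the window
  average, in which the difference quotient plays the part of the time derivative.\<close>

lemma window_eq_test:
 assumes t: "t \<in> A" "t + h \<in> A" "0 < h" and ph: "test_fun \<Omega> ph"
 shows "\<i> * (lint (%x. (H 0 (t + h) x - H 0 t x) / h * ph x)) =
   (\<Sum>b\<in>Basis. lint (%x. avg (win t h) (H b) x * pd b ph x))
    - (lint (%x. V x * avg (win t h) (H 0) x * ph x))
    - (lint (%x. avg (win t h) P x * ph x)) + (lint (%x. avg (win t h) F x * ph x))"
proof -
 have t0: "0 <= t" using t A_pos by auto
 let ?\<mu> = "win t h"
 define f where "f s = (\<Sum>b\<in>Basis. lint (%x. H b s x * pd b ph x))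
    - (lint (%x. V x * H 0 s x * ph x)) - (lint (%x. P s x * ph x)) + (lint (%x. F s x * ph x))" for s
 note intf = window_rhs[OF t0 t(3) ph, folded f_def[abs_def]]
 have mf: "f \<in> bm"
  using borel_measurable_integrable[OF intf(1)] by (simp add: measurable_cong_sets[OF sets_win refl])
 have "\<i> * (lint (%x. (H 0 (t + h) x - H 0 t x) / h * ph x)) = (1 / h) *\<^sub>R (\<i> * (lint (%x. (H 0 (t + h) x - H 0 t x) * ph x)))"
 proof -
  have "(lint (%x. (H 0 (t + h) x - H 0 t x) / h * ph x)) = (lint (%x. cor (1 / h) * ((H 0 (t + h) x - H 0 t x) * ph x)))"
   by (intro BI_integral_cong refl) simp
  also have "... = cor (1 / h) * (lint (%x. (H 0 (t + h) x - H 0 t x) * ph x))"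
   by (rule integral_mult_right_zero)
  finally show ?thesis by (simp add: scaleR_conv_of_real)
 qed
 also have "\<i> * (lint (%x. (H 0 (t + h) x - H 0 t x) * ph x)) = (lint (%r. indicator {t<..t + h} r *\<^sub>R f r))"
  unfolding f_def using eqn[OF t(1,2) _ ph] t(3) by simp
 also have "(1 / h) *\<^sub>R ... = integral\<^sup>L ?\<mu> f"
  by (rule integral_win[OF mf t(3), symmetric])
 finally show ?thesis using intf(2) by simp
qed

end

context evo
begin

definition W :: "real => real => 'a => 'a => complex" where
 "W t h i = avg (win t h) (H i)"

definition Dq :: "real => real => 'a => complex" where
 "Dq t h x = (H 0 (t + h) x - H 0 t x) / of_real h"

lemma sqi_Dq: "t \<in> A ==> t + h \<in> A ==> sqi (Dq t h)"
 unfolding Dq_def[abs_def] divide_inverse mult.commute[of _ "inverse _"]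
 by (intro sqi_cmult sqi_diff) (use H1_sqi[OF H_H1] in auto)

lemma chi_tendsto:
 assumes K: "sqi K" and f: "!!n::nat. sqi (f n)" and l: "(%n. nrm (%x. K x - f n x)) \<longlonglongrightarrow> 0"
 shows "(%n. nrm (%x. cor (chi R x) * K x - cor (chi R x) * f n x)) \<longlonglongrightarrow> 0"
proof (rule tendsto_sandwich[OF _ _ tendsto_const l])
 show "\<forall>\<^sub>F n in sequentially. nrm (%x. cor (chi R x) * K x - cor (chi R x) * f n x) <= nrm (%x. K x - f n x)"
  using sqi_chi(2)[OF sqi_diff(1)[OF K f]] by (simp add: right_diff_distrib)
qed simp

text \<open>Extends the averaged equation from test functions to chi R * K with K in their closure.
  The cut-off serves the P term: it confines that pairing to the ball of radius 2 R, where P is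
  square integrable. The potential term converges because multiplication by \<open>vw V\<close> is
  bounded from the jet norm to L^2.\<close>

lemma window_eq_chi:
 assumes t: "t \<in> A" "t + h \<in> A" "0 < h" and R: "R >= 1" and K: "H1 \<Omega> K"
 shows "\<i> * (lint (%x. Dq t h x * (cor (chi R x) * K 0 x))) =
   (\<Sum>b\<in>Basis. lint (%x. W t h b x * (chid R b x * K 0 x + cor (chi R x) * K b x)))
    - (lint (%x. V x * W t h 0 x * (cor (chi R x) * K 0 x)))
    - (lint (%x. avg (win t h) P x * (cor (chi R x) * K 0 x)))
    + (lint (%x. avg (win t h) F x * (cor (chi R x) * K 0 x)))"
proof -
 have t0: "0 <= t" using t A_pos by auto
 have Hw: "H1 \<Omega> (W t h)" unfolding W_def[abs_def] by (rule H1_w[OF t0 t(3)])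
 have sW: "i \<in> idx ==> sqi (W t h i)" for i by (rule H1_sqi[OF Hw])
 obtain ph where ph: "!!n::nat. test_fun \<Omega> (ph n)"
  "!!i. i \<in> idx ==> (%n. nrm (%x. K i x - jet (ph n) i x)) \<longlonglongrightarrow> 0"
  "!!i. i \<in> idx ==> (%n. nrm (jet (ph n) i)) \<longlonglongrightarrow> nrm (K i)"
  using H1_seq[OF K] by blast
 have sK: "i \<in> idx ==> sqi (K i)" for i by (rule H1_sqi[OF K])
 have sph: "i \<in> idx ==> sqi (jet (ph n) i)" for i n by (rule sqi_jet[OF ph(1)])
 have sph0: "sqi (ph n)" for n using sph[of 0] by simp
 have l0: "(%n. nrm (%x. K 0 x - ph n x)) \<longlonglongrightarrow> 0" using ph(2)[of 0] by simp
 let ?c = "%x::'a. cor (chi R x)"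
 have c0: "(%n. nrm (%x. ?c x * K 0 x - ?c x * ph n x)) \<longlonglongrightarrow> 0"
  by (rule chi_tendsto[OF sK[OF zero_idx] sph0 l0])
 have scK: "sqi (%x. ?c x * K 0 x)" and scph: "sqi (%x. ?c x * ph n x)" for n
  by (intro sqi_chi sK sph0 zero_idx)+
 have eq: "\<i> * (lint (%x. Dq t h x * (?c x * ph n x))) =
   (\<Sum>b\<in>Basis. lint (%x. W t h b x * (chid R b x * ph n x + ?c x * pd b (ph n) x)))
    - (lint (%x. V x * W t h 0 x * (?c x * ph n x)))
    - (lint (%x. avg (win t h) P x * (?c x * ph n x)))
    + (lint (%x. avg (win t h) F x * (?c x * ph n x)))" for n
 proof -
  have tc: "test_fun \<Omega> (%x. ?c x * ph n x)" by (rule test_fun_mult[OF smooth_chi ph(1)])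
  have p: "pd b (%x. ?c x * ph n x) x = chid R b x * ph n x + ?c x * pd b (ph n) x" if "b \<in> Basis" for b x
   unfolding chid_def by (rule pd_mult[OF smooth_chi test_fun_smooth[OF ph(1)] that])
  show ?thesis using window_eq_test[OF t tc] p by (simp add: Dq_def W_def)
 qed
 have L1: "(%n. lint (%x. Dq t h x * (?c x * ph n x))) \<longlonglongrightarrow> (lint (%x. Dq t h x * (?c x * K 0 x)))"
  by (rule pair_tendsto[OF sqi_Dq[OF t(1,2)] scph scK c0])
 have L2: "(%n. lint (%x. W t h b x * (chid R b x * ph n x + ?c x * pd b (ph n) x))) \<longlonglongrightarrow>
  (lint (%x. W t h b x * (chid R b x * K 0 x + ?c x * K b x)))" if b: "b \<in> Basis" for b
 proof (rule pair_tendsto)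
  have bi: "b \<in> idx" using b by simp
  have s1: "sqi (%x. chid R b x * f x)" if "sqi f" for f by (rule sqi_chid[OF that R b])
  have sb: "sqi (pd b (ph n))" for n using sph[OF bi] b by simp
  show "sqi (%x. chid R b x * ph n x + ?c x * pd b (ph n) x)" for n
   by (intro sqi_add s1 sph0 sqi_chi sb)
  show "sqi (%x. chid R b x * K 0 x + ?c x * K b x)"
   by (intro sqi_add s1 sqi_chi sK bi zero_idx)
  have lb: "(%n. nrm (%x. K b x - pd b (ph n) x)) \<longlonglongrightarrow> 0" using ph(2)[OF bi] b by simp
  show "(%n. nrm (%x. chid R b x * K 0 x + ?c x * K b x - (chid R b x * ph n x + ?c x * pd b (ph n) x))) \<longlonglongrightarrow> 0"
  proof (rule tendsto_sandwich[OF _ _ tendsto_const])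
   show "(%n. cchi TYPE('a) / R * nrm (%x. K 0 x - ph n x) + nrm (%x. ?c x * K b x - ?c x * pd b (ph n) x)) \<longlonglongrightarrow> 0"
    using tendsto_add[OF tendsto_mult_right_zero[OF l0, of "cchi TYPE('a) / R"] chi_tendsto[OF sK[OF bi] sb lb, of R]] by simp
   have "nrm (%x. chid R b x * K 0 x + ?c x * K b x - (chid R b x * ph n x + ?c x * pd b (ph n) x)) <=
    cchi TYPE('a) / R * nrm (%x. K 0 x - ph n x) + nrm (%x. ?c x * K b x - ?c x * pd b (ph n) x)" for n
   proof -
    have "(%x. chid R b x * K 0 x + ?c x * K b x - (chid R b x * ph n x + ?c x * pd b (ph n) x)) =
     (%x. chid R b x * (K 0 x - ph n x) + (?c x * K b x - ?c x * pd b (ph n) x))"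
     by (simp add: algebra_simps)
    moreover have "nrm (%x. chid R b x * (K 0 x - ph n x) + (?c x * K b x - ?c x * pd b (ph n) x)) <=
     nrm (%x. chid R b x * (K 0 x - ph n x)) + nrm (%x. ?c x * K b x - ?c x * pd b (ph n) x)"
     by (intro sqi_add(2) s1 sqi_diff(1) sqi_chi sK sph0 sb bi zero_idx)
    ultimately show ?thesis
     using sqi_chid(2)[OF sqi_diff(1)[OF sK[OF zero_idx] sph0] R b, of n] by simp
   qed
   then show "\<forall>\<^sub>F n in sequentially. nrm (%x. chid R b x * K 0 x + ?c x * K b x - (chid R b x * ph n x + ?c x * pd b (ph n) x))
    <= cchi TYPE('a) / R * nrm (%x. K 0 x - ph n x) + nrm (%x. ?c x * K b x - ?c x * pd b (ph n) x)" by simp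
  qed simp
 qed (use sW b in simp)
 have L3: "(%n. lint (%x. V x * W t h 0 x * (?c x * ph n x))) \<longlonglongrightarrow> (lint (%x. V x * W t h 0 x * (?c x * K 0 x)))"
 proof -
  have e: "V x * W t h 0 x * (?c x * f) = (cor (sgn (V x)) * (vw V x * W t h 0 x)) * (?c x * (vw V x * f))" for x f
   unfolding V_split[of x "W t h 0 x" "?c x * f"] by (simp only: mult_ac)
  have svK: "sqi (%x. vw V x * K 0 x)" by (rule CV(2)[OF K])
  have svph: "sqi (%x. vw V x * ph n x)" for n using CV(2)[OF H1_jet[OF ph(1)]] by simp
  have "(%n. nrm (%x. vw V x * K 0 x - vw V x * ph n x)) \<longlonglongrightarrow> 0"
  proof (rule tendsto_sandwich[OF _ _ tendsto_const])
   have "(%n. jn (%i x. K i x - jet (ph n) i x)) \<longlonglongrightarrow> (\<Sum>i\<in>(idx::'a set). 0)"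
    unfolding jn_def by (intro tendsto_sum ph)
   then have "(%n. jn (%i x. K i x - jet (ph n) i x)) \<longlonglongrightarrow> 0" by simp
   then show "(%n. sqrt (CV + 1) * jn (%i x. K i x - jet (ph n) i x)) \<longlonglongrightarrow> 0"
    by (rule tendsto_mult_right_zero)
   show "\<forall>\<^sub>F n in sequentially. nrm (%x. vw V x * K 0 x - vw V x * ph n x) <= sqrt (CV + 1) * jn (%i x. K i x - jet (ph n) i x)"
    using nrm_vw_le[OF H1_diff[OF K H1_jet[OF ph(1)]]] by (simp add: right_diff_distrib)
  qed simp
  from chi_tendsto[OF svK svph this]
  have "(%n. nrm (%x. ?c x * (vw V x * K 0 x) - ?c x * (vw V x * ph n x))) \<longlonglongrightarrow> 0" .
  then show ?thesis unfolding e
   by (intro pair_tendsto sqi_sgn sqi_chi svK svph CV(2)[OF Hw])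
 qed
 have L4: "(%n. lint (%x. avg (win t h) P x * (?c x * ph n x))) \<longlonglongrightarrow> (lint (%x. avg (win t h) P x * (?c x * K 0 x)))"
 proof -
  have "avg (win t h) P x * (?c x * f) = avg (win t h) (PR (2 * R)) x * (?c x * f)" for x f
   using chi_0[of R x] R by (cases "norm x <= 2 * R") (auto simp: avg_PR indicator_def)
  moreover have "(%n. lint (%x. avg (win t h) (PR (2 * R)) x * (?c x * ph n x))) \<longlonglongrightarrow>
   (lint (%x. avg (win t h) (PR (2 * R)) x * (?c x * K 0 x)))"
   by (intro pair_tendsto[OF _ scph scK c0] time_avg.sqi_avg ta_P t0 t)
  ultimately show ?thesis by presburger
 qed
 have L5: "(%n. lint (%x. avg (win t h) F x * (?c x * ph n x))) \<longlonglongrightarrow> (lint (%x. avg (win t h) F x * (?c x * K 0 x)))"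
  by (intro pair_tendsto[OF _ scph scK c0] time_avg.sqi_avg ta_F t0 t)
 have "(%n. \<i> * (lint (%x. Dq t h x * (?c x * ph n x)))) \<longlonglongrightarrow>
   (\<Sum>b\<in>Basis. lint (%x. W t h b x * (chid R b x * K 0 x + ?c x * K b x)))
    - (lint (%x. V x * W t h 0 x * (?c x * K 0 x)))
    - (lint (%x. avg (win t h) P x * (?c x * K 0 x)))
    + (lint (%x. avg (win t h) F x * (?c x * K 0 x)))"
  unfolding eq by (intro tendsto_intros L2 L3 L4 L5)
 moreover have "(%n. \<i> * (lint (%x. Dq t h x * (?c x * ph n x)))) \<longlonglongrightarrow> \<i> * (lint (%x. Dq t h x * (?c x * K 0 x)))"
  by (intro tendsto_intros L1)
 ultimately show ?thesis by (rule LIMSEQ_unique[symmetric])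
qed

definition Pw :: "real => real => real => complex" where
 "Pw R t h = (lint (%x. avg (win t h) P x * (cor (chi R x) * cnj (W t h 0 x))))"

definition Qw :: "real => real => real => real" where
 "Qw R t h = (\<Sum>b\<in>Basis. lint (%x. chi R x * (cmod (W t h b x))\<^sup>2))"

lemma chi_square:
 "(lint (%x. f x * (cor (chi R x) * cnj (f x)))) = cor (lint (%x. chi R x * (cmod (f x))\<^sup>2))"
proof -
 have "f x * (cor (chi R x) * cnj (f x)) = cor (chi R x * (cmod (f x))\<^sup>2)" for x
  unfolding of_real_mult complex_norm_square by (simp only: mult_ac)
 then show ?thesis by (simp only: integral_complex_of_real)
qed

text \<open>The test function is the cut-off times the conjugate of the average itself. E is the
  commutator with the cut-off, U the potential and G the forcing. U and \<open>Qw\<close> are real,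
  so they drop out of the imaginary part, which gives the energy balance, while the real part gives
  the gradient bound.\<close>

lemma window_identity:
 assumes t: "t \<in> A" "t + h \<in> A" "0 < h" and R: "R >= 1"
 obtains E U G where
  "\<i> * (lint (%x. Dq t h x * (cor (chi R x) * cnj (W t h 0 x)))) =
   E + of_real (Qw R t h) - of_real U - Pw R t h + G"
  "cmod E <= cchi TYPE('a) / R * (\<Sum>b\<in>Basis. nrm (W t h b)) * nrm (W t h 0)"
  "\<bar>U\<bar> <= (nrm (%x. vw V x * W t h 0 x))\<^sup>2"
  "cmod G <= nrm (avg (win t h) F) * nrm (W t h 0)"
proof -
 have t0: "0 <= t" using t A_pos by auto
 have Hw: "H1 \<Omega> (W t h)" unfolding W_def[abs_def] by (rule H1_w[OF t0 t(3)])
 have sW: "i \<in> idx ==> sqi (W t h i)" for i by (rule H1_sqi[OF Hw])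
 let ?c = "%x::'a. cor (chi R x)"
 define E where "E = (\<Sum>b\<in>Basis. lint (%x. W t h b x * (chid R b x * cnj (W t h 0 x))))"
 define U where "U = (lint (%x. V x * (chi R x * (cmod (W t h 0 x))\<^sup>2)))"
 define G where "G = (lint (%x. avg (win t h) F x * (?c x * cnj (W t h 0 x))))"
 have s0: "sqi (%x. cnj (W t h 0 x))" using sW by simp
 show ?thesis
 proof (rule that[of E U G])
  have "(lint (%x. W t h b x * (chid R b x * cnj (W t h 0 x) + ?c x * cnj (W t h b x)))) =
   (lint (%x. W t h b x * (chid R b x * cnj (W t h 0 x)))) + of_real (lint (%x. chi R x * (cmod (W t h b x))\<^sup>2))"
   if b: "b \<in> Basis" for b
  proof -
   have "intl (%x. W t h b x * (chid R b x * cnj (W t h 0 x)))"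
    "intl (%x. W t h b x * (?c x * cnj (W t h b x)))"
    using sW b R by (auto intro!: cauchy_schwarz(1) sqi_chid sqi_chi)
   then show ?thesis unfolding distrib_left by (simp add: chi_square)
  qed
  then have "(\<Sum>b\<in>Basis. lint (%x. W t h b x * (chid R b x * cnj (W t h 0 x) + ?c x * cnj (W t h b x)))) = E + of_real (Qw R t h)"
   by (simp add: E_def Qw_def sum.distrib)
  moreover have "(lint (%x. V x * W t h 0 x * (?c x * cnj (W t h 0 x)))) = of_real U"
  proof -
   have "V x * W t h 0 x * (?c x * cnj (W t h 0 x)) = cor (V x * (chi R x * (cmod (W t h 0 x))\<^sup>2))" for x
    unfolding of_real_mult complex_norm_square by (simp only: mult_ac)
   then show ?thesis unfolding U_def by (simp only: integral_complex_of_real)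
  qed
  ultimately show "\<i> * (lint (%x. Dq t h x * (?c x * cnj (W t h 0 x)))) = E + of_real (Qw R t h) - of_real U - Pw R t h + G"
   using window_eq_chi[OF t R H1_cnj[OF Hw]] by (simp only: G_def Pw_def)
  have "cmod E <= (\<Sum>b\<in>Basis. nrm (W t h b) * (cchi TYPE('a) / R * nrm (W t h 0)))"
   unfolding E_def
  proof (rule order_trans[OF norm_sum sum_mono])
   fix b :: 'a assume b: "b \<in> Basis"
   have "cmod (lint (%x. W t h b x * (chid R b x * cnj (W t h 0 x)))) <= nrm (W t h b) * nrm (%x. chid R b x * cnj (W t h 0 x))"
    using b sW by (intro cauchy_schwarz(3) sqi_chid[OF s0 R b]) auto
   also have "... <= nrm (W t h b) * (cchi TYPE('a) / R * nrm (W t h 0))"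
    using sqi_chid(2)[OF s0 R b] by (intro mult_left_mono) auto
   finally show "cmod (lint (%x. W t h b x * (chid R b x * cnj (W t h 0 x)))) <= nrm (W t h b) * (cchi TYPE('a) / R * nrm (W t h 0))" .
  qed
  also have "... = cchi TYPE('a) / R * (\<Sum>b\<in>Basis. nrm (W t h b)) * nrm (W t h 0)"
   unfolding sum_distrib_right[symmetric] by simp
  finally show "cmod E <= cchi TYPE('a) / R * (\<Sum>b\<in>Basis. nrm (W t h b)) * nrm (W t h 0)" .
  show "cmod G <= nrm (avg (win t h) F) * nrm (W t h 0)"
  proof -
   have "cmod G <= nrm (avg (win t h) F) * nrm (%x. ?c x * cnj (W t h 0 x))"
    unfolding G_def by (intro cauchy_schwarz(3) sqi_chi s0 time_avg.sqi_avg ta_F t0 t)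
   also have "... <= nrm (avg (win t h) F) * nrm (W t h 0)"
    using sqi_chi(2)[OF s0, of R] by (intro mult_left_mono) auto
   finally show ?thesis .
  qed
  show "\<bar>U\<bar> <= (nrm (%x. vw V x * W t h 0 x))\<^sup>2"
  proof -
   have "\<bar>U\<bar> <= (lint (%x. \<bar>V x * (chi R x * (cmod (W t h 0 x))\<^sup>2)\<bar>))"
    unfolding U_def by (rule integral_abs_bound)
   also have "... <= (lint (%x. (cmod (vw V x * W t h 0 x))\<^sup>2))"
   proof (rule integral_mono')
    show "intl (%x. (cmod (vw V x * W t h 0 x))\<^sup>2)" using CV(2)[OF Hw] by (simp add: sqi_def)
    fix x
    have "chi R x * (\<bar>V x\<bar> * (cmod (W t h 0 x))\<^sup>2) <= \<bar>V x\<bar> * (cmod (W t h 0 x))\<^sup>2" by (intro mult_left_le_one_le) auto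
    then show "\<bar>V x * (chi R x * (cmod (W t h 0 x))\<^sup>2)\<bar> <= (cmod (vw V x * W t h 0 x))\<^sup>2"
     by (simp add: vw_def norm_mult power_mult_distrib abs_mult mult_ac)
   qed simp
   finally show ?thesis by (simp add: nrm_sq)
  qed
 qed
qed

end

section \<open>The energy inequality\<close>

text \<open>Symmetrise the double integral of \<open>g t * cnj (g r)\<close> over \<open>r \<le> t\<close> and \<open>t < r\<close>.\<close>
lemma primitive_square_aux:
 fixes g :: "real => complex"
 assumes g: "intl g"
 shows "intl (%t. g t * cnj (lint (%r. indicator {..t} r *\<^sub>R g r)))"
  and "(cmod (lint (%t. g t)))\<^sup>2 = 2 * Re (lint (%t. g t * cnj (lint (%r. indicator {..t} r *\<^sub>R g r))))"
proof -
 have [measurable]: "g \<in> bm" using borel_measurable_integrable[OF g] by simp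
 have cg: "intl (%r. cnj (g r))" using g by simp
 have prod: "integrable (lborel \<Otimes>\<^sub>M lborel) (%(t, r). g t * cnj (g r))"
 proof (rule lborel_pair.Fubini_integrable)
  show "(%(t, r). g t * cnj (g r)) \<in> borel_measurable (lborel \<Otimes>\<^sub>M lborel)" by measurable
  show "intl (%t. lint (%r. norm (case (t, r) of (t, r) => g t * cnj (g r))))"
   using integrable_norm[OF g] by (simp add: norm_mult)
  show "AE t in lborel. intl (%r. case (t, r) of (t, r) => g t * cnj (g r))"
   using cg by simp
 qed
 define S where "S = {p::real \<times> real. snd p <= fst p}"
 have S [measurable]: "S \<in> sets (lborel \<Otimes>\<^sub>M lborel)" "- S \<in> sets (lborel \<Otimes>\<^sub>M lborel)"
 proof -
  have "closed S" unfolding S_def by (intro closed_Collect_le continuous_intros)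
  then have "S \<in> sets borel" "- S \<in> sets borel" by auto
  then show "S \<in> sets (lborel \<Otimes>\<^sub>M lborel)" "- S \<in> sets (lborel \<Otimes>\<^sub>M lborel)" by (simp_all only: lborel_prod sets_lborel)
 qed
 have i1: "integrable (lborel \<Otimes>\<^sub>M lborel) (%(t, r). indicator S (t, r) *\<^sub>R (g t * cnj (g r)))"
  using integrable_mult_indicator[OF S(1) prod] by (simp add: split_beta')
 have i2: "integrable (lborel \<Otimes>\<^sub>M lborel) (%(t, r). indicator (- S) (t, r) *\<^sub>R (g t * cnj (g r)))"
  using integrable_mult_indicator[OF S(2) prod] by (simp add: split_beta')
 let ?G = "%t. lint (%r. indicator {..t} r *\<^sub>R g r)"
 have e1: "(lint (%r. indicator S (t, r) *\<^sub>R (g t * cnj (g r)))) = g t * cnj (?G t)" for t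
 proof -
  have "(lint (%r. indicator S (t, r) *\<^sub>R (g t * cnj (g r)))) = (lint (%r. g t * cnj (indicator {..t} r *\<^sub>R g r)))"
   by (intro BI_integral_cong) (auto simp: S_def indicator_def)
  then show ?thesis by (simp only: integral_mult_right_zero BI_integral_cnj)
 qed
 have X: "intl (%t. g t * cnj (?G t))"
  using lborel_pair.integrable_fst[OF i1] by (simp add: e1)
 have e2: "(lint (%t. indicator (- S) (t, r) *\<^sub>R (g t * cnj (g r)))) = cnj (g r * cnj (?G r))" for r
 proof -
  have "(lint (%t. indicator (- S) (t, r) *\<^sub>R (g t * cnj (g r)))) = (lint (%t. cnj (g r) * (indicator {..r} t *\<^sub>R g t)))"
  proof (rule integral_cong_AE)
   show "AE t in lborel. indicator (- S) (t, r) *\<^sub>R (g t * cnj (g r)) = cnj (g r) * (indicator {..r} t *\<^sub>R g t)"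
    using AE_lborel_singleton[of r] by eventually_elim (auto simp: S_def indicator_def)
  qed measurable
  then show ?thesis by (simp only: integral_mult_right_zero complex_cnj_mult complex_cnj_cnj)
 qed
 have "(lint (%t. lint (%r. g t * cnj (g r)))) =
  (lint (%t. (lint (%r. indicator S (t, r) *\<^sub>R (g t * cnj (g r)))) + (lint (%r. indicator (- S) (t, r) *\<^sub>R (g t * cnj (g r))))))"
 proof (intro BI_integral_cong refl)
  fix t
  have ir: "intl (%r. g t * cnj (g r))" using cg by simp
  have a: "(%r. indicator S (t, r) *\<^sub>R (g t * cnj (g r))) = (%r. indicator {..t} r *\<^sub>R (g t * cnj (g r)))"
   "(%r. indicator (- S) (t, r) *\<^sub>R (g t * cnj (g r))) = (%r. indicator {t<..} r *\<^sub>R (g t * cnj (g r)))"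
   by (auto simp: S_def indicator_def fun_eq_iff)
  have "(lint (%r. indicator {..t} r *\<^sub>R (g t * cnj (g r)))) + (lint (%r. indicator {t<..} r *\<^sub>R (g t * cnj (g r)))) =
   (lint (%r. indicator {..t} r *\<^sub>R (g t * cnj (g r)) + indicator {t<..} r *\<^sub>R (g t * cnj (g r))))"
   by (intro BI_integral_add[symmetric] integrable_mult_indicator ir) auto
  also have "... = (lint (%r. g t * cnj (g r)))"
   by (intro BI_integral_cong) (auto simp: indicator_def)
  finally show "(lint (%r. g t * cnj (g r))) = (lint (%r. indicator S (t, r) *\<^sub>R (g t * cnj (g r)))) + (lint (%r. indicator (- S) (t, r) *\<^sub>R (g t * cnj (g r))))"
   unfolding a by simp
 qed
 also have "... = (lint (%t. lint (%r. indicator S (t, r) *\<^sub>R (g t * cnj (g r))))) + (lint (%t. lint (%r. indicator (- S) (t, r) *\<^sub>R (g t * cnj (g r)))))"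
  using lborel_pair.integrable_fst[OF i1] lborel_pair.integrable_fst[OF i2] by (intro BI_integral_add) auto
 also have "(lint (%t. lint (%r. indicator (- S) (t, r) *\<^sub>R (g t * cnj (g r))))) = (lint (%r. lint (%t. indicator (- S) (t, r) *\<^sub>R (g t * cnj (g r)))))"
  using lborel_pair.Fubini_integral[OF i2] by simp
 also have "... = cnj (lint (%r. g r * cnj (?G r)))"
  unfolding e2 by (rule BI_integral_cnj)
 also have "(lint (%t. lint (%r. g t * cnj (g r)))) = (lint (%t. g t)) * cnj (lint (%r. g r))"
  by simp
 finally have "cor ((cmod (lint (%t. g t)))\<^sup>2) = (lint (%t. g t * cnj (?G t))) + cnj (lint (%r. g r * cnj (?G r)))"
  by (simp only: e1 complex_norm_square)
 then have "Re (cor ((cmod (lint (%t. g t)))\<^sup>2)) = Re ((lint (%t. g t * cnj (?G t))) + cnj (lint (%r. g r * cnj (?G r))))"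
  by simp
 then show "(cmod (lint (%t. g t)))\<^sup>2 = 2 * Re (lint (%t. g t * cnj (?G t)))" by simp
 show "intl (%t. g t * cnj (?G t))" by (rule X)
qed

text \<open>The chain rule for |w|^2, where w is a sliding mean of a function that is merely
  integrable: w is a primitive of the difference quotient, and \<open>primitive_square_aux\<close>
  handles the square of a primitive by Fubini, without pointwise differentiation.\<close>

lemma window_square:
 fixes \<rho> :: "real => complex"
 assumes [measurable]: "\<rho> \<in> bm" and i: "intl (%r. indicator {s<..T + h} r *\<^sub>R \<rho> r)"
  and sT: "s < T" and h: "0 < h"
 defines "w t \<equiv> integral\<^sup>L (win t h) \<rho>"
 shows "(cmod (w T))\<^sup>2 - (cmod (w s))\<^sup>2 =
  2 * Re (lint (%t. indicator {s<..T} t *\<^sub>R ((\<rho> (t + h) - \<rho> t) / h * cnj (w t))))"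
proof -
 have isub: "intl (%r. indicator {a<..b} r *\<^sub>R \<rho> r)" if "s <= a" "b <= T + h" for a b
 proof -
  have "(%r. indicator {a<..b} r *\<^sub>R \<rho> r) = (%r. indicator {a<..b} r *\<^sub>R (indicator {s<..T + h} r *\<^sub>R \<rho> r))"
   using that by (auto simp: indicator_def fun_eq_iff)
  moreover have "intl (%r. indicator {a<..b} r *\<^sub>R (indicator {s<..T + h} r *\<^sub>R \<rho> r))"
   by (intro integrable_mult_indicator i) auto
  ultimately show ?thesis by simp
 qed
 define PH where "PH t = (lint (%r. indicator {s<..t} r *\<^sub>R \<rho> r))" for t
 have PHd: "(lint (%r. indicator {a<..b} r *\<^sub>R \<rho> r)) = PH b - PH a" if "s <= a" "a <= b" "b <= T + h" for a b
 proof -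
  have "PH b - PH a = (lint (%r. indicator {s<..b} r *\<^sub>R \<rho> r - indicator {s<..a} r *\<^sub>R \<rho> r))"
   unfolding PH_def using that by (intro BI_integral_diff[symmetric] isub) auto
  also have "... = (lint (%r. indicator {a<..b} r *\<^sub>R \<rho> r))"
   using that by (intro BI_integral_cong) (auto simp: indicator_def)
  finally show ?thesis by simp
 qed
 have shift: "intl (%r. indicator {a<..b} r *\<^sub>R \<rho> (r + h))"
   "(lint (%r. indicator {a<..b} r *\<^sub>R \<rho> (r + h))) = PH (b + h) - PH (a + h)" if "s <= a" "a <= b" "b <= T" for a b
 proof -
  have e: "indicator {a<..b} r *\<^sub>R \<rho> (r + h) = indicator {a + h<..b + h} (h + 1 * r) *\<^sub>R \<rho> (h + 1 * r)" for r
   by (auto simp: indicator_def add.commute)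
  have "intl (%r. indicator {a + h<..b + h} r *\<^sub>R \<rho> r)" using that h by (intro isub) auto
  then show "intl (%r. indicator {a<..b} r *\<^sub>R \<rho> (r + h))"
   unfolding e by (rule lborel_integrable_real_affine) simp
  have "(lint (%r. indicator {a + h<..b + h} r *\<^sub>R \<rho> r)) = \<bar>1\<bar> *\<^sub>R (lint (%r. indicator {a + h<..b + h} (h + 1 * r) *\<^sub>R \<rho> (h + 1 * r)))"
   by (rule lborel_integral_real_affine) simp
  then show "(lint (%r. indicator {a<..b} r *\<^sub>R \<rho> (r + h))) = PH (b + h) - PH (a + h)"
   unfolding e using PHd[of "a + h" "b + h"] that h by simp
 qed
 define D where "D t = (\<rho> (t + h) - \<rho> t) / h" for t
 have [measurable]: "D \<in> bm" unfolding D_def[abs_def] by measurable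
 have iD: "intl (%r. indicator {s<..t} r *\<^sub>R D r)"
  and D: "(lint (%r. indicator {s<..t} r *\<^sub>R D r)) = w t - w s" if "s <= t" "t <= T" for t
 proof -
  have e: "indicator {s<..t} r *\<^sub>R D r = (1 / h) *\<^sub>R (indicator {s<..t} r *\<^sub>R \<rho> (r + h) - indicator {s<..t} r *\<^sub>R \<rho> r)" for r
   by (simp add: D_def scaleR_conv_of_real algebra_simps diff_divide_distrib)
  show "intl (%r. indicator {s<..t} r *\<^sub>R D r)"
   unfolding e using that h by (intro integrable_scaleR_right BI_integrable_diff shift isub) auto
  have "(lint (%r. indicator {s<..t} r *\<^sub>R D r)) = (1 / h) *\<^sub>R ((PH (t + h) - PH (s + h)) - (PH t - PH s))"
   unfolding e using that h shift[of s t] isub[of s t] PHd[of s t] by (simp del: scaleR_scaleR)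
  also have "... = (1 / h) *\<^sub>R (PH (t + h) - PH t) - (1 / h) *\<^sub>R (PH (s + h) - PH s)"
   by (simp add: scaleR_right_diff_distrib)
  also have "... = w t - w s"
   unfolding w_def using that h PHd[of t "t + h"] PHd[of s "s + h"] by (simp add: integral_win)
  finally show "(lint (%r. indicator {s<..t} r *\<^sub>R D r)) = w t - w s" .
 qed
 define g where "g t = indicator {s<..T} t *\<^sub>R D t" for t
 have g: "intl g" unfolding g_def using sT by (intro iD) auto
 have Ig: "(lint (%t. g t)) = w T - w s" unfolding g_def using sT by (intro D) auto
 have Gt: "(lint (%r. indicator {..t} r *\<^sub>R g r)) = w t - w s" if "s < t" "t <= T" for t
 proof -
  have "(lint (%r. indicator {..t} r *\<^sub>R g r)) = (lint (%r. indicator {s<..t} r *\<^sub>R D r))"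
   using that by (intro BI_integral_cong) (auto simp: g_def indicator_def)
  then show ?thesis using D[of t] that by simp
 qed
 \<comment> \<open>Writing w t as (w t - w s) + w s splits the pairing into a function times its own
   primitive and a constant multiple of that function.\<close>
 have e: "indicator {s<..T} t *\<^sub>R (D t * cnj (w t)) = g t * cnj (lint (%r. indicator {..t} r *\<^sub>R g r)) + g t * cnj (w s)" for t
 proof (cases "s < t & t <= T")
  case True
  then have G: "(lint (%r. indicator {..t} r *\<^sub>R g r)) = w t - w s" by (intro Gt) auto
  have "g t = D t" using True by (simp add: g_def)
  then show ?thesis unfolding G using True by (simp add: algebra_simps)
 qed (auto simp: g_def)
 have "(lint (%t. indicator {s<..T} t *\<^sub>R (D t * cnj (w t)))) =
  (lint (%t. g t * cnj (lint (%r. indicator {..t} r *\<^sub>R g r)))) + (w T - w s) * cnj (w s)"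
  unfolding e using primitive_square_aux(1)[OF g] g Ig by simp
 then have "2 * Re (lint (%t. indicator {s<..T} t *\<^sub>R (D t * cnj (w t)))) = (cmod (w T - w s))\<^sup>2 + 2 * Re ((w T - w s) * cnj (w s))"
  using primitive_square_aux(2)[OF g] Ig by simp
 also have "... = (cmod (w T))\<^sup>2 - (cmod (w s))\<^sup>2"
  unfolding cmod_power2 by (simp add: power2_eq_square algebra_simps)
 finally show ?thesis by (simp add: D_def)
qed

text \<open>By Fubini the time r receives as weight the length of (s, T] \<inter> [r - h, r) divided
  by h. It never exceeds 1, vanishes for r outside (s, T + h], and equals 1 on (s + h, T]; hence the
  different intervals in the two bounds.\<close>

lemma window_avg_bounds:
 fixes k :: "real => real"
 assumes [measurable]: "k \<in> bm" and k0: "!!r. 0 <= k r"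
  and i: "intl (%r. indicator {s<..T + h} r * k r)" and h: "0 < h" and sT: "s < T"
 shows "intl (%t. indicator {s<..T} t * integral\<^sup>L (win t h) k)"
  and "(lint (%t. indicator {s<..T} t * integral\<^sup>L (win t h) k)) <= (lint (%r. indicator {s<..T + h} r * k r))"
  and "(lint (%r. indicator {s + h<..T} r * k r)) <= (lint (%t. indicator {s<..T} t * integral\<^sup>L (win t h) k))"
proof -
 have isub: "intl (%r. indicator {a<..b} r * k r)" if "s <= a" "b <= T + h" for a b
 proof -
  have "(%r. indicator {a<..b} r * k r) = (%r. indicator {a<..b} r *\<^sub>R (indicator {s<..T + h} r * k r))"
   using that by (auto simp: indicator_def fun_eq_iff)
  moreover have "intl (%r. indicator {a<..b} r *\<^sub>R (indicator {s<..T + h} r * k r))"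
   by (intro integrable_mult_indicator i) auto
  ultimately show ?thesis by simp
 qed
 define f where "f t = indicator {s<..T} t * integral\<^sup>L (win t h) k" for t
 have f0: "0 <= f t" for t unfolding f_def by (intro mult_nonneg_nonneg BI_integral_nonneg k0) auto
 have f: "ennreal (f t) = (nint (%r. ennreal (k r / h) * indicator {(t, r). s < t & t <= T & t < r & r <= t + h} (t, r)))" for t
 proof (cases "s < t & t <= T")
  case True
  have "ennreal (f t) = ennreal (lint (%r. indicator {t<..t + h} r * k r / h))"
   using True h by (simp add: f_def integral_win)
  also have "... = (nint (%r. ennreal (indicator {t<..t + h} r * k r / h)))"
   using True k0 h isub[of t "t + h"] by (intro nn_integral_eq_integral[symmetric]) auto
  also have "... = (nint (%r. ennreal (k r / h) * indicator {(t, r). s < t & t <= T & t < r & r <= t + h} (t, r)))"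
   using True by (intro nn_integral_cong) (auto simp: indicator_def)
  finally show ?thesis .
 next
  case False
  then have "(nint (%r. ennreal (k r / h) * indicator {(t, r). s < t & t <= T & t < r & r <= t + h} (t, r))) = (\<integral>\<^sup>+r. 0 \<partial>(lborel :: real measure))"
   by (intro nn_integral_cong) (auto simp: indicator_def)
  then show ?thesis using False by (auto simp: f_def indicator_def)
 qed
 have mS: "{(t::real, r). s < t & t <= T & t < r & r <= t + h} \<in> sets (borel \<Otimes>\<^sub>M borel)"
 proof -
  have "Measurable.pred (borel \<Otimes>\<^sub>M borel) (%p::real \<times> real. s < fst p & fst p <= T & fst p < snd p & snd p <= fst p + h)"
   by measurable
  then show ?thesis by (simp add: pred_def space_pair_measure split_beta')
 qed
 have [measurable]: "(%p. indicator {(t::real, r). s < t & t <= T & t < r & r <= t + h} p :: ennreal) \<in> borel_measurable (borel \<Otimes>\<^sub>M borel)"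
  using mS by measurable
 have mf: "f \<in> bm"
 proof -
  have "f = (%t. enn2real (nint (%r. ennreal (k r / h) * indicator {(t, r). s < t & t <= T & t < r & r <= t + h} (t, r))))"
   unfolding f[symmetric] using f0 by simp
  moreover have "(%t. enn2real (nint (%r. ennreal (k r / h) * indicator {(t, r). s < t & t <= T & t < r & r <= t + h} (t, r)))) \<in> bm"
   by measurable
  ultimately show ?thesis by simp
 qed
 have "(nint (%t. ennreal (f t))) = (nint (%r. nint (%t. ennreal (k r / h) * indicator {(t, r). s < t & t <= T & t < r & r <= t + h} (t, r))))"
  unfolding f by (rule lborel_pair.Fubini') measurable
 also have "... = (nint (%r. ennreal (k r / h) * emeasure lborel ({s<..T} \<inter> {r - h..<r})))"
 proof (rule nn_integral_cong)
  fix r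
  have "(nint (%t. ennreal (k r / h) * indicator {(t, r). s < t & t <= T & t < r & r <= t + h} (t, r))) =
   (nint (%t. ennreal (k r / h) * indicator ({s<..T} \<inter> {r - h..<r}) t))"
   by (intro nn_integral_cong) (auto simp: indicator_def)
  then show "(nint (%t. ennreal (k r / h) * indicator {(t, r). s < t & t <= T & t < r & r <= t + h} (t, r))) =
   ennreal (k r / h) * emeasure lborel ({s<..T} \<inter> {r - h..<r})" by (simp add: nn_integral_cmult_indicator)
 qed
 finally have nn: "(nint (%t. ennreal (f t))) = (nint (%r. ennreal (k r / h) * emeasure lborel ({s<..T} \<inter> {r - h..<r})))" .
 have iI: "(nint (%r. ennreal (indicator {s<..T + h} r * k r))) = ennreal (lint (%r. indicator {s<..T + h} r * k r))"
  using i k0 by (intro nn_integral_eq_integral) auto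
 have upper: "(nint (%t. ennreal (f t))) <= ennreal (lint (%r. indicator {s<..T + h} r * k r))"
  unfolding nn iI[symmetric]
 proof (rule nn_integral_mono)
  fix r
  show "ennreal (k r / h) * emeasure lborel ({s<..T} \<inter> {r - h..<r}) <= ennreal (indicator {s<..T + h} r * k r)"
  proof (cases "s < r & r <= T + h")
   case True
   have "emeasure lborel ({s<..T} \<inter> {r - h..<r}) <= emeasure lborel {r - h..<r}" by (rule emeasure_mono) auto
   also have "... = ennreal h" using h by simp
   finally have "ennreal (k r / h) * emeasure lborel ({s<..T} \<inter> {r - h..<r}) <= ennreal (k r / h) * ennreal h"
    by (rule mult_left_mono) simp
   also have "... = ennreal (k r)" using h k0[of r] by (simp flip: ennreal_mult)
   finally show ?thesis using True by simp
  next
   case False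
   then have "{s<..T} \<inter> {r - h..<r} = {}" by auto
   then show ?thesis by simp
  qed
 qed
 show if': "intl (%t. indicator {s<..T} t * integral\<^sup>L (win t h) k)"
  unfolding f_def[symmetric] using upper mf f0 by (intro integrableI_nonneg) (auto intro: le_less_trans)
 have fI: "(nint (%t. ennreal (f t))) = ennreal (lint (%t. f t))"
  using if' f0 by (intro nn_integral_eq_integral) (auto simp: f_def[symmetric])
 have "0 <= (lint (%r. indicator {s<..T + h} r * k r))"
  by (intro BI_integral_nonneg mult_nonneg_nonneg k0) auto
 then show "(lint (%t. indicator {s<..T} t * integral\<^sup>L (win t h) k)) <= (lint (%r. indicator {s<..T + h} r * k r))"
  using upper unfolding fI f_def[symmetric] by (simp add: ennreal_le_iff)
 have "ennreal (lint (%r. indicator {s + h<..T} r * k r)) = (nint (%r. ennreal (indicator {s + h<..T} r * k r)))"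
  using isub[of "s + h" T] k0 h by (intro nn_integral_eq_integral[symmetric]) auto
 also have "... <= (nint (%r. ennreal (k r / h) * emeasure lborel ({s<..T} \<inter> {r - h..<r})))"
 proof (rule nn_integral_mono)
  fix r
  show "ennreal (indicator {s + h<..T} r * k r) <= ennreal (k r / h) * emeasure lborel ({s<..T} \<inter> {r - h..<r})"
  proof (cases "s + h < r & r <= T")
   case True
   then have "{s<..T} \<inter> {r - h..<r} = {r - h..<r}" by auto
   then show ?thesis using True h k0[of r] by (simp flip: ennreal_mult)
  qed auto
 qed
 also have "... = ennreal (lint (%t. f t))" using nn fI by simp
 finally show "(lint (%r. indicator {s + h<..T} r * k r)) <= (lint (%t. indicator {s<..T} t * integral\<^sup>L (win t h) k))"
  unfolding f_def[symmetric] using f0 by (subst (asm) ennreal_le_iff) (auto intro: BI_integral_nonneg)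
qed

context evo
begin

lemma time_avg_diff:
 assumes "0 <= t" "0 < h" "r \<in> A"
 shows "time_avg (win t h) (%s x. H 0 s x - H 0 r x)"
proof -
 interpret T: time_avg "win t h" "H 0" by (rule ta_H[OF zero_idx assms(1,2)])
 have sr: "sqi (H 0 r)" using H1_sqi[OF H_H1[OF assms(3)]] by simp
 have mm: "(%(s, x). H 0 s x - H 0 r x) \<in> bm"
 proof -
  have [measurable]: "(%(s, x). H 0 s x) \<in> borel_measurable (borel \<Otimes>\<^sub>M borel)" "H 0 r \<in> bm"
   using H_meas[OF zero_idx] sr by (auto simp: borel_prod sqi_measurable)
  have "(%(s, x). H 0 s x - H 0 r x) \<in> borel_measurable (borel \<Otimes>\<^sub>M borel)" by measurable
  then show ?thesis by (simp add: borel_prod)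
 qed
 show ?thesis
 proof
  show "AE s in win t h. sqi (%x. H 0 s x - H 0 r x)"
   using T.AE_sqi by eventually_elim (rule sqi_diff(1)[OF _ sr])
  show "integrable (win t h) (%s. nrm (%x. H 0 s x - H 0 r x))"
  proof (rule BI_integrable_bound)
   show "integrable (win t h) (%s. nrm (H 0 s) + nrm (H 0 r))"
    using T.int_nrm by (intro BI_integrable_add) auto
   show "(%s. nrm (%x. H 0 s x - H 0 r x)) \<in> borel_measurable (win t h)"
    using nrm_measurable[OF mm] by simp
   show "AE s in win t h. norm (nrm (%x. H 0 s x - H 0 r x)) <= norm (nrm (H 0 s) + nrm (H 0 r))"
    using T.AE_sqi by eventually_elim (use sqi_diff(2)[OF _ sr] in auto)
  qed
 qed (use mm in auto)
qed

text \<open>The norm of a mean of the differences H 0 s - H 0 r is at most the mean of their norms,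
  and a probability measure reproduces the constant H 0 r.\<close>

lemma W_close:
 assumes t: "0 <= t" "0 < h" and r: "r \<in> A"
  and le: "!!s. s \<in> A ==> t < s ==> s <= t + h ==> nrm (%x. H 0 s x - H 0 r x) <= e"
 shows "nrm (%x. W t h 0 x - H 0 r x) <= e"
proof -
 interpret T: time_avg "win t h" "H 0" by (rule ta_H[OF zero_idx t])
 interpret D: time_avg "win t h" "%s x. H 0 s x - H 0 r x" by (rule time_avg_diff[OF t r])
 have sr: "sqi (H 0 r)" using H1_sqi[OF H_H1[OF r]] by simp
 have "AE x in lborel. W t h 0 x - H 0 r x = avg (win t h) (%s x. H 0 s x - H 0 r x) x"
  using T.AE_integrable
 proof eventually_elim
  case (elim x)
  have "avg (win t h) (%s x. H 0 s x - H 0 r x) x = (\<integral>s. H 0 s x \<partial>win t h) - (\<integral>s. H 0 r x \<partial>win t h)"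
   unfolding avg_def using elim by (intro BI_integral_diff) auto
  then show ?case by (simp only: W_def avg_def integral_win_const[OF t(2)])
 qed
 then have "nrm (%x. W t h 0 x - H 0 r x) = nrm (avg (win t h) (%s x. H 0 s x - H 0 r x))"
  by (rule nrm_cong_AE) (use T.sqi_avg sr D.sqi_avg in \<open>auto simp: W_def sqi_measurable intro!: borel_measurable_diff\<close>)
 also have "... <= (\<integral>s. nrm (%x. H 0 s x - H 0 r x) \<partial>win t h)" by (rule D.nrm_avg)
 also have "... <= (\<integral>s. e \<partial>win t h)"
 proof (rule integral_mono_AE[OF D.int_nrm])
  have "AE s in win t h. t < s & s <= t + h" by (rule AE_win[OF t(2)]) auto
  then show "AE s in win t h. nrm (%x. H 0 s x - H 0 r x) <= e"
   using AE_win_A[OF t] by eventually_elim (use le in auto)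
 qed simp
 also have "... = e" by (rule integral_win_constr[OF t(2)])
 finally show ?thesis .
qed

lemma nrm_W_le:
 assumes t: "0 <= t" "0 < h" and le: "!!s. s \<in> A ==> s <= t + h ==> nrm (H 0 s) <= M"
 shows "nrm (W t h 0) <= M"
proof -
 interpret T: time_avg "win t h" "H 0" by (rule ta_H[OF zero_idx t])
 have "nrm (W t h 0) <= (\<integral>s. nrm (H 0 s) \<partial>win t h)" unfolding W_def by (rule T.nrm_avg)
 also have "... <= (\<integral>s. M \<partial>win t h)"
 proof (rule integral_mono_AE[OF T.int_nrm])
  have "AE s in win t h. t < s & s <= t + h" by (rule AE_win[OF t(2)]) auto
  then show "AE s in win t h. nrm (H 0 s) <= M" using AE_win_A[OF t] by eventually_elim (use le in auto)
 qed simp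
 also have "... = M" by (rule integral_win_constr[OF t(2)])
 finally show ?thesis .
qed

text \<open>The dissipation rate weighted by the cut-off; the weight makes the integrand integrable
  at every good time.\<close>

definition gR :: "real => real => real" where
 "gR R r = (lint (%x. chi R x * Im (P r x * cnj (H 0 r x))))"

lemma PR_chi: "R >= 1 ==> PR (2 * R) r x * (cor (chi R x) * y) = P r x * (cor (chi R x) * y)"
 using chi_0[of R x] by (cases "norm x <= 2 * R") (auto simp: PR_def indicator_def)

lemma gR_eq:
 assumes "r \<in> A" "R >= 1"
 shows "intl (%x. PR (2 * R) r x * (cor (chi R x) * cnj (H 0 r x)))"
  and "gR R r = Im (lint (%x. PR (2 * R) r x * (cor (chi R x) * cnj (H 0 r x))))"
proof -
 have sP: "sqi (PR (2 * R) r)" using P_loc[of r "2 * R"] assms unfolding PR_def[abs_def] by auto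
 have sH: "sqi (%x. cnj (H 0 r x))" using H1_sqi[OF H_H1[OF assms(1)]] by simp
 show i: "intl (%x. PR (2 * R) r x * (cor (chi R x) * cnj (H 0 r x)))"
  by (intro cauchy_schwarz(1) sP sqi_chi sH)
 have "Im (lint (%x. PR (2 * R) r x * (cor (chi R x) * cnj (H 0 r x)))) =
  (lint (%x. Im (PR (2 * R) r x * (cor (chi R x) * cnj (H 0 r x)))))"
  using i by (rule integral_Im[symmetric])
 also have "... = gR R r"
  unfolding gR_def PR_chi[OF assms(2)] by (intro BI_integral_cong) (auto simp: algebra_simps)
 finally show "gR R r = Im (lint (%x. PR (2 * R) r x * (cor (chi R x) * cnj (H 0 r x))))" by simp
qed

lemma gR_measurable: "gR R \<in> bm"
proof -
 have [measurable]: "(%(s, x). H 0 s x) \<in> borel_measurable (borel \<Otimes>\<^sub>M borel)"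
   "(%(s, x). P s x) \<in> borel_measurable (borel \<Otimes>\<^sub>M borel)"
  using H_meas[OF zero_idx] P_meas by (auto simp: borel_prod)
 show ?thesis unfolding gR_def[abs_def] by measurable
qed

text \<open>One window at a time: the imaginary part of the window identity, with the average in the
 nonlinear term replaced by the solution itself at the cost of the modulus of continuity e.\<close>
lemma window_energy:
 assumes t: "t \<in> A" "t + h \<in> A" "0 < h" and R: "R >= 1"
  and M: "!!s. s \<in> A ==> s <= t + h ==> nrm (H 0 s) <= M"
  and C: "0 <= C" "!!s. s \<in> A ==> s <= t + h ==> sqi (PR (2 * R) s) & nrm (PR (2 * R) s) <= C"
  and e: "!!r s. r \<in> A ==> s \<in> A ==> t < r ==> r <= t + h ==> t < s ==> s <= t + h ==> nrm (%x. H 0 s x - H 0 r x) <= e" "0 <= e"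
 shows "Re (lint (%x. Dq t h x * (cor (chi R x) * cnj (W t h 0 x)))) <=
  (\<integral>r. (cchi TYPE('a) / R * M * (\<Sum>b\<in>Basis. nrm (H b r)) + M * nrm (F r)) \<partial>win t h) - (\<integral>r. gR R r \<partial>win t h) + C * e"
  and "integrable (win t h) (gR R)"
proof -
 have t0: "0 <= t" using t A_pos by auto
 have Hw: "H1 \<Omega> (W t h)" unfolding W_def[abs_def] by (rule H1_w[OF t0 t(3)])
 have sW: "i \<in> idx ==> sqi (W t h i)" for i by (rule H1_sqi[OF Hw])
 have WM: "nrm (W t h 0) <= M" by (rule nrm_W_le[OF t0 t(3) M])
 have M0: "0 <= M" using WM nrm_nonneg[of "W t h 0"] by linarith
 let ?c = "%x::'a. cor (chi R x)"
 obtain E U G where id: "\<i> * (lint (%x. Dq t h x * (?c x * cnj (W t h 0 x)))) = E + of_real (Qw R t h) - of_real U - Pw R t h + G"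
  and E: "cmod E <= cchi TYPE('a) / R * (\<Sum>b\<in>Basis. nrm (W t h b)) * nrm (W t h 0)"
  and U: "\<bar>U\<bar> <= (nrm (%x. vw V x * W t h 0 x))\<^sup>2"
  and G: "cmod G <= nrm (avg (win t h) F) * nrm (W t h 0)"
  by (rule window_identity[OF t R])
 have "Re (lint (%x. Dq t h x * (?c x * cnj (W t h 0 x)))) = Im (\<i> * (lint (%x. Dq t h x * (?c x * cnj (W t h 0 x)))))"
  by simp
 also have "... = Im E - Im (Pw R t h) + Im G" unfolding id by simp
 finally have re: "Re (lint (%x. Dq t h x * (?c x * cnj (W t h 0 x)))) <= cmod E - Im (Pw R t h) + cmod G"
  using abs_Im_le_cmod[of E] abs_Im_le_cmod[of G] by linarith
 have iH: "integrable (win t h) (%r. nrm (H b r))" if "b \<in> Basis" for b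
  using that by (intro time_avg.int_nrm ta_H t0 t) auto
 have iF: "integrable (win t h) (%r. nrm (F r))" by (intro time_avg.int_nrm ta_F t0 t)
 have c0: "0 <= cchi TYPE('a) / R" using cchi(1)[where 'a = 'a] R by simp
 have E': "cmod E <= (\<integral>r. cchi TYPE('a) / R * M * (\<Sum>b\<in>Basis. nrm (H b r)) \<partial>win t h)"
 proof -
  have "(\<Sum>b\<in>Basis. nrm (W t h b)) <= (\<Sum>b\<in>Basis. \<integral>r. nrm (H b r) \<partial>win t h)"
   unfolding W_def by (intro sum_mono time_avg.nrm_avg ta_H t0 t) auto
  also have "... = (\<integral>r. (\<Sum>b\<in>Basis. nrm (H b r)) \<partial>win t h)"
   using iH by (simp add: BI_integral_sum)
  finally have S1: "(\<Sum>b\<in>Basis. nrm (W t h b)) <= (\<integral>r. (\<Sum>b\<in>Basis. nrm (H b r)) \<partial>win t h)" .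
  have "cchi TYPE('a) / R * (\<Sum>b\<in>Basis. nrm (W t h b)) * nrm (W t h 0) <=
   cchi TYPE('a) / R * (\<integral>r. (\<Sum>b\<in>Basis. nrm (H b r)) \<partial>win t h) * M"
  proof -
   have "0 <= (\<integral>r. (\<Sum>b\<in>Basis. nrm (H b r)) \<partial>win t h)"
    by (intro BI_integral_nonneg sum_nonneg) auto
   then show ?thesis
    by (intro mult_mono mult_left_mono mult_nonneg_nonneg c0 WM S1 sum_nonneg) auto
  qed
  also have "... = (\<integral>r. cchi TYPE('a) / R * M * (\<Sum>b\<in>Basis. nrm (H b r)) \<partial>win t h)"
   by simp
  finally show ?thesis using E by linarith
 qed
 have G': "cmod G <= (\<integral>r. M * nrm (F r) \<partial>win t h)"
 proof -
  have "nrm (avg (win t h) F) <= (\<integral>r. nrm (F r) \<partial>win t h)" by (intro time_avg.nrm_avg ta_F t0 t)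
  then have "nrm (avg (win t h) F) * nrm (W t h 0) <= (\<integral>r. nrm (F r) \<partial>win t h) * M"
   using WM M0 by (intro mult_mono) (auto intro!: BI_integral_nonneg)
  with G show ?thesis by (simp add: mult.commute)
 qed
 have split: "(\<integral>r. (cchi TYPE('a) / R * M * (\<Sum>b\<in>Basis. nrm (H b r)) + M * nrm (F r)) \<partial>win t h) =
  (\<integral>r. cchi TYPE('a) / R * M * (\<Sum>b\<in>Basis. nrm (H b r)) \<partial>win t h) + (\<integral>r. M * nrm (F r) \<partial>win t h)"
  using iH iF by (intro BI_integral_add) auto
 have sw: "sqi (%x. ?c x * cnj (W t h 0 x))" using sW by (intro sqi_chi) auto
 have Pwe: "Pw R t h = (\<integral>r. lint (%x. PR (2 * R) r x * (?c x * cnj (W t h 0 x))) \<partial>win t h)"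
  and Pwi: "integrable (win t h) (%r. lint (%x. PR (2 * R) r x * (?c x * cnj (W t h 0 x))))"
 proof -
  have "avg (win t h) P x * (?c x * y) = avg (win t h) (PR (2 * R)) x * (?c x * y)" for x y
   using chi_0[of R x] R by (cases "norm x <= 2 * R") (auto simp: avg_PR indicator_def)
  then have "Pw R t h = (lint (%x. avg (win t h) (PR (2 * R)) x * (?c x * cnj (W t h 0 x))))"
   unfolding Pw_def by presburger
  then show "Pw R t h = (\<integral>r. lint (%x. PR (2 * R) r x * (?c x * cnj (W t h 0 x))) \<partial>win t h)"
   "integrable (win t h) (%r. lint (%x. PR (2 * R) r x * (?c x * cnj (W t h 0 x))))"
   using time_avg.pair[OF ta_P[OF t0 t(3)] sw, of "2 * R"] by auto
 qed
 have aeA: "AE r in win t h. r \<in> A & t < r & r <= t + h"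
  using AE_win_A[OF t0 t(3)] AE_win[OF t(3), of t "%r. t < r & r <= t + h"] by auto
 have close: "AE r in win t h. gR R r <= Im (lint (%x. PR (2 * R) r x * (?c x * cnj (W t h 0 x)))) + C * e & \<bar>gR R r\<bar> <= C * M"
  using aeA
 proof eventually_elim
  case (elim r)
  then have r: "r \<in> A" "t < r" "r <= t + h" by auto
  have sr: "sqi (H 0 r)" using H1_sqi[OF H_H1[OF r(1)]] by simp
  have sP: "sqi (PR (2 * R) r)" "nrm (PR (2 * R) r) <= C" using C(2) r by auto
  have sd: "sqi (%x. cnj (W t h 0 x - H 0 r x))" unfolding sqi_cnj by (intro sqi_diff sW sr zero_idx)
  have "(lint (%x. PR (2 * R) r x * (?c x * cnj (W t h 0 x)))) - (lint (%x. PR (2 * R) r x * (?c x * cnj (H 0 r x)))) =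
   (lint (%x. PR (2 * R) r x * (?c x * cnj (W t h 0 x - H 0 r x))))"
   using cauchy_schwarz(1)[OF sP(1) sw] gR_eq(1)[OF r(1) R]
   by (subst BI_integral_diff[symmetric]) (auto simp: algebra_simps)
  also have "cmod ... <= nrm (PR (2 * R) r) * nrm (%x. ?c x * cnj (W t h 0 x - H 0 r x))"
   by (intro cauchy_schwarz(3) sP sqi_chi sd)
  also have "... <= C * e"
  proof (rule mult_mono[OF sP(2) _ C(1)])
   have "nrm (%x. ?c x * cnj (W t h 0 x - H 0 r x)) <= nrm (%x. cnj (W t h 0 x - H 0 r x))" by (rule sqi_chi[OF sd])
   also have "... = nrm (%x. W t h 0 x - H 0 r x)" by (rule nrm_cnj)
   also have "... <= e" using e(1) r by (intro W_close t0 t) auto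
   finally show "nrm (%x. ?c x * cnj (W t h 0 x - H 0 r x)) <= e" .
  qed simp
  finally have "\<bar>Im ((lint (%x. PR (2 * R) r x * (?c x * cnj (W t h 0 x)))) - (lint (%x. PR (2 * R) r x * (?c x * cnj (H 0 r x)))))\<bar> <= C * e"
   by (rule order_trans[OF abs_Im_le_cmod])
  then have 1: "gR R r <= Im (lint (%x. PR (2 * R) r x * (?c x * cnj (W t h 0 x)))) + C * e"
   unfolding gR_eq(2)[OF r(1) R] by simp
  have sc: "sqi (%x. cnj (H 0 r x))" using sr by simp
  have "cmod (lint (%x. PR (2 * R) r x * (?c x * cnj (H 0 r x)))) <= nrm (PR (2 * R) r) * nrm (%x. ?c x * cnj (H 0 r x))"
   by (intro cauchy_schwarz(3) sP sqi_chi sc)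
  also have "... <= C * M"
   using sP(2) C(1) M[OF r(1,3)] sqi_chi(2)[OF sc, of R] by (intro mult_mono) auto
  finally have "\<bar>gR R r\<bar> <= C * M" unfolding gR_eq(2)[OF r(1) R] by (rule order_trans[OF abs_Im_le_cmod])
  with 1 show ?case by blast
 qed
 show ig: "integrable (win t h) (gR R)"
 proof -
  interpret finite_measure "win t h" by (rule finite_measure_win[OF t(3)])
  show ?thesis using close gR_measurable
   by (intro integrable_const_bound[where B = "C * M"]) (auto elim!: eventually_mono)
 qed
 have "(\<integral>r. gR R r \<partial>win t h) <= (\<integral>r. Im (lint (%x. PR (2 * R) r x * (?c x * cnj (W t h 0 x)))) + C * e \<partial>win t h)"
 proof (rule integral_mono_AE[OF ig])
  interpret finite_measure "win t h" by (rule finite_measure_win[OF t(3)])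
  show "integrable (win t h) (%r. Im (lint (%x. PR (2 * R) r x * (?c x * cnj (W t h 0 x)))) + C * e)"
   using integrable_Im[OF Pwi] by (intro BI_integrable_add) auto
 qed (use close in \<open>auto elim!: eventually_mono\<close>)
 also have "... = Im (Pw R t h) + C * e"
 proof -
  interpret finite_measure "win t h" by (rule finite_measure_win[OF t(3)])
  have "(\<integral>r. Im (lint (%x. PR (2 * R) r x * (?c x * cnj (W t h 0 x)))) + C * e \<partial>win t h) =
   (\<integral>r. Im (lint (%x. PR (2 * R) r x * (?c x * cnj (W t h 0 x)))) \<partial>win t h) + (\<integral>r. C * e \<partial>win t h)"
   using integrable_Im[OF Pwi] by (intro BI_integral_add) auto
  then show ?thesis using integral_Im[OF Pwi] by (simp only: Pwe integral_win_constr[OF t(3)])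
 qed
 finally show "Re (lint (%x. Dq t h x * (?c x * cnj (W t h 0 x)))) <=
  (\<integral>r. (cchi TYPE('a) / R * M * (\<Sum>b\<in>Basis. nrm (H b r)) + M * nrm (F r)) \<partial>win t h) - (\<integral>r. gR R r \<partial>win t h) + C * e"
  using re E' G' split by linarith
qed

end

context evo
begin

lemma AE_A_shift: "AE t in lborel. 0 < t --> 0 <= h --> t \<in> A & t + h \<in> A"
proof -
 obtain N where N: "N \<in> null_sets lborel" "{t. \<not> (0 < t --> t \<in> A)} \<subseteq> N"
  using A_AE unfolding eventually_ae_filter by auto
 have [measurable]: "N \<in> sets borel" using N by auto
 have n: "AE t in lborel. t \<notin> N" using N(1) by (rule AE_not_in)
 have "Measurable.pred borel (%t. t \<notin> N)" by measurable
 from AE_borel_affine[OF _ this n, of 1 h] have "AE t in lborel. h + 1 * t \<notin> N" by simp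
 then show ?thesis using n
 proof eventually_elim
  case (elim t)
  then show ?case using N(2) subsetD[OF N(2), of t] subsetD[OF N(2), of "h + t"] by (auto simp: add.commute)
 qed
qed

lemma chi_norm:
 "sqi f ==> (lint (%x. chi R x * (cmod (f x))\<^sup>2)) = (nrm (%x. cor (sqrt (chi R x)) * f x))\<^sup>2"
 "sqi f ==> sqi (%x. cor (sqrt (chi R x)) * f x)"
 "sqi f ==> nrm (%x. cor (sqrt (chi R x)) * f x) <= nrm f"
proof -
 show "(lint (%x. chi R x * (cmod (f x))\<^sup>2)) = (nrm (%x. cor (sqrt (chi R x)) * f x))\<^sup>2"
  by (simp add: nrm_sq norm_mult power_mult_distrib)
 assume f: "sqi f"
 have [measurable]: "f \<in> bm" using f by (rule sqi_measurable)
 have m: "(%x. cor (sqrt (chi R x)) * f x) \<in> bm" by measurable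
 have ae: "AE x in lborel. cmod (cor (sqrt (chi R x)) * f x) <= 1 * cmod (f x)"
  by (rule AE_I2) (simp add: norm_mult mult_left_le_one_le)
 show "sqi (%x. cor (sqrt (chi R x)) * f x)" by (rule sqi_dom(1)[OF m f ae zero_le_one])
 show "nrm (%x. cor (sqrt (chi R x)) * f x) <= nrm f"
  using sqi_dom(2)[OF m f ae zero_le_one] by (simp only: mult_1)
qed

lemma chi_norm_close:
 assumes f: "sqi f" and g: "sqi g" and e: "nrm (%x. f x - g x) <= e" and M: "nrm g <= M" and e1: "0 <= e"
 shows "(lint (%x. chi R x * (cmod (g x))\<^sup>2)) <= (lint (%x. chi R x * (cmod (f x))\<^sup>2)) + 2 * e * M"
  and "(lint (%x. chi R x * (cmod (f x))\<^sup>2)) <= (lint (%x. chi R x * (cmod (g x))\<^sup>2)) + 2 * e * M + e\<^sup>2"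
proof -
 define a where "a = nrm (%x. cor (sqrt (chi R x)) * f x)"
 define b where "b = nrm (%x. cor (sqrt (chi R x)) * g x)"
 have d: "nrm (%x. cor (sqrt (chi R x)) * f x - cor (sqrt (chi R x)) * g x) <= e"
  using chi_norm(3)[OF sqi_diff(1)[OF f g], of R] e by (simp add: right_diff_distrib)
 have ab: "a <= b + e" unfolding a_def b_def
  using nrm_diff_le[OF chi_norm(2)[OF f] chi_norm(2)[OF g], of R R] d by linarith
 have ba: "b <= a + e" unfolding a_def b_def
  using nrm_diff_le[OF chi_norm(2)[OF g] chi_norm(2)[OF f], of R R] d
   nrm_minus_commute[of "%x. cor (sqrt (chi R x)) * f x" "%x. cor (sqrt (chi R x)) * g x"] by linarith
 have b0: "0 <= b" and a0: "0 <= a" and bM: "b <= M" using chi_norm(3)[OF g, of R] M by (auto simp: b_def a_def)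
 have "b\<^sup>2 <= a\<^sup>2 + 2 * e * M"
 proof (cases "b <= e")
  case True
  then have "b\<^sup>2 <= e * M" unfolding power2_eq_square using bM b0 e1 by (intro mult_mono) auto
  moreover have "0 <= e * M" using e1 b0 bM by (intro mult_nonneg_nonneg) auto
  ultimately show ?thesis using zero_le_power2[of a] by linarith
 next
  case False
  then have "(b - e)\<^sup>2 <= a\<^sup>2" using ba by (intro power_mono) auto
  moreover have "e * b <= e * M" using bM e1 by (rule mult_left_mono)
  moreover have "(b - e)\<^sup>2 = b\<^sup>2 - 2 * (e * b) + e\<^sup>2" by (simp add: power2_diff)
  ultimately show ?thesis using zero_le_power2[of e] by linarith
 qed
 then show "(lint (%x. chi R x * (cmod (g x))\<^sup>2)) <= (lint (%x. chi R x * (cmod (f x))\<^sup>2)) + 2 * e * M"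
  unfolding chi_norm(1)[OF f] chi_norm(1)[OF g] a_def b_def .
 have "a\<^sup>2 <= (b + e)\<^sup>2" using ab a0 by (intro power_mono) auto
 moreover have "e * b <= e * M" using bM e1 by (rule mult_left_mono)
 ultimately have "a\<^sup>2 <= b\<^sup>2 + 2 * e * M + e\<^sup>2" by (simp add: power2_sum algebra_simps)
 then show "(lint (%x. chi R x * (cmod (f x))\<^sup>2)) <= (lint (%x. chi R x * (cmod (g x))\<^sup>2)) + 2 * e * M + e\<^sup>2"
  unfolding chi_norm(1)[OF f] chi_norm(1)[OF g] a_def b_def .
qed

text \<open>Integrated over x, the pointwise identity \<open>window_square\<close> is the energy balance of the window averages.\<close>
lemma window_balance:
 fixes R :: real
 assumes s: "0 < s" "s < T" and h: "0 < h" and M: "!!r. r \<in> A ==> r <= T + h ==> nrm (H 0 r) <= M"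
 defines "e t \<equiv> Re (lint (%x. Dq t h x * (cor (chi R x) * cnj (W t h 0 x))))"
 shows "intl (%t. indicator {s<..T} t * e t)"
  and "(lint (%x. chi R x * (cmod (W T h 0 x))\<^sup>2)) - (lint (%x. chi R x * (cmod (W s h 0 x))\<^sup>2)) =
   2 * (lint (%t. indicator {s<..T} t * e t))"
proof -
 let ?c = "%x::'a. cor (chi R x)"
 have mH [measurable]: "(%(s, x). H 0 s x) \<in> borel_measurable (borel \<Otimes>\<^sub>M borel)"
  using H_meas[OF zero_idx] by (simp add: borel_prod)
 have sect [measurable]: "(%r. H 0 r x) \<in> bm" for x
  by (rule section_measurable(2)[OF H_meas[OF zero_idx]])
 have mW: "(%(t, x). W t h 0 x) \<in> borel_measurable (borel \<Otimes>\<^sub>M borel)"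
 proof -
  have "W t h 0 x = (1 / h) *\<^sub>R (lint (%r. (if t < r & r <= t + h then H 0 r x else 0)))" for t x
   unfolding W_def avg_def using h
   by (subst integral_win) (auto simp: indicator_def if_distrib intro!: arg_cong2[where f = scaleR] BI_integral_cong)
  moreover have "(%(t, x). (1 / h) *\<^sub>R (lint (%r. (if t < r & r <= t + h then H 0 r x else 0)))) \<in> borel_measurable (borel \<Otimes>\<^sub>M borel)"
   by measurable
  ultimately show ?thesis by presburger
 qed
 have mD: "(%(t, x). Dq t h x) \<in> borel_measurable (borel \<Otimes>\<^sub>M borel)"
  unfolding Dq_def by measurable
 define \<Psi> where "\<Psi> p = indicator {s<..T} (fst p) *\<^sub>R (Dq (fst p) h (snd p) * (?c (snd p) * cnj (W (fst p) h 0 (snd p))))" for p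
 have m\<Psi>: "\<Psi> \<in> borel_measurable (lborel \<Otimes>\<^sub>M lborel)"
  unfolding \<Psi>_def[abs_def] using mW mD by (simp add: split_beta') measurable
 have aeA: "AE t in lborel. t \<in> {s<..T} --> t \<in> A & t + h \<in> A"
  using AE_A_shift[of h] by eventually_elim (use s h in auto)
 have key: "sqi (Dq t h) & sqi (%x. ?c x * cnj (W t h 0 x)) & nrm (Dq t h) * nrm (%x. ?c x * cnj (W t h 0 x)) <= (2 * M / h) * M"
  if t: "t \<in> {s<..T}" "t \<in> A" "t + h \<in> A" for t
 proof -
  have sW: "sqi (W t h 0)" unfolding W_def using t s h by (intro time_avg.sqi_avg ta_H) auto
  have sWc: "sqi (%x. cnj (W t h 0 x))" using sW by simp
  have "nrm (W t h 0) <= M" using t s h by (intro nrm_W_le M) auto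
  then have 1: "nrm (%x. ?c x * cnj (W t h 0 x)) <= M" using sqi_chi(2)[OF sWc, of R] by simp
  have "nrm (Dq t h) = cmod (inverse (of_real h)) * nrm (%x. H 0 (t + h) x - H 0 t x)"
   unfolding Dq_def[abs_def] divide_inverse mult.commute[of _ "inverse _"] by (rule nrm_cmult)
  also have "... <= cmod (inverse (of_real h)) * (M + M)"
  proof (rule mult_left_mono)
   have "nrm (%x. H 0 (t + h) x - H 0 t x) <= nrm (H 0 (t + h)) + nrm (H 0 t)"
    using t by (intro sqi_diff(2)) (use H1_sqi[OF H_H1] in auto)
   also have "... <= M + M" using t h by (intro add_mono M) auto
   finally show "nrm (%x. H 0 (t + h) x - H 0 t x) <= M + M" .
  qed simp
  also have "cmod (inverse (cor h)) = 1 / h"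
   unfolding norm_inverse norm_of_real using h by (simp add: inverse_eq_divide)
  finally have "nrm (Dq t h) <= 1 / h * (M + M)" .
  also have "... = 2 * M / h" by simp
  finally have 2: "nrm (Dq t h) <= 2 * M / h" .
  have "nrm (Dq t h) * nrm (%x. ?c x * cnj (W t h 0 x)) <= (2 * M / h) * M"
   using 1 2 by (intro mult_mono) (use order_trans[OF nrm_nonneg 2] in auto)
  then show ?thesis using sqi_Dq[OF t(2,3)] sqi_chi(1)[OF sWc] by blast
 qed
 have int\<Psi>: "integrable (lborel \<Otimes>\<^sub>M lborel) \<Psi>"
 proof (rule lborel_pair.Fubini_integrable[OF m\<Psi>])
  have mn: "(%t. lint (%x. norm (\<Psi> (t, x)))) \<in> borel_measurable lborel"
   using m\<Psi> by measurable
  show "intl (%t. lint (%x. norm (\<Psi> (t, x))))"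
  proof (rule BI_integrable_bound[OF _ mn])
   show "intl (%t. indicator {s<..T} t * ((2 * M / h) * M))"
    by (intro integrable_mult_left integrable_real_indicator) (use s in auto)
   show "AE t in lborel. norm (lint (%x. norm (\<Psi> (t, x)))) <= norm (indicator {s<..T} t * ((2 * M / h) * M))"
    using aeA
   proof eventually_elim
    case (elim t)
    show ?case
    proof (cases "t \<in> {s<..T}")
     case True
     with elim key have k: "sqi (Dq t h)" "sqi (%x. ?c x * cnj (W t h 0 x))"
      "nrm (Dq t h) * nrm (%x. ?c x * cnj (W t h 0 x)) <= (2 * M / h) * M" by auto
     have "(lint (%x. norm (\<Psi> (t, x)))) = (lint (%x. cmod (Dq t h x) * cmod (?c x * cnj (W t h 0 x))))"
      using True by (simp add: \<Psi>_def norm_mult)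
     also have "... <= (2 * M / h) * M" using cauchy_schwarz(2)[OF k(1,2)] k(3) by linarith
     finally have "(lint (%x. norm (\<Psi> (t, x)))) <= (2 * M / h) * M" .
     moreover have "0 <= (lint (%x. norm (\<Psi> (t, x))))" by (rule BI_integral_nonneg) simp
     ultimately show ?thesis using True h by simp
    qed (simp add: \<Psi>_def)
   qed
  qed
  show "AE t in lborel. intl (%x. \<Psi> (t, x))"
   using aeA
  proof eventually_elim
   case (elim t)
   show ?case
   proof (cases "t \<in> {s<..T}")
    case True
    with elim key have k: "sqi (Dq t h)" "sqi (%x. ?c x * cnj (W t h 0 x))" by auto
    then show ?thesis using True cauchy_schwarz(1)[OF k] by (simp add: \<Psi>_def)
   qed (simp add: \<Psi>_def)
  qed
 qed
 then have int\<Psi>': "integrable (lborel \<Otimes>\<^sub>M lborel) (%(t, x). \<Psi> (t, x))" by simp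
 have e: "Re (lint (%x. \<Psi> (t, x))) = indicator {s<..T} t * e t" for t
  by (simp add: \<Psi>_def e_def indicator_def)
 show "intl (%t. indicator {s<..T} t * e t)"
  using integrable_Re[OF lborel_pair.integrable_fst[OF int\<Psi>']] by (simp only: e)
 have swap: "(lint (%x. lint (%t. \<Psi> (t, x)))) = (lint (%t. lint (%x. \<Psi> (t, x))))"
  using lborel_pair.Fubini_integral[OF int\<Psi>'] by simp
 have sWW: "sqi (W t h 0)" if "0 <= t" for t unfolding W_def by (intro time_avg.sqi_avg ta_H that h zero_idx)
 have iW: "intl (%x. chi R x * (cmod (W t h 0 x))\<^sup>2)" if "0 <= t" for t
  using chi_norm(2)[OF sWW[OF that], of R] by (simp add: sqi_def norm_mult power_mult_distrib)
 have "(lint (%x. chi R x * (cmod (W T h 0 x))\<^sup>2)) - (lint (%x. chi R x * (cmod (W s h 0 x))\<^sup>2)) =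
  (lint (%x. chi R x * (cmod (W T h 0 x))\<^sup>2 - chi R x * (cmod (W s h 0 x))\<^sup>2))"
  using iW[of T] iW[of s] s by (intro BI_integral_diff[symmetric]) auto
 also have "... = (lint (%x. 2 * Re (lint (%t. \<Psi> (t, x)))))"
 proof (rule integral_cong_AE)
  \<comment> \<open>One long window covering exactly (s, T + h] yields, for almost every x, the
    integrability in time that \<open>window_square\<close> asks for.\<close>
  have "AE x in lborel. integrable (win s (T + h - s)) (%r. H 0 r x)"
   using s h by (intro time_avg.AE_integrable ta_H) auto
  then show "AE x in lborel. chi R x * (cmod (W T h 0 x))\<^sup>2 - chi R x * (cmod (W s h 0 x))\<^sup>2 = 2 * Re (lint (%t. \<Psi> (t, x)))"
  proof eventually_elim
   case (elim x)
   then have i: "intl (%r. indicator {s<..T + h} r *\<^sub>R H 0 r x)"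
    using s h by (subst (asm) integrable_win) auto
   have "(lint (%t. \<Psi> (t, x))) = (lint (%t. ?c x * (indicator {s<..T} t *\<^sub>R ((H 0 (t + h) x - H 0 t x) / h * cnj (integral\<^sup>L (win t h) (%r. H 0 r x))))))"
    by (simp add: \<Psi>_def Dq_def W_def avg_def mult_ac)
   also have "... = ?c x * (lint (%t. indicator {s<..T} t *\<^sub>R ((H 0 (t + h) x - H 0 t x) / h * cnj (integral\<^sup>L (win t h) (%r. H 0 r x)))))"
    by (rule integral_mult_right_zero)
   finally have "2 * Re (lint (%t. \<Psi> (t, x))) = chi R x * (2 * Re (lint (%t. indicator {s<..T} t *\<^sub>R ((H 0 (t + h) x - H 0 t x) / h * cnj (integral\<^sup>L (win t h) (%r. H 0 r x))))))"
    by simp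
   also have "... = chi R x * ((cmod (W T h 0 x))\<^sup>2 - (cmod (W s h 0 x))\<^sup>2)"
    using window_square[OF sect i s(2) h] by (simp only: W_def avg_def)
   finally show ?case by (simp add: right_diff_distrib)
  qed
  show "(%x. chi R x * (cmod (W T h 0 x))\<^sup>2 - chi R x * (cmod (W s h 0 x))\<^sup>2) \<in> borel_measurable lborel"
   using iW[of T] iW[of s] s by (intro borel_measurable_diff borel_measurable_integrable) auto
  show "(%x. 2 * Re (lint (%t. \<Psi> (t, x)))) \<in> borel_measurable lborel"
   using lborel_pair.integrable_snd[OF int\<Psi>'] by (intro borel_measurable_integrable) auto
 qed
 also have "... = 2 * Re (lint (%x. lint (%t. \<Psi> (t, x))))"
  using lborel_pair.integrable_snd[OF int\<Psi>'] by simp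
 also have "... = 2 * (lint (%t. indicator {s<..T} t * e t))"
  unfolding swap e[symmetric] using integral_Re[OF lborel_pair.integrable_fst[OF int\<Psi>']] by simp
 finally show "(lint (%x. chi R x * (cmod (W T h 0 x))\<^sup>2)) - (lint (%x. chi R x * (cmod (W s h 0 x))\<^sup>2)) =
   2 * (lint (%t. indicator {s<..T} t * e t))" .
qed

end

context evo
begin

lemma integrable_Ioc:
 fixes f :: "real => real"
 assumes "set_integrable lborel {0..T} f" "0 <= s"
 shows "intl (%r. indicator {s<..T} r * f r)"
proof -
 have "set_integrable lborel {s<..T} f"
  by (rule set_integrable_subset[OF assms(1)]) (use assms(2) in auto)
 then show ?thesis by (simp add: set_integrable_def)
qed

lemma le_of_small_error:
 fixes X Y Z :: real
 assumes "!!e. 0 < e ==> e <= 1 ==> X <= Y + e * Z" "0 <= Z"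
 shows "X <= Y"
proof (rule ccontr)
 assume "\<not> X <= Y"
 then have d: "0 < X - Y" by simp
 define e where "e = min 1 ((X - Y) / (2 * (Z + 1)))"
 have e: "0 < e" "e <= 1" using d assms(2) by (auto simp: e_def)
 have "e * Z <= (X - Y) / (2 * (Z + 1)) * (Z + 1)" using assms(2) d by (intro mult_mono) (auto simp: e_def)
 also have "... = (X - Y) / 2" using assms(2) by (simp add: field_simps)
 finally show False using assms(1)[OF e] d by simp
qed

lemma gR_nonneg: "(!!r x. 0 <= Im (P r x * cnj (H 0 r x))) ==> 0 <= gR R r"
 unfolding gR_def by (intro BI_integral_nonneg mult_nonneg_nonneg) auto

text \<open>The limit h to 0 of the window balance at a fixed radius R. The dissipation is seen in
  full only from s + h on, whence the margin \<eta> on the left, and windows starting before T reach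
  beyond T, whence T' > T on the right.\<close>

lemma energy_cutoff:
 assumes s: "s \<in> A" and T: "T \<in> A" "s < T" "T < T'" and \<eta>: "0 < \<eta>" and R: "R >= 1"
  and M: "!!r. r \<in> A ==> r <= T' ==> nrm (H 0 r) <= M"
  and pos: "!!r x. 0 <= Im (P r x * cnj (H 0 r x))"
 shows "(lint (%x. chi R x * (cmod (H 0 T x))\<^sup>2)) / 2 + (lint (%r. indicator {s + \<eta><..T} r * gR R r)) <=
  (lint (%x. chi R x * (cmod (H 0 s x))\<^sup>2)) / 2 +
  (lint (%r. indicator {s<..T'} r * (cchi TYPE('a) / R * M * (\<Sum>b\<in>Basis. nrm (H b r)) + M * nrm (F r))))"
  and "intl (%r. indicator {s<..T'} r * gR R r)"
proof -
 have s0: "0 < s" using s A_pos by auto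
 obtain C where C: "0 <= C" "!!r. r \<in> A ==> r <= T' ==> sqi (PR (2 * R) r) & nrm (PR (2 * R) r) <= C"
  using P_loc[of T' "2 * R"] unfolding PR_def[abs_def] by blast
 have M0: "0 <= M" using order_trans[OF nrm_nonneg M[OF T(1)]] T by simp
 have g0: "0 <= gR R r" for r by (rule gR_nonneg[OF pos])
 have gb: "gR R r <= C * M" if r: "r \<in> A" "r <= T'" for r
 proof -
  have sc: "sqi (%x. cnj (H 0 r x))" using H1_sqi[OF H_H1[OF r(1)]] by simp
  have "cmod (lint (%x. PR (2 * R) r x * (cor (chi R x) * cnj (H 0 r x)))) <= nrm (PR (2 * R) r) * nrm (%x. cor (chi R x) * cnj (H 0 r x))"
   using C(2)[OF r] by (intro cauchy_schwarz(3) sqi_chi sc) auto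
  also have "... <= C * M"
   using C r M[OF r] sqi_chi(2)[OF sc, of R] by (intro mult_mono) auto
  finally have "\<bar>gR R r\<bar> <= C * M" unfolding gR_eq(2)[OF r(1) R] by (rule order_trans[OF abs_Im_le_cmod])
  then show ?thesis by simp
 qed
 have aeA: "AE r in lborel. 0 < r --> r \<in> A" by (rule A_AE)
 show ig: "intl (%r. indicator {s<..T'} r * gR R r)"
 proof (rule BI_integrable_bound)
  show "intl (%r. indicator {s<..T'} r * (C * M))"
   by (intro integrable_mult_left integrable_real_indicator) (use T in auto)
  show "(%r. indicator {s<..T'} r * gR R r) \<in> borel_measurable lborel" using gR_measurable by measurable
  show "AE r in lborel. norm (indicator {s<..T'} r * gR R r) <= norm (indicator {s<..T'} r * (C * M))"
   using aeA by eventually_elim (use g0 gb C(1) M0 s0 in \<open>auto simp: indicator_def\<close>)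
 qed
 define \<psi> where "\<psi> r = cchi TYPE('a) / R * M * (\<Sum>b\<in>Basis. nrm (H b r)) + M * nrm (F r)" for r
 have cR: "0 <= cchi TYPE('a) / R" using cchi(1)[where 'a = 'a] R by simp
 have \<psi>0: "0 <= \<psi> r" for r
  unfolding \<psi>_def using cR M0 by (intro add_nonneg_nonneg mult_nonneg_nonneg sum_nonneg) auto
 have m\<psi>: "\<psi> \<in> bm"
  unfolding \<psi>_def[abs_def]
  by (intro borel_measurable_add borel_measurable_times borel_measurable_const borel_measurable_sum
    nrm_measurable[OF F_meas] nrmH_measurable) auto
 have s\<psi>: "set_integrable lborel {0..u} \<psi>" for u
 proof -
  have "set_integrable lborel {0..u} (%r. \<Sum>b\<in>Basis. nrm (H b r))"
   unfolding set_integrable_def scaleR_sum_right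
   using H_int by (intro BI_integrable_sum) (auto simp: set_integrable_def)
  then show ?thesis
   unfolding \<psi>_def[abs_def] by (intro set_integral_add(1) set_integrable_mult_right F_int)
 qed
 have i\<psi>: "intl (%r. indicator {s<..u} r * \<psi> r)" for u
  using s0 by (intro integrable_Ioc s\<psi>) auto
 let ?X = "(lint (%x. chi R x * (cmod (H 0 T x))\<^sup>2)) / 2 + (lint (%r. indicator {s + \<eta><..T} r * gR R r))"
 let ?Y = "(lint (%x. chi R x * (cmod (H 0 s x))\<^sup>2)) / 2 + (lint (%r. indicator {s<..T'} r * \<psi> r))"
 have "?X <= ?Y"
 proof (rule le_of_small_error)
  \<comment> \<open>The terms with M measure the replacement of the averages at T and s by the
    solution itself, the 1 absorbs e^2 <= e, and C (T - s) collects the same replacement inside the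
    dissipation.\<close>
  show "0 <= 2 * M + 1 + C * (T - s)" using M0 C T by auto
  fix e :: real assume e: "0 < e" "e <= 1"
  obtain d where d: "0 < d" "!!r u. r \<in> A ==> u \<in> A ==> r <= T' ==> u <= T' ==> \<bar>r - u\<bar> <= d ==> nrm (%x. H 0 r x - H 0 u x) <= e"
   using ucont[OF e(1), of T'] by blast
  define h where "h = min d (min \<eta> (T' - T))"
  have h: "0 < h" "h <= d" "h <= \<eta>" "T + h <= T'" using d(1) \<eta> T by (auto simp: h_def)
  define ee where "ee t = Re (lint (%x. Dq t h x * (cor (chi R x) * cnj (W t h 0 x))))" for t
  have bal: "intl (%t. indicator {s<..T} t * ee t)"
   "(lint (%x. chi R x * (cmod (W T h 0 x))\<^sup>2)) - (lint (%x. chi R x * (cmod (W s h 0 x))\<^sup>2)) =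
   2 * (lint (%t. indicator {s<..T} t * ee t))"
   unfolding ee_def using window_balance[OF s0 T(2) h(1), of M R] M h(4) by auto
  have igT: "intl (%r. indicator {s<..T + h} r * gR R r)"
  proof -
   have "(%r. indicator {s<..T + h} r * gR R r) = (%r. indicator {s<..T + h} r *\<^sub>R (indicator {s<..T'} r * gR R r))"
    using h(4) by (auto simp: indicator_def fun_eq_iff)
   moreover have "intl (%r. indicator {s<..T + h} r *\<^sub>R (indicator {s<..T'} r * gR R r))"
    by (intro integrable_mult_indicator ig) auto
   ultimately show ?thesis by simp
  qed
  note wg = window_avg_bounds[OF gR_measurable g0 igT h(1) T(2)]
  note w\<psi> = window_avg_bounds[OF m\<psi> \<psi>0 i\<psi>[of "T + h"] h(1) T(2)]
  have ic: "intl (%t. indicator {s<..T} t * (C * e))"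
   by (intro integrable_mult_left integrable_real_indicator) (use T in auto)
  have "(lint (%t. indicator {s<..T} t * ee t)) <=
   (lint (%t. indicator {s<..T} t * integral\<^sup>L (win t h) \<psi> - indicator {s<..T} t * integral\<^sup>L (win t h) (gR R) + indicator {s<..T} t * (C * e)))"
  proof (rule integral_mono_AE[OF bal(1)])
   show "intl (%t. indicator {s<..T} t * integral\<^sup>L (win t h) \<psi> - indicator {s<..T} t * integral\<^sup>L (win t h) (gR R) + indicator {s<..T} t * (C * e))"
    by (intro BI_integrable_add BI_integrable_diff wg(1) w\<psi>(1) ic)
   show "AE t in lborel. indicator {s<..T} t * ee t <= indicator {s<..T} t * integral\<^sup>L (win t h) \<psi> - indicator {s<..T} t * integral\<^sup>L (win t h) (gR R) + indicator {s<..T} t * (C * e)"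
    using AE_A_shift[of h]
   proof eventually_elim
    case (elim t)
    show ?case
    proof (cases "t \<in> {s<..T}")
     case True
     then have tA: "t \<in> A" "t + h \<in> A" "t + h <= T'" using elim s0 h by auto
     have "ee t <= (\<integral>r. (cchi TYPE('a) / R * M * (\<Sum>b\<in>Basis. nrm (H b r)) + M * nrm (F r)) \<partial>win t h) - (\<integral>r. gR R r \<partial>win t h) + C * e"
      unfolding ee_def
     proof (rule window_energy(1)[OF tA(1,2) h(1) R])
      show "nrm (H 0 u) <= M" if "u \<in> A" "u <= t + h" for u using M that tA by auto
      show "sqi (PR (2 * R) u) & nrm (PR (2 * R) u) <= C" if "u \<in> A" "u <= t + h" for u using C that tA by auto
      show "nrm (%x. H 0 u x - H 0 r x) <= e" if "r \<in> A" "u \<in> A" "t < r" "r <= t + h" "t < u" "u <= t + h" for r u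
       using that tA h(2) by (intro d(2)) auto
     qed (use C e in auto)
     then show ?thesis using True by (simp add: \<psi>_def[abs_def])
    qed simp
   qed
  qed
  also have "... = (lint (%t. indicator {s<..T} t * integral\<^sup>L (win t h) \<psi>)) - (lint (%t. indicator {s<..T} t * integral\<^sup>L (win t h) (gR R))) + (lint (%t. indicator {s<..T} t * (C * e)))"
   using wg(1) w\<psi>(1) ic by simp
  also have "(lint (%t. indicator {s<..T} t * (C * e))) = (T - s) * (C * e)"
   using T by simp
  finally have 1: "(lint (%t. indicator {s<..T} t * ee t)) <= (lint (%r. indicator {s<..T + h} r * \<psi> r)) - (lint (%r. indicator {s + h<..T} r * gR R r)) + (T - s) * (C * e)"
   using w\<psi>(2) wg(3) by linarith
  have 2: "(lint (%r. indicator {s<..T + h} r * \<psi> r)) <= (lint (%r. indicator {s<..T'} r * \<psi> r))"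
   using i\<psi> \<psi>0 h(4) by (intro integral_mono) (auto simp: indicator_def)
  have isub: "intl (%r. indicator {s + u<..T} r * gR R r)" if "0 <= u" for u
  proof -
   have "(%r. indicator {s + u<..T} r * gR R r) = (%r. indicator {s + u<..T} r *\<^sub>R (indicator {s<..T'} r * gR R r))"
    using T that by (auto simp: indicator_def fun_eq_iff)
   moreover have "intl (%r. indicator {s + u<..T} r *\<^sub>R (indicator {s<..T'} r * gR R r))"
    by (intro integrable_mult_indicator ig) auto
   ultimately show ?thesis by simp
  qed
  have 3: "(lint (%r. indicator {s + \<eta><..T} r * gR R r)) <= (lint (%r. indicator {s + h<..T} r * gR R r))"
   using isub h \<eta> g0 by (intro integral_mono) (auto simp: indicator_def)
  have sv: "sqi (H 0 u)" if "u \<in> A" for u using H1_sqi[OF H_H1[OF that]] by simp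
  have sw: "sqi (W u h 0)" if "0 <= u" for u unfolding W_def by (intro time_avg.sqi_avg ta_H that h zero_idx)
  have 4: "(lint (%x. chi R x * (cmod (H 0 T x))\<^sup>2)) <= (lint (%x. chi R x * (cmod (W T h 0 x))\<^sup>2)) + 2 * e * M"
  proof (rule chi_norm_close(1))
   show "nrm (%x. W T h 0 x - H 0 T x) <= e"
    by (rule W_close) (use T s0 h d(2) in auto)
  qed (use sw sv T s0 M e in auto)
  have 5: "(lint (%x. chi R x * (cmod (W s h 0 x))\<^sup>2)) <= (lint (%x. chi R x * (cmod (H 0 s x))\<^sup>2)) + 2 * e * M + e\<^sup>2"
  proof (rule chi_norm_close(2))
   show "nrm (%x. W s h 0 x - H 0 s x) <= e"
    by (rule W_close) (use T s s0 h d(2) in auto)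
  qed (use sw sv T s s0 M e in auto)
  have 6: "e\<^sup>2 <= e" using e by (simp add: power2_eq_square mult_left_le)
  have "?X <= ?Y + (e * M + e * M + e + (T - s) * (C * e))"
   using bal(2) 1 2 3 4 5 6 e by (simp add: field_simps)
  then show "?X <= ?Y + e * (2 * M + 1 + C * (T - s))" by (simp add: algebra_simps)
 qed
 then show "?X <= (lint (%x. chi R x * (cmod (H 0 s x))\<^sup>2)) / 2 +
  (lint (%r. indicator {s<..T'} r * (cchi TYPE('a) / R * M * (\<Sum>b\<in>Basis. nrm (H b r)) + M * nrm (F r))))"
  by (simp add: \<psi>_def)
qed

lemma chi_norm_tendsto:
 fixes f :: "'a => complex"
 assumes f: "sqi f"
 shows "(%n. lint (%x. chi (real (Suc n)) x * (cmod (f x))\<^sup>2)) \<longlonglongrightarrow> (nrm f)\<^sup>2"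
 unfolding nrm_sq
proof (rule integral_dominated_convergence[where w = "%x. (cmod (f x))\<^sup>2"])
 have [measurable]: "f \<in> bm" using f by (rule sqi_measurable)
 show "(%x. (cmod (f x))\<^sup>2) \<in> borel_measurable lborel" "(%x. chi (real (Suc n)) x * (cmod (f x))\<^sup>2) \<in> borel_measurable lborel" for n
  by measurable
 show "intl (%x. (cmod (f x))\<^sup>2)" using f by (simp add: sqi_def)
 show "AE x in lborel. norm (chi (real (Suc n)) x * (cmod (f x))\<^sup>2) <= (cmod (f x))\<^sup>2" for n
  by (intro AE_I2) (simp add: mult_left_le_one_le)
 show "AE x in lborel. (%n. chi (real (Suc n)) x * (cmod (f x))\<^sup>2) \<longlonglongrightarrow> (cmod (f x))\<^sup>2"
 proof (rule AE_I2, rule tendsto_eventually)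
  fix x :: 'a
  obtain N :: nat where N: "norm x <= real N" using real_arch_simple by blast
  show "\<forall>\<^sub>F n in sequentially. chi (real (Suc n)) x * (cmod (f x))\<^sup>2 = (cmod (f x))\<^sup>2"
   unfolding eventually_sequentially using N by (intro exI[of _ N] allI impI) (simp add: chi_1)
 qed
qed

text \<open>The limit R to infinity: by the gradient bound of the cut-off the commutator error is K
  / R. The dissipation is stated as an extended integral, since its finiteness is part of the
  conclusion, and is recovered by monotone convergence over balls.\<close>

lemma energy:
 assumes s: "s \<in> A" and T: "T \<in> A" "s < T" "T < T'" and \<eta>: "0 < \<eta>"
  and M: "!!r. r \<in> A ==> r <= T' ==> nrm (H 0 r) <= M"
  and pos: "!!r x. 0 <= Im (P r x * cnj (H 0 r x))"
 defines "I \<equiv> lint (%r. indicator {s<..T'} r * nrm (F r))"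
 shows "(nrm (H 0 T))\<^sup>2 / 2 <= (nrm (H 0 s))\<^sup>2 / 2 + M * I"
  and "(nint (%r. indicator {s + \<eta><..T} r * (nint (%x. ennreal (Im (P r x * cnj (H 0 r x))))))) <= ennreal ((nrm (H 0 s))\<^sup>2 / 2 + M * I)"
proof -
 have s0: "0 < s" using s A_pos by auto
 have M0: "0 <= M" using order_trans[OF nrm_nonneg M[OF T(1)]] T by simp
 have sv: "sqi (H 0 u)" if "u \<in> A" for u using H1_sqi[OF H_H1[OF that]] by simp
 define J where "J = (lint (%r. indicator {s<..T'} r * (\<Sum>b\<in>Basis. nrm (H b r))))"
 define K where "K = cchi TYPE('a) * M * J"
 have iJ: "intl (%r. indicator {s<..T'} r * (\<Sum>b\<in>Basis. nrm (H b r)))"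
  unfolding sum_distrib_left using s0 by (intro BI_integrable_sum integrable_Ioc H_int) auto
 have iI: "intl (%r. indicator {s<..T'} r * nrm (F r))"
  using s0 by (intro integrable_Ioc F_int) auto
 define Y where "Y = (nrm (H 0 s))\<^sup>2 / 2 + M * I"
 have I0: "0 <= I" unfolding I_def by (intro BI_integral_nonneg) auto
 have J0: "0 <= J" unfolding J_def by (intro BI_integral_nonneg mult_nonneg_nonneg sum_nonneg) auto
 have Y0: "0 <= Y" using M0 I0 by (simp add: Y_def)
 have K0: "0 <= K" using M0 J0 cchi(1)[where 'a = 'a] by (simp add: K_def)
 have main: "(lint (%x. chi R x * (cmod (H 0 T x))\<^sup>2)) / 2 + (lint (%r. indicator {s + \<eta><..T} r * gR R r)) <= Y + K / R"
  if R: "R >= 1" for R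
 proof -
  have "(lint (%r. indicator {s<..T'} r * (cchi TYPE('a) / R * M * (\<Sum>b\<in>Basis. nrm (H b r)) + M * nrm (F r)))) =
   (lint (%r. cchi TYPE('a) / R * M * (indicator {s<..T'} r * (\<Sum>b\<in>Basis. nrm (H b r))) + M * (indicator {s<..T'} r * nrm (F r))))"
   by (intro BI_integral_cong refl) (simp add: algebra_simps)
  also have "... = cchi TYPE('a) / R * M * J + M * I"
   unfolding J_def I_def using iJ iI by simp
  finally have e: "(lint (%r. indicator {s<..T'} r * (cchi TYPE('a) / R * M * (\<Sum>b\<in>Basis. nrm (H b r)) + M * nrm (F r)))) = K / R + M * I"
   by (simp add: K_def)
  have "(lint (%x. chi R x * (cmod (H 0 s x))\<^sup>2)) <= (nrm (H 0 s))\<^sup>2"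
   using chi_norm(1,3)[OF sv[OF s]] by (simp add: power_mono)
  then show ?thesis using energy_cutoff(1)[OF s T \<eta> R M pos] unfolding e Y_def by linarith
 qed
 have gnn: "0 <= (lint (%r. indicator {s + \<eta><..T} r * gR R r))" for R
  by (intro BI_integral_nonneg mult_nonneg_nonneg gR_nonneg pos) auto
 have limK: "(%n. Y + K / real (Suc n)) \<longlonglongrightarrow> Y"
  using tendsto_add[OF tendsto_const tendsto_mult_right_zero[OF LIMSEQ_inverse_real_of_nat], of Y K] by (simp add: field_simps)
 have "(nrm (H 0 T))\<^sup>2 / 2 <= Y"
 proof (rule LIMSEQ_le[OF tendsto_divide[OF chi_norm_tendsto[OF sv[OF T(1)]] tendsto_const] limK])
  show "\<exists>N. \<forall>n\<ge>N. (lint (%x. chi (real (Suc n)) x * (cmod (H 0 T x))\<^sup>2)) / 2 <= Y + K / real (Suc n)"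
  proof (intro exI allI impI)
   fix n
   show "(lint (%x. chi (real (Suc n)) x * (cmod (H 0 T x))\<^sup>2)) / 2 <= Y + K / real (Suc n)"
   proof -
    have "1 <= real (Suc n)" by simp
    from main[OF this] gnn[of "real (Suc n)"] show ?thesis by linarith
   qed
  qed
 qed simp
 then show "(nrm (H 0 T))\<^sup>2 / 2 <= (nrm (H 0 s))\<^sup>2 / 2 + M * I" by (simp add: Y_def)
 define k where "k n r = (nint (%x. indicator (cball 0 (real (Suc n))) x * ennreal (Im (P r x * cnj (H 0 r x)))))" for n r
 have [measurable]: "(%(s, x). H 0 s x) \<in> borel_measurable (borel \<Otimes>\<^sub>M borel)"
   "(%(s, x). P s x) \<in> borel_measurable (borel \<Otimes>\<^sub>M borel)" "cball (0::'a) u \<in> sets borel" for u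
  using H_meas[OF zero_idx] P_meas by (auto simp: borel_prod)
 have mk [measurable]: "k n \<in> bm" for n unfolding k_def[abs_def] by measurable
 have kinc: "incseq k"
  unfolding k_def incseq_def le_fun_def
  by (intro allI impI nn_integral_mono mult_right_mono) (auto simp: indicator_def)
 have ksup: "(nint (%x. ennreal (Im (P r x * cnj (H 0 r x))))) = (SUP n. k n r)" for r
 proof -
  have "(SUP n. indicator (cball 0 (real (Suc n))) x * ennreal (Im (P r x * cnj (H 0 r x)))) = ennreal (Im (P r x * cnj (H 0 r x)))" for x
  proof (rule antisym)
   obtain N :: nat where N: "norm x <= real N" using real_arch_simple by blast
   then have "ennreal (Im (P r x * cnj (H 0 r x))) = indicator (cball 0 (real (Suc N))) x * ennreal (Im (P r x * cnj (H 0 r x)))"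
    by (simp add: indicator_def)
   also have "... <= (SUP n. indicator (cball 0 (real (Suc n))) x * ennreal (Im (P r x * cnj (H 0 r x))))"
    by (rule SUP_upper) simp
   finally show "ennreal (Im (P r x * cnj (H 0 r x))) <= (SUP n. indicator (cball 0 (real (Suc n))) x * ennreal (Im (P r x * cnj (H 0 r x))))" .
  qed (auto intro!: SUP_least simp: indicator_def)
  then have "(nint (%x. ennreal (Im (P r x * cnj (H 0 r x))))) =
   (nint (%x. (SUP n. indicator (cball 0 (real (Suc n))) x * ennreal (Im (P r x * cnj (H 0 r x))))))" by simp
  also have "... = (SUP n. k n r)"
   unfolding k_def
  proof (rule nn_integral_monotone_convergence_SUP)
   show "incseq (%n x. indicator (cball 0 (real (Suc n))) x * ennreal (Im (P r x * cnj (H 0 r x))))"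
    unfolding incseq_def le_fun_def by (intro allI impI mult_right_mono) (auto simp: indicator_def)
   have [measurable]: "(%x. P r x) \<in> bm" "(%x. H 0 r x) \<in> bm"
    using section_measurable(1)[OF P_meas, of r] section_measurable(1)[OF H_meas[OF zero_idx], of r] by auto
   show "(%x. indicator (cball 0 (real (Suc n))) x * ennreal (Im (P r x * cnj (H 0 r x)))) \<in> borel_measurable lborel" for n
    by measurable
  qed
  finally show ?thesis .
 qed
 \<comment> \<open>For n <= m the ball of radius n + 1 lies where the cut-off of radius m + 1 equals
   1. Afterwards n stays fixed while m tends to infinity.\<close>
 have kle: "(nint (%r. indicator {s + \<eta><..T} r * k n r)) <= ennreal (Y + K / real (Suc m))" if nm: "n <= m" for n m
 proof -
  let ?R = "real (Suc m)"
  have R: "?R >= 1" by simp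
  have ig: "intl (%r. indicator {s + \<eta><..T} r * gR ?R r)"
  proof -
   have "(%r. indicator {s + \<eta><..T} r * gR ?R r) = (%r. indicator {s + \<eta><..T} r *\<^sub>R (indicator {s<..T'} r * gR ?R r))"
    using T \<eta> by (auto simp: indicator_def fun_eq_iff)
   moreover have "intl (%r. indicator {s + \<eta><..T} r *\<^sub>R (indicator {s<..T'} r * gR ?R r))"
    by (intro integrable_mult_indicator energy_cutoff(2)[OF s T \<eta> R M pos]) auto
   ultimately show ?thesis by simp
  qed
  have "(nint (%r. indicator {s + \<eta><..T} r * k n r)) <= (nint (%r. ennreal (indicator {s + \<eta><..T} r * gR ?R r)))"
  proof (rule nn_integral_mono_AE)
   show "AE r in lborel. indicator {s + \<eta><..T} r * k n r <= ennreal (indicator {s + \<eta><..T} r * gR ?R r)"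
    using A_AE
   proof eventually_elim
    case (elim r)
    show ?case
    proof (cases "r \<in> {s + \<eta><..T}")
     case True
     then have r: "r \<in> A" using elim s0 \<eta> by auto
     have i: "intl (%x. chi ?R x * Im (P r x * cnj (H 0 r x)))"
     proof -
      have "Im (PR (2 * ?R) r x * (cor (chi ?R x) * cnj (H 0 r x))) = chi ?R x * Im (P r x * cnj (H 0 r x))" for x
       unfolding PR_chi[OF R] by (simp add: algebra_simps)
      then show ?thesis using integrable_Im[OF gR_eq(1)[OF r R]] by simp
     qed
     have "k n r <= (nint (%x. ennreal (chi ?R x * Im (P r x * cnj (H 0 r x)))))"
      unfolding k_def
     proof (rule nn_integral_mono)
      fix x
      show "indicator (cball 0 (real (Suc n))) x * ennreal (Im (P r x * cnj (H 0 r x))) <= ennreal (chi ?R x * Im (P r x * cnj (H 0 r x)))"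
      proof (cases "norm x <= real (Suc n)")
       case True
       then have "chi ?R x = 1" using nm by (intro chi_1) auto
       then show ?thesis by (simp add: indicator_def)
      qed (simp add: indicator_def)
     qed
     also have "... = ennreal (gR ?R r)"
      unfolding gR_def using i pos by (intro nn_integral_eq_integral) auto
     finally show ?thesis using True by simp
    qed simp
   qed
  qed
  also have "... = ennreal (lint (%r. indicator {s + \<eta><..T} r * gR ?R r))"
   using ig gR_nonneg[OF pos] by (intro nn_integral_eq_integral) auto
  also have "... <= ennreal (Y + K / ?R)"
  proof (rule ennreal_leI)
   have "0 <= (lint (%x. chi ?R x * (cmod (H 0 T x))\<^sup>2))" by (intro BI_integral_nonneg) auto
   then show "(lint (%r. indicator {s + \<eta><..T} r * gR ?R r)) <= Y + K / ?R" using main[OF R] by linarith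
  qed
  finally show ?thesis .
 qed
 have kY: "(nint (%r. indicator {s + \<eta><..T} r * k n r)) <= ennreal Y" for n
 proof (rule LIMSEQ_le_const[OF tendsto_ennrealI[OF limK]])
  show "\<exists>N. \<forall>m\<ge>N. (nint (%r. indicator {s + \<eta><..T} r * k n r)) <= ennreal (Y + K / real (Suc m))"
   using kle by blast
 qed
 have "(nint (%r. indicator {s + \<eta><..T} r * (nint (%x. ennreal (Im (P r x * cnj (H 0 r x))))))) =
  (nint (%r. (SUP n. indicator {s + \<eta><..T} r * k n r)))"
  by (simp only: ksup SUP_mult_left_ennreal)
 also have "... = (SUP n. nint (%r. indicator {s + \<eta><..T} r * k n r))"
 proof (rule nn_integral_monotone_convergence_SUP)
  show "incseq (%n r. indicator {s + \<eta><..T} r * k n r)"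
   using kinc unfolding incseq_def le_fun_def by (auto intro: mult_left_mono)
 qed measurable
 also have "... <= ennreal Y" by (rule SUP_least) (rule kY)
 finally show "(nint (%r. indicator {s + \<eta><..T} r * (nint (%x. ennreal (Im (P r x * cnj (H 0 r x))))))) <= ennreal ((nrm (H 0 s))\<^sup>2 / 2 + M * I)"
  by (simp add: Y_def)
qed

end

section \<open>Smallness of the window averages\<close>

lemma section_measurable_real:
 fixes q :: "real => 'a::euclidean_space => real"
 assumes "(%(s, x). q s x) \<in> bm"
 shows "(%s. q s x) \<in> bm"
proof -
 have m: "(%(s, x). q s x) \<in> borel_measurable (borel \<Otimes>\<^sub>M borel)"
  using assms by (simp add: borel_prod)
 show ?thesis using measurable_Pair1[OF m, of x] by simp
qed

context evo
begin

text \<open>The real part of the window identity. By the form bound the potential contributes at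
  most half of the squared gradient on the left, which is absorbed once R has tended to infinity and
  doubles the remaining terms: difference quotient, L^2 part of the potential, nonlinear term and
  forcing, in this order.\<close>

lemma window_gradient:
 assumes t: "t \<in> A" "t + h \<in> A" "0 < h"
  and M: "!!r. r \<in> A ==> r <= t + h ==> nrm (H 0 r) <= M"
  and f0: "(\<integral>r. nrm (F r) \<partial>win t h) <= f0"
  and B: "!!R. R >= 1 ==> cmod (Pw R t h) <= B"
 shows "(\<Sum>b\<in>Basis. (nrm (W t h b))\<^sup>2) <= 2 * (2 * M / h * M + CV * M\<^sup>2 + B + f0 * M)"
proof -
 have t0: "0 <= t" using t A_pos by auto
 have Hw: "H1 \<Omega> (W t h)" unfolding W_def[abs_def] by (rule H1_w[OF t0 t(3)])
 have sW: "i \<in> idx ==> sqi (W t h i)" for i by (rule H1_sqi[OF Hw])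
 have WM: "nrm (W t h 0) <= M" by (rule nrm_W_le[OF t0 t(3) M])
 have M0: "0 <= M" using WM nrm_nonneg[of "W t h 0"] by linarith
 define S where "S = (\<Sum>b\<in>Basis. (nrm (W t h b))\<^sup>2)"
 define K where "K = cchi TYPE('a) * (\<Sum>b\<in>Basis. nrm (W t h b)) * nrm (W t h 0)"
 have D: "nrm (Dq t h) <= 2 * M / h"
 proof -
  have "nrm (Dq t h) = cmod (inverse (of_real h)) * nrm (%x. H 0 (t + h) x - H 0 t x)"
   unfolding Dq_def[abs_def] divide_inverse mult.commute[of _ "inverse _"] by (rule nrm_cmult)
  also have "... <= cmod (inverse (of_real h)) * (M + M)"
  proof (rule mult_left_mono)
   have "nrm (%x. H 0 (t + h) x - H 0 t x) <= nrm (H 0 (t + h)) + nrm (H 0 t)"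
    using t by (intro sqi_diff(2)) (use H1_sqi[OF H_H1] in auto)
   also have "... <= M + M" using t by (intro add_mono M) auto
   finally show "nrm (%x. H 0 (t + h) x - H 0 t x) <= M + M" .
  qed simp
  also have "cmod (inverse (cor h)) = 1 / h"
   unfolding norm_inverse norm_of_real using t(3) by (simp add: inverse_eq_divide)
  finally have "nrm (Dq t h) <= 1 / h * (M + M)" .
  also have "... = 2 * M / h" by simp
  finally show ?thesis .
 qed
 have main: "Qw R t h <= (2 * M / h * M + (CV * M\<^sup>2 + S / 2) + B + f0 * M) + K / R" if R: "R >= 1" for R
 proof -
  obtain E U G where id: "\<i> * (lint (%x. Dq t h x * (cor (chi R x) * cnj (W t h 0 x)))) = E + of_real (Qw R t h) - of_real U - Pw R t h + G"
   and E: "cmod E <= cchi TYPE('a) / R * (\<Sum>b\<in>Basis. nrm (W t h b)) * nrm (W t h 0)"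
   and U: "\<bar>U\<bar> <= (nrm (%x. vw V x * W t h 0 x))\<^sup>2"
   and G: "cmod G <= nrm (avg (win t h) F) * nrm (W t h 0)"
   by (rule window_identity[OF t R])
  define c where "c = (lint (%x. Dq t h x * (cor (chi R x) * cnj (W t h 0 x))))"
  have sWc: "sqi (%x. cnj (W t h 0 x))" using sW by simp
  have "cmod c <= nrm (Dq t h) * nrm (%x. cor (chi R x) * cnj (W t h 0 x))"
   unfolding c_def by (intro cauchy_schwarz(3) sqi_Dq t sqi_chi sWc)
  also have "... <= 2 * M / h * M"
   using D WM sqi_chi(2)[OF sWc, of R] M0 t(3) by (intro mult_mono) auto
  finally have c: "cmod c <= 2 * M / h * M" .
  have "cor (Qw R t h) = \<i> * c - E + of_real U + Pw R t h - G"
   using id unfolding c_def by (simp add: algebra_simps)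
  then have "Re (cor (Qw R t h)) = Re (\<i> * c - E + of_real U + Pw R t h - G)" by (rule arg_cong)
  then have "Qw R t h = Re (\<i> * c) - Re E + U + Re (Pw R t h) - Re G" by simp
  also have "... <= cmod c + cmod E + \<bar>U\<bar> + cmod (Pw R t h) + cmod G"
   using abs_Re_le_cmod[of "\<i> * c"] abs_Re_le_cmod[of E] abs_Re_le_cmod[of "Pw R t h"] abs_Re_le_cmod[of G]
   unfolding norm_mult norm_ii by linarith
  also have "... <= 2 * M / h * M + K / R + (CV * M\<^sup>2 + S / 2) + B + f0 * M"
  proof (intro add_mono c B R)
   show "cmod E <= K / R" using E by (simp add: K_def)
   have "CV * (nrm (W t h 0))\<^sup>2 <= CV * M\<^sup>2" using CV(1) WM by (intro mult_left_mono power_mono) auto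
   then show "\<bar>U\<bar> <= CV * M\<^sup>2 + S / 2" using U CV(3)[OF Hw] unfolding S_def by linarith
   have "nrm (avg (win t h) F) <= f0"
    using time_avg.nrm_avg[OF ta_F[OF t0 t(3)]] f0 by linarith
   then have "nrm (avg (win t h) F) * nrm (W t h 0) <= f0 * M"
    using WM M0 by (intro mult_mono) (use order_trans[OF nrm_nonneg] in auto)
   then show "cmod G <= f0 * M" using G by linarith
  qed
  finally show ?thesis by simp
 qed
 have lim: "(%n. Qw (real (Suc n)) t h) \<longlonglongrightarrow> S"
  unfolding Qw_def S_def using sW by (intro tendsto_sum chi_norm_tendsto) auto
 have limK: "(%n. (2 * M / h * M + (CV * M\<^sup>2 + S / 2) + B + f0 * M) + K / real (Suc n)) \<longlonglongrightarrow> (2 * M / h * M + (CV * M\<^sup>2 + S / 2) + B + f0 * M) + 0"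
 proof (rule tendsto_add[OF tendsto_const])
  have "(%n. K * inverse (real (Suc n))) \<longlonglongrightarrow> 0" by (rule tendsto_mult_right_zero[OF LIMSEQ_inverse_real_of_nat])
  then show "(%n. K / real (Suc n)) \<longlonglongrightarrow> 0" by (simp only: divide_inverse)
 qed
 have "S <= (2 * M / h * M + (CV * M\<^sup>2 + S / 2) + B + f0 * M) + 0"
 proof (rule LIMSEQ_le[OF lim limK], intro exI allI impI)
  fix n :: nat
  have "1 <= real (Suc n)" by simp
  then show "Qw (real (Suc n)) t h <= (2 * M / h * M + (CV * M\<^sup>2 + S / 2) + B + f0 * M) + K / real (Suc n)" by (rule main)
 qed
 then show ?thesis unfolding S_def[symmetric] by simp
qed

lemma avg_le_nn:
 "ennreal (cmod (avg \<mu> v x)) <= (\<integral>\<^sup>+s. ennreal (cmod (v s x)) \<partial>\<mu>)"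
proof (cases "integrable \<mu> (%s. v s x)")
 case True
 then show ?thesis unfolding avg_def by (rule integral_norm_bound_ennreal)
qed (simp add: avg_def not_integrable_integral_eq)

text \<open>P and the solution are averaged separately, so their product pairs P at time s with the
  solution at another time s'. A Young type inequality separating the two times reduces this to the
  density q at single times; each of its two terms gives c \<rho>.\<close>

lemma Pw_bound:
 fixes q :: "real => 'a => real"
 assumes t: "0 <= t" "0 < h" and mq: "(%(s, x). q s x) \<in> bm"
  and c: "0 <= c" and q0: "!!s x. 0 <= q s x"
  and le: "!!s s' x. cmod (P s x) * cmod (H 0 s' x) <= c * (q s x + q s' x)"
  and \<rho>: "(\<integral>\<^sup>+s. nint (%x. ennreal (q s x)) \<partial>win t h) <= ennreal \<rho>" "0 <= \<rho>"
 shows "cmod (Pw R t h) <= 2 * c * \<rho>"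
proof -
 interpret finite_measure "win t h" by (rule finite_measure_win[OF t(2)])
 interpret PP: pair_sigma_finite "win t h" "lborel :: 'a measure" ..
 have [measurable]: "(%(s, x). H 0 s x) \<in> borel_measurable (borel \<Otimes>\<^sub>M borel)"
   "(%(s, x). P s x) \<in> borel_measurable (borel \<Otimes>\<^sub>M borel)" "(%(s, x). q s x) \<in> borel_measurable (borel \<Otimes>\<^sub>M borel)"
  using H_meas[OF zero_idx] P_meas mq by (auto simp: borel_prod)
 have [measurable]: "(%s. H 0 s x) \<in> bm" "(%s. P s x) \<in> bm"
   "(%s. q s x) \<in> bm" for x
  using section_measurable(2)[OF H_meas[OF zero_idx]] section_measurable(2)[OF P_meas] section_measurable_real[OF mq] by auto
 have one: "emeasure (win t h) UNIV = 1" using emeasure_win[OF t(2), of t] by (simp add: win_def)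
 have "ennreal (cmod (Pw R t h)) <= (nint (%x. ennreal (cmod (avg (win t h) P x * (cor (chi R x) * cnj (W t h 0 x))))))"
 proof (cases "intl (%x. avg (win t h) P x * (cor (chi R x) * cnj (W t h 0 x)))")
  case True
  then show ?thesis unfolding Pw_def by (rule integral_norm_bound_ennreal)
 qed (simp add: Pw_def not_integrable_integral_eq)
 also have "... <= (nint (%x. (\<integral>\<^sup>+s. ennreal (cmod (P s x)) \<partial>win t h) * (\<integral>\<^sup>+s'. ennreal (cmod (H 0 s' x)) \<partial>win t h)))"
 proof (rule nn_integral_mono)
  fix x
  have "cmod (avg (win t h) P x * (cor (chi R x) * cnj (W t h 0 x))) <= cmod (avg (win t h) P x) * cmod (W t h 0 x)"
   by (simp add: norm_mult mult_left_mono mult_left_le_one_le)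
  then have "ennreal (cmod (avg (win t h) P x * (cor (chi R x) * cnj (W t h 0 x)))) <= ennreal (cmod (avg (win t h) P x)) * ennreal (cmod (W t h 0 x))"
   by (simp add: ennreal_leI flip: ennreal_mult)
  also have "... <= (\<integral>\<^sup>+s. ennreal (cmod (P s x)) \<partial>win t h) * (\<integral>\<^sup>+s'. ennreal (cmod (H 0 s' x)) \<partial>win t h)"
   unfolding W_def by (intro mult_mono avg_le_nn) auto
  finally show "ennreal (cmod (avg (win t h) P x * (cor (chi R x) * cnj (W t h 0 x)))) <= ..." .
 qed
 also have "... <= (nint (%x. ennreal (2 * c) * (\<integral>\<^sup>+s. ennreal (q s x) \<partial>win t h)))"
 proof (rule nn_integral_mono)
  fix x
  have "(\<integral>\<^sup>+s. ennreal (cmod (P s x)) \<partial>win t h) * (\<integral>\<^sup>+s'. ennreal (cmod (H 0 s' x)) \<partial>win t h) =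
   (\<integral>\<^sup>+s. \<integral>\<^sup>+s'. ennreal (cmod (P s x)) * ennreal (cmod (H 0 s' x)) \<partial>win t h \<partial>win t h)"
   by (simp add: nn_integral_cmult nn_integral_multc)
  also have "... <= (\<integral>\<^sup>+s. \<integral>\<^sup>+s'. ennreal c * ennreal (q s x) + ennreal c * ennreal (q s' x) \<partial>win t h \<partial>win t h)"
  proof (intro nn_integral_mono)
   fix s s'
   show "ennreal (cmod (P s x)) * ennreal (cmod (H 0 s' x)) <= ennreal c * ennreal (q s x) + ennreal c * ennreal (q s' x)"
    using le[of s x s'] c q0 by (simp add: ennreal_leI distrib_left flip: ennreal_mult ennreal_plus)
  qed
  also have "... = ennreal c * (\<integral>\<^sup>+s. ennreal (q s x) \<partial>win t h) + ennreal c * (\<integral>\<^sup>+s. ennreal (q s x) \<partial>win t h)"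
   using one by (simp add: nn_integral_add nn_integral_cmult win_def[symmetric] sets_eq_imp_space_eq[OF sets_win])
  also have "... = ennreal (2 * c) * (\<integral>\<^sup>+s. ennreal (q s x) \<partial>win t h)"
   using c by (simp add: distrib_right[symmetric] flip: ennreal_plus)
  finally show "(\<integral>\<^sup>+s. ennreal (cmod (P s x)) \<partial>win t h) * (\<integral>\<^sup>+s'. ennreal (cmod (H 0 s' x)) \<partial>win t h) <= ..." .
 qed
 also have "... = ennreal (2 * c) * (\<integral>\<^sup>+s. nint (%x. ennreal (q s x)) \<partial>win t h)"
 proof -
  have "(nint (%x. \<integral>\<^sup>+s. ennreal (q s x) \<partial>win t h)) = (\<integral>\<^sup>+s. nint (%x. ennreal (q s x)) \<partial>win t h)"
   by (rule PP.Fubini') measurable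
  then show ?thesis by (subst nn_integral_cmult) auto
 qed
 also have "... <= ennreal (2 * c) * ennreal \<rho>" by (intro mult_left_mono \<rho>) auto
 also have "... = ennreal (2 * c * \<rho>)" using c \<rho> by (simp flip: ennreal_mult)
 finally show ?thesis using c \<rho> by (subst (asm) ennreal_le_iff) auto
qed

text \<open>Where \<open>\<bar>w\<bar> \<le> k\<close> the average is controlled by the dissipation density q; the set where
 \<open>\<bar>w\<bar> > k\<close> has small measure, and there the form bound with \<open>V = 1\<close> on that set excludes
 concentration of mass.\<close>
lemma window_small:
 fixes q :: "real => 'a => real"
 assumes t: "0 <= t" "0 < h" and mq: "(%(s, x). q s x) \<in> bm"
  and q1: "!!s x. cmod (H 0 s x) <= 1 ==> (cmod (H 0 s x))\<^sup>2 <= q s x"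
  and q2: "!!s x. cmod (H 0 s x) > 1 ==> cmod (H 0 s x) <= q s x"
  and \<rho>: "(\<integral>\<^sup>+s. nint (%x. ennreal (q s x)) \<partial>win t h) <= ennreal \<rho>" "0 <= \<rho>"
  and M: "nrm (W t h 0) <= M" and S: "(\<Sum>b\<in>Basis. (nrm (W t h b))\<^sup>2) <= La"
  and k: "0 < k" and de: "0 < de" "de <= 1"
 shows "(nrm (W t h 0))\<^sup>2 <= (1 + 2 * k) * \<rho> + 2 * M ^ 4 / (de ^ DIM('a) * k\<^sup>2) / bvol TYPE('a) + 8 * de\<^sup>2 * La"
proof -
 interpret finite_measure "win t h" by (rule finite_measure_win[OF t(2)])
 interpret PP: pair_sigma_finite "win t h" "lborel :: 'a measure" ..
 interpret T: time_avg "win t h" "H 0" by (rule ta_H[OF zero_idx t])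
 let ?c = "bvol TYPE('a)"
 have c: "0 < ?c" by (rule bvol_pos)
 define w where "w = W t h 0"
 have Hw: "H1 \<Omega> (W t h)" unfolding W_def[abs_def] by (rule H1_w[OF t])
 have sw: "sqi w" unfolding w_def by (rule H1_sqi[OF Hw]) simp
 have [measurable]: "w \<in> bm" using sw by (rule sqi_measurable)
 have [measurable]: "(%(s, x). q s x) \<in> borel_measurable (borel \<Otimes>\<^sub>M borel)"
  using mq by (auto simp: borel_prod)
 have [measurable]: "(%s. H 0 s x) \<in> bm" "(%s. q s x) \<in> bm" for x
  using section_measurable(2)[OF H_meas[OF zero_idx]] section_measurable_real[OF mq] by auto
 have one: "emeasure (win t h) UNIV = 1"
  using emeasure_win[OF t(2), of t] sets_eq_imp_space_eq[OF sets_win[of t h]] by simp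
 define Q where "Q x = (\<integral>\<^sup>+s. ennreal (q s x) \<partial>win t h)" for x
 have mQ [measurable]: "Q \<in> bm" unfolding Q_def[abs_def] by measurable
 define E where "E = {x. k < cmod (w x)}"
 have mE [measurable]: "E \<in> sets borel" unfolding E_def by measurable
 have pw: "ennreal ((cmod (w x))\<^sup>2) <= ennreal (1 + 2 * k) * Q x" if x: "x \<notin> E" for x
 proof (cases "Q x = \<infinity>")
  case True
  then show ?thesis using k by (simp add: ennreal_mult_top)
 next
  case False
  then obtain Qr where Qr: "Q x = ennreal Qr" "0 <= Qr" by (cases "Q x" rule: ennreal_cases) auto
  \<comment> \<open>The values |H 0 s x| are split at height 1. Cauchy-Schwarz for the probability
    measure gives a^2 <= Q x for the lower part, and the upper part satisfies b <= Q x outright.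
    Then |w|^2 <= |w| a + |w| b, where |w| a <= (|w|^2 + a^2) / 2 and |w| <= k off
    \<open>E\<close>.\<close>
  define a where "a = (\<integral>\<^sup>+s. (if cmod (H 0 s x) <= 1 then ennreal (cmod (H 0 s x)) else 0) \<partial>win t h)"
  define b where "b = (\<integral>\<^sup>+s. (if cmod (H 0 s x) <= 1 then 0 else ennreal (cmod (H 0 s x))) \<partial>win t h)"
  have "ennreal (cmod (w x)) <= (\<integral>\<^sup>+s. ennreal (cmod (H 0 s x)) \<partial>win t h)"
   unfolding w_def W_def by (rule avg_le_nn)
  also have "... = (\<integral>\<^sup>+s. (if cmod (H 0 s x) <= 1 then ennreal (cmod (H 0 s x)) else 0) + (if cmod (H 0 s x) <= 1 then 0 else ennreal (cmod (H 0 s x))) \<partial>win t h)"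
   by (intro nn_integral_cong) auto
  also have "... = a + b" unfolding a_def b_def by (rule nn_integral_add) measurable
  finally have wab: "ennreal (cmod (w x)) <= a + b" .
  have "a\<^sup>2 = (\<integral>\<^sup>+s. (if cmod (H 0 s x) <= 1 then ennreal (cmod (H 0 s x)) else 0) * 1 \<partial>win t h)\<^sup>2"
   by (simp add: a_def)
  also have "... <= (\<integral>\<^sup>+s. (if cmod (H 0 s x) <= 1 then ennreal (cmod (H 0 s x)) else 0)\<^sup>2 \<partial>win t h) * (\<integral>\<^sup>+s. 1\<^sup>2 \<partial>win t h)"
   by (rule Cauchy_Schwarz_nn_integral) auto
  also have "... = (\<integral>\<^sup>+s. (if cmod (H 0 s x) <= 1 then ennreal (cmod (H 0 s x)) else 0)\<^sup>2 \<partial>win t h)"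
   using one sets_eq_imp_space_eq[OF sets_win[of t h]] by simp
  also have "... <= Q x"
   unfolding Q_def by (intro nn_integral_mono) (use q1 in \<open>auto simp: ennreal_power intro!: ennreal_leI\<close>)
  finally have a2: "a\<^sup>2 <= ennreal Qr" by (simp add: Qr)
  have bQ: "b <= ennreal Qr"
   unfolding b_def Qr(1)[symmetric] Q_def by (intro nn_integral_mono) (use q2 in \<open>auto intro!: ennreal_leI\<close>)
  have "a ~= \<infinity>" using a2 by (auto simp: power2_eq_square top_unique ennreal_mult_top)
  then obtain ar where ar: "a = ennreal ar" "0 <= ar" by (cases a rule: ennreal_cases) auto
  obtain br where br: "b = ennreal br" "0 <= br" using bQ by (cases b rule: ennreal_cases) (auto simp: top_unique)
  have r1: "cmod (w x) <= ar + br" using wab ar br by (simp flip: ennreal_plus)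
  have r2: "ar\<^sup>2 <= Qr" using a2 ar Qr by (simp add: ennreal_power)
  have r3: "br <= Qr" using bQ br Qr by simp
  have wk: "cmod (w x) <= k" using x by (simp add: E_def)
  have "(cmod (w x))\<^sup>2 <= cmod (w x) * (ar + br)" unfolding power2_eq_square using r1 by (intro mult_left_mono) auto
  then have u1: "(cmod (w x))\<^sup>2 <= cmod (w x) * ar + cmod (w x) * br" by (simp only: distrib_left)
  have u2: "cmod (w x) * br <= k * Qr" using wk r3 br(2) k by (intro mult_mono) auto
  have u3: "cmod (w x) * ar <= ((cmod (w x))\<^sup>2 + ar\<^sup>2) / 2"
   using sum_squares_bound[of "cmod (w x)" ar] by simp
  have "(cmod (w x))\<^sup>2 <= ((cmod (w x))\<^sup>2 + ar\<^sup>2) / 2 + k * Qr"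
   by (rule order_trans[OF u1 add_mono[OF u3 u2]])
  then have "(cmod (w x))\<^sup>2 <= ar\<^sup>2 + 2 * (k * Qr)" by (simp add: field_simps)
  also have "... <= (1 + 2 * k) * Qr" using r2 by (simp add: algebra_simps)
  finally have "ennreal ((cmod (w x))\<^sup>2) <= ennreal ((1 + 2 * k) * Qr)" by (rule ennreal_leI)
  moreover have k': "0 <= 1 + 2 * k" using k by simp
  ultimately show ?thesis unfolding Qr(1) by (simp only: ennreal_mult[OF k' Qr(2)])
 qed
 have low: "(nint (%x. ennreal (1 + 2 * k) * Q x)) <= ennreal ((1 + 2 * k) * \<rho>)"
 proof -
  have "(nint (%x. Q x)) = (\<integral>\<^sup>+s. nint (%x. ennreal (q s x)) \<partial>win t h)"
   unfolding Q_def by (rule PP.Fubini') measurable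
  then have "(nint (%x. Q x)) <= ennreal \<rho>" using \<rho>(1) by simp
  then have "ennreal (1 + 2 * k) * (nint (%x. Q x)) <= ennreal (1 + 2 * k) * ennreal \<rho>" by (rule mult_left_mono) simp
  moreover have k': "0 <= 1 + 2 * k" using k by simp
  moreover have "(nint (%x. ennreal (1 + 2 * k) * Q x)) = ennreal (1 + 2 * k) * (nint (%x. Q x))"
   by (rule nn_integral_cmult) measurable
  ultimately show ?thesis by (simp only: ennreal_mult[OF k' \<rho>(2)])
 qed
 define VE where "VE = (%x. indicator E x :: ennreal)"
 have mV [measurable]: "VE \<in> bm" unfolding VE_def by measurable
 \<comment> \<open>By Chebyshev the set \<open>E\<close> has measure at most M^2 / k^2, so its ball
   average at radius de is at most that number divided by de^N, N being the dimension.\<close>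
 define A0 where "A0 = M\<^sup>2 / (de ^ DIM('a) * k\<^sup>2)"
 have A00: "0 <= A0" unfolding A0_def using de by simp
 have EM: "(nint (%x. VE x)) <= ennreal (M\<^sup>2 / k\<^sup>2)"
 proof -
  have "(nint (%x. VE x)) <= (nint (%x. ennreal (1 / k\<^sup>2) * ennreal ((cmod (w x))\<^sup>2)))"
  proof (rule nn_integral_mono)
   fix x
   show "VE x <= ennreal (1 / k\<^sup>2) * ennreal ((cmod (w x))\<^sup>2)"
   proof (cases "x \<in> E")
    case True
    then have "k\<^sup>2 <= (cmod (w x))\<^sup>2" using k by (intro power_mono) (auto simp: E_def)
    then have "1 <= 1 / k\<^sup>2 * (cmod (w x))\<^sup>2" using k by (simp add: field_simps)
    then have e: "ennreal 1 <= ennreal (1 / k\<^sup>2 * (cmod (w x))\<^sup>2)" by (rule ennreal_leI)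
    have p: "0 <= 1 / k\<^sup>2" "0 <= (cmod (w x))\<^sup>2" by auto
    have v: "VE x = ennreal 1" using True by (simp add: VE_def)
    show ?thesis using e unfolding v by (simp only: ennreal_mult[OF p])
   qed (simp add: VE_def)
  qed
  also have "... = ennreal (1 / k\<^sup>2 * (nrm w)\<^sup>2)"
   by (subst nn_integral_cmult) (auto simp: nn_nrm_sq[OF sw] simp flip: ennreal_mult)
  also have "... <= ennreal (M\<^sup>2 / k\<^sup>2)"
  proof (rule ennreal_leI)
   have "(nrm w)\<^sup>2 <= M\<^sup>2" using M by (intro power_mono) (auto simp: w_def)
   then show "1 / k\<^sup>2 * (nrm w)\<^sup>2 <= M\<^sup>2 / k\<^sup>2" by (simp add: divide_right_mono)
  qed
  finally show ?thesis .
 qed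
 have "(nint (%x. VE x * ennreal ((cmod (W t h 0 x))\<^sup>2))) <=
  ennreal ((2 * A0 * (nrm (W t h 0))\<^sup>2 + 8 * (?c * de) * de * (\<Sum>b\<in>Basis. (nrm (W t h b))\<^sup>2)) / ?c)"
 proof (rule form_bound[OF Hw mV de(1) _ A00])
  show "0 <= ?c * de" using c de by simp
  show "bavg VE de z <= ennreal A0" for z
  proof (rule bavg_le_integral[OF mV de(1) _ A00])
   have "(nint (%x. indicator (ball z de) x * VE x)) <= (nint (%x. VE x))"
    by (intro nn_integral_mono) (auto simp: indicator_def)
   also have "... <= ennreal (M\<^sup>2 / k\<^sup>2)" by (rule EM)
   also have "M\<^sup>2 / k\<^sup>2 = de ^ DIM('a) * A0" using de by (simp add: A0_def)
   finally show "(nint (%x. indicator (ball z de) x * VE x)) <= ennreal (de ^ DIM('a) * A0)" .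
  qed
  \<comment> \<open>An indicator is at most 1, so its averages are at most c <= c * de / r; the
    Morrey constant c * de then produces the Poincare coefficient 8 de^2.\<close>
  show "bavg VE r z <= ennreal (?c * de / r)" if r: "0 < r" "r <= de" for r z
  proof -
   have "bavg VE r z <= bavg (%x. 1) r z" by (rule bavg_mono) (simp add: VE_def indicator_def)
   also have "... = ennreal ?c" by (simp add: bavg_def emeasure_unit_ball)
   also have "... <= ennreal (?c * de / r)" using r c by (intro ennreal_leI) (simp add: field_simps)
   finally show ?thesis .
  qed
 qed
 also have "... <= ennreal (2 * M ^ 4 / (de ^ DIM('a) * k\<^sup>2) / ?c + 8 * de\<^sup>2 * La)"
 proof (rule ennreal_leI)
  have "A0 * (nrm (W t h 0))\<^sup>2 <= A0 * M\<^sup>2" using M A00 by (intro mult_left_mono power_mono) auto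
  also have "... = M ^ 4 / (de ^ DIM('a) * k\<^sup>2)" by (simp add: A0_def power2_eq_square power4_eq_xxxx)
  finally have 1: "2 * A0 * (nrm (W t h 0))\<^sup>2 / ?c <= 2 * M ^ 4 / (de ^ DIM('a) * k\<^sup>2) / ?c"
   using c by (intro divide_right_mono) auto
  have "8 * (?c * de) * de * (\<Sum>b\<in>Basis. (nrm (W t h b))\<^sup>2) / ?c = 8 * de\<^sup>2 * (\<Sum>b\<in>Basis. (nrm (W t h b))\<^sup>2)"
   using c by (simp add: power2_eq_square)
  also have "... <= 8 * de\<^sup>2 * La" using S by (intro mult_left_mono) auto
  finally show "(2 * A0 * (nrm (W t h 0))\<^sup>2 + 8 * (?c * de) * de * (\<Sum>b\<in>Basis. (nrm (W t h b))\<^sup>2)) / ?c <=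
   2 * M ^ 4 / (de ^ DIM('a) * k\<^sup>2) / ?c + 8 * de\<^sup>2 * La"
   using 1 by (simp add: add_divide_distrib)
 qed
 finally have high: "(nint (%x. VE x * ennreal ((cmod (w x))\<^sup>2))) <= ennreal (2 * M ^ 4 / (de ^ DIM('a) * k\<^sup>2) / ?c + 8 * de\<^sup>2 * La)"
  by (simp add: w_def)
 have M0: "0 <= M" using M nrm_nonneg[of "W t h 0"] by linarith
 have L0: "0 <= La" using S by (rule order_trans[rotated]) (auto intro: sum_nonneg)
 have "ennreal ((nrm w)\<^sup>2) = (nint (%x. ennreal ((cmod (w x))\<^sup>2)))" by (simp add: nn_nrm_sq[OF sw])
 also have "... <= (nint (%x. ennreal (1 + 2 * k) * Q x + VE x * ennreal ((cmod (w x))\<^sup>2)))"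
 proof (rule nn_integral_mono)
  fix x
  show "ennreal ((cmod (w x))\<^sup>2) <= ennreal (1 + 2 * k) * Q x + VE x * ennreal ((cmod (w x))\<^sup>2)"
   using pw[of x] by (cases "x \<in> E") (auto simp: VE_def)
 qed
 also have "... = (nint (%x. ennreal (1 + 2 * k) * Q x)) + (nint (%x. VE x * ennreal ((cmod (w x))\<^sup>2)))"
  by (rule nn_integral_add) measurable
 also have "... <= ennreal ((1 + 2 * k) * \<rho>) + ennreal (2 * M ^ 4 / (de ^ DIM('a) * k\<^sup>2) / ?c + 8 * de\<^sup>2 * La)"
  by (rule add_mono[OF low high])
 also have "... = ennreal ((1 + 2 * k) * \<rho> + (2 * M ^ 4 / (de ^ DIM('a) * k\<^sup>2) / ?c + 8 * de\<^sup>2 * La))"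
  using k \<rho> de c M0 L0 by (intro ennreal_plus[symmetric]) auto
 finally show ?thesis
  using k \<rho> de c M0 L0 by (subst (asm) ennreal_le_iff) (auto simp: w_def add.assoc)
qed

end

section \<open>Monotonicity of the nonlinearity\<close>

lemma sinh_mult_le:
 fixes x :: real
 assumes l: "0 <= l" "l <= 1" and x: "0 <= x"
 shows "sinh (l * x) <= l * sinh x"
proof -
 have "(%x. l * sinh x - sinh (l * x)) 0 <= (%x. l * sinh x - sinh (l * x)) x"
 proof (rule DERIV_nonneg_imp_nondecreasing[OF x])
  fix y :: real assume y: "0 <= y" "y <= x"
  have "cosh (l * y) <= cosh y" using y l by (subst cosh_real_nonneg_le_iff) (auto simp: mult_left_le_one_le)
  then show "\<exists>z. ((%x. l * sinh x - sinh (l * x)) has_real_derivative z) (at y) & 0 <= z"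
   using l by (intro exI[of _ "l * cosh y - cosh (l * y) * l"]) (auto intro!: derivative_eq_intros simp: mult_left_mono mult.commute)
 qed
 then show ?thesis by simp
qed

text \<open>With \<open>r = exp (c + x)\<close> and \<open>s = exp (c - x)\<close> this is \<open>sinh Q / Q \<le> sinh P / P\<close> for
 \<open>P = (1 + m) x\<close> and \<open>Q = (1 - m) x\<close>.\<close>
lemma power_gap:
 fixes r s m :: real
 assumes m: "0 <= m" "m <= 1" and rs: "0 < s" "s <= r"
 shows "4 * m * (r powr m * s - s powr m * r)\<^sup>2 <=
  (1 - m)\<^sup>2 * (((r powr m)\<^sup>2 - (s powr m)\<^sup>2) * (r\<^sup>2 - s\<^sup>2))"
proof -
 define c where "c = (ln r + ln s) / 2"
 define x where "x = (ln r - ln s) / 2"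
 have x0: "0 <= x" using rs by (simp add: x_def)
 have r: "r = exp (c + x)" and s: "s = exp (c - x)" using rs by (auto simp: c_def x_def field_simps)
 have pr: "r powr m = exp (m * (c + x))" "s powr m = exp (m * (c - x))" by (auto simp: r s powr_def)
 define E where "E = exp (m * c + c)"
 define P where "P = (1 + m) * x"
 define Q where "Q = (1 - m) * x"
 have e1: "r powr m * s - s powr m * r = - (2 * E * sinh Q)"
  unfolding pr unfolding r s E_def Q_def sinh_field_def by (simp add: field_simps flip: exp_add; simp add: algebra_simps)
 have e2: "((r powr m)\<^sup>2 - (s powr m)\<^sup>2) * (r\<^sup>2 - s\<^sup>2) = 4 * E\<^sup>2 * (sinh (2 * m * x) * sinh (2 * x))"
 proof -
  have a: "(r powr m)\<^sup>2 - (s powr m)\<^sup>2 = exp (2 * m * c) * (2 * sinh (2 * m * x))"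
   unfolding pr sinh_field_def by (simp add: field_simps flip: exp_add exp_double; simp add: algebra_simps)
  have b: "r\<^sup>2 - s\<^sup>2 = exp (2 * c) * (2 * sinh (2 * x))"
   unfolding r s sinh_field_def by (simp add: field_simps flip: exp_add exp_double; simp add: algebra_simps)
  have "E\<^sup>2 = exp (2 * m * c) * exp (2 * c)" by (simp add: E_def algebra_simps flip: exp_add exp_double)
  then show ?thesis unfolding a b by simp
 qed
 have pq: "sinh (2 * m * x) * sinh (2 * x) = (sinh P)\<^sup>2 - (sinh Q)\<^sup>2"
 proof -
  have e: "2 * m * x = P - Q" "2 * x = P + Q" by (auto simp: P_def Q_def algebra_simps)
  have "sinh (2 * m * x) * sinh (2 * x) = (sinh P * cosh Q)\<^sup>2 - (cosh P * sinh Q)\<^sup>2"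
   unfolding e sinh_add sinh_diff by (simp add: power2_eq_square algebra_simps)
  then show ?thesis by (simp add: power_mult_distrib cosh_square_eq algebra_simps)
 qed
 have "sinh ((1 - m) / (1 + m) * P) <= (1 - m) / (1 + m) * sinh P"
  using m x0 by (intro sinh_mult_le) (auto simp: P_def field_simps)
 moreover have "(1 - m) / (1 + m) * P = Q" using m by (simp add: P_def Q_def)
 ultimately have "sinh Q <= (1 - m) / (1 + m) * sinh P" by simp
 then have "(1 + m) * sinh Q <= (1 + m) * ((1 - m) / (1 + m) * sinh P)" using m by (intro mult_left_mono) auto
 also have "... = (1 - m) * sinh P" using m by simp
 finally have "(1 + m) * sinh Q <= (1 - m) * sinh P" .
 then have "((1 + m) * sinh Q)\<^sup>2 <= ((1 - m) * sinh P)\<^sup>2"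
  using m x0 by (intro power_mono) (auto simp: Q_def)
 then have "4 * m * (sinh Q)\<^sup>2 <= (1 - m)\<^sup>2 * ((sinh P)\<^sup>2 - (sinh Q)\<^sup>2)"
  by (simp add: power2_eq_square algebra_simps)
 then have "4 * E\<^sup>2 * (4 * m * (sinh Q)\<^sup>2) <= 4 * E\<^sup>2 * ((1 - m)\<^sup>2 * ((sinh P)\<^sup>2 - (sinh Q)\<^sup>2))"
  by (intro mult_left_mono) auto
 then show ?thesis unfolding e1 e2 pq by (simp add: power_mult_distrib mult_ac)
qed

text \<open>\<open>NL m z n\<close>: n is an admissible value of the nonlinearity \<open>\<bar>z\<bar>^(m-1) z\<close>; at \<open>m = 0\<close>, \<open>z = 0\<close> every
 n of modulus at most 1 is.\<close>
definition NL :: "real => complex => complex => bool" where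
 "NL m z n \<longleftrightarrow> (if m = 0 then cmod n <= 1 & (z ~= 0 --> n = z / of_real (cmod z)) else n = gm m z)"

lemma NL_cases:
 assumes "NL m z n" "z ~= 0"
 shows "n = of_real (cmod z powr m / cmod z) * z"
proof (cases "m = 0")
 case True
 then show ?thesis using assms by (simp add: NL_def divide_inverse mult.commute)
next
 case False
 then show ?thesis using assms by (simp add: NL_def gm_def powr_diff)
qed

lemma NL_zero:
 assumes "NL m 0 n" shows "if m = 0 then cmod n <= 1 else n = 0"
 using assms by (auto simp: NL_def gm_def)

lemma NL_mult_cnj: "NL m z n ==> n * cnj z = of_real (cmod z powr (m + 1))"
proof (cases "z = 0")
 case False
 assume n: "NL m z n"
 have "n * cnj z = of_real (cmod z powr m / cmod z) * (z * cnj z)"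
  by (subst NL_cases[OF n False]) (simp only: mult.assoc)
 also have "... = of_real (cmod z powr m / cmod z * (cmod z)\<^sup>2)"
  by (simp only: of_real_mult complex_norm_square)
 also have "cmod z powr m / cmod z * (cmod z)\<^sup>2 = cmod z powr (m + 1)"
  using False by (simp add: powr_add power2_eq_square)
 finally show ?thesis .
qed simp

lemma NL_norm_nonzero: "NL m z n ==> z ~= 0 ==> cmod n = cmod z powr m"
 using NL_cases[of m z n] by (simp add: norm_mult norm_divide)

lemma NL_norm:
 assumes "NL m z n" "0 <= m" "m <= 1"
 shows "cmod n <= 1 + cmod z"
proof (cases "z = 0")
 case True
 then show ?thesis using NL_zero[of m n] assms(1) by (auto split: if_splits)
next
 case False
 have "cmod z powr m <= 1 + cmod z"
 proof (cases "cmod z <= 1")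
  case True
  then have "cmod z powr m <= 1" using assms by (intro powr_le1) auto
  then show ?thesis using norm_ge_zero[of z] by linarith
 next
  case False
  then have "cmod z powr m <= cmod z powr 1" using assms by (intro powr_mono) auto
  then show ?thesis using False by simp
 qed
 then show ?thesis using NL_norm_nonzero[OF assms(1) False] by simp
qed

text \<open>For z nonzero the modulus of n is |z|^m, so the product is at most the power m + 1 of
  the larger of |y| and |z|. With y the solution at another time this is the decoupling that
  \<open>Pw_bound\<close> asks for.\<close>

lemma NL_young:
 assumes "NL m z n" "0 <= m"
 shows "cmod n * cmod y <= cmod z powr (m + 1) + cmod y powr (m + 1)"
proof (cases "z = 0")
 case True
 then have "cmod n * cmod y <= cmod y powr (m + 1)"
  using NL_zero[of m n] assms(1) by (auto split: if_splits simp: mult_left_le_one_le)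
 then show ?thesis by (simp add: True)
next
 case False
 then have n: "cmod n = cmod z powr m" by (rule NL_norm_nonzero[OF assms(1)])
 have p: "cmod u powr (m + 1) = cmod u powr m * cmod u" for u :: complex by (cases "u = 0") (auto simp: powr_add)
 show ?thesis
 proof (cases "cmod y <= cmod z")
  case True
  then have "cmod n * cmod y <= cmod z powr (m + 1)" unfolding n p by (intro mult_left_mono) auto
  then show ?thesis by (simp add: add_increasing2)
 next
  case False
  then have "cmod n * cmod y <= cmod y powr (m + 1)"
   unfolding n p using assms(2) by (intro mult_right_mono powr_mono2) auto
  then show ?thesis by (simp add: add_increasing)
 qed
qed

text \<open>The set C(m) is dual to a sector. With Z = (n1 - n2) cnj (z1 - z2) the quantity is Im a
  Re Z + Re a Im Z, and the inequality of Liskevich and Perelmuter, 2 sqrt m |Im Z| <= (1 - m) Re Z,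
  places Z in the sector against which every a in C(m) is nonnegative. For m = 0 the condition on a
  forces Re a = 0 and Re Z >= 0 decides.\<close>

lemma NL_monotone:
 assumes m: "0 <= m" "m <= 1" and a: "a \<in> Cset m" and n1: "NL m z1 n1" and n2: "NL m z2 n2"
 shows "0 <= Im (a * (n1 - n2) * cnj (z1 - z2))"
proof -
 have a1: "0 < Im a" "(1 - m) * \<bar>Re a\<bar> <= 2 * sqrt m * Im a" using a by (auto simp: Cset_def)
 define Z where "Z = (n1 - n2) * cnj (z1 - z2)"
 have Z: "Z = of_real (cmod z1 powr (m + 1)) + of_real (cmod z2 powr (m + 1)) - n1 * cnj z2 - n2 * cnj z1"
  using NL_mult_cnj[OF n1] NL_mult_cnj[OF n2] by (simp add: Z_def algebra_simps)
 have IZ: "Im (a * (n1 - n2) * cnj (z1 - z2)) = Im a * Re Z + Re a * Im Z"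
  unfolding Z_def by (simp only: mult.assoc) (simp add: algebra_simps)
 show ?thesis
 proof (cases "m = 0")
  case True
  then have "Re a = 0" using a1 by simp
  have c: "cmod n1 <= 1" "cmod n2 <= 1" using n1 n2 True by (auto simp: NL_def)
  have "Re (n1 * cnj z2) <= cmod z2"
   using complex_Re_le_cmod[of "n1 * cnj z2"] mult_right_mono[OF c(1), of "cmod z2"] by (simp add: norm_mult)
  moreover have "Re (n2 * cnj z1) <= cmod z1"
   using complex_Re_le_cmod[of "n2 * cnj z1"] mult_right_mono[OF c(2), of "cmod z1"] by (simp add: norm_mult)
  ultimately have "0 <= Re Z" unfolding Z True by simp
  then show ?thesis unfolding IZ using \<open>Re a = 0\<close> a1 by simp
 next
  case False
  then have m0: "0 < m" using m by simp
  have main: "0 <= Re Z & 2 * sqrt m * \<bar>Im Z\<bar> <= (1 - m) * Re Z"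
  proof (cases "z1 = 0 \<or> z2 = 0")
   case True
   then have "Z = of_real (cmod z1 powr (m + 1)) + of_real (cmod z2 powr (m + 1))"
    unfolding Z using NL_zero[of m n1] NL_zero[of m n2] n1 n2 m0 by auto
   then show ?thesis using m by simp
  next
   case nz: False
   define r where "r = cmod z1"
   define s where "s = cmod z2"
   have rs: "0 < r" "0 < s" using nz by (auto simp: r_def s_def)
   define p where "p = r powr m"
   define q where "q = s powr m"
   have pq: "0 < p" "0 < q" using rs by (auto simp: p_def q_def)
   \<comment> \<open>The relative phase of z1 and z2. Given the moduli r, s and their powers p, q,
     the numbers Re Z and Im Z are affine in Re u and Im u, so that only the position of u on the
     unit circle remains free.\<close>
   define u where "u = z1 * cnj z2 / of_real (r * s)"
   have u1: "cmod u = 1" using rs by (simp add: u_def norm_mult norm_divide r_def s_def)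
   have zu: "z1 * cnj z2 = of_real (r * s) * u" using rs by (simp add: u_def)
   have zu': "z2 * cnj z1 = of_real (r * s) * cnj u"
    using arg_cong[OF zu, of cnj] by (simp add: mult.commute)
   have "n1 * cnj z2 = of_real (p * s) * u"
   proof -
    have "n1 * cnj z2 = of_real (p / r) * (z1 * cnj z2)" using NL_cases[OF n1] nz by (simp add: p_def r_def)
    then show ?thesis unfolding zu using rs by simp
   qed
   moreover have "n2 * cnj z1 = of_real (q * r) * cnj u"
   proof -
    have "n2 * cnj z1 = of_real (q / s) * (z2 * cnj z1)" using NL_cases[OF n2] nz by (simp add: q_def s_def)
    then show ?thesis unfolding zu' using rs by simp
   qed
   moreover have "cmod z1 powr (m + 1) = p * r" "cmod z2 powr (m + 1) = q * s"
    using rs by (auto simp: p_def q_def r_def s_def powr_add)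
   ultimately have Z': "Z = of_real (p * r + q * s) - of_real (p * s) * u - of_real (q * r) * cnj u"
    unfolding Z by simp
   have ReZ: "Re Z = p * r + q * s - (p * s + q * r) * Re u" unfolding Z' by (simp add: algebra_simps)
   have ImZ: "Im Z = - ((p * s - q * r) * Im u)" unfolding Z' by (simp add: algebra_simps)
   have xy: "(Re u)\<^sup>2 + (Im u)\<^sup>2 = 1" using u1 cmod_power2[of u] by simp
   have mono: "0 <= (p - q) * (r - s)"
   proof (cases "s <= r")
    case True
    then have "q <= p" unfolding p_def q_def using rs m by (intro powr_mono2) auto
    then show ?thesis using True by simp
   next
    case False
    then have "p <= q" unfolding p_def q_def using rs m by (intro powr_mono2) auto
    then show ?thesis using False by (simp add: mult_nonpos_nonpos)
   qed
   have "Re u <= 1" using complex_Re_le_cmod[of u] u1 by simp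
   then have "(p * s + q * r) * Re u <= (p * s + q * r) * 1" using pq rs by (intro mult_left_mono) auto
   then have R0: "0 <= Re Z" unfolding ReZ using mono by (simp add: algebra_simps)
   have gap: "4 * m * (p * s - q * r)\<^sup>2 <= (1 - m)\<^sup>2 * ((p\<^sup>2 - q\<^sup>2) * (r\<^sup>2 - s\<^sup>2))"
   proof (cases "s <= r")
    case True
    then show ?thesis unfolding p_def q_def using power_gap[OF m rs(2)] by simp
   next
    case False
    then have "4 * m * (q * r - p * s)\<^sup>2 <= (1 - m)\<^sup>2 * ((q\<^sup>2 - p\<^sup>2) * (s\<^sup>2 - r\<^sup>2))"
     unfolding p_def q_def using power_gap[OF m rs(1), of s] by simp
    then show ?thesis by (simp add: power2_commute[of "q * r"] algebra_simps)
   qed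
   define al where "al = 2 * sqrt m * \<bar>p * s - q * r\<bar>"
   define \<beta> where "\<beta> = (1 - m) * (p * s + q * r)"
   define ga where "ga = (1 - m) * (p * r + q * s)"
   have g0: "0 <= ga" unfolding ga_def using m pq rs by (intro mult_nonneg_nonneg) auto
   have ab: "al\<^sup>2 + \<beta>\<^sup>2 <= ga\<^sup>2"
   proof -
    have "al\<^sup>2 = 4 * m * (p * s - q * r)\<^sup>2" using m by (simp add: al_def power_mult_distrib)
    moreover have "ga\<^sup>2 - \<beta>\<^sup>2 = (1 - m)\<^sup>2 * ((p\<^sup>2 - q\<^sup>2) * (r\<^sup>2 - s\<^sup>2))"
     unfolding ga_def \<beta>_def by (simp add: power2_eq_square algebra_simps)
    ultimately show ?thesis using gap by linarith
   qed
   \<comment> \<open>Cauchy-Schwarz in the plane for (al, \<beta>) and the unit vector (|Im u|, Re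
     u); by \<open>power_gap\<close> the first vector has length at most ga, which settles all
     phases at once.\<close>
   have "(al * \<bar>Im u\<bar> + \<beta> * Re u)\<^sup>2 <= (al\<^sup>2 + \<beta>\<^sup>2) * ((Im u)\<^sup>2 + (Re u)\<^sup>2)"
   proof -
    have "(al\<^sup>2 + \<beta>\<^sup>2) * (\<bar>Im u\<bar>\<^sup>2 + (Re u)\<^sup>2) - (al * \<bar>Im u\<bar> + \<beta> * Re u)\<^sup>2 = (al * Re u - \<beta> * \<bar>Im u\<bar>)\<^sup>2"
     by (simp add: power2_eq_square algebra_simps)
    then show ?thesis using zero_le_power2[of "al * Re u - \<beta> * \<bar>Im u\<bar>"] unfolding power2_abs by linarith
   qed
   also have "... <= ga\<^sup>2" using ab xy by (simp add: add.commute)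
   finally have "al * \<bar>Im u\<bar> + \<beta> * Re u <= ga" using g0 by (rule power2_le_imp_le)
   moreover have "al * \<bar>Im u\<bar> = 2 * sqrt m * \<bar>Im Z\<bar>" unfolding ImZ by (simp add: al_def abs_mult)
   moreover have "ga - \<beta> * Re u = (1 - m) * Re Z" unfolding ReZ ga_def \<beta>_def by (simp add: algebra_simps)
   ultimately show ?thesis using R0 by linarith
  qed
  have "2 * sqrt m * (\<bar>Re a\<bar> * \<bar>Im Z\<bar>) = \<bar>Re a\<bar> * (2 * sqrt m * \<bar>Im Z\<bar>)" by simp
  also have "... <= \<bar>Re a\<bar> * ((1 - m) * Re Z)" using main by (intro mult_left_mono) auto
  also have "... = ((1 - m) * \<bar>Re a\<bar>) * Re Z" by simp
  also have "... <= (2 * sqrt m * Im a) * Re Z" using a1 main by (intro mult_right_mono) auto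
  finally have "2 * sqrt m * (\<bar>Re a\<bar> * \<bar>Im Z\<bar>) <= 2 * sqrt m * (Im a * Re Z)" by simp
  then have "\<bar>Re a * Im Z\<bar> <= Im a * Re Z" using m0 by (simp add: abs_mult)
  then show ?thesis unfolding IZ by linarith
 qed
qed

section \<open>Borel representatives\<close>

text \<open>Passes from functions measurable for a completed, restricted measure to Borel functions
  on the whole space, for which product measurability and Fubini are at hand; vanishing outside S
  turns integrals over S into integrals over the space.\<close>

definition rep :: "'a::euclidean_space set => ('a => complex) => ('a => complex) => bool" where
 "rep S g g' \<longleftrightarrow> g' \<in> bm & (\<forall>p. p \<notin> S --> g' p = 0) & (AE p in lborel. p \<in> S --> g' p = g p)"

lemma rep_measurable: "rep S g g' ==> g' \<in> bm"
 by (simp add: rep_def)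

lemma AE_lebesgue_on:
 assumes "S \<in> sets borel"
 shows "(AE x in lebesgue_on S. Q x) \<longleftrightarrow> (AE x in lborel. x \<in> S --> Q x)"
 using assms by (subst AE_restrict_space_iff) (auto simp: AE_completion_iff)

lemma ex_rep:
 assumes S: "S \<in> sets borel" and g: "g \<in> borel_measurable (lebesgue_on S)"
 obtains g' where "rep S g g'"
proof -
 have "(%x. indicator S x *\<^sub>R g x) \<in> borel_measurable lebesgue"
  using g S by (subst (asm) borel_measurable_restrict_space_iff) auto
 then have m: "(%x. Re (indicator S x *\<^sub>R g x)) \<in> borel_measurable (completion lborel)"
  "(%x. Im (indicator S x *\<^sub>R g x)) \<in> borel_measurable (completion lborel)"
  by measurable
 obtain r1 where r1: "r1 \<in> borel_measurable lborel" "AE x in lborel. Re (indicator S x *\<^sub>R g x) = r1 x"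
  using completion_ex_borel_measurable_real[OF m(1)] by auto
 obtain r2 where r2: "r2 \<in> borel_measurable lborel" "AE x in lborel. Im (indicator S x *\<^sub>R g x) = r2 x"
  using completion_ex_borel_measurable_real[OF m(2)] by auto
 have [measurable]: "r1 \<in> bm" "r2 \<in> bm" "S \<in> sets borel"
  using r1(1) r2(1) S by auto
 have "rep S g (%x. indicator S x *\<^sub>R (cor (r1 x) + \<i> * cor (r2 x)))"
  unfolding rep_def
 proof (intro conjI allI impI)
  show "(%x. indicator S x *\<^sub>R (cor (r1 x) + \<i> * cor (r2 x))) \<in> bm"
   by measurable
  show "AE p in lborel. p \<in> S --> indicator S p *\<^sub>R (cor (r1 p) + \<i> * cor (r2 p)) = g p"
   using r1(2) r2(2) by eventually_elim (auto simp: complex_eq_iff)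
 qed auto
 then show thesis by (rule that)
qed

lemma nn_integral_rep:
 fixes S :: "'a::euclidean_space set"
 assumes S: "S \<in> sets borel" and r: "rep S g g'" and p: "0 < p"
 shows "(\<integral>\<^sup>+x. ennreal (cmod (g x) powr p) \<partial>lebesgue_on S) = (nint (%x. ennreal (cmod (g' x) powr p)))"
proof -
 have "(\<integral>\<^sup>+x. ennreal (cmod (g x) powr p) \<partial>lebesgue_on S) = (nint (%x. ennreal (cmod (g x) powr p) * indicator S x))"
  using S by (subst nn_integral_restrict_space) (auto simp: nn_integral_completion)
 also have "... = (nint (%x. ennreal (cmod (g' x) powr p)))"
  by (rule nn_integral_cong_AE) (use r p in \<open>auto simp: rep_def indicator_def elim!: eventually_mono\<close>)
 finally show ?thesis .
qed

lemma rep_Lpn: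
 assumes S: "S \<in> sets borel" and r: "rep S g g'"
 shows "Lpn 2 S g = nrm g'"
proof -
 have [measurable]: "g' \<in> bm" using r by (rule rep_measurable)
 have "nrm g' = sqrt (enn2real (nint (%x. ennreal ((cmod (g' x))\<^sup>2))))"
  unfolding nrm_def by (subst integral_eq_nn_integral) auto
 also have "... = Lpn 2 S g"
  unfolding Lpn_def nn_integral_rep[OF S r zero_less_numeral] by (simp add: powr_half_sqrt powr_numeral)
 finally show ?thesis by simp
qed

lemma rep_sqi:
 assumes S: "S \<in> sets borel" and r: "rep S g g'" and g: "memLp 2 S g"
 shows "sqi g'"
proof -
 have "(nint (%x. ennreal (cmod (g' x) powr 2))) < \<infinity>"
  using g unfolding memLp_def nn_integral_rep[OF S r zero_less_numeral] by simp
 then show ?thesis using rep_measurable[OF r] by (simp add: sqi_iff_nn powr_numeral)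
qed

lemma rep_diff: "rep S f f' ==> rep S g g' ==> rep S (%x. f x - g x) (%x. f' x - g' x)"
 unfolding rep_def by (auto elim: eventually_elim2)

lemma rep_add: "rep S f f' ==> rep S g g' ==> rep S (%x. f x + g x) (%x. f' x + g' x)"
 unfolding rep_def by (auto elim: eventually_elim2)

lemma rep_mult: "rep S f f' ==> rep S g g' ==> rep S (%x. f x * g x) (%x. f' x * g' x)"
 unfolding rep_def by (auto elim: eventually_elim2)

lemma rep_mult_borel: "rep S f f' ==> g \<in> bm ==> rep S (%x. f x * g x) (%x. f' x * g x)"
 unfolding rep_def by (auto elim: eventually_mono)

lemma rep_cmult: "rep S f f' ==> rep S (%x. c * f x) (%x. c * f' x)"
 unfolding rep_def by (auto elim: eventually_mono)

lemma rep_test_fun: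
 assumes "test_fun S ph"
 shows "rep S ph ph"
 unfolding rep_def using test_fun_outside[OF assms] test_fun_smooth[OF assms] smooth_measurable by auto

lemma rep_integral:
 fixes S :: "'a::euclidean_space set"
 assumes S: "S \<in> sets borel" and r: "rep S g g'" and i: "integrable (lebesgue_on S) g"
 shows "intl g'" and "integral\<^sup>L (lebesgue_on S) g = (lint (%x. g' x))"
proof -
 have [measurable]: "g' \<in> bm" using r by (rule rep_measurable)
 have i': "integrable lebesgue (%x. indicator S x *\<^sub>R g x)"
  using i S by (subst (asm) integrable_restrict_space) auto
 have ae: "AE x in lebesgue. indicator S x *\<^sub>R g x = g' x"
  unfolding AE_completion_iff using r by (auto simp: rep_def indicator_def elim!: eventually_mono)
 have m: "g' \<in> borel_measurable lebesgue" by (rule measurable_completion) simp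
 have "integrable lebesgue g'" using i' by (subst (asm) integrable_cong_AE[OF borel_measurable_integrable[OF i'] m ae])
 then show "intl g'" by (subst (asm) integrable_completion) auto
 have "integral\<^sup>L (lebesgue_on S) g = integral\<^sup>L lebesgue (%x. indicator S x *\<^sub>R g x)"
  using S by (subst integral_restrict_space) auto
 also have "... = integral\<^sup>L lebesgue g'" by (rule integral_cong_AE[OF borel_measurable_integrable[OF i'] m ae])
 also have "... = (lint (%x. g' x))" by (rule integral_completion) simp
 finally show "integral\<^sup>L (lebesgue_on S) g = (lint (%x. g' x))" .
qed

definition jrep :: "'a::euclidean_space set => (real => 'a => complex) => (real => 'a => complex) => bool" where
 "jrep \<Omega> u u' \<longleftrightarrow> rep ({0<..} \<times> \<Omega>) (%(t, x). u t x) (%(t, x). u' t x)"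

lemma ex_jrep:
 assumes "\<Omega> \<in> sets borel" "jmeas \<Omega> u"
 obtains u' where "jrep \<Omega> u u'"
proof -
 have S: "{0 :: real<..} \<times> \<Omega> \<in> sets borel" using assms(1) by (intro borel_Times) auto
 obtain g where g: "rep ({0<..} \<times> \<Omega>) (%(t, x). u t x) g"
  by (rule ex_rep[OF S assms(2)[unfolded jmeas_def]])
 have "g = (%(t, x). g (t, x))" by auto
 then have "jrep \<Omega> u (%t x. g (t, x))" using g unfolding jrep_def by simp
 then show thesis by (rule that)
qed

lemma AE_sections:
 fixes Q :: "real \<times> 'a::euclidean_space => bool"
 assumes "AE p in lborel. Q p"
 shows "AE t in lborel. AE x in lborel. Q (t, x)"
 by (rule lborel_pair.AE_pair[OF assms[folded lborel_prod]])

lemma jrep_AE: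
 fixes \<Omega> :: "'a::euclidean_space set"
 assumes "jrep \<Omega> u u'"
 shows "AE t in lborel. 0 < t --> rep \<Omega> (u t) (u' t)"
proof -
 have m: "(%(t, x). u' t x) \<in> bm" using assms by (simp add: jrep_def rep_def)
 have "AE p in lborel. p \<in> {0<..} \<times> \<Omega> --> (%(t, x). u' t x) p = (%(t, x). u t x) p"
  using assms by (simp add: jrep_def rep_def)
 from AE_sections[OF this] show ?thesis
 proof eventually_elim
  case (elim t)
  have "(%x. (%(t, x). u' t x) (t, x)) \<in> bm"
   by (rule measurable_compose[OF _ m]) (simp add: borel_prod[symmetric])
  then show ?case using elim assms by (auto simp: rep_def jrep_def)
 qed
qed

lemma jrep_measurable: "jrep \<Omega> u u' ==> (%(t, x). u' t x) \<in> bm"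
 by (simp add: jrep_def rep_def)

lemma jrep_0: "jrep \<Omega> u u' ==> t <= 0 \<or> x \<notin> \<Omega> ==> u' t x = 0"
 by (auto simp: jrep_def rep_def)

lemma jrep_space:
 fixes \<Omega> :: "'a::euclidean_space set"
 assumes "rep \<Omega> g g'"
 shows "jrep \<Omega> (%t x. g x) (%t x. indicator {0<..} t * g' x)"
proof -
 have [measurable]: "g' \<in> bm" using assms by (rule rep_measurable)
 have m: "(%(t :: real, x). indicator {0<..} t * g' x :: complex) \<in> bm"
  unfolding borel_prod[symmetric] by measurable
 have "AE t in (lborel :: real measure). AE x in lborel. x \<in> \<Omega> --> g' x = g x"
  using assms by (simp add: rep_def)
 then have "AE p in (lborel :: (real \<times> 'a) measure). snd p \<in> \<Omega> --> g' (snd p) = g (snd p)"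
 proof -
  obtain N where N: "N \<in> null_sets lborel" "{x. \<not> (x \<in> \<Omega> --> g' x = g x)} \<subseteq> N"
   using assms unfolding rep_def by (auto elim!: AE_E simp: null_sets_def)
  have "(UNIV :: real set) \<times> N \<in> null_sets (lborel \<Otimes>\<^sub>M lborel)"
   using N(1) by (auto simp: null_sets_def lborel.emeasure_pair_measure_Times)
  then have "(UNIV :: real set) \<times> N \<in> null_sets lborel" by (simp add: lborel_prod)
  then show ?thesis by (rule AE_I') (use N(2) in auto)
 qed
 then have "AE p in (lborel :: (real \<times> 'a) measure). p \<in> {0<..} \<times> \<Omega> -->
  (%(t :: real, x). indicator {0<..} t * g' x) p = (%(t, x). g x) p"
  by eventually_elim auto
 then show ?thesis using m assms by (auto simp: rep_def jrep_def)
qed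

lemma pot_rep:
 fixes \<Omega> :: "'a::euclidean_space set"
 assumes S: "\<Omega> \<in> sets borel" and V: "pot_ok \<Omega> V"
 obtains V' \<kappa> where "V' \<in> bm" "morrey (%x. ennreal \<bar>V' x\<bar>) \<kappa>"
  "rep \<Omega> (%x. cor (V x)) (%x. cor (V' x))"
proof -
 obtain V1 V2 p where e: "!!x. x \<in> \<Omega> ==> V x = V1 x + V2 x" and V1: "memLinf \<Omega> (%x. cor (V1 x))"
  and p: "if DIM('a) = 1 then p = 2 else if DIM('a) = 2 then (\<exists>\<beta>>0. p = 2 + \<beta>) else p = real DIM('a)"
  and V2: "memLp p \<Omega> (%x. cor (V2 x))"
  using V unfolding pot_ok_def by blast
 have "0 < DIM('a)" by simp
 \<comment> \<open>In each of the three cases p is at least the dimension and at least 1, which is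
   what the Morrey estimate asks for.\<close>
 then have p1: "p >= real DIM('a)" "p >= 1" using p by (auto split: if_splits)
 obtain g1 where g1: "rep \<Omega> (%x. cor (V1 x)) g1"
  by (rule ex_rep[OF S]) (use V1 in \<open>auto simp: memLinf_def\<close>)
 obtain g2 where g2: "rep \<Omega> (%x. cor (V2 x)) g2"
  by (rule ex_rep[OF S]) (use V2 in \<open>auto simp: memLp_def\<close>)
 have [measurable]: "g1 \<in> bm" "g2 \<in> bm"
  using g1 g2 by (auto dest: rep_measurable)
 define V' where "V' x = Re (g1 x) + Re (g2 x)" for x
 have m: "V' \<in> bm" unfolding V'_def by measurable
 obtain C where C: "AE x in lborel. x \<in> \<Omega> --> \<bar>V1 x\<bar> <= C"
  using V1 unfolding memLinf_def AE_lebesgue_on[OF S] by auto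
 have a1: "AE x in lborel. x \<in> \<Omega> --> g1 x = cor (V1 x)"
  "AE x in lborel. x \<in> \<Omega> --> g2 x = cor (V2 x)"
  "!!x. x \<notin> \<Omega> ==> g1 x = 0" "!!x. x \<notin> \<Omega> ==> g2 x = 0"
  using g1 g2 by (auto simp: rep_def)
 have le: "AE x in lborel. ennreal \<bar>V' x\<bar> <= ennreal (max C 0 + \<bar>Re (g2 x)\<bar>)"
  using a1(1) C
 proof eventually_elim
  case (elim x)
  have "\<bar>Re (g1 x)\<bar> <= max C 0" using elim a1(3)[of x] by (cases "x \<in> \<Omega>") auto
  then show ?case by (intro ennreal_leI) (auto simp: V'_def)
 qed
 have "(nint (%x. ennreal (\<bar>Re (g2 x)\<bar> powr p))) <= (nint (%x. ennreal (cmod (g2 x) powr p)))"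
  by (intro nn_integral_mono ennreal_leI powr_mono2) (use p1 in \<open>auto simp: abs_Re_le_cmod\<close>)
 also have "... < \<infinity>" using V2 nn_integral_rep[OF S g2, of p] p1 by (simp add: memLp_def)
 finally have fin: "(nint (%x. ennreal (\<bar>Re (g2 x)\<bar> powr p))) < \<infinity>" .
 have "\<exists>\<kappa>. morrey (%x. ennreal \<bar>V' x\<bar>) \<kappa>"
  by (rule morrey_Lp[OF _ _ le _ p1 fin]) (use m in auto)
 then obtain \<kappa> where \<kappa>: "morrey (%x. ennreal \<bar>V' x\<bar>) \<kappa>" ..
 have "AE x in lborel. x \<in> \<Omega> --> cor (V' x) = cor (V x)"
  using a1(1,2) by eventually_elim (auto simp: V'_def e)
 moreover have "(%x. cor (V' x)) \<in> bm" using m by measurable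
 ultimately have "rep \<Omega> (%x. cor (V x)) (%x. cor (V' x))"
  using a1(3,4) by (auto simp: rep_def V'_def)
 with m \<kappa> show thesis by (rule that)
qed

section \<open>From \<open>H\<^sup>2\<close>-solutions to evolutions\<close>

lemma memLp_ex_rep:
 assumes "S \<in> sets borel" "memLp p S g"
 obtains g' where "rep S g g'"
 by (rule ex_rep[OF assms(1), of g]) (use assms(2) that in \<open>auto simp: memLp_def\<close>)

lemma Lpn_triangle:
 assumes S: "S \<in> sets borel" and m: "memLp 2 S f" "memLp 2 S g" "memLp 2 S h"
 shows "Lpn 2 S (%x. f x - h x) <= Lpn 2 S (%x. f x - g x) + Lpn 2 S (%x. g x - h x)"
proof -
 obtain f' where f: "rep S f f'" by (rule memLp_ex_rep[OF S m(1)])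
 obtain g' where g: "rep S g g'" by (rule memLp_ex_rep[OF S m(2)])
 obtain h' where h: "rep S h h'" by (rule memLp_ex_rep[OF S m(3)])
 show ?thesis
  unfolding rep_Lpn[OF S rep_diff[OF f h]] rep_Lpn[OF S rep_diff[OF f g]] rep_Lpn[OF S rep_diff[OF g h]]
  by (rule nrm_triangle) (use rep_sqi[OF S f] rep_sqi[OF S g] rep_sqi[OF S h] m in auto)
qed

lemma Lpn_diff_le:
 assumes S: "S \<in> sets borel" and m: "memLp 2 S f" "memLp 2 S g"
 shows "Lpn 2 S f <= Lpn 2 S g + Lpn 2 S (%x. f x - g x)"
proof -
 obtain f' where f: "rep S f f'" by (rule memLp_ex_rep[OF S m(1)])
 obtain g' where g: "rep S g g'" by (rule memLp_ex_rep[OF S m(2)])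
 show ?thesis
  unfolding rep_Lpn[OF S f] rep_Lpn[OF S g] rep_Lpn[OF S rep_diff[OF f g]]
  by (rule nrm_diff_le) (use rep_sqi[OF S f] rep_sqi[OF S g] m in auto)
qed

lemma Lpn_minus_commute: "Lpn p S (%x. f x - g x) = Lpn p S (%x. g x - f x)"
 by (simp add: Lpn_def norm_minus_commute)

text \<open>Heine-Cantor for a seminorm: a Lebesgue number for the cover of [0, T] by intervals of
  continuity, with half of e spent on each of the two times.\<close>

lemma C_L2_uniform:
 assumes S: "S \<in> sets borel" and u: "C_L2 S u" and e: "0 < e"
 shows "\<exists>d>0. \<forall>s t. 0 <= s --> s <= T --> 0 <= t --> t <= T --> \<bar>s - t\<bar> <= d --> Lpn 2 S (%x. u s x - u t x) <= e"
proof -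
 have m: "memLp 2 S (u t)" if "0 <= t" for t using u that by (simp add: C_L2_def)
 have "\<exists>d>0. \<forall>s\<ge>0. \<bar>s - t\<bar> < d --> Lpn 2 S (%x. u s x - u t x) <= e / 2" if t: "0 <= t" for t
 proof -
  have "((%s. Lpn 2 S (%x. u s x - u t x)) \<longlongrightarrow> 0) (at t within {0..})" using u t by (simp add: C_L2_def)
  then have "eventually (%s. Lpn 2 S (%x. u s x - u t x) < e / 2) (at t within {0..})"
   using e by (intro order_tendstoD) auto
  then obtain d where d: "0 < d" "!!s. 0 <= s ==> s ~= t ==> dist s t < d ==> Lpn 2 S (%x. u s x - u t x) < e / 2"
   by (auto simp: eventually_at)
  have z: "Lpn 2 S (%x. u t x - u t x) = 0" by (simp add: Lpn_def)
  have "Lpn 2 S (%x. u s x - u t x) <= e / 2" if "0 <= s" "\<bar>s - t\<bar> < d" for s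
  proof (cases "s = t")
   case True
   then show ?thesis using z e by simp
  next
   case False
   then show ?thesis using d(2)[of s] that by (simp add: dist_real_def)
  qed
  with d(1) show ?thesis by blast
 qed
 then obtain de where de: "!!t. 0 <= t ==> 0 < de t"
  "!!t s. 0 <= t ==> 0 <= s ==> \<bar>s - t\<bar> < de t ==> Lpn 2 S (%x. u s x - u t x) <= e / 2"
  by metis
 obtain ep where ep: "0 < ep" "!!x. x \<in> {0..T} ==> \<exists>G\<in>(%t. ball t (de t)) ` {0..T}. ball x ep \<subseteq> G"
 proof (rule Heine_Borel_lemma[of "{0..T}" "(%t. ball t (de t)) ` {0..T}"])
  show "{0..T} \<subseteq> \<Union> ((%t. ball t (de t)) ` {0..T})"
  proof
   fix x assume "x \<in> {0..T}"
   then show "x \<in> \<Union> ((%t. ball t (de t)) ` {0..T})" using de(1)[of x] by (intro UnionI[of "ball x (de x)"]) auto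
  qed
 qed auto
 show ?thesis
 proof (intro exI[of _ "ep / 2"] conjI allI impI)
  fix s t assume st: "0 <= s" "s <= T" "0 <= t" "t <= T" "\<bar>s - t\<bar> <= ep / 2"
  obtain r where r: "0 <= r" "r <= T" "ball s ep \<subseteq> ball r (de r)" using ep(2)[of s] st by auto
  have "s \<in> ball r (de r)" using ep(1) by (intro subsetD[OF r(3)]) auto
  moreover have "t \<in> ball r (de r)" using st ep(1) by (intro subsetD[OF r(3)]) (auto simp: dist_real_def)
  ultimately have a: "\<bar>s - r\<bar> < de r" "\<bar>t - r\<bar> < de r" by (auto simp: dist_real_def)
  have "Lpn 2 S (%x. u s x - u t x) <= Lpn 2 S (%x. u s x - u r x) + Lpn 2 S (%x. u r x - u t x)"
   by (rule Lpn_triangle[OF S]) (use m st r in auto)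
  also have "... <= e / 2 + e / 2"
   by (subst (2) Lpn_minus_commute, intro add_mono de(2)) (use a st r in auto)
  finally show "Lpn 2 S (%x. u s x - u t x) <= e" by simp
 qed (use ep in auto)
qed

text \<open>Uniform continuity with tolerance 1: going back from t to 0 in steps of length d costs
  at most 1 per step, and about T / d steps suffice.\<close>

lemma C_L2_bounded:
 assumes S: "S \<in> sets borel" and u: "C_L2 S u"
 obtains M where "0 <= M" "!!t. 0 <= t ==> t <= T ==> Lpn 2 S (u t) <= M"
proof -
 obtain d where d: "0 < d" "!!s t. 0 <= s ==> s <= T ==> 0 <= t ==> t <= T ==> \<bar>s - t\<bar> <= d ==> Lpn 2 S (%x. u s x - u t x) <= 1"
  using C_L2_uniform[OF S u zero_less_one, where T = T] by auto
 have m: "memLp 2 S (u t)" if "0 <= t" for t using u that by (simp add: C_L2_def)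
 have b: "Lpn 2 S (u t) <= Lpn 2 S (u 0) + real n" if "0 <= t" "t <= T" "t <= real n * d" for t n
  using that
 proof (induction n arbitrary: t)
  case (Suc n)
  let ?s = "max 0 (t - d)"
  have "Lpn 2 S (u t) <= Lpn 2 S (u ?s) + Lpn 2 S (%x. u t x - u ?s x)"
   by (rule Lpn_diff_le[OF S]) (use m Suc in auto)
  also have "... <= (Lpn 2 S (u 0) + real n) + 1"
  proof (intro add_mono Suc.IH d(2))
   show "?s <= real n * d" using Suc.prems d(1) by (auto simp: algebra_simps max_def)
  qed (use Suc.prems d(1) in auto)
  finally show ?case by simp
 qed (use that in simp)
 obtain N where N: "T / d <= real N" using real_arch_simple by blast
 have "T <= real N * d" using N d(1) by (simp add: field_simps)
 then have "Lpn 2 S (u t) <= Lpn 2 S (u 0) + real N" if "0 <= t" "t <= T" for t using b[of t N] that by simp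
 moreover have "0 <= Lpn 2 S (u 0) + real N" by (simp add: Lpn_def)
 ultimately show thesis by (intro that) auto
qed

lemma weak_grad_rep:
 assumes S: "\<Omega> \<in> sets borel" and wg: "weak_grad \<Omega> g G" and g: "rep \<Omega> g g'" and G: "rep \<Omega> (%x. G x b) G'"
  and b: "b \<in> Basis" and ph: "test_fun \<Omega> ph"
 shows "(lint (%x. g' x * pd b ph x)) = - (lint (%x. G' x * ph x))"
proof -
 have w: "integrable (lebesgue_on \<Omega>) (%x. g x * pd b ph x)" "integrable (lebesgue_on \<Omega>) (%x. G x b * ph x)"
  "integral\<^sup>L (lebesgue_on \<Omega>) (%x. g x * pd b ph x) = - integral\<^sup>L (lebesgue_on \<Omega>) (%x. G x b * ph x)"
  using wg b ph unfolding weak_grad_def by auto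
 have r: "rep \<Omega> (%x. g x * pd b ph x) (%x. g' x * pd b ph x)" "rep \<Omega> (%x. G x b * ph x) (%x. G' x * ph x)"
  using rep_test_fun[OF test_fun_pd[OF ph b]] rep_test_fun[OF ph] by (auto intro: rep_mult g G)
 show ?thesis using w(3) unfolding rep_integral(2)[OF S r(1) w(1)] rep_integral(2)[OF S r(2) w(2)] .
qed

text \<open>The approximating test functions come with some weak gradient K of one time slice,
  whereas a solution carries its own gradient G, measurable jointly in time and space. Weak
  gradients are unique by the fundamental lemma, so the approximation transfers to G.\<close>

lemma H10_H1:
 fixes \<Omega> :: "'a::euclidean_space set"
 assumes \<Omega>: "open \<Omega>" and h: "H10 \<Omega> g" and wg: "weak_grad \<Omega> g G" and G2: "!!b. b \<in> Basis ==> memLp 2 \<Omega> (%x. G x b)"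
  and g: "rep \<Omega> g g'" and G: "!!b. b \<in> Basis ==> rep \<Omega> (%x. G x b) (G' b)"
 shows "H1 \<Omega> (%i. if i = 0 then g' else G' i)"
proof -
 have S: "\<Omega> \<in> sets borel" using \<Omega> by simp
 obtain K where g2: "memLp 2 \<Omega> g" and K: "weak_grad \<Omega> g K" "!!b. b \<in> Basis ==> memLp 2 \<Omega> (%x. K x b)"
  and ap: "!!e. 0 < e ==> \<exists>ph. test_fun \<Omega> ph & Lpn 2 \<Omega> (%x. g x - ph x) + (\<Sum>b\<in>Basis. Lpn 2 \<Omega> (%x. K x b - pd b ph x)) < e"
  using h unfolding H10_def by blast
 have "\<forall>b\<in>Basis. \<exists>K'. rep \<Omega> (%x. K x b) K'"
 proof
  fix b :: 'a assume "b \<in> Basis"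
  then have "(%x. K x b) \<in> borel_measurable (lebesgue_on \<Omega>)" using K(2) by (auto simp: memLp_def)
  from ex_rep[OF S this] show "\<exists>K'. rep \<Omega> (%x. K x b) K'" by blast
 qed
 then obtain K' where K': "!!b. b \<in> Basis ==> rep \<Omega> (%x. K x b) (K' b)" by metis
 have sG: "sqi (G' b)" and sK: "sqi (K' b)" if "b \<in> Basis" for b
  using rep_sqi[OF S G[OF that] G2[OF that]] rep_sqi[OF S K'[OF that] K(2)[OF that]] by auto
 have ae: "AE x in lborel. G' b x = K' b x" if b: "b \<in> Basis" for b
 proof -
  have "AE x in lborel. x \<in> \<Omega> --> G' b x - K' b x = 0"
  proof (rule fundamental_lemma[OF \<Omega> sqi_diff(1)[OF sG[OF b] sK[OF b]]])
   fix ph assume ph: "test_fun \<Omega> ph"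
   have "(lint (%x. G' b x * ph x)) = (lint (%x. K' b x * ph x))"
    using weak_grad_rep[OF S wg g G[OF b] b ph] weak_grad_rep[OF S K(1) g K'[OF b] b ph] by simp
   then show "(lint (%x. (G' b x - K' b x) * ph x)) = 0"
    using cauchy_schwarz(1)[OF sG[OF b] test_fun_sqi[OF ph]] cauchy_schwarz(1)[OF sK[OF b] test_fun_sqi[OF ph]]
    by (simp add: left_diff_distrib)
  qed
  then show ?thesis
   by (rule eventually_mono) (use G[OF b] K'[OF b] in \<open>auto simp: rep_def\<close>)
 qed
 show ?thesis unfolding H1_def
 proof (intro conjI ballI allI impI)
  fix i :: 'a assume "i \<in> idx"
  then show "sqi (if i = 0 then g' else G' i)" using rep_sqi[OF S g g2] sG by (auto simp: idx_def)
 next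
  fix e :: real assume "0 < e"
  then obtain ph where ph: "test_fun \<Omega> ph" and l: "Lpn 2 \<Omega> (%x. g x - ph x) + (\<Sum>b\<in>Basis. Lpn 2 \<Omega> (%x. K x b - pd b ph x)) < e"
   using ap by blast
  have n: "0 <= Lpn 2 \<Omega> q" for q by (simp add: Lpn_def)
  have l0: "nrm (%x. g' x - ph x) < e"
  proof -
   have "Lpn 2 \<Omega> (%x. g x - ph x) < e" using l sum_nonneg[of Basis "%b. Lpn 2 \<Omega> (%x. K x b - pd b ph x)"] n by auto
   then show ?thesis unfolding rep_Lpn[OF S rep_diff[OF g rep_test_fun[OF ph]]] .
  qed
  have lb: "nrm (%x. G' b x - pd b ph x) < e" if b: "b \<in> Basis" for b
  proof -
   have "Lpn 2 \<Omega> (%x. K x b - pd b ph x) <= (\<Sum>b\<in>Basis. Lpn 2 \<Omega> (%x. K x b - pd b ph x))"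
    by (rule member_le_sum) (use b n in auto)
   then have "Lpn 2 \<Omega> (%x. K x b - pd b ph x) < e" using l n[of "%x. g x - ph x"] by linarith
   then have k: "nrm (%x. K' b x - pd b ph x) < e"
    unfolding rep_Lpn[OF S rep_diff[OF K'[OF b] rep_test_fun[OF test_fun_pd[OF ph b]]]] .
   have [measurable]: "G' b \<in> bm" "K' b \<in> bm" "pd b ph \<in> bm"
    using sG[OF b] sK[OF b] test_fun_sqi[OF test_fun_pd[OF ph b]] by (auto dest: sqi_measurable)
   have "nrm (%x. G' b x - pd b ph x) = nrm (%x. K' b x - pd b ph x)"
    by (rule nrm_cong_AE) (use ae[OF b] in \<open>auto elim: eventually_mono\<close>)
   then show ?thesis using k by simp
  qed
  show "\<exists>ph. test_fun \<Omega> ph & (\<forall>i\<in>idx. nrm (%x. (if i = 0 then g' else G' i) x - jet ph i x) < e)"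
   by (rule exI[of _ ph]) (use ph l0 lb in \<open>auto simp: idx_def jet_def\<close>)
 qed
qed

section \<open>One-sided mollifiers and cut-offs in time, and the passage to point values\<close>

definition mol :: "real => real => real => real" where
 "mol p e r = bump ((1 / e) * r + - p / e) / bumpI / e"

text \<open>Rises from 0 to 1 on [s, s + d] and falls back on [t, t + e], so its derivative is a
  difference of two unit masses placed just after s and just after t. The arguments of
  \<open>step\<close> are written in the affine form that \<open>smooth_affine\<close>
  expects.\<close>

definition cut :: "real => real => real => real => real => real" where
 "cut s d t e r = step ((1 / d) * r + - s / d) - step ((1 / e) * r + - t / e)"

lemma affine_arg: "0 < e ==> (1 / e) * r + - p / e = (r - p) / (e :: real)"
 by (simp add: field_simps)

lemma mol_nonneg: "0 < e ==> 0 <= mol p e r"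
 using bumpI_pos by (simp add: mol_def bump_nonneg)

lemma mol_eq_0:
 assumes "0 < e" "r <= p \<or> p + e <= r"
 shows "mol p e r = 0"
 unfolding mol_def affine_arg[OF assms(1)] using assms by (subst bump_eq_0) (auto simp: field_simps)

lemma measurable_mol [measurable]: "mol p e \<in> bm"
proof -
 have [measurable]: "bump \<in> bm" by (rule borel_measurable_continuous_onI[OF continuous_bump])
 show ?thesis unfolding mol_def[abs_def] by measurable
qed

lemma mol_integral:
 assumes e: "0 < e"
 shows "intl (mol p e)" "(lint (%r. mol p e r)) = 1"
proof -
 have eq: "mol p e r * indicator {p..p + e} r = mol p e r" for r
 proof (cases "p <= r & r <= p + e")
  case False
  then have "mol p e r = 0" by (intro mol_eq_0[OF e]) auto
  then show ?thesis by simp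
 qed simp
 have "has_bochner_integral lborel (%r. mol p e r * indicator {p..p + e} r)
  (step ((1 / e) * (p + e) + - p / e) - step ((1 / e) * p + - p / e))"
 proof (rule has_bochner_integral_FTC_Icc_real)
  fix r
  show "DERIV (%r. step ((1 / e) * r + - p / e)) r :> mol p e r"
  proof -
   have "((%r. (1 / e) * r + - p / e) has_real_derivative 1 / e) (at r)"
    by (rule derivative_eq_intros refl)+ simp
   from DERIV_chain2[OF step_deriv this] show ?thesis by (simp add: mol_def)
  qed
  show "isCont (mol p e) r"
   unfolding mol_def[abs_def]
   by (rule continuous_on_interior[of UNIV])
    (intro continuous_intros continuous_on_compose2[OF continuous_bump], use bumpI_pos e in auto)
 qed (use e in auto)
 then have "has_bochner_integral lborel (mol p e) 1"
  unfolding eq affine_arg[OF e] using e by (simp add: step_0 step_1)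
 then show "intl (mol p e)" "(lint (%r. mol p e r)) = 1"
  by (auto simp: has_bochner_integral_iff)
qed

lemma cut_test_fun:
 assumes "0 < s" "0 < d" "0 < e" "s + d <= t"
 shows "test_fun {0<..} (%r. cor (cut s d t e r))"
  and "pd 1 (%r. cor (cut s d t e r)) r = cor (mol s d r - mol t e r)"
proof -
 have c: "(%r. cor (cut s d t e r)) =
   (%r. cor (step ((1 / d) * r + - s / d)) + (-1) * cor (step ((1 / e) * r + - t / e)))"
  by (simp add: cut_def)
 have sm: "smooth (%r. cor (step (k * r + l)))" for k l by (rule smooth_affine[OF smooth_step])
 show "test_fun {0<..} (%r. cor (cut s d t e r))"
 proof (rule test_funI[where K = "{s..t + e}"])
  show "smooth (%r. cor (cut s d t e r))"
   unfolding c by (intro smooth_add smooth_cmult sm)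
  fix r assume "r \<notin> {s..t + e}"
  then consider "r < s" | "t + e < r" by force
  then show "cor (cut s d t e r) = 0"
  proof cases
   case 1
   then show ?thesis unfolding cut_def affine_arg[OF assms(2)] affine_arg[OF assms(3)]
    using assms by (simp add: step_0 divide_nonpos_pos)
  next
   case 2
   then show ?thesis unfolding cut_def affine_arg[OF assms(2)] affine_arg[OF assms(3)]
    using assms by (simp add: step_1)
  qed
 qed (use assms in auto)
 show "pd 1 (%r. cor (cut s d t e r)) r = cor (mol s d r - mol t e r)"
  unfolding c
  by (subst pd_add[OF sm smooth_cmult[OF sm]], simp, subst pd_cmult[OF sm], simp,
    subst (1 2) pd_affine[OF smooth_step]) (simp add: pd_step mol_def mult.commute)
qed

lemma mollify_close:
 fixes al :: "real => complex"
 assumes [measurable]: "al \<in> bm" and A: "AE r in lborel. 0 < r --> r \<in> A" and p: "0 < p" "0 < d"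
  and c: "!!r. r \<in> A ==> p <= r ==> r <= p + d ==> cmod (al r - z) <= e"
 shows "intl (%r. al r * mol p d r)" and "cmod ((lint (%r. al r * mol p d r)) - z) <= e"
proof -
 have b: "AE r in lborel. cmod ((al r - z) * mol p d r) <= e * mol p d r"
  using A
 proof eventually_elim
  case (elim r)
  show ?case
  proof (cases "p < r & r < p + d")
   case True
   then show ?thesis using elim p c[of r] mol_nonneg[OF p(2), of p r] by (simp add: norm_mult mult_right_mono)
  next
   case False
   then have "mol p d r = 0" using p by (intro mol_eq_0) auto
   then show ?thesis by simp
  qed
 qed
 have i: "intl (%r. e * mol p d r)" using mol_integral(1)[OF p(2)] by simp
 have i1: "intl (%r. (al r - z) * mol p d r)"
  by (rule BI_integrable_bound[OF i]) (use b in \<open>auto elim!: eventually_mono\<close>)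
 have i2: "intl (%r. z * cor (mol p d r))"
  using mol_integral(1)[OF p(2)] by simp
 show i3: "intl (%r. al r * mol p d r)"
  using BI_integrable_add[OF i1 i2] by (simp add: algebra_simps)
 have "(lint (%r. al r * mol p d r)) - z = (lint (%r. (al r - z) * mol p d r))"
  using i3 i2 mol_integral(2)[OF p(2), of p] by (simp add: left_diff_distrib)
 also have "cmod ... <= (lint (%r. e * mol p d r))"
  by (rule order_trans[OF integral_norm_bound integral_mono_AE[OF integrable_norm[OF i1] i b]])
 also have "... = e" using mol_integral(2)[OF p(2), of p] by simp
 finally show "cmod ((lint (%r. al r * mol p d r)) - z) <= e" .
qed

lemma cut_bounds:
 assumes "0 < d" "0 < e" "s + d <= t"
 shows "\<bar>cut s d t e r\<bar> <= 1" and "r <= s \<or> t + e <= r ==> cut s d t e r = 0"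
  and "s + d <= r ==> r <= t ==> cut s d t e r = 1"
proof -
 show "\<bar>cut s d t e r\<bar> <= 1"
  unfolding cut_def using step_range[of "(1 / d) * r + - s / d"] step_range[of "(1 / e) * r + - t / e"] by (auto simp: abs_le_iff)
 show "cut s d t e r = 0" if "r <= s \<or> t + e <= r"
  using that
 proof
  assume "r <= s"
  then show ?thesis unfolding cut_def affine_arg[OF assms(1)] affine_arg[OF assms(2)]
   using assms by (simp add: step_0 divide_nonpos_pos)
 next
  assume "t + e <= r"
  then show ?thesis unfolding cut_def affine_arg[OF assms(1)] affine_arg[OF assms(2)]
   using assms by (simp add: step_1)
 qed
 show "cut s d t e r = 1" if "s + d <= r" "r <= t"
  unfolding cut_def affine_arg[OF assms(1)] affine_arg[OF assms(2)]
  using assms that by (simp add: step_0 step_1 divide_nonpos_pos)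
qed

text \<open>Cut-offs with shrinking ramps turn the weak time derivative into a difference of values
  mollified over the ramps, and uniform continuity on \<open>A\<close> gives the limits. Local
  integrability of ga comes from that of the tested expression, the part with al being bounded on
  the ramps.\<close>

lemma distributional_ftc:
 fixes al ga :: "real => complex"
 assumes m: "al \<in> bm" "ga \<in> bm"
  and A: "AE r in lborel. 0 < r --> r \<in> A"
  and uc: "!!T e. 0 < e ==> \<exists>d>0. \<forall>r\<in>A. \<forall>r'\<in>A. r <= T --> r' <= T --> \<bar>r - r'\<bar> <= d --> cmod (al r - al r') <= e"
  and bd: "!!T. \<exists>C. \<forall>r\<in>A. r <= T --> cmod (al r) <= C"
  and D: "!!th. test_fun {0<..} th ==> intl (%r. \<i> * al r * pd 1 th r + ga r * th r) &
   (lint (%r. \<i> * al r * pd 1 th r + ga r * th r)) = 0"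
  and s: "s \<in> A" "t \<in> A" "0 < s" "s < t"
 shows "\<i> * (al t - al s) = (lint (%r. indicator {s<..t} r *\<^sub>R ga r))"
proof -
 note [measurable] = m
 have test: "intl (%r. ga r * cor (cut p d q e r)) &
   (lint (%r. ga r * cor (cut p d q e r))) = - \<i> * (lint (%r. al r * mol p d r)) + \<i> * (lint (%r. al r * mol q e r))"
  if pq: "0 < p" "0 < d" "0 < e" "p + d <= q" for p d q e
 proof -
  have ia: "intl (%r. al r * mol x y r)" if xy: "0 < x" "0 < y" for x y
  proof -
   obtain C where C: "\<forall>r\<in>A. r <= x + y --> cmod (al r) <= C" using bd by blast
   show ?thesis by (rule mollify_close(1)[OF m(1) A xy, of 0 C]) (use C in auto)
  qed
  have p0: "0 < q" using pq by linarith
  note i1 = ia[OF pq(1,2)] and i2 = ia[OF p0 pq(3)]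
  have d: "intl (%r. \<i> * al r * cor (mol p d r - mol q e r) + ga r * cor (cut p d q e r))"
    "(lint (%r. \<i> * al r * cor (mol p d r - mol q e r) + ga r * cor (cut p d q e r))) = 0"
   using D[OF cut_test_fun(1)[OF pq]] unfolding cut_test_fun(2)[OF pq] by auto
  have i3: "intl (%r. \<i> * (al r * cor (mol p d r)) - \<i> * (al r * cor (mol q e r)))"
   using i1 i2 by (intro BI_integrable_diff integrable_mult_right)
  have e: "(%r. \<i> * al r * cor (mol p d r - mol q e r) + ga r * cor (cut p d q e r)) =
   (%r. (\<i> * (al r * cor (mol p d r)) - \<i> * (al r * cor (mol q e r))) + ga r * cor (cut p d q e r))"
   by (auto simp: algebra_simps)
  have i4: "intl (%r. ga r * cor (cut p d q e r))"
   using BI_integrable_diff[OF d(1)[unfolded e] i3] by simp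
  have "0 = (\<i> * (lint (%r. al r * mol p d r)) - \<i> * (lint (%r. al r * mol q e r))) + (lint (%r. ga r * cor (cut p d q e r)))"
   using d(2)[unfolded e] i1 i2 by (subst (asm) BI_integral_add[OF i3 i4]) (simp add: BI_integral_diff)
  then show ?thesis using i4 by (simp add: algebra_simps eq_neg_iff_add_eq_0)
 qed
 \<comment> \<open>The bound t - s keeps the rising ramp before t, and 1 / (n + 1) <= 1 keeps the
   falling ramp inside the wider cut-off used as a majorant.\<close>
 define ep where "ep n = min (1 / real (Suc n)) (t - s)" for n
 have ep: "0 < ep n" "s + ep n <= t" "ep n <= 1" for n using s by (auto simp: ep_def min_le_iff_disj)
 have cb: "\<bar>cut s (ep n) t (ep n) r\<bar> <= 1" "r <= s \<or> t + ep n <= r ==> cut s (ep n) t (ep n) r = 0"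
  "s + ep n <= r ==> r <= t ==> cut s (ep n) t (ep n) r = 1" for n r
  by (rule cut_bounds[OF ep(1) ep(1) ep(2)], assumption?)+
 have tn: "intl (%r. ga r * cor (cut s (ep n) t (ep n) r))"
  "(lint (%r. ga r * cor (cut s (ep n) t (ep n) r))) = - \<i> * (lint (%r. al r * mol s (ep n) r)) + \<i> * (lint (%r. al r * mol t (ep n) r))" for n
  using test[OF s(3) ep(1) ep(1) ep(2)] by auto
 have el: "ep \<longlonglongrightarrow> 0"
 proof (rule tendsto_sandwich[of "%_. 0" _ _ "%n. 1 / real (Suc n)"])
  show "(%n. 1 / real (Suc n)) \<longlonglongrightarrow> 0" using LIMSEQ_inverse_real_of_nat by (simp add: inverse_eq_divide)
 qed (use ep(1) in \<open>auto simp: less_imp_le ep_def\<close>)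
 have ml: "(%n. lint (%r. al r * mol p (ep n) r)) \<longlonglongrightarrow> al p" if p: "p \<in> A" "0 < p" for p
 proof (rule LIMSEQ_I)
  fix e :: real assume e: "0 < e"
  then obtain d where d: "0 < d" "\<forall>r\<in>A. \<forall>r'\<in>A. r <= p + 1 --> r' <= p + 1 --> \<bar>r - r'\<bar> <= d --> cmod (al r - al r') <= e / 2"
   using uc[of "e / 2" "p + 1"] by auto
  have "eventually (%n. ep n < d) sequentially" by (rule order_tendstoD(2)[OF el d(1)])
  then obtain N where N: "!!n. n >= N ==> ep n < d" by (auto simp: eventually_sequentially)
  have "cmod ((lint (%r. al r * mol p (ep n) r)) - al p) < e" if n: "n >= N" for n
  proof -
   have "cmod ((lint (%r. al r * mol p (ep n) r)) - al p) <= e / 2"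
   proof (rule mollify_close(2)[OF m(1) A p(2) ep(1)])
    fix r assume r: "r \<in> A" "p <= r" "r <= p + ep n"
    show "cmod (al r - al p) <= e / 2" using d(2) r p N[OF n] ep(3)[of n] by auto
   qed
   then show ?thesis using e by linarith
  qed
  then show "\<exists>N. \<forall>n\<ge>N. cmod ((lint (%r. al r * mol p (ep n) r)) - al p) < e" by blast
 qed
 have L1: "(%n. lint (%r. ga r * cor (cut s (ep n) t (ep n) r))) \<longlonglongrightarrow> - \<i> * al s + \<i> * al t"
  unfolding tn(2) using s by (auto intro!: tendsto_intros ml)
 have L2: "(%n. lint (%r. ga r * cor (cut s (ep n) t (ep n) r))) \<longlonglongrightarrow> (lint (%r. indicator {s<..t} r *\<^sub>R ga r))"
 \<comment> \<open>The wide cut-off is 1 on [s, t + 1], where all the narrow ones are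
   supported.\<close>
 proof (rule integral_dominated_convergence[where w = "%r. cmod (ga r * cor (cut (s / 2) (s / 2) (t + 1) 1 r))"])
  show "intl (%r. cmod (ga r * cor (cut (s / 2) (s / 2) (t + 1) 1 r)))"
   using test[of "s / 2" "s / 2" 1 "t + 1"] s by (intro integrable_norm) auto
  show "(%r. indicator {s<..t} r *\<^sub>R ga r) \<in> borel_measurable lborel" by measurable
  show "(%r. ga r * cor (cut s (ep n) t (ep n) r)) \<in> borel_measurable lborel" for n
   by (rule borel_measurable_integrable[OF tn(1)])
  show "AE r in lborel. cmod (ga r * cor (cut s (ep n) t (ep n) r)) <= cmod (ga r * cor (cut (s / 2) (s / 2) (t + 1) 1 r))" for n
  proof (rule AE_I2)
   fix r
   show "cmod (ga r * cor (cut s (ep n) t (ep n) r)) <= cmod (ga r * cor (cut (s / 2) (s / 2) (t + 1) 1 r))"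
   proof (cases "r <= s \<or> t + ep n <= r")
    case True
    then show ?thesis using cb(2) by simp
   next
    case False
    then have c: "cut (s / 2) (s / 2) (t + 1) 1 r = 1" by (intro cut_bounds(3)) (use s ep(3)[of n] in auto)
    show ?thesis unfolding c using cb(1)[of n r]
     by (auto simp: norm_mult intro: mult_left_le)
   qed
  qed
  show "AE r in lborel. (%n. ga r * cor (cut s (ep n) t (ep n) r)) \<longlonglongrightarrow> indicator {s<..t} r *\<^sub>R ga r"
  proof (rule AE_I2, rule tendsto_eventually)
   fix r
   show "eventually (%n. ga r * cor (cut s (ep n) t (ep n) r) = indicator {s<..t} r *\<^sub>R ga r) sequentially"
   proof (cases "r <= s")
    case True
    then show ?thesis using cb(2) by simp
   next
    case False
    show ?thesis
    proof (cases "r <= t")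
     case True
     have "eventually (%n. ep n < r - s) sequentially" by (rule order_tendstoD(2)[OF el]) (use False in simp)
     then show ?thesis
     proof eventually_elim
      case (elim n)
      then show ?case using cb(3)[of n r] True False by simp
     qed
    next
     case F: False
     have "eventually (%n. ep n < r - t) sequentially" by (rule order_tendstoD(2)[OF el]) (use F in simp)
     then show ?thesis
     proof eventually_elim
      case (elim n)
      then show ?case using cb(2)[of r n] F by simp
     qed
    qed
   qed
  qed
 qed
 have "- \<i> * al s + \<i> * al t = (lint (%r. indicator {s<..t} r *\<^sub>R ga r))" by (rule LIMSEQ_unique[OF L1 L2])
 then show ?thesis by (simp add: algebra_simps)
qed

section \<open>From the distributional equation to the equation integrated in time\<close>

lemma time_integral_measurable:
 fixes f :: "real => 'a::euclidean_space => complex"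
 assumes "(%(r, x). f r x) \<in> bm"
 shows "(%r. lint (%x. f r x)) \<in> bm"
proof -
 have "(%(r, x). f r x) \<in> borel_measurable (borel \<Otimes>\<^sub>M lborel)"
  using assms by (simp add: borel_prod[symmetric] cong: measurable_cong_sets)
 then show ?thesis by (rule lborel.borel_measurable_lebesgue_integral)
qed

lemma rhs_measurable:
 fixes H :: "'a::euclidean_space => real => 'a => complex" and V :: "'a => real"
 assumes V: "V \<in> bm"
  and Hm: "!!i. i \<in> idx ==> (%(s, x). H i s x) \<in> bm"
  and Pm: "(%(s, x). P s x) \<in> bm"
  and Fm: "(%(s, x). F s x) \<in> bm" and ph: "test_fun \<Omega> ph"
 shows "(%r. (\<Sum>b\<in>Basis. lint (%x. H b r x * pd b ph x))
    - (lint (%x. V x * H 0 r x * ph x)) - (lint (%x. P r x * ph x)) + (lint (%x. F r x * ph x))) \<in> bm"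
proof -
 have [measurable]: "V \<in> bm" by (rule V)
 have [measurable]: "ph \<in> bm" by (rule sqi_measurable[OF test_fun_sqi[OF ph]])
 have i0: "0 \<in> (idx :: 'a set)" and ib: "!!b :: 'a. b \<in> Basis ==> b \<in> idx" by (auto simp: idx_def)
 have pm: "(%(r, x). f r x * g x) \<in> bm"
  if "(%(r, x). f r x) \<in> bm" "g \<in> bm" for f :: "real => 'a => complex" and g
 proof -
  have "(%p. (%(r, x). f r x) p * g (snd p)) \<in> bm"
   by (rule borel_measurable_times[OF that(1)]) (use that(2) in \<open>simp add: borel_prod[symmetric]\<close>)
  then show ?thesis by (simp add: case_prod_beta')
 qed
 have 1: "(%r. lint (%x. H b r x * pd b ph x)) \<in> bm" if "b \<in> Basis" for b
  by (rule time_integral_measurable[OF pm[OF Hm[OF ib[OF that]] sqi_measurable[OF test_fun_sqi[OF test_fun_pd[OF ph that]]]]])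
 have "(%r. lint (%x. H 0 r x * (V x * ph x))) \<in> bm"
  by (rule time_integral_measurable[OF pm[OF Hm[OF i0]]]) measurable
 then have 2: "(%r. lint (%x. V x * H 0 r x * ph x)) \<in> bm" by (simp add: mult_ac)
 have 3: "(%r. lint (%x. P r x * ph x)) \<in> bm"
  by (rule time_integral_measurable[OF pm[OF Pm]]) measurable
 have 4: "(%r. lint (%x. F r x * ph x)) \<in> bm"
  by (rule time_integral_measurable[OF pm[OF Fm]]) measurable
 show ?thesis by (intro borel_measurable_add borel_measurable_diff borel_measurable_sum 1 2 3 4)
qed

text \<open>Products th(t) ph(x) separate the variables: integrating over x at fixed time leaves the
  scalar equation i al' = ga in the sense of distributions in t, with one integration by parts in x
  supplied by the weak gradient.\<close>

lemma evolution_equation: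
 fixes \<Omega> :: "'a::euclidean_space set" and H :: "'a => real => 'a => complex"
 assumes V: "V \<in> bm"
  and Hm: "!!i. i \<in> idx ==> (%(s, x). H i s x) \<in> bm"
  and Nm: "(%(s, x). N s x) \<in> bm"
  and Fm: "(%(s, x). F s x) \<in> bm"
  and A: "AE t in lborel. 0 < t --> t \<in> A" "A \<subseteq> {0<..}"
  and sH: "!!t i. t \<in> A ==> i \<in> idx ==> sqi (H i t)"
  and sF: "!!t. t \<in> A ==> sqi (F t)"
  and wg: "!!t b ph. t \<in> A ==> b \<in> Basis ==> test_fun \<Omega> ph ==> (lint (%x. H 0 t x * pd b ph x)) = - (lint (%x. H b t x * ph x))"
  and N: "!!t x. cmod (N t x) <= 1 + cmod (H 0 t x)"
  and uc: "!!T e. 0 < e ==> \<exists>d>0. \<forall>s\<in>A. \<forall>t\<in>A. s <= T --> t <= T --> \<bar>s - t\<bar> <= d --> nrm (%x. H 0 s x - H 0 t x) <= e"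
  and bd: "!!T. \<exists>M. \<forall>t\<in>A. t <= T --> nrm (H 0 t) <= M"
  and D: "!!PH. test_fun ({0<..} \<times> \<Omega>) PH ==>
   intl (%(t, x). - \<i> * H 0 t x * dt PH (t, x) + H 0 t x * lapx PH (t, x)
    + cor (V x) * H 0 t x * PH (t, x) + a * N t x * PH (t, x) - F t x * PH (t, x)) &
   (lint (%p. (%(t, x). - \<i> * H 0 t x * dt PH (t, x) + H 0 t x * lapx PH (t, x)
    + cor (V x) * H 0 t x * PH (t, x) + a * N t x * PH (t, x) - F t x * PH (t, x)) p)) = 0"
  and s: "s \<in> A" "t \<in> A" "s < t" and ph: "test_fun \<Omega> ph"
 shows "\<i> * (lint (%x. (H 0 t x - H 0 s x) * ph x)) =
   (lint (%r. indicator {s<..t} r *\<^sub>R ((\<Sum>b\<in>Basis. lint (%x. H b r x * pd b ph x))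
    - (lint (%x. V x * H 0 r x * ph x)) - (lint (%x. a * N r x * ph x)) + (lint (%x. F r x * ph x)))))"
proof -
 have [measurable]: "V \<in> bm" by (rule V)
 have i0: "0 \<in> (idx :: 'a set)" and ib: "!!b :: 'a. b \<in> Basis ==> b \<in> idx" by (auto simp: idx_def)
 have sp: "sqi ph" and spb: "!!b. b \<in> Basis ==> sqi (pd b ph)" and spbb: "!!b. b \<in> Basis ==> sqi (pd b (pd b ph))"
  using ph by (auto intro: test_fun_sqi test_fun_pd)
 have [measurable]: "ph \<in> bm" using sp by (rule sqi_measurable)
 have pm: "(%(r, x). f r x * g x) \<in> bm"
  if "(%(r, x). f r x) \<in> bm" "g \<in> bm" for f :: "real => 'a => complex" and g
 proof -
  have "(%p. (%(r, x). f r x) p * g (snd p)) \<in> bm"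
   by (rule borel_measurable_times[OF that(1)]) (use that(2) in \<open>simp add: borel_prod[symmetric]\<close>)
  then show ?thesis by (simp add: case_prod_beta')
 qed
 define al where "al r = (lint (%x. H 0 r x * ph x))" for r
 define ga where "ga r = (\<Sum>b\<in>Basis. lint (%x. H b r x * pd b ph x))
    - (lint (%x. V x * H 0 r x * ph x)) - (lint (%x. a * N r x * ph x)) + (lint (%x. F r x * ph x))" for r
 have mal [measurable]: "al \<in> bm"
  unfolding al_def[abs_def] by (rule time_integral_measurable[OF pm[OF Hm[OF i0]]]) measurable
 have mga [measurable]: "ga \<in> bm"
 proof -
  have "(%(r, x). a * N r x) \<in> bm"
   using borel_measurable_times[OF borel_measurable_const Nm, of a] by (simp add: case_prod_beta')
  from rhs_measurable[OF V Hm this Fm ph] show ?thesis by (simp only: ga_def[abs_def])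
 qed
 have idiff: "al r - al r' = (lint (%x. (H 0 r x - H 0 r' x) * ph x))" if "r \<in> A" "r' \<in> A" for r r'
  unfolding al_def left_diff_distrib using cauchy_schwarz(1)[OF sH sp] that i0
  by (simp add: BI_integral_diff)
 have "\<i> * (al t - al s) = (lint (%r. indicator {s<..t} r *\<^sub>R ga r))"
 proof (rule distributional_ftc[OF mal mga A(1) _ _ _ s(1,2) _ s(3)])
  show "0 < s" using s A(2) by auto
  show "\<exists>d>0. \<forall>r\<in>A. \<forall>r'\<in>A. r <= T --> r' <= T --> \<bar>r - r'\<bar> <= d --> cmod (al r - al r') <= e" if e: "0 < e" for T e
  proof -
   have p: "0 < nrm ph + 1" by (simp add: add_nonneg_pos)
   obtain d where d: "0 < d" "\<forall>s\<in>A. \<forall>t\<in>A. s <= T --> t <= T --> \<bar>s - t\<bar> <= d --> nrm (%x. H 0 s x - H 0 t x) <= e / (nrm ph + 1)"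
    using uc[of "e / (nrm ph + 1)" T] e p by auto
   have "cmod (al r - al r') <= e" if r: "r \<in> A" "r' \<in> A" "r <= T" "r' <= T" "\<bar>r - r'\<bar> <= d" for r r'
   proof -
    have "cmod (al r - al r') <= nrm (%x. H 0 r x - H 0 r' x) * nrm ph"
     unfolding idiff[OF r(1,2)] by (rule cauchy_schwarz(3)[OF sqi_diff(1)[OF sH[OF r(1) i0] sH[OF r(2) i0]] sp])
    also have "... <= e / (nrm ph + 1) * (nrm ph + 1)"
     by (rule mult_mono) (use d r e p in auto)
    also have "... = e" using p by simp
    finally show ?thesis .
   qed
   with d(1) show ?thesis by blast
  qed
  show "\<exists>C. \<forall>r\<in>A. r <= T --> cmod (al r) <= C" for T
  proof -
   obtain M where M: "\<forall>t\<in>A. t <= T --> nrm (H 0 t) <= M" using bd by blast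
   have "cmod (al r) <= M * nrm ph" if "r \<in> A" "r <= T" for r
    using cauchy_schwarz(3)[OF sH[OF that(1) i0] sp] mult_right_mono[of "nrm (H 0 r)" M "nrm ph"] M that
    unfolding al_def by force
   then show ?thesis by blast
  qed
  fix th :: "real => complex" assume th: "test_fun {0<..} th"
  define PH where "PH p = th (fst p) * ph (snd p)" for p :: "real \<times> 'a"
  have PH: "test_fun ({0<..} \<times> \<Omega>) PH" unfolding PH_def[abs_def] by (rule test_fun_tensor[OF th ph])
  have dt: "dt PH (r, x) = pd 1 th r * ph x" for r x
   unfolding dt_def PH_def[abs_def] by (subst pd_tensor_fst[OF test_fun_smooth[OF th]]) simp
  have lx: "lapx PH (r, x) = th r * lap ph x" for r x
  proof -
   have 1: "pd (0, b) PH = (%p. th (fst p) * pd b ph (snd p))" if "b \<in> Basis" for b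
    unfolding PH_def[abs_def] by (rule ext, rule pd_tensor_snd) (use that test_fun_smooth[OF ph] in auto)
   have 2: "pd (0, b) (pd (0, b) PH) (r, x) = th r * pd b (pd b ph) x" if "b \<in> Basis" for b
    unfolding 1[OF that]
    by (subst pd_tensor_snd) (use that test_fun_smooth[OF test_fun_pd[OF ph that]] in auto)
   show ?thesis unfolding lapx_def lap_def sum_distrib_left by (rule sum.cong) (auto simp: 2)
  qed
  define E where "E = (%(t, x). - \<i> * H 0 t x * dt PH (t, x) + H 0 t x * lapx PH (t, x)
    + cor (V x) * H 0 t x * PH (t, x) + a * N t x * PH (t, x) - F t x * PH (t, x))"
  have E: "integrable (lborel \<Otimes>\<^sub>M lborel) E" "(\<integral>p. E p \<partial>(lborel \<Otimes>\<^sub>M lborel)) = 0"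
   using D[OF PH] unfolding E_def lborel_prod by auto
  have Ee: "E (r, x) = - \<i> * pd 1 th r * (H 0 r x * ph x) + th r * (H 0 r x * lap ph x)
    + th r * (V x * H 0 r x * ph x) + th r * (a * N r x * ph x) - th r * (F r x * ph x)" for r x
   unfolding E_def by (simp add: dt lx) (simp add: PH_def algebra_simps)
  have "AE r in lborel. - (lint (%x. E (r, x))) = \<i> * al r * pd 1 th r + ga r * th r"
   using lborel_pair.AE_integrable_fst'[OF E(1)] A(1)
  proof eventually_elim
   case (elim r)
   show ?case
   proof (cases "0 < r")
    case False
    then have "th r = 0" "pd 1 th r = 0"
     using test_fun_outside[OF th] test_fun_outside[OF test_fun_pd[OF th, of 1]] by auto
    then show ?thesis by (simp add: Ee)
   next
    case True
    then have r: "r \<in> A" using elim by simp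
    have s0: "sqi (H 0 r)" by (rule sH[OF r i0])
    have [measurable]: "(%x. N r x) \<in> bm" by (rule section_measurable(1)[OF Nm])
    have i1: "intl (%x. H 0 r x * ph x)" by (rule cauchy_schwarz(1)[OF s0 sp])
    have i2b: "intl (%x. H 0 r x * pd b (pd b ph) x)" if "b \<in> Basis" for b
     by (rule cauchy_schwarz(1)[OF s0 spbb[OF that]])
    have lapeq: "H 0 r x * lap ph x = (\<Sum>b\<in>Basis. H 0 r x * pd b (pd b ph) x)" for x
     by (simp add: lap_def sum_distrib_left)
    have i2: "intl (%x. H 0 r x * lap ph x)" unfolding lapeq using i2b by auto
    have v2: "(lint (%x. H 0 r x * lap ph x)) = - (\<Sum>b\<in>Basis. lint (%x. H b r x * pd b ph x))"
     unfolding lapeq using i2b wg[OF r _ test_fun_pd[OF ph]]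
     by (subst BI_integral_sum) (auto simp: sum_negf)
    have sN: "intl ph"
    proof -
     have [measurable]: "tsupport ph \<in> sets borel" by (rule borel_closed[OF closed_tsupport])
     have "bounded (tsupport ph)" using ph by (auto simp: test_fun_def compact_imp_bounded)
     then have si: "sqi (%x. indicator (tsupport ph) x)"
      by (rule sqi_bounded_support[rotated, where C = 1]) (measurable, auto simp: indicator_def)
     have "intl (%x. ph x * indicator (tsupport ph) x)" by (rule cauchy_schwarz(1)[OF sp si])
     moreover have "(%x. ph x * indicator (tsupport ph) x) = ph"
     proof
      show "ph x * indicator (tsupport ph) x = ph x" for x by (cases "x \<in> tsupport ph") (auto simp: tsupport_0)
     qed
     ultimately show ?thesis by simp
    qed
    have i3: "intl (%x. a * N r x * ph x)"
    proof (rule BI_integrable_bound)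
     show "intl (%x. cmod a * (cmod (ph x) + cmod (H 0 r x * ph x)))"
      using sN i1 by (intro integrable_mult_right BI_integrable_add integrable_norm)
     show "(%x. a * N r x * ph x) \<in> borel_measurable lborel" by measurable
     show "AE x in lborel. cmod (a * N r x * ph x) <= norm (cmod a * (cmod (ph x) + cmod (H 0 r x * ph x)))"
     proof (rule AE_I2)
      fix x
      have "cmod (N r x) * cmod (ph x) <= (1 + cmod (H 0 r x)) * cmod (ph x)" by (intro mult_right_mono N) simp
      then have "cmod a * (cmod (N r x) * cmod (ph x)) <= cmod a * ((1 + cmod (H 0 r x)) * cmod (ph x))"
       by (intro mult_left_mono) auto
      then show "cmod (a * N r x * ph x) <= norm (cmod a * (cmod (ph x) + cmod (H 0 r x * ph x)))"
       by (simp add: norm_mult algebra_simps)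
     qed
    qed
    have i4: "intl (%x. F r x * ph x)" by (rule cauchy_schwarz(1)[OF sF[OF r] sp])
    show ?thesis
    proof (cases "th r = 0")
     case True
     then have "(lint (%x. E (r, x))) = (lint (%x. (- \<i> * pd 1 th r) * (H 0 r x * ph x)))"
      unfolding Ee by simp
     then show ?thesis unfolding integral_mult_right_zero al_def using True by simp
    next
     case False
     \<comment> \<open>Integrability of the potential term is not given on its own. It is recovered
       from that of the whole expression by subtracting the other terms and dividing by th r; hence
       the separate case th r = 0, in which the potential term is absent.\<close>
     have "intl (%x. inverse (th r) * (E (r, x) + \<i> * pd 1 th r * (H 0 r x * ph x) - th r * (H 0 r x * lap ph x)
      - th r * (a * N r x * ph x) + th r * (F r x * ph x)))"
      by (intro integrable_mult_right BI_integrable_add BI_integrable_diff elim(1) i1 i2 i3 i4)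
     also have "(%x. inverse (th r) * (E (r, x) + \<i> * pd 1 th r * (H 0 r x * ph x) - th r * (H 0 r x * lap ph x)
      - th r * (a * N r x * ph x) + th r * (F r x * ph x))) = (%x. V x * H 0 r x * ph x)"
      using False by (auto simp: Ee)
     finally have i5: "intl (%x. V x * H 0 r x * ph x)" .
     have "(lint (%x. E (r, x))) = - \<i> * pd 1 th r * al r + th r * (lint (%x. H 0 r x * lap ph x))
      + th r * (lint (%x. V x * H 0 r x * ph x)) + th r * (lint (%x. a * N r x * ph x)) - th r * (lint (%x. F r x * ph x))"
     proof -
      note j = integrable_mult_right[OF i1, of "- \<i> * pd 1 th r"] integrable_mult_right[OF i2, of "th r"]
       integrable_mult_right[OF i5, of "th r"] integrable_mult_right[OF i3, of "th r"] integrable_mult_right[OF i4, of "th r"]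
      note k1 = BI_integrable_add[OF j(1) j(2)]
      note k2 = BI_integrable_add[OF k1 j(3)]
      note k3 = BI_integrable_add[OF k2 j(4)]
      show ?thesis unfolding Ee al_def
       unfolding BI_integral_diff[OF k3 j(5)] BI_integral_add[OF k2 j(4)]
        BI_integral_add[OF k1 j(3)] BI_integral_add[OF j(1) j(2)]
       by (simp only: integral_mult_right_zero)
     qed
     then show ?thesis unfolding v2 ga_def by (simp add: algebra_simps)
    qed
   qed
  qed
  then have ae: "AE r in lborel. - (lint (%x. E (r, x))) = \<i> * al r * pd 1 th r + ga r * th r" .
  have i: "intl (%r. - (lint (%x. E (r, x))))"
   by (rule BI_integrable_minus[OF lborel_pair.integrable_fst'[OF E(1)]])
  have [measurable]: "th \<in> bm" "pd 1 th \<in> bm"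
   using test_fun_sqi[OF th] test_fun_sqi[OF test_fun_pd[OF th, of 1]] by (auto dest: sqi_measurable)
  have mm: "(%r. \<i> * al r * pd 1 th r + ga r * th r) \<in> borel_measurable lborel" by measurable
  have "(lint (%r. - (lint (%x. E (r, x))))) = 0"
   using lborel_pair.integral_fst'[OF E(1)] E(2) by simp
  then show "intl (%r. \<i> * al r * pd 1 th r + ga r * th r) & (lint (%r. \<i> * al r * pd 1 th r + ga r * th r)) = 0"
   using integrable_cong_AE[OF borel_measurable_integrable[OF i] mm ae] i
    integral_cong_AE[OF borel_measurable_integrable[OF i] mm ae] by simp
 qed
 then show ?thesis unfolding idiff[OF s(2,1)] unfolding ga_def .
qed

section \<open>H^2 solutions as instances of the abstract evolution\<close>

lemma set_integrable_intro:
 fixes g :: "real => real"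
 assumes [measurable]: "g \<in> bm" and g: "!!t. 0 <= g t"
  and f: "!!T. 0 < T ==> (\<integral>\<^sup>+t. ennreal (g t) \<partial>lebesgue_on {0<..<T}) < \<infinity>"
 shows "set_integrable lborel {0..T} g"
proof -
 have "(nint (%t. ennreal (norm (indicator {0..T} t *\<^sub>R g t)))) <= (nint (%t. ennreal (g t) * indicator {0<..<\<bar>T\<bar> + 1} t))"
 proof (rule nn_integral_mono_AE)
  show "AE t in lborel. ennreal (norm (indicator {0..T} t *\<^sub>R g t)) <= ennreal (g t) * indicator {0<..<\<bar>T\<bar> + 1} t"
   using AE_lborel_singleton[of 0] by eventually_elim (use g in \<open>auto simp: indicator_def\<close>)
 qed
 also have "... = (\<integral>\<^sup>+t. ennreal (g t) \<partial>lebesgue_on {0<..<\<bar>T\<bar> + 1})"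
  by (subst nn_integral_restrict_space) (auto simp: nn_integral_completion)
 also have "... < \<infinity>" by (rule f) simp
 finally show ?thesis unfolding set_integrable_def by (intro integrableI_bounded) auto
qed

lemma rep_fst_snd: "jrep \<Omega> u u' \<longleftrightarrow> rep ({0<..} \<times> \<Omega>) (%p. u (fst p) (snd p)) (%p. u' (fst p) (snd p))"
 by (simp add: jrep_def case_prod_beta')

text \<open>The data are replaced by Borel representatives, jointly in time and space, and the
  exceptional times are left out of \<open>A\<close>. The nonlinearity is rebuilt from the
  representatives so that \<open>NL\<close> holds at every point and the monotonicity inequality can
  be used pointwise.\<close>

lemma H2sol_evo:
 fixes \<Omega> :: "'a::euclidean_space set"
 assumes \<Omega>: "open \<Omega>" and m0: "0 <= m" "m <= 1"
  and V'm: "V' \<in> bm" and mo: "morrey (%x. ennreal \<bar>V' x\<bar>) \<kappa>"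
  and rV: "rep \<Omega> (%x. cor (V x)) (%x. cor (V' x))"
  and sol: "H2sol \<Omega> m V a f u" and f: "L1loc_L2 \<Omega> f" and uC: "C_L2 \<Omega> u"
 obtains A H N F where "evo \<Omega> V' \<kappa> A H (%t x. a * N t x) F" "!!t x. NL m (H 0 t x) (N t x)"
  "(%(t, x). N t x) \<in> bm"
  "!!t. t \<in> A ==> rep \<Omega> (u t) (H 0 t)" "!!t. t \<in> A ==> rep \<Omega> (f t) (F t)"
proof -
 have S: "\<Omega> \<in> sets borel" using \<Omega> by simp
 have SS: "{0 :: real<..} \<times> \<Omega> \<in> sets borel" using S by (intro borel_Times) auto
 obtain G U where ju: "jmeas \<Omega> u" and jG: "\<forall>b\<in>Basis. jmeas \<Omega> (%t x. G t x b)"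
  and aeG: "AE t in lebesgue_on {0<..}. H10 \<Omega> (u t) & weak_grad \<Omega> (u t) (G t) &
    (\<forall>b\<in>Basis. memLp 2 \<Omega> (%x. G t x b)) & memLp (m + 1) \<Omega> (u t)"
  and tG: "\<forall>T>0. in_time_Lq (ereal (m + 1)) T
    (%t. Lpn 2 \<Omega> (u t) + (\<Sum>b\<in>Basis. Lpn 2 \<Omega> (%x. G t x b)) + Lpn (m + 1) \<Omega> (u t))"
  and U: "m = 0 --> jmeas \<Omega> U & (\<forall>t>0. \<forall>x\<in>\<Omega>. cmod (U t x) <= 1 &
         (u t x ~= 0 --> U t x = u t x / cor (cmod (u t x))))"
  and D: "\<forall>PH. test_fun ({0<..} \<times> \<Omega>) PH -->
    (let N = (%t x. if m = 0 then U t x else gm m (u t x));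
      E = (%(t, x). - \<i> * u t x * dt PH (t, x) + u t x * lapx PH (t, x)
          + cor (V x) * u t x * PH (t, x) + a * N t x * PH (t, x)
          - f t x * PH (t, x))
    in integrable (lebesgue_on ({0<..} \<times> \<Omega>)) E & integral\<^sup>L (lebesgue_on ({0<..} \<times> \<Omega>)) E = 0)"
  using sol unfolding H2sol_def by (elim exE conjE) (rule that)
 obtain u' where u': "jrep \<Omega> u u'" by (rule ex_jrep[OF S ju])
 have "\<forall>b\<in>Basis. \<exists>g. jrep \<Omega> (%t x. G t x b) g"
 proof
  fix b :: 'a assume "b \<in> Basis"
  then have "jmeas \<Omega> (%t x. G t x b)" using jG by simp
  then obtain g where "jrep \<Omega> (%t x. G t x b) g" by (rule ex_jrep[OF S])
  then show "\<exists>g. jrep \<Omega> (%t x. G t x b) g" by (rule exI[where x = g])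
 qed
 from bchoice[OF this] obtain G' where "\<forall>b\<in>Basis. jrep \<Omega> (%t x. G t x b) (G' b)" ..
 then have G': "!!b. b \<in> Basis ==> jrep \<Omega> (%t x. G t x b) (G' b)" by simp
 have jf: "jmeas \<Omega> f" using f by (simp add: L1loc_L2_def)
 obtain f' where f': "jrep \<Omega> f f'" by (rule ex_jrep[OF S jf])
 have "\<exists>U'. (%(t, x). U' t x) \<in> bm & (m = 0 --> jrep \<Omega> U U')"
 proof (cases "m = 0")
  case True
  then have "jmeas \<Omega> U" using U by simp
  then obtain g where g: "jrep \<Omega> U g" by (rule ex_jrep[OF S])
  show ?thesis by (rule exI[of _ g]) (use g jrep_measurable[OF g] in simp)
 next
  case False
  then show ?thesis by (intro exI[of _ "%t x. 0"]) auto
 qed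
 then obtain U' where U'm: "(%(t, x). U' t x) \<in> bm" and U': "m = 0 ==> jrep \<Omega> U U'" by blast
 \<comment> \<open>For m = 0 the representative of U obeys the bound by 1 only almost everywhere, so
   at zeros of u' it is replaced by 0 wherever its modulus exceeds 1; \<open>NL\<close> then holds
   at every point.\<close>
 define N where "N t x = (if m = 0 then (if u' t x = 0 then (if cmod (U' t x) <= 1 then U' t x else 0)
  else u' t x / cor (cmod (u' t x))) else gm m (u' t x))" for t x
 have um: "(%p. u' (fst p) (snd p)) \<in> bm" and Um: "(%p. U' (fst p) (snd p)) \<in> bm"
  using jrep_measurable[OF u'] U'm by (simp_all add: case_prod_beta')
 have Nm: "(%p. N (fst p) (snd p)) \<in> bm"
 proof -
  define v where "v p = u' (fst p) (snd p)" for p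
  define w where "w p = U' (fst p) (snd p)" for p
  have [measurable]: "v \<in> bm" "w \<in> bm"
   using um Um unfolding v_def[abs_def] w_def[abs_def] by auto
  have "(%p. if m = 0 then (if v p = 0 then (if cmod (w p) <= 1 then w p else 0)
  else v p / cor (cmod (v p))) else (if v p = 0 then 0 else cor (cmod (v p) powr (m - 1)) * v p)) \<in> bm"
   by measurable
  then show ?thesis unfolding N_def gm_def v_def w_def .
 qed
 have NL: "NL m (u' t x) (N t x)" for t x
  by (auto simp: NL_def N_def norm_divide)
 have rN: "jrep \<Omega> (%t x. if m = 0 then U t x else gm m (u t x)) N"
  unfolding rep_fst_snd rep_def
 proof (intro conjI allI impI Nm)
  fix p :: "real \<times> 'a" assume p: "p \<notin> {0<..} \<times> \<Omega>"
  then have z: "u' (fst p) (snd p) = 0" by (intro jrep_0[OF u']) (auto simp: mem_Times_iff)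
  show "N (fst p) (snd p) = 0"
  proof (cases "m = 0")
   case True
   have "U' (fst p) (snd p) = 0" using p by (intro jrep_0[OF U'[OF True]]) (auto simp: mem_Times_iff)
   then show ?thesis using z True by (simp add: N_def)
  qed (use z in \<open>simp add: N_def gm_def\<close>)
 next
  have au: "AE p in lborel. p \<in> {0<..} \<times> \<Omega> --> u' (fst p) (snd p) = u (fst p) (snd p)"
   using u' by (simp add: rep_fst_snd rep_def)
  show "AE p in lborel. p \<in> {0<..} \<times> \<Omega> --> N (fst p) (snd p) = (if m = 0 then U (fst p) (snd p) else gm m (u (fst p) (snd p)))"
  proof (cases "m = 0")
   case True
   have "AE p in lborel. p \<in> {0<..} \<times> \<Omega> --> U' (fst p) (snd p) = U (fst p) (snd p)"
    using U'[OF True] by (simp add: rep_fst_snd rep_def)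
   with au show ?thesis
   proof eventually_elim
    case (elim p)
    then show ?case using True U by (auto simp: N_def mem_Times_iff)
   qed
  next
   case False
   from au show ?thesis by (rule eventually_mono) (use False in \<open>auto simp: N_def\<close>)
  qed
 qed
 define H where "H i t = (if i = 0 then u' t else G' i t)" for i t
 have H0: "H 0 = u'" and Hb: "!!b. b \<in> Basis ==> H b = G' b" by (auto simp: H_def fun_eq_iff dest: nonzero_Basis)
 define A where "A = {t. 0 < t & rep \<Omega> (u t) (u' t) & (\<forall>b\<in>Basis. rep \<Omega> (%x. G t x b) (G' b t)) & rep \<Omega> (f t) (f' t) &
  H10 \<Omega> (u t) & weak_grad \<Omega> (u t) (G t) & (\<forall>b\<in>Basis. memLp 2 \<Omega> (%x. G t x b)) & memLp 2 \<Omega> (f t)}"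
 have A_AE: "AE t in lborel. 0 < t --> t \<in> A"
 proof -
  have "AE t in lebesgue_on {0<..}. memLp 2 \<Omega> (f t)" using f by (simp add: L1loc_L2_def)
  then have 1: "AE t in lborel. t \<in> {0<..} --> memLp 2 \<Omega> (f t)" by (subst (asm) AE_lebesgue_on) auto
  have 2: "AE t in lborel. t \<in> {0<..} --> H10 \<Omega> (u t) & weak_grad \<Omega> (u t) (G t) &
    (\<forall>b\<in>Basis. memLp 2 \<Omega> (%x. G t x b)) & memLp (m + 1) \<Omega> (u t)"
   using aeG by (subst (asm) AE_lebesgue_on) auto
  have 3: "AE t in lborel. \<forall>b\<in>Basis. 0 < t --> rep \<Omega> (%x. G t x b) (G' b t)"
   by (rule AE_finite_allI) (auto intro: jrep_AE[OF G'])
  from 1 2 3 jrep_AE[OF u'] jrep_AE[OF f'] show ?thesis by eventually_elim (auto simp: A_def)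
 qed
 have uA: "rep \<Omega> (u t) (H 0 t)" "0 < t" "memLp 2 \<Omega> (u t)" if "t \<in> A" for t
  using that uC by (auto simp: A_def H0 C_L2_def)
 have fA: "rep \<Omega> (f t) (f' t)" "memLp 2 \<Omega> (f t)" if "t \<in> A" for t
  using that by (auto simp: A_def)
 have H1: "H1 \<Omega> (%i. H i t)" if t: "t \<in> A" for t
  unfolding H_def by (rule H10_H1[OF \<Omega>]) (use t in \<open>auto simp: A_def\<close>)
 have sH: "sqi (H i t)" if "t \<in> A" "i \<in> idx" for i t using H1_sqi[OF H1[OF that(1)] that(2)] .
 have nd: "nrm (%x. H 0 s x - H 0 t x) = Lpn 2 \<Omega> (%x. u s x - u t x)" if "s \<in> A" "t \<in> A" for s t
  by (rule rep_Lpn[OF S rep_diff[OF uA(1)[OF that(1)] uA(1)[OF that(2)]], symmetric])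
 have uc: "\<exists>d>0. \<forall>s\<in>A. \<forall>t\<in>A. s <= T --> t <= T --> \<bar>s - t\<bar> <= d --> nrm (%x. H 0 s x - H 0 t x) <= e" if "0 < e" for T e
 proof -
  obtain d where d: "d > 0" "\<forall>s t. 0 <= s --> s <= T --> 0 <= t --> t <= T --> \<bar>s - t\<bar> <= d --> Lpn 2 \<Omega> (%x. u s x - u t x) <= e"
   using C_L2_uniform[OF S uC \<open>0 < e\<close>, where T = T] by blast
  show ?thesis
  proof (intro exI[of _ d] conjI d(1) ballI impI)
   fix s t assume "s \<in> A" "t \<in> A" "s <= T" "t <= T" "\<bar>s - t\<bar> <= d"
   then show "nrm (%x. H 0 s x - H 0 t x) <= e" using d(2) uA(2)[of s] uA(2)[of t] nd[of s t] by auto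
  qed
 qed
 have bd: "\<exists>M. 0 <= M & (\<forall>t\<in>A. t <= T --> nrm (H 0 t) <= M)" for T
 proof -
  obtain M where M: "0 <= M" "!!t. 0 <= t ==> t <= T ==> Lpn 2 \<Omega> (u t) <= M"
   using C_L2_bounded[OF S uC, where T = T] by auto
  have "nrm (H 0 t) <= M" if "t \<in> A" "t <= T" for t
   using M(2)[of t] uA[OF that(1)] that rep_Lpn[OF S uA(1)[OF that(1)]] by simp
  with M(1) show ?thesis by blast
 qed
 have Hm: "(%(s, x). H i s x) \<in> bm" if "i \<in> idx" for i
  using that jrep_measurable[OF u'] jrep_measurable[OF G'] by (auto simp: idx_def H0 Hb)
 have Nb: "cmod (N t x) <= 1 + cmod (H 0 t x)" for t x
  unfolding H0 by (rule NL_norm[OF NL m0])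
 have D': "intl (%(t, x). - \<i> * H 0 t x * dt PH (t, x) + H 0 t x * lapx PH (t, x)
    + cor (V' x) * H 0 t x * PH (t, x) + a * N t x * PH (t, x) - f' t x * PH (t, x)) &
   (lint (%p. (%(t, x). - \<i> * H 0 t x * dt PH (t, x) + H 0 t x * lapx PH (t, x)
    + cor (V' x) * H 0 t x * PH (t, x) + a * N t x * PH (t, x) - f' t x * PH (t, x)) p)) = 0"
  if PH: "test_fun ({0<..} \<times> \<Omega>) PH" for PH :: "real \<times> 'a => complex"
 proof -
  let ?E = "%p. - \<i> * u (fst p) (snd p) * dt PH p + u (fst p) (snd p) * lapx PH p
    + cor (V (snd p)) * u (fst p) (snd p) * PH p
    + a * (if m = 0 then U (fst p) (snd p) else gm m (u (fst p) (snd p))) * PH p - f (fst p) (snd p) * PH p"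
  let ?E' = "%p. - \<i> * u' (fst p) (snd p) * dt PH p + u' (fst p) (snd p) * lapx PH p
    + indicator {0<..} (fst p) * cor (V' (snd p)) * u' (fst p) (snd p) * PH p
    + a * N (fst p) (snd p) * PH p - f' (fst p) (snd p) * PH p"
  have e: "integrable (lebesgue_on ({0<..} \<times> \<Omega>)) ?E" "integral\<^sup>L (lebesgue_on ({0<..} \<times> \<Omega>)) ?E = 0"
   using D[rule_format, OF PH] by (simp_all add: Let_def case_prod_beta')
  have b1: "(1 :: real, 0 :: 'a) \<in> Basis" and b2: "!!b :: 'a. b \<in> Basis ==> (0 :: real, b) \<in> Basis" by (auto simp: Basis_prod_def)
  have m1: "dt PH \<in> bm" unfolding dt_def
   by (rule sqi_measurable[OF test_fun_sqi[OF test_fun_pd[OF PH b1]]])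
  have m2: "lapx PH \<in> bm" unfolding lapx_def[abs_def]
   by (intro borel_measurable_sum sqi_measurable[OF test_fun_sqi[OF test_fun_pd[OF test_fun_pd[OF PH b2] b2]]])
  have m3: "PH \<in> bm" by (rule sqi_measurable[OF test_fun_sqi[OF PH]])
  note ru = u'[unfolded rep_fst_snd] and rN' = rN[unfolded rep_fst_snd] and rf = f'[unfolded rep_fst_snd]
   and rV' = jrep_space[OF rV, unfolded rep_fst_snd]
  have r: "rep ({0<..} \<times> \<Omega>) ?E ?E'"
   by (intro rep_add rep_diff rep_mult_borel[OF _ m1] rep_mult_borel[OF _ m2] rep_mult_borel[OF _ m3] rep_cmult ru rN' rf rep_mult rV')
  have ee: "?E' = (%(t, x). - \<i> * H 0 t x * dt PH (t, x) + H 0 t x * lapx PH (t, x)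
    + cor (V' x) * H 0 t x * PH (t, x) + a * N t x * PH (t, x) - f' t x * PH (t, x))"
  proof (rule ext)
   fix p :: "real \<times> 'a"
   obtain t x where p: "p = (t, x)" by (cases p)
   \<comment> \<open>\<open>jrep_space\<close> inserts the indicator of positive times; it is
     harmless because the representative of u vanishes at all other times.\<close>
   have "indicator {0<..} t * cor (V' x) * u' t x = cor (V' x) * u' t x"
    using jrep_0[OF u', of t x] by (cases "0 < t") auto
   then show "?E' p = (%(t, x). - \<i> * H 0 t x * dt PH (t, x) + H 0 t x * lapx PH (t, x)
    + cor (V' x) * H 0 t x * PH (t, x) + a * N t x * PH (t, x) - f' t x * PH (t, x)) p"
    by (simp only: p H0 fst_conv snd_conv prod.case)
  qed
  show ?thesis using rep_integral[OF SS r e(1)] e(2) unfolding ee by simp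
 qed
 have NM: "(%(t, x). N t x) \<in> bm" using Nm by (simp add: case_prod_beta')
 have fm: "(%(t, x). f' t x) \<in> bm" by (rule jrep_measurable[OF f'])
 have aN: "(%(s, x). a * N s x) \<in> bm"
  using borel_measurable_times[OF borel_measurable_const Nm, of a] by (simp add: case_prod_beta')
 have wg: "(lint (%x. H 0 t x * pd b ph x)) = - (lint (%x. H b t x * ph x))"
  if "t \<in> A" "b \<in> Basis" "test_fun \<Omega> ph" for t b ph
  unfolding H0 Hb[OF that(2)] by (rule weak_grad_rep[OF S _ _ _ that(2,3), where g = "u t" and G = "G t"]) (use that in \<open>auto simp: A_def\<close>)
 have Hi: "set_integrable lborel {0..T} (%t. nrm (H i t))" if i: "i \<in> idx" for T i
 proof (rule set_integrable_intro)
  show "(%t. nrm (H i t)) \<in> bm" by (rule nrm_measurable[OF Hm[OF i]])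
  fix T :: real assume T: "0 < T"
  define W where "W t = Lpn 2 \<Omega> (u t) + (\<Sum>b\<in>Basis. Lpn 2 \<Omega> (%x. G t x b)) + Lpn (m + 1) \<Omega> (u t)" for t
  have W: "W \<in> borel_measurable (lebesgue_on {0<..<T})" "(\<integral>\<^sup>+ t. ennreal (W t powr (m + 1)) \<partial>(lebesgue_on {0<..<T})) < \<infinity>"
   using tG[rule_format, OF T] unfolding in_time_Lq_def W_def[abs_def] by auto
  have n: "0 <= Lpn p \<Omega> q" for p q by (simp add: Lpn_def)
  \<comment> \<open>Integrability of the power m + 1 on a bounded interval gives plain integrability
    through W <= 1 + W^(m+1).\<close>
  have le: "nrm (H i t) <= 1 + W t powr (m + 1)" if t: "t \<in> A" for t
  proof -
   have s: "0 <= (\<Sum>b\<in>Basis. Lpn 2 \<Omega> (%x. G t x b))" by (intro sum_nonneg n)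
   have "nrm (H i t) <= W t"
   proof (cases "i = 0")
    case True
    then show ?thesis using rep_Lpn[OF S uA(1)[OF t]] s n by (simp add: W_def)
   next
    case False
    then have b: "i \<in> Basis" using i by (simp add: idx_def)
    have "rep \<Omega> (%x. G t x i) (G' i t)" using t b by (simp add: A_def)
    then have "nrm (H i t) = Lpn 2 \<Omega> (%x. G t x i)" using rep_Lpn[OF S] Hb[OF b] by simp
    also have "... <= (\<Sum>b\<in>Basis. Lpn 2 \<Omega> (%x. G t x b))" by (rule member_le_sum) (use b n in auto)
    also have "... <= W t" using n[of 2 "u t"] n[of "m + 1" "u t"] by (simp add: W_def)
    finally show ?thesis .
   qed
   also have "W t <= 1 + W t powr (m + 1)"
   proof (cases "W t <= 1")
    case False
    then have "W t powr 1 <= W t powr (m + 1)" using m0 by (intro powr_mono) auto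
    then show ?thesis using False by simp
   qed (use powr_ge_zero[of "W t" "m + 1"] in linarith)
   finally show ?thesis .
  qed
  have "(\<integral>\<^sup>+t. ennreal (nrm (H i t)) \<partial>lebesgue_on {0<..<T}) <= (\<integral>\<^sup>+t. 1 + ennreal (W t powr (m + 1)) \<partial>lebesgue_on {0<..<T})"
  proof (rule nn_integral_mono_AE, subst AE_lebesgue_on)
   show "AE t in lborel. t \<in> {0<..<T} --> ennreal (nrm (H i t)) <= 1 + ennreal (W t powr (m + 1))"
    using A_AE
   proof eventually_elim
    case (elim t)
    show ?case
    proof
     assume "t \<in> {0<..<T}"
     then have "ennreal (nrm (H i t)) <= ennreal (1 + W t powr (m + 1))" using elim by (intro ennreal_leI le) auto
     then show "ennreal (nrm (H i t)) <= 1 + ennreal (W t powr (m + 1))" by (simp add: ennreal_plus)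
    qed
   qed
  qed simp
  also have "... = emeasure (lebesgue_on {0<..<T}) (space (lebesgue_on {0<..<T})) + (\<integral>\<^sup>+ t. ennreal (W t powr (m + 1)) \<partial>(lebesgue_on {0<..<T}))"
   using W(1) by (subst nn_integral_add) auto
  also have "... < \<infinity>" using W(2) T by (auto simp: emeasure_restrict_space less_imp_le)
  finally show "(\<integral>\<^sup>+t. ennreal (nrm (H i t)) \<partial>lebesgue_on {0<..<T}) < \<infinity>" .
 qed simp
 have Fi: "set_integrable lborel {0..T} (%t. nrm (f' t))" for T
 proof (rule set_integrable_intro)
  show "(%t. nrm (f' t)) \<in> bm" by (rule nrm_measurable[OF fm])
  fix T :: real assume T: "0 < T"
  have "(\<integral>\<^sup>+t. ennreal (nrm (f' t)) \<partial>lebesgue_on {0<..<T}) = (\<integral>\<^sup>+t. ennreal (Lpn 2 \<Omega> (f t)) \<partial>lebesgue_on {0<..<T})"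
  proof (rule nn_integral_cong_AE, subst AE_lebesgue_on)
   show "AE t in lborel. t \<in> {0<..<T} --> ennreal (nrm (f' t)) = ennreal (Lpn 2 \<Omega> (f t))"
    using A_AE by eventually_elim (auto simp: rep_Lpn[OF S fA(1)])
  qed simp
  then show "(\<integral>\<^sup>+t. ennreal (nrm (f' t)) \<partial>lebesgue_on {0<..<T}) < \<infinity>" using f T by (simp add: L1loc_L2_def)
 qed simp
 \<comment> \<open>The growth bound |N| <= 1 + |u| contains a constant, which is why square
   integrability is asserted on balls.\<close>
 have Pl: "\<exists>C\<ge>0. \<forall>t\<in>A. t <= T --> sqi (%x. indicator (cball 0 R) x * (a * N t x)) & nrm (%x. indicator (cball 0 R) x * (a * N t x)) <= C" for T R
 proof -
  obtain M where M: "0 <= M" "\<forall>t\<in>A. t <= T --> nrm (H 0 t) <= M" using bd by blast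
  define I where "I = (%x :: 'a. indicator (cball 0 R) x :: complex)"
  have sI: "sqi I" unfolding I_def
   by (rule sqi_bounded_support[where C = 1, OF _ bounded_cball[of 0 R]]) (measurable, auto simp: indicator_def)
  have mI [measurable]: "I \<in> bm" by (rule sqi_measurable[OF sI])
  have "sqi (%x. I x * (a * N t x)) & nrm (%x. I x * (a * N t x)) <= cmod a * (nrm I + M)" if t: "t \<in> A" "t <= T" for t
  proof -
   have s0: "sqi (H 0 t)" by (rule sH[OF t(1)]) (simp add: idx_def)
   have [measurable]: "H 0 t \<in> bm" by (rule sqi_measurable[OF s0])
   have [measurable]: "(%x. N t x) \<in> bm" by (rule section_measurable(1)[OF NM])
   have a1: "sqi (%x. cor (cmod (H 0 t x)))" "nrm (%x. cor (cmod (H 0 t x))) <= 1 * nrm (H 0 t)"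
   proof -
    have m1: "(%x. cor (cmod (H 0 t x))) \<in> bm" by measurable
    have m2: "AE x in lborel. cmod (cor (cmod (H 0 t x))) <= 1 * cmod (H 0 t x)" by simp
    show "sqi (%x. cor (cmod (H 0 t x)))" "nrm (%x. cor (cmod (H 0 t x))) <= 1 * nrm (H 0 t)"
     using sqi_dom[OF m1 s0 m2] by auto
   qed
   have a2: "cmod (I x * (a * N t x)) <= cmod a * cmod (I x + cor (cmod (H 0 t x)))" for x
   proof (cases "x \<in> cball 0 R")
    case True
    have "cmod (N t x) <= cmod (1 + cor (cmod (H 0 t x)))"
     using Nb[of t x] norm_of_real[of "1 + cmod (H 0 t x)", where 'a = complex] by simp
    then have "cmod a * cmod (N t x) <= cmod a * cmod (1 + cor (cmod (H 0 t x)))" by (intro mult_left_mono) auto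
    then show ?thesis using True by (simp add: I_def norm_mult)
   qed (simp add: I_def)
   have a3: "sqi (%x. I x * (a * N t x))" "nrm (%x. I x * (a * N t x)) <= cmod a * nrm (%x. I x + cor (cmod (H 0 t x)))"
   proof -
    have m1: "(%x. I x * (a * N t x)) \<in> bm" by measurable
    have m2: "AE x in lborel. cmod (I x * (a * N t x)) <= cmod a * cmod (I x + cor (cmod (H 0 t x)))"
     by (rule AE_I2) (rule a2)
    show "sqi (%x. I x * (a * N t x))" "nrm (%x. I x * (a * N t x)) <= cmod a * nrm (%x. I x + cor (cmod (H 0 t x)))"
     using sqi_dom[OF m1 sqi_add(1)[OF sI a1(1)] m2] by auto
   qed
   have "nrm (%x. I x + cor (cmod (H 0 t x))) <= nrm I + M"
    using sqi_add(2)[OF sI a1(1)] a1(2) M(2) t by force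
   then have "cmod a * nrm (%x. I x + cor (cmod (H 0 t x))) <= cmod a * (nrm I + M)" by (intro mult_left_mono) auto
   then show ?thesis using a3 by (intro conjI) (auto intro: order_trans)
  qed
  moreover have "0 <= cmod a * (nrm I + M)" using M(1) by simp
  ultimately show ?thesis unfolding I_def by blast
 qed
 have A_pos: "A \<subseteq> {0<..}" by (auto simp: A_def)
 have sF: "sqi (f' t)" if "t \<in> A" for t by (rule rep_sqi[OF S fA[OF that]])
 have bd': "\<exists>M. \<forall>t\<in>A. t <= T --> nrm (H 0 t) <= M" for T using bd[of T] by (elim exE conjE) (rule exI)
 have eqn: "\<i> * (lint (%x. (H 0 t x - H 0 s x) * ph x)) =
   (lint (%r. indicator {s<..t} r *\<^sub>R ((\<Sum>b\<in>Basis. lint (%x. H b r x * pd b ph x))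
    - (lint (%x. V' x * H 0 r x * ph x)) - (lint (%x. a * N r x * ph x)) + (lint (%x. f' r x * ph x)))))"
  if "s \<in> A" "t \<in> A" "s < t" "test_fun \<Omega> ph" for s t ph
  by (rule evolution_equation[OF V'm Hm NM fm A_AE A_pos sH sF wg Nb uc bd' D' that])
 show thesis
 proof (rule that[of A H N f'])
  show "evo \<Omega> V' \<kappa> A H (%t x. a * N t x) f'"
   by (rule evo.intro[OF V'm mo A_pos A_AE Hm aN fm H1 sF Hi Fi uc Pl eqn])
  show "NL m (H 0 t x) (N t x)" for t x unfolding H0 by (rule NL)
  show "(%(t, x). N t x) \<in> bm" by (rule NM)
  show "rep \<Omega> (u t) (H 0 t)" if "t \<in> A" for t by (rule uA(1)[OF that])
  show "rep \<Omega> (f t) (f' t)" if "t \<in> A" for t by (rule fA(1)[OF that])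
 qed
qed

section \<open>Differences of time translates\<close>

context evo begin

lemma V_pair_integrable:
 assumes "r \<in> A" "test_fun \<Omega> ph"
 shows "intl (%x. V x * H 0 r x * ph x)"
proof -
 have 1: "sqi (%x. cor (sgn (V x)) * (vw V x * H 0 r x))" by (rule sqi_sgn(1)[OF CV(2)[OF H_H1[OF assms(1)]]])
 have 2: "sqi (%x. vw V x * ph x)" using CV(2)[OF H1_jet[OF assms(2)]] by (simp add: jet_def)
 show ?thesis unfolding V_split by (rule cauchy_schwarz(1)[OF 1 2])
qed

lemma P_pair_integrable:
 assumes "r \<in> A" "test_fun \<Omega> ph"
 shows "intl (%x. P r x * ph x)"
proof -
 have "compact (tsupport ph)" using assms(2) by (simp add: test_fun_def)
 then obtain R where R: "\<forall>x\<in>tsupport ph. norm x <= R" using compact_imp_bounded bounded_iff by metis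
 obtain C where "\<forall>t\<in>A. t <= r --> sqi (%x. indicator (cball 0 R) x * P t x) & nrm (%x. indicator (cball 0 R) x * P t x) <= C"
  using P_loc[of r R] by (elim exE conjE)
 then have s: "sqi (%x. indicator (cball 0 R) x * P r x)" using assms(1) by simp
 have e: "indicator (cball 0 R) x * P r x * ph x = P r x * ph x" for x
  using R tsupport_0[of x ph] by (cases "x \<in> tsupport ph") auto
 show ?thesis using cauchy_schwarz(1)[OF s test_fun_sqi[OF assms(2)]] by (simp only: e)
qed

lemma A_AE_ex:
 fixes p q :: real
 assumes "AE t in lborel. 0 < t --> Q t" "0 <= p" "p < q"
 obtains t where "p < t" "t < q" "Q t"
proof (rule ccontr)
 assume c: "\<not> thesis"
 then have n: "\<not> Q t" if "p < t" "t < q" for t using that that assms by (auto intro: \<open>!!t. p < t ==> t < q ==> Q t ==> thesis\<close>)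
 have "AE t in lborel. t \<notin> {p<..<q}" using assms(1)
 proof eventually_elim
  case (elim t)
  show ?case
  proof
   assume t: "t \<in> {p<..<q}"
   then have "0 < t" using assms(2) by (auto intro: order_le_less_trans)
   then show False using elim n[of t] t by simp
  qed
 qed
 then have "{p<..<q} \<in> null_sets lborel" by (subst AE_iff_null_sets) auto
 then show False using assms(3) by auto
qed

end

lemma set_integrable_shift:
 fixes g :: "real => real"
 assumes [measurable]: "g \<in> bm" and i: "set_integrable lborel {0..T + ta} g" and ta: "0 <= ta"
 shows "set_integrable lborel {0..T} (%t. g (t + ta))"
proof -
 have "intl (%t. indicator {0..T + ta} (ta + 1 * t) *\<^sub>R g (ta + 1 * t))"
  using lborel_integrable_real_affine[OF i[unfolded set_integrable_def], of 1 ta] by simp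
 then show ?thesis unfolding set_integrable_def
  by (rule BI_integrable_bound) (use ta in \<open>auto simp: indicator_def add.commute\<close>)
qed

lemma shift_diff_measurable:
 fixes g :: "real => 'a::euclidean_space => complex"
 assumes "(%(s, x). g s x) \<in> bm"
 shows "(%(s, x). g (s + ta) x - g s x) \<in> bm"
proof -
 have m: "(%p. g (fst p) (snd p)) \<in> bm" using assms by (simp add: case_prod_beta')
 have "(%p :: real \<times> 'a. (fst p + ta, snd p)) \<in> bm"
  by (intro borel_measurable_continuous_onI continuous_intros)
 from measurable_compose[OF this m] have "(%p. g (fst p + ta) (snd p) - g (fst p) (snd p)) \<in> bm"
  using m by (intro borel_measurable_diff) (simp_all add: fst_conv snd_conv)
 then show ?thesis by (simp add: case_prod_beta')
qed

text \<open>The evolution equation is linear in H, P and F jointly, and the potential does not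
  depend on time; so a translate minus the original is an evolution for the same V, on those good
  times whose translates are good as well.\<close>

lemma (in evo) evo_shift:
 assumes ta: "0 <= ta"
 shows "evo \<Omega> V \<kappa> {t \<in> A. t + ta \<in> A} (%i t x. H i (t + ta) x - H i t x) (%t x. P (t + ta) x - P t x) (%t x. F (t + ta) x - F t x)"
proof -
 let ?A = "{t \<in> A. t + ta \<in> A}"
 have AE': "AE t in lborel. 0 < t --> t \<in> ?A"
  using AE_A_shift[of ta] by eventually_elim (use ta in auto)
 have sH: "sqi (H i t)" if "t \<in> A" "i \<in> idx" for i t using H1_sqi[OF H_H1[OF that(1)] that(2)] .
 have int: "set_integrable lborel {0..T} (%t. nrm (%x. g (t + ta) x - g t x))"
  if gm: "(%(s, x). g s x) \<in> bm" and gs: "!!t. t \<in> A ==> sqi (g t)"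
   and gi: "!!T. set_integrable lborel {0..T} (%t. nrm (g t))" for g T
 proof -
  have m: "(%t. nrm (g t)) \<in> bm" by (rule nrm_measurable[OF gm])
  have m': "(%t. nrm (%x. g (t + ta) x - g t x)) \<in> bm"
   by (rule nrm_measurable[OF shift_diff_measurable[OF gm]])
  have i: "intl (%t. indicator {0..T} t *\<^sub>R nrm (g (t + ta)) + indicator {0..T} t *\<^sub>R nrm (g t))"
   using set_integrable_shift[OF m gi ta] gi[of T] unfolding set_integrable_def by (rule BI_integrable_add)
  show ?thesis unfolding set_integrable_def
  proof (rule BI_integrable_bound[OF i])
   show "(%t. indicator {0..T} t *\<^sub>R nrm (%x. g (t + ta) x - g t x)) \<in> borel_measurable lborel"
    using m' by measurable
   show "AE t in lborel. norm (indicator {0..T} t *\<^sub>R nrm (%x. g (t + ta) x - g t x)) <=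
    norm (indicator {0..T} t *\<^sub>R nrm (g (t + ta)) + indicator {0..T} t *\<^sub>R nrm (g t))"
    using AE' AE_lborel_singleton[of 0]
   proof eventually_elim
    case (elim t)
    show ?case
    proof (cases "t \<in> {0..T}")
     case True
     then have "t \<in> A" "t + ta \<in> A" using elim by auto
     then have "nrm (%x. g (t + ta) x - g t x) <= nrm (g (t + ta)) + nrm (g t)" by (intro sqi_diff(2) gs)
     then show ?thesis using True by simp
    qed simp
   qed
  qed
 qed
 have H1': "H1 \<Omega> (%i x. H i (t + ta) x - H i t x)" if "t \<in> ?A" for t
  using that by (intro H1_diff H_H1) auto
 have uc: "\<exists>d>0. \<forall>s\<in>?A. \<forall>t\<in>?A. s <= T --> t <= T --> \<bar>s - t\<bar> <= d -->
  nrm (%x. (H 0 (s + ta) x - H 0 s x) - (H 0 (t + ta) x - H 0 t x)) <= e" if e: "0 < e" for T e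
 proof -
  obtain d where d: "d > 0" "\<forall>s\<in>A. \<forall>t\<in>A. s <= T + ta --> t <= T + ta --> \<bar>s - t\<bar> <= d --> nrm (%x. H 0 s x - H 0 t x) <= e / 2"
   using ucont[of "e / 2" "T + ta"] e by (auto simp del: ball_simps)
  show ?thesis
  proof (intro exI[of _ d] conjI d(1) ballI impI)
   fix s t assume st: "s \<in> ?A" "t \<in> ?A" "s <= T" "t <= T" "\<bar>s - t\<bar> <= d"
   have 1: "nrm (%x. H 0 (s + ta) x - H 0 (t + ta) x) <= e / 2" using d(2) st by simp
   have 2: "nrm (%x. H 0 s x - H 0 t x) <= e / 2" using d(2) st ta by simp
   have eq: "(%x. (H 0 (s + ta) x - H 0 s x) - (H 0 (t + ta) x - H 0 t x)) =
    (%x. (H 0 (s + ta) x - H 0 (t + ta) x) - (H 0 s x - H 0 t x))" by (auto simp: algebra_simps)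
   have "nrm (%x. (H 0 (s + ta) x - H 0 (t + ta) x) - (H 0 s x - H 0 t x)) <=
    nrm (%x. H 0 (s + ta) x - H 0 (t + ta) x) + nrm (%x. H 0 s x - H 0 t x)"
    by (intro sqi_diff(2) sqi_diff(1) sH) (use st zero_idx in auto)
   then show "nrm (%x. (H 0 (s + ta) x - H 0 s x) - (H 0 (t + ta) x - H 0 t x)) <= e"
    unfolding eq using 1 2 by simp
  qed
 qed
 have Pl: "\<exists>C\<ge>0. \<forall>t\<in>?A. t <= T --> sqi (%x. indicator (cball 0 R) x * (P (t + ta) x - P t x)) &
  nrm (%x. indicator (cball 0 R) x * (P (t + ta) x - P t x)) <= C" for T R
 proof -
  obtain C where C: "0 <= C" "\<forall>t\<in>A. t <= T + ta --> sqi (%x. indicator (cball 0 R) x * P t x) & nrm (%x. indicator (cball 0 R) x * P t x) <= C"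
   using P_loc[of "T + ta" R] by (elim exE conjE)
  show ?thesis
  proof (intro exI[of _ "C + C"] conjI ballI impI)
   show "0 <= C + C" using C(1) by simp
   fix t assume t: "t \<in> ?A" "t <= T"
   have 1: "sqi (%x. indicator (cball 0 R) x * P (t + ta) x)" "nrm (%x. indicator (cball 0 R) x * P (t + ta) x) <= C"
    "sqi (%x. indicator (cball 0 R) x * P t x)" "nrm (%x. indicator (cball 0 R) x * P t x) <= C"
    using C(2) t ta by auto
   show "sqi (%x. indicator (cball 0 R) x * (P (t + ta) x - P t x))"
    unfolding right_diff_distrib by (rule sqi_diff(1)[OF 1(1,3)])
   show "nrm (%x. indicator (cball 0 R) x * (P (t + ta) x - P t x)) <= C + C"
    unfolding right_diff_distrib using sqi_diff(2)[OF 1(1,3)] 1(2,4) by linarith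
  qed
 qed
 have eqn': "\<i> * (lint (%x. ((H 0 (t + ta) x - H 0 t x) - (H 0 (s + ta) x - H 0 s x)) * ph x)) =
   (lint (%r. indicator {s<..t} r *\<^sub>R ((\<Sum>b\<in>Basis. lint (%x. (H b (r + ta) x - H b r x) * pd b ph x))
    - (lint (%x. V x * (H 0 (r + ta) x - H 0 r x) * ph x)) - (lint (%x. (P (r + ta) x - P r x) * ph x))
    + (lint (%x. (F (r + ta) x - F r x) * ph x)))))"
  if st: "s \<in> ?A" "t \<in> ?A" "s < t" and ph: "test_fun \<Omega> ph" for s t ph
 proof -
  define ga where "ga r = (\<Sum>b\<in>Basis. lint (%x. H b r x * pd b ph x))
    - (lint (%x. V x * H 0 r x * ph x)) - (lint (%x. P r x * ph x)) + (lint (%x. F r x * ph x))" for r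
  let ?de = "%r. (\<Sum>b\<in>Basis. lint (%x. (H b (r + ta) x - H b r x) * pd b ph x))
    - (lint (%x. V x * (H 0 (r + ta) x - H 0 r x) * ph x)) - (lint (%x. (P (r + ta) x - P r x) * ph x))
    + (lint (%x. (F (r + ta) x - F r x) * ph x))"
  have s0: "0 < s" using st A_pos by auto
  have mga: "ga \<in> bm" unfolding ga_def[abs_def]
   by (rule rhs_measurable[OF V_meas H_meas P_meas F_meas ph])
  have mde: "?de \<in> bm"
   by (rule rhs_measurable[OF V_meas _ shift_diff_measurable[OF P_meas] shift_diff_measurable[OF F_meas] ph])
    (rule shift_diff_measurable[OF H_meas])
  have ig: "intl (%r. indicator {p<..p + h} r *\<^sub>R ga r)" if "0 <= p" "0 < h" for p h
   using window_rhs(1)[OF that ph] integrable_win[OF mga that(2)] by (simp add: ga_def[abs_def])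
  have i1: "intl (%r. indicator {s<..t} r *\<^sub>R ga r)" using ig[of s "t - s"] s0 st by simp
  have i2: "intl (%r. indicator {s + ta<..t + ta} r *\<^sub>R ga r)" using ig[of "s + ta" "t - s"] s0 st ta by (simp add: algebra_simps)
  have ind: "indicator {s + ta<..t + ta} (ta + 1 * r) *\<^sub>R ga (ta + 1 * r) = indicator {s<..t} r *\<^sub>R ga (r + ta)" for r
   by (auto simp: indicator_def add.commute)
  have i3: "intl (%r. indicator {s<..t} r *\<^sub>R ga (r + ta))"
   using lborel_integrable_real_affine[OF i2, of 1 ta] unfolding ind by simp
  have e3: "(lint (%r. indicator {s + ta<..t + ta} r *\<^sub>R ga r)) = (lint (%r. indicator {s<..t} r *\<^sub>R ga (r + ta)))"
   using lborel_integral_real_affine[of 1 "%r. indicator {s + ta<..t + ta} r *\<^sub>R ga r" ta] unfolding ind by simp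
  have q1: "\<i> * (lint (%x. (H 0 t x - H 0 s x) * ph x)) = (lint (%r. indicator {s<..t} r *\<^sub>R ga r))"
   unfolding ga_def by (rule eqn) (use st ph in auto)
  have q2: "\<i> * (lint (%x. (H 0 (t + ta) x - H 0 (s + ta) x) * ph x)) = (lint (%r. indicator {s + ta<..t + ta} r *\<^sub>R ga r))"
   unfolding ga_def by (rule eqn) (use st ph in auto)
  have sp: "sqi ph" by (rule test_fun_sqi[OF ph])
  have j: "intl (%x. (H 0 p x - H 0 q x) * ph x)" if "p \<in> A" "q \<in> A" for p q
   by (rule cauchy_schwarz(1)[OF sqi_diff(1)[OF sH[OF that(1) zero_idx] sH[OF that(2) zero_idx]] sp])
  have "(lint (%x. ((H 0 (t + ta) x - H 0 t x) - (H 0 (s + ta) x - H 0 s x)) * ph x)) =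
   (lint (%x. (H 0 (t + ta) x - H 0 (s + ta) x) * ph x - (H 0 t x - H 0 s x) * ph x))"
   by (rule arg_cong[where f = "integral\<^sup>L lborel"]) (auto simp: algebra_simps)
  also have "... = (lint (%x. (H 0 (t + ta) x - H 0 (s + ta) x) * ph x)) - (lint (%x. (H 0 t x - H 0 s x) * ph x))"
   by (rule BI_integral_diff[OF j j]) (use st in auto)
  finally have l: "\<i> * (lint (%x. ((H 0 (t + ta) x - H 0 t x) - (H 0 (s + ta) x - H 0 s x)) * ph x)) =
   (lint (%r. indicator {s<..t} r *\<^sub>R ga (r + ta))) - (lint (%r. indicator {s<..t} r *\<^sub>R ga r))"
   using q1 q2 e3 by (simp add: right_diff_distrib)
  have pt: "ga (r + ta) - ga r = ?de r" if r: "r \<in> A" "r + ta \<in> A" for r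
  proof -
   have d1: "(lint (%x. (H b (r + ta) x - H b r x) * pd b ph x)) = (lint (%x. H b (r + ta) x * pd b ph x)) - (lint (%x. H b r x * pd b ph x))"
    if b: "b \<in> Basis" for b
    unfolding left_diff_distrib
    by (rule BI_integral_diff; rule cauchy_schwarz(1)[OF sH test_fun_sqi[OF test_fun_pd[OF ph b]]]) (use r b in \<open>auto simp: idx_def\<close>)
   have d2: "(lint (%x. V x * (H 0 (r + ta) x - H 0 r x) * ph x)) = (lint (%x. V x * H 0 (r + ta) x * ph x)) - (lint (%x. V x * H 0 r x * ph x))"
    unfolding left_diff_distrib right_diff_distrib
    by (rule BI_integral_diff[OF V_pair_integrable[OF r(2) ph] V_pair_integrable[OF r(1) ph]])
   have d3: "(lint (%x. (P (r + ta) x - P r x) * ph x)) = (lint (%x. P (r + ta) x * ph x)) - (lint (%x. P r x * ph x))"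
    unfolding left_diff_distrib
    by (rule BI_integral_diff[OF P_pair_integrable[OF r(2) ph] P_pair_integrable[OF r(1) ph]])
   have d4: "(lint (%x. (F (r + ta) x - F r x) * ph x)) = (lint (%x. F (r + ta) x * ph x)) - (lint (%x. F r x * ph x))"
    unfolding left_diff_distrib
    by (rule BI_integral_diff[OF cauchy_schwarz(1)[OF F_sqi[OF r(2)] sp] cauchy_schwarz(1)[OF F_sqi[OF r(1)] sp]])
   show ?thesis unfolding ga_def d2 d3 d4 by (simp add: d1 sum_subtractf)
  qed
  have i4: "intl (%r. indicator {s<..t} r *\<^sub>R ga (r + ta) - indicator {s<..t} r *\<^sub>R ga r)"
   by (rule BI_integrable_diff[OF i3 i1])
  have "(lint (%r. indicator {s<..t} r *\<^sub>R ga (r + ta) - indicator {s<..t} r *\<^sub>R ga r)) = (lint (%r. indicator {s<..t} r *\<^sub>R ?de r))"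
  proof (rule integral_cong_AE[OF borel_measurable_integrable[OF i4]])
   show "(%r. indicator {s<..t} r *\<^sub>R ?de r) \<in> borel_measurable lborel"
    using mde by (intro borel_measurable_scaleR borel_measurable_indicator) auto
   show "AE r in lborel. indicator {s<..t} r *\<^sub>R ga (r + ta) - indicator {s<..t} r *\<^sub>R ga r = indicator {s<..t} r *\<^sub>R ?de r"
    using AE'
   proof eventually_elim
    case (elim r)
    show ?case
    proof (cases "r \<in> {s<..t}")
     case True
     then show ?thesis using pt[of r] elim s0 by (simp del: right_diff_distrib')
    qed simp
   qed
  qed
  then show ?thesis unfolding l by (simp only: BI_integral_diff[OF i3 i1])
 qed
 have Ap: "?A \<subseteq> {0<..}" using A_pos by auto
 have sF: "sqi (%x. F (t + ta) x - F t x)" if "t \<in> ?A" for t using that by (intro sqi_diff(1) F_sqi) auto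
 have iH: "set_integrable lborel {0..T} (%t. nrm (%x. H i (t + ta) x - H i t x))" if "i \<in> idx" for T i
  by (rule int[OF H_meas[OF that] sH[OF _ that] H_int[OF that]])
 have iF: "set_integrable lborel {0..T} (%t. nrm (%x. F (t + ta) x - F t x))" for T
  by (rule int[OF F_meas F_sqi F_int])
 show ?thesis
  by (rule evo.intro[OF V_meas V_morrey Ap AE' shift_diff_measurable[OF H_meas] shift_diff_measurable[OF P_meas]
    shift_diff_measurable[OF F_meas] H1' sF iH iF uc Pl eqn'])
qed

section \<open>Smallness on some time window\<close>

text \<open>With S the supremum of the norms, the energy inequality gives S^2 <= b^2 + 2 S j, and
  hence S <= b + 2 j. The crude bound \<open>M0\<close> guarantees that S is finite and does not
  enter the result.\<close>

lemma (in evo) energy_global: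
 assumes pos: "!!r x. 0 <= Im (P r x * cnj (H 0 r x))" and s: "s \<in> A" "s < T'"
  and b: "!!r. r \<in> A ==> r <= s ==> nrm (H 0 r) <= b" and j: "(lint (%r. indicator {s<..T'} r * nrm (F r))) <= j" "0 <= j"
  and bdd: "!!r. r \<in> A ==> r <= T' ==> nrm (H 0 r) <= M0" and r: "r \<in> A" "r <= T'"
 shows "nrm (H 0 r) <= b + 2 * j"
proof -
 have sH: "sqi (H 0 r)" if "r \<in> A" for r using H1_sqi[OF H_H1[OF that] zero_idx] .
 define S where "S = (SUP r\<in>{r\<in>A. r <= T'}. nrm (H 0 r))"
 have up: "nrm (H 0 r) <= S" if "r \<in> A" "r <= T'" for r
  unfolding S_def by (rule cSUP_upper) (use that bdd in \<open>auto intro!: bdd_aboveI2[where M = M0]\<close>)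
 have S0: "0 <= S" using up[OF s(1)] s(2) nrm_nonneg[of "H 0 s"] by linarith
 have b0: "0 <= b" using b[OF s(1)] nrm_nonneg[of "H 0 s"] by linarith
 define B where "B = sqrt (b\<^sup>2 + 2 * S * j)"
 have 1: "nrm (H 0 r) <= B" if r: "r \<in> A" "r < T'" for r
  unfolding B_def
 proof (rule real_le_rsqrt, cases "r <= s")
  case True
  then have "(nrm (H 0 r))\<^sup>2 <= b\<^sup>2" using b[OF r(1)] by (intro power_mono) auto
  then show "(nrm (H 0 r))\<^sup>2 <= b\<^sup>2 + 2 * S * j" using mult_nonneg_nonneg[OF S0 j(2)] by simp
 next
  case False
  have "(nrm (H 0 r))\<^sup>2 / 2 <= (nrm (H 0 s))\<^sup>2 / 2 + S * (lint (%r. indicator {s<..T'} r * nrm (F r)))"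
   by (rule energy(1)[OF s(1) r(1) _ r(2) zero_less_one up pos]) (use False in auto)
  moreover have "S * (lint (%r. indicator {s<..T'} r * nrm (F r))) <= S * j" by (rule mult_left_mono[OF j(1) S0])
  moreover have "(nrm (H 0 s))\<^sup>2 <= b\<^sup>2" using b[OF s(1)] by (intro power_mono) auto
  ultimately show "(nrm (H 0 r))\<^sup>2 <= b\<^sup>2 + 2 * S * j" by simp
 qed
 \<comment> \<open>The energy inequality needs room to the right of r; the end point r = T' is
   reached by continuity from good times just before it.\<close>
 have 2: "nrm (H 0 r) <= B" if r: "r \<in> A" "r <= T'" for r
 proof (rule field_le_epsilon)
  fix e :: real assume e: "0 < e"
  obtain d where d: "d > 0" "\<forall>s\<in>A. \<forall>t\<in>A. s <= T' --> t <= T' --> \<bar>s - t\<bar> <= d --> nrm (%x. H 0 s x - H 0 t x) <= e"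
   using ucont[OF e, of T'] by (elim exE conjE)
  have r0: "0 < r" using r A_pos by auto
  obtain r' where r': "max 0 (r - d) < r'" "r' < r" "r' \<in> A"
   by (rule A_AE_ex[OF A_AE, of "max 0 (r - d)" r]) (use r0 d(1) in auto)
  have "nrm (H 0 r) <= nrm (H 0 r') + nrm (%x. H 0 r x - H 0 r' x)" by (rule nrm_diff_le[OF sH[OF r(1)] sH[OF r'(3)]])
  also have "... <= B + e" using r r' d(2) by (intro add_mono 1) auto
  finally show "nrm (H 0 r) <= B + e" .
 qed
 have "S <= B" unfolding S_def by (rule cSUP_least) (use s 2 in auto)
 then have "S\<^sup>2 <= B\<^sup>2" using S0 by (intro power_mono) auto
 also have "... = b\<^sup>2 + 2 * S * j" unfolding B_def using S0 j(2) by (intro real_sqrt_pow2) simp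
 finally have S2: "S\<^sup>2 <= b\<^sup>2 + 2 * S * j" .
 have "S <= b + 2 * j"
 proof (rule ccontr)
  assume "\<not> S <= b + 2 * j"
  then have "b * b < S * (S - 2 * j)" using b0 j(2) by (intro mult_strict_mono') auto
  then show False using S2 by (simp add: power2_eq_square algebra_simps)
 qed
 then show ?thesis using up[OF r] by simp
qed

text \<open>Pigeonhole over K consecutive windows: the dissipation from \<sigma> + 1 on is at most
  M^2, so one window carries at most 2 M^2 / K, the factor 2 making the contrary strictly
  impossible. There the average is small by \<open>window_gradient\<close> and
  \<open>window_small\<close>, and the oscillation bound carries this to the solution at the left
  end of the window.\<close>

lemma small_time:
 fixes H :: "'a::euclidean_space => real => 'a => complex"
 assumes evo: "evo \<Omega> V \<kappa> A H (%t x. a * N t x) F"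
  and NL: "!!t x. NL m (H 0 t x) (N t x)" and m: "0 <= m" "m <= 1" and a: "0 < Im a"
  and \<sigma>: "\<sigma> \<in> A" and h: "0 < h" and K: "0 < K" and M: "0 < M" and T: "T' = \<sigma> + 2 + real K * h"
  and bound: "!!r. r \<in> A ==> r <= T' ==> nrm (H 0 r) <= M"
  and I: "(lint (%r. indicator {\<sigma><..T'} r * nrm (F r))) <= M / 2"
  and osc: "!!r s. r \<in> A ==> s \<in> A ==> \<sigma> < r ==> r <= s ==> s <= r + h ==> s <= T' ==> nrm (%x. H 0 s x - H 0 r x) <= e'"
  and \<rho>: "\<rho> = 2 * M\<^sup>2 / (Im a * h * real K)" "\<rho> <= 1"
  and La: "La = 2 * (2 * M / h * M + evo.CV V * M\<^sup>2 + 2 * cmod a + M / h * M)"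
  and de: "0 < de" "de <= 1" and k: "0 < k"
  and num: "(1 + 2 * k) * \<rho> + 2 * M ^ 4 / (de ^ DIM('a) * k\<^sup>2) / bvol TYPE('a) + 8 * de\<^sup>2 * La <= e\<^sup>2" and e: "0 <= e"
 obtains t where "t \<in> A" "\<sigma> < t" "t <= T'" "nrm (H 0 t) <= e + e'"
proof -
 interpret evo \<Omega> V \<kappa> A H "%t x. a * N t x" F by (rule evo)
 have \<sigma>0: "0 < \<sigma>" using \<sigma> A_pos by auto
 define q where "q s x = cmod (H 0 s x) powr (m + 1)" for s x
 have Ima: "Im (a * N s x * cnj (H 0 s x)) = Im a * q s x" for s x
  unfolding mult.assoc NL_mult_cnj[OF NL] q_def by simp
 have q0: "0 <= q s x" for s x by (simp add: q_def)
 have pos: "0 <= Im (a * N s x * cnj (H 0 s x))" for s x unfolding Ima using a q0 by simp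
 have mH: "(%p. H 0 (fst p) (snd p)) \<in> bm" using H_meas[OF zero_idx] by (simp add: case_prod_beta')
 then have "(%p. cmod (H 0 (fst p) (snd p)) powr (m + 1)) \<in> bm" by measurable
 then have mq: "(%(s, x). q s x) \<in> bm" by (simp add: case_prod_beta' q_def)
 have mq': "(%x. q s x) \<in> bm" for s
  using section_measurable(1)[OF H_meas[OF zero_idx], of s] unfolding q_def by measurable
 define D where "D r = ennreal (Im a) * (nint (%x. ennreal (q r x)))" for r
 have mD0: "(%r. nint (%x. ennreal (q r x))) \<in> bm"
 proof -
  have "(%p. ennreal ((%(s, x). q s x) p)) \<in> bm" using mq by (rule measurable_compose) simp
  then have "(%(s, x). ennreal (q s x)) \<in> borel_measurable (borel \<Otimes>\<^sub>M lborel)"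
   by (simp add: case_prod_beta' borel_prod[symmetric] cong: measurable_cong_sets)
  then show ?thesis by (rule lborel.borel_measurable_nn_integral)
 qed
 have mD [measurable]: "D \<in> bm" unfolding D_def[abs_def] using mD0 by measurable
 \<comment> \<open>A single p is sought for which all K + 1 grid points are good times. It is taken
   beyond \<sigma> + 1, the unit being the left margin in the energy inequality.\<close>
 have "AE t in lborel. \<forall>i\<in>{..K}. 0 < t --> t + real i * h \<in> A"
 proof (rule AE_finite_allI)
  fix i
  show "AE t in lborel. 0 < t --> t + real i * h \<in> A"
   using AE_A_shift[of "real i * h"] by eventually_elim (use h in auto)
 qed simp
 then have "AE t in lborel. 0 < t --> (\<forall>i\<in>{..K}. t + real i * h \<in> A)" by eventually_elim auto
 then obtain p where p: "\<sigma> + 1 < p" "p < \<sigma> + 2" "\<forall>i\<in>{..K}. p + real i * h \<in> A"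
  by (rule A_AE_ex[of _ "\<sigma> + 1" "\<sigma> + 2"]) (use \<sigma>0 in auto)
 have Kh: "0 < real K * h" using K h by simp
 have "(nint (%r. indicator {\<sigma> + 1<..p + real K * h} r * (nint (%x. ennreal (Im (a * N r x * cnj (H 0 r x)))))))
   <= ennreal ((nrm (H 0 \<sigma>))\<^sup>2 / 2 + M * (lint (%r. indicator {\<sigma><..T'} r * nrm (F r))))"
  by (rule energy(2)[OF \<sigma> _ _ _ zero_less_one bound pos]) (use p Kh T in auto)
 also have "(%r. nint (%x. ennreal (Im (a * N r x * cnj (H 0 r x))))) = D"
 proof
  fix r
  have [measurable]: "(%x. q r x) \<in> bm" by (rule mq')
  show "(nint (%x. ennreal (Im (a * N r x * cnj (H 0 r x))))) = D r"
   unfolding Ima D_def using a q0 by (subst nn_integral_cmult[symmetric]) (auto simp: ennreal_mult)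
 qed
 also have "ennreal ((nrm (H 0 \<sigma>))\<^sup>2 / 2 + M * (lint (%r. indicator {\<sigma><..T'} r * nrm (F r)))) <= ennreal (M\<^sup>2)"
 proof (rule ennreal_leI)
  have "(nrm (H 0 \<sigma>))\<^sup>2 <= M\<^sup>2" by (intro power_mono bound \<sigma>) (use T Kh in auto)
  moreover have "M * (lint (%r. indicator {\<sigma><..T'} r * nrm (F r))) <= M * (M / 2)" using M by (intro mult_left_mono I) auto
  ultimately show "(nrm (H 0 \<sigma>))\<^sup>2 / 2 + M * (lint (%r. indicator {\<sigma><..T'} r * nrm (F r))) <= M\<^sup>2" by (simp add: power2_eq_square)
 qed
 finally have EN: "(nint (%r. indicator {\<sigma> + 1<..p + real K * h} r * D r)) <= ennreal (M\<^sup>2)" .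
 define X where "X i = (nint (%r. indicator {p + real i * h<..p + real i * h + h} r * D r))" for i
 have SX: "(\<Sum>i<n. X i) <= (nint (%r. indicator {p<..p + real n * h} r * D r))" for n
 proof (induction n)
  case (Suc n)
  have "(\<Sum>i<Suc n. X i) <= (nint (%r. indicator {p<..p + real n * h} r * D r)) + X n" using Suc.IH by (simp add: add_right_mono)
  also have "... = (nint (%r. indicator {p<..p + real n * h} r * D r + indicator {p + real n * h<..p + real n * h + h} r * D r))"
   unfolding X_def by (rule nn_integral_add[symmetric]) measurable
  also have "... <= (nint (%r. indicator {p<..p + real (Suc n) * h} r * D r))"
  proof (rule nn_integral_mono)
   fix r
   define y where "y = real n * h"
   have y: "0 <= y" "real (Suc n) * h = y + h" using h by (auto simp: y_def algebra_simps)
   show "indicator {p<..p + real n * h} r * D r + indicator {p + real n * h<..p + real n * h + h} r * D r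
    <= indicator {p<..p + real (Suc n) * h} r * D r"
    unfolding y(2) y_def[symmetric] using h y(1) by (auto simp: indicator_def)
  qed
  finally show ?case .
 qed simp
 have "\<exists>i<K. X i <= ennreal (2 * M\<^sup>2 / real K)"
 proof (rule ccontr)
  assume c: "\<not> (\<exists>i<K. X i <= ennreal (2 * M\<^sup>2 / real K))"
  have "ennreal (2 * M\<^sup>2) = (\<Sum>i<K. ennreal (2 * M\<^sup>2 / real K))" using K by (subst sum_ennreal) auto
  also have "... <= (\<Sum>i<K. X i)" by (rule sum_mono) (use c in \<open>auto simp: not_le intro: less_imp_le\<close>)
  also have "... <= (nint (%r. indicator {p<..p + real K * h} r * D r))" by (rule SX)
  also have "... <= (nint (%r. indicator {\<sigma> + 1<..p + real K * h} r * D r))"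
   by (intro nn_integral_mono mult_right_mono) (use p in \<open>auto simp: indicator_def\<close>)
  also note EN
  finally have "2 * M\<^sup>2 <= M\<^sup>2" by (subst (asm) ennreal_le_iff) auto
  then show False using M by simp
 qed
 then obtain i where i: "i < K" "X i <= ennreal (2 * M\<^sup>2 / real K)" by (elim exE conjE)
 define t where "t = p + real i * h"
 have tA: "t \<in> A" using p(3) i unfolding t_def by simp
 have thA: "t + h \<in> A" using p(3)[rule_format, of "Suc i"] i unfolding t_def by (simp add: algebra_simps)
 have ih: "0 <= real i * h" using h by simp
 have thT: "t + h <= T'"
 proof -
  have "real (Suc i) * h <= real K * h" using i h by (intro mult_right_mono) auto
  then show ?thesis unfolding t_def T using p by (simp add: algebra_simps)
 qed
 have t0: "0 <= t" and \<sigma>t: "\<sigma> < t" using p \<sigma>0 ih by (auto simp: t_def)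
 have \<rho>0: "0 <= \<rho>" unfolding \<rho>(1) using a h by simp
 have \<rho>D: "(\<integral>\<^sup>+s. nint (%x. ennreal (q s x)) \<partial>win t h) <= ennreal \<rho>"
 proof -
  have "(\<integral>\<^sup>+s. nint (%x. ennreal (q s x)) \<partial>win t h) = (nint (%s. ennreal (indicator {t<..t + h} s / h) * (nint (%x. ennreal (q s x)))))"
   unfolding win_def using mD0 by (subst nn_integral_density) auto
  also have "... = (nint (%s. ennreal (1 / (Im a * h)) * (indicator {t<..t + h} s * D s)))"
  proof (rule nn_integral_cong)
   fix s
   have e1: "ennreal (1 / (Im a * h)) * ennreal (Im a) = ennreal (1 / h)"
    using a h by (subst ennreal_mult[symmetric]) auto
   show "ennreal (indicator {t<..t + h} s / h) * (nint (%x. ennreal (q s x))) = ennreal (1 / (Im a * h)) * (indicator {t<..t + h} s * D s)"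
    by (cases "s \<in> {t<..t + h}") (simp_all add: D_def mult.assoc[symmetric] e1)
  qed
  also have "... = ennreal (1 / (Im a * h)) * X i"
   unfolding X_def t_def by (rule nn_integral_cmult) measurable
  also have "... <= ennreal (1 / (Im a * h)) * ennreal (2 * M\<^sup>2 / real K)" by (rule mult_left_mono[OF i(2)]) simp
  also have "... = ennreal \<rho>" unfolding \<rho>(1) using a h by (subst ennreal_mult[symmetric]) auto
  finally show ?thesis .
 qed
 have f0: "(\<integral>r. nrm (F r) \<partial>win t h) <= M / h"
 proof -
  have ss: "intl (%r. indicator S r * nrm (F r))" if "S \<subseteq> {0..T'}" "S \<in> sets borel" for S
   using set_integrable_subset[OF F_int[of T'], of S] that by (simp add: set_integrable_def)
  have mF: "(%r. nrm (F r)) \<in> bm" by (rule nrm_measurable[OF F_meas])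
  have "(\<integral>r. nrm (F r) \<partial>win t h) = (1 / h) * (lint (%r. indicator {t<..t + h} r * nrm (F r)))"
   using integral_win[OF mF h, of t] by simp
  also have "... <= (1 / h) * (lint (%r. indicator {\<sigma><..T'} r * nrm (F r)))"
  proof (rule mult_left_mono, rule integral_mono)
   show "intl (%r. indicator {t<..t + h} r * nrm (F r))" by (rule ss) (use t0 thT in auto)
   show "intl (%r. indicator {\<sigma><..T'} r * nrm (F r))" by (rule ss) (use \<sigma>0 in auto)
   show "indicator {t<..t + h} r * nrm (F r) <= indicator {\<sigma><..T'} r * nrm (F r)" for r
    using \<sigma>t thT by (intro mult_right_mono) (auto simp: indicator_def)
  qed (use h in simp)
  also have "... <= (1 / h) * M" using I M h by (intro mult_left_mono) auto
  finally show ?thesis by simp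
 qed
 have PW: "cmod (Pw R t h) <= 2 * cmod a * \<rho>" for R
 proof (rule Pw_bound[OF t0 h mq norm_ge_zero q0 _ \<rho>D \<rho>0])
  fix s s' x
  have "cmod (N s x) * cmod (H 0 s' x) <= q s x + q s' x" unfolding q_def by (rule NL_young[OF NL m(1)])
  then have "cmod a * (cmod (N s x) * cmod (H 0 s' x)) <= cmod a * (q s x + q s' x)" by (rule mult_left_mono) simp
  then show "cmod (a * N s x) * cmod (H 0 s' x) <= cmod a * (q s x + q s' x)" by (simp add: norm_mult mult.assoc)
 qed
 have bt: "nrm (H 0 r) <= M" if "r \<in> A" "r <= t + h" for r using bound[OF that(1)] that(2) thT by simp
 have "(\<Sum>b\<in>Basis. (nrm (W t h b))\<^sup>2) <= 2 * (2 * M / h * M + CV * M\<^sup>2 + 2 * cmod a * \<rho> + M / h * M)"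
  by (rule window_gradient[OF tA thA h bt f0 PW])
 \<comment> \<open>With \<rho> <= 1 the bound becomes independent of \<rho>, so that La can be fixed
   before the number K of windows.\<close>
 also have "... <= La" unfolding La using mult_left_le[OF \<rho>(2), of "2 * cmod a"] by simp
 finally have S: "(\<Sum>b\<in>Basis. (nrm (W t h b))\<^sup>2) <= La" .
 have q1: "(cmod (H 0 s x))\<^sup>2 <= q s x" if "cmod (H 0 s x) <= 1" for s x
  using powr_mono'[of "m + 1" 2 "cmod (H 0 s x)"] that m by (simp add: q_def powr_numeral)
 have q2: "cmod (H 0 s x) <= q s x" if "cmod (H 0 s x) > 1" for s x
  using powr_mono[of 1 "m + 1" "cmod (H 0 s x)"] that m by (simp add: q_def)
 have "(nrm (W t h 0))\<^sup>2 <= (1 + 2 * k) * \<rho> + 2 * M ^ 4 / (de ^ DIM('a) * k\<^sup>2) / bvol TYPE('a) + 8 * de\<^sup>2 * La"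
  by (rule window_small[OF t0 h mq q1 q2 \<rho>D \<rho>0 nrm_W_le[OF t0 h bt] S k de])
 also note num
 finally have "(nrm (W t h 0))\<^sup>2 <= e\<^sup>2" .
 then have W: "nrm (W t h 0) <= e" by (rule power2_le_imp_le[OF _ e])
 have c: "nrm (%x. W t h 0 x - H 0 t x) <= e'"
  by (rule W_close[OF t0 h tA]) (use osc tA \<sigma>t thT in auto)
 have sW: "sqi (W t h 0)" using H1_sqi[OF H1_w[OF t0 h] zero_idx] by (simp add: W_def)
 have "nrm (H 0 t) <= nrm (W t h 0) + nrm (%x. H 0 t x - W t h 0 x)"
  by (rule nrm_diff_le[OF H1_sqi[OF H_H1[OF tA] zero_idx] sW])
 then have "nrm (H 0 t) <= e + e'" using W c by (simp add: nrm_minus_commute[of "H 0 t"])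
 then show thesis using tA \<sigma>t thT h by (intro that[of t]) auto
qed

text \<open>The energy inequality for the difference of the solution and its translate by ta = s -
  r: its dissipation is nonnegative by monotonicity, its norm is at most 2 M and its forcing
  integrates to at most 2 J, whence 2 * 2 M * 2 J = 8 M J. The starting time p lies in (\<sigma>0,
  \<sigma>), where the increment is small by hypothesis.\<close>

lemma osc_bound:
 fixes H :: "'a::euclidean_space => real => 'a => complex"
 assumes evo: "evo \<Omega> V \<kappa> A H (%t x. a * N t x) F"
  and NL: "!!t x. NL m (H 0 t x) (N t x)" and m: "0 <= m" "m <= 1" and a: "a \<in> Cset m"
  and \<sigma>: "0 <= \<sigma>0" "\<sigma>0 < \<sigma>"
  and bound: "!!r. r \<in> A ==> r <= T' + h ==> nrm (H 0 r) <= M"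
  and J: "(lint (%r. indicator {\<sigma>0<..T' + h} r * nrm (F r))) <= J"
  and ini: "!!r s. r \<in> A ==> s \<in> A ==> \<sigma>0 < r ==> r < \<sigma> ==> r <= s ==> s <= r + h ==> nrm (%x. H 0 s x - H 0 r x) <= e0"
  and r: "r \<in> A" "s \<in> A" "\<sigma> <= r" "r <= s" "s <= r + h" "r < T'"
 shows "(nrm (%x. H 0 s x - H 0 r x))\<^sup>2 <= e0\<^sup>2 + 8 * M * J"
proof -
 interpret evo \<Omega> V \<kappa> A H "%t x. a * N t x" F by (rule evo)
 define ta where "ta = s - r"
 have ta: "0 <= ta" "ta <= h" "r + ta = s" using r by (auto simp: ta_def)
 have "AE t in lborel. 0 < t --> t \<in> {t \<in> A. t + ta \<in> A}" using AE_A_shift[of ta] by eventually_elim (use ta in auto)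
 then obtain p where p: "\<sigma>0 < p" "p < \<sigma>" "p \<in> {t \<in> A. t + ta \<in> A}" by (rule A_AE_ex[OF _ \<sigma>])
 interpret S: evo \<Omega> V \<kappa> "{t \<in> A. t + ta \<in> A}" "%i t x. H i (t + ta) x - H i t x"
  "%t x. a * N (t + ta) x - a * N t x" "%t x. F (t + ta) x - F t x" by (rule evo_shift[OF ta(1)])
 have sH: "sqi (H 0 r)" if "r \<in> A" for r using H1_sqi[OF H_H1[OF that] zero_idx] .
 have M0: "0 <= M" using order_trans[OF nrm_nonneg bound[OF r(1)]] r by simp
 let ?I = "lint (%r. indicator {p<..T'} r * nrm (%x. F (r + ta) x - F r x))"
 have "(nrm (%x. H 0 (r + ta) x - H 0 r x))\<^sup>2 / 2 <= (nrm (%x. H 0 (p + ta) x - H 0 p x))\<^sup>2 / 2 + (M + M) * ?I"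
 proof (rule S.energy(1)[OF p(3) _ _ r(6) zero_less_one])
  show "r \<in> {t \<in> A. t + ta \<in> A}" "p < r" using r p ta by auto
  show "nrm (%x. H 0 (u + ta) x - H 0 u x) <= M + M" if "u \<in> {t \<in> A. t + ta \<in> A}" "u <= T'" for u
  proof -
   have u: "u \<in> A" "u + ta \<in> A" using that by auto
   have "nrm (%x. H 0 (u + ta) x - H 0 u x) <= nrm (H 0 (u + ta)) + nrm (H 0 u)" by (rule sqi_diff(2)[OF sH[OF u(2)] sH[OF u(1)]])
   also have "... <= M + M" using u that ta by (intro add_mono bound) auto
   finally show ?thesis .
  qed
  show "0 <= Im ((a * N (u + ta) x - a * N u x) * cnj (H 0 (u + ta) x - H 0 u x))" for u x
   unfolding right_diff_distrib[symmetric] by (rule NL_monotone[OF m a NL NL])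
 qed
 moreover have "nrm (%x. H 0 (p + ta) x - H 0 p x) <= e0" using p ta by (intro ini) auto
 then have "(nrm (%x. H 0 (p + ta) x - H 0 p x))\<^sup>2 <= e0\<^sup>2" by (intro power_mono) auto
 moreover have "(M + M) * ?I <= (M + M) * (J + J)"
 proof (rule mult_left_mono)
  define g where "g r = indicator {\<sigma>0<..T' + h} r * nrm (F r)" for r
  have ig: "intl g"
   using set_integrable_subset[OF F_int[of "T' + h"], of "{\<sigma>0<..T' + h}"] \<sigma> by (simp add: set_integrable_def g_def[abs_def] subset_eq)
  have ig': "intl (%r. g (r + ta))" "(lint (%r. g (r + ta))) = (lint (%r. g r))"
   using lborel_integrable_real_affine[OF ig, of 1 ta] lborel_integral_real_affine[of 1 g ta] by (simp_all add: add.commute)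
  have iL: "intl (%r. indicator {p<..T'} r * nrm (%x. F (r + ta) x - F r x))"
   using set_integrable_subset[OF S.F_int[of T'], of "{p<..T'}"] \<sigma> p by (simp add: set_integrable_def subset_eq)
  have "?I <= (lint (%r. g (r + ta) + g r))"
  proof (rule integral_mono_AE[OF iL BI_integrable_add[OF ig'(1) ig]])
   show "AE r in lborel. indicator {p<..T'} r * nrm (%x. F (r + ta) x - F r x) <= g (r + ta) + g r"
    using S.A_AE
   proof eventually_elim
    case (elim u)
    show ?case
    proof (cases "u \<in> {p<..T'}")
     case True
     then have u: "u \<in> A" "u + ta \<in> A" using elim p \<sigma> by auto
     have "nrm (%x. F (u + ta) x - F u x) <= nrm (F (u + ta)) + nrm (F u)" by (rule sqi_diff(2)[OF F_sqi[OF u(2)] F_sqi[OF u(1)]])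
     then show ?thesis using True p ta by (simp add: g_def)
    next
     case False
     then show ?thesis by (simp add: g_def)
    qed
   qed
  qed
  also have "... = (lint (%r. g (r + ta))) + (lint (%r. g r))" by (rule BI_integral_add[OF ig'(1) ig])
  also have "... <= J + J" unfolding ig'(2) using J[folded g_def] by simp
  finally show "?I <= J + J" .
 qed (use M0 in simp)
 ultimately show ?thesis unfolding ta(3) by (simp add: algebra_simps)
qed

section \<open>Choice of parameters and conclusion\<close>

lemma choose_parameters:
 fixes M La e c v :: real
 assumes M: "0 < M" and La: "0 <= La" and e: "0 < e" and c: "0 < c" and v: "0 < v"
 obtains de k :: real and K :: nat where "0 < de" "de <= 1" "0 < k" "0 < K" "2 * M\<^sup>2 / (c * real K) <= 1"
  "(1 + 2 * k) * (2 * M\<^sup>2 / (c * real K)) + 2 * M ^ 4 / (de ^ d * k\<^sup>2) / v + 8 * de\<^sup>2 * La <= e\<^sup>2"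
proof -
 \<comment> \<open>Each of the three summands is made at most e^2 / 4: de is chosen in terms of La,
   then k in terms of de, and K in terms of k. The dependencies allow no other order.\<close>
 define de where "de = min 1 (e / (6 * (La + 1)))"
 have de: "0 < de" "de <= 1" using e La by (auto simp: de_def)
 have "de <= e / (6 * (La + 1))" by (simp add: de_def)
 then have "de * (La + 1) <= e / 6" using La by (simp add: field_simps)
 then have "(de * (La + 1))\<^sup>2 <= (e / 6)\<^sup>2" using de La by (intro power_mono) auto
 then have x1: "36 * (de\<^sup>2 * (La + 1)\<^sup>2) <= e\<^sup>2" by (simp add: power_mult_distrib power_divide)
 have x2: "0 <= de\<^sup>2 * (La + 1)\<^sup>2" by simp
 have "La <= (La + 1)\<^sup>2" using La by (simp add: power2_eq_square algebra_simps)
 then have x3: "de\<^sup>2 * La <= de\<^sup>2 * (La + 1)\<^sup>2" by (intro mult_left_mono) auto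
 have t3: "8 * de\<^sup>2 * La <= e\<^sup>2 / 4" unfolding mult.assoc using x1 x2 x3 by linarith
 define c0 where "c0 = 2 * M ^ 4 / de ^ d / v"
 have c0: "0 < c0" using M de v by (simp add: c0_def)
 define k where "k = max 1 (4 * c0 / e\<^sup>2)"
 have k: "1 <= k" "4 * c0 / e\<^sup>2 <= k" by (auto simp: k_def)
 have e2: "0 < e\<^sup>2" using e by simp
 have "4 * c0 <= k * e\<^sup>2" using k(2) e2 by (simp add: pos_divide_le_eq)
 also have "... <= k\<^sup>2 * e\<^sup>2" using k(1) e2 by (intro mult_right_mono) (auto simp: power2_eq_square)
 finally have "c0 / k\<^sup>2 <= e\<^sup>2 / 4" using k(1) by (simp add: pos_divide_le_eq mult.commute)
 moreover have "2 * M ^ 4 / (de ^ d * k\<^sup>2) / v = c0 / k\<^sup>2" by (simp add: c0_def)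
 ultimately have t2: "2 * M ^ 4 / (de ^ d * k\<^sup>2) / v <= e\<^sup>2 / 4" by simp
 define Y where "Y = 2 * M\<^sup>2 / c"
 have Y: "0 < Y" using M c by (simp add: Y_def)
 define z where "z = (1 + 2 * k) * 4 / e\<^sup>2"
 have z: "0 < z" using k(1) e2 by (simp add: z_def)
 obtain K :: nat where K: "Y * (1 + z) < real K" using reals_Archimedean2 by blast
 have Yz: "Y <= Y * (1 + z)" "Y * z <= Y * (1 + z)" using Y z by auto
 have K0: "0 < real K" using K Yz Y by linarith
 have \<rho>: "2 * M\<^sup>2 / (c * real K) = Y / real K" by (simp add: Y_def)
 have t1: "Y / real K <= 1" using K Yz K0 by simp
 have "Y * z <= real K" using K Yz by linarith
 then have "z * (Y / real K) <= 1" using K0 by (simp add: mult.commute)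
 then have "(1 + 2 * k) * (Y / real K) * (4 / e\<^sup>2) <= 1" by (simp add: z_def mult_ac)
 moreover have "w <= E / 4" if "w * (4 / E) <= 1" "0 < E" for w E :: real using that by (simp add: field_simps)
 ultimately have "(1 + 2 * k) * (Y / real K) <= e\<^sup>2 / 4" using e2 by blast
 then have "(1 + 2 * k) * (2 * M\<^sup>2 / (c * real K)) + 2 * M ^ 4 / (de ^ d * k\<^sup>2) / v + 8 * de\<^sup>2 * La <= e\<^sup>2"
  unfolding \<rho> using t2 t3 e2 by linarith
 moreover have "0 < k" "0 < K" using k(1) K0 by auto
 ultimately show thesis using de t1 by (intro that[of de k K]) (auto simp: \<rho>)
qed

text \<open>Order of choice: \<epsilon>, the tail time \<sigma>0, h from the modulus of continuity
  of u up to a little after \<sigma>0, and the number K of windows. The threshold for T depends on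
  these alone; for each T an approximating solution is then chosen that is close to u up to a time
  beyond T.\<close>

theorem theorem3p3:
  fixes \<Omega> :: "'a::euclidean_space set" and m :: real and a :: complex and V :: "'a \<Rightarrow> real"
    and f :: "real \<Rightarrow> 'a \<Rightarrow> complex" and u0 :: "'a \<Rightarrow> complex" and u :: "real \<Rightarrow> 'a \<Rightarrow> complex"
  assumes "assumption1 \<Omega> m a V"
    and "L1_L2 \<Omega> f"
    and "memLp 2 \<Omega> u0"
    and "weak_sol \<Omega> m V a f u0 u"
  shows "((\<lambda>t. Lpn 2 \<Omega> (u t)) \<longlongrightarrow> 0) at_top"
proof -
 have \<Omega>: "open \<Omega>" and m: "0 <= m" "m <= 1" and aC: "a \<in> Cset m" and pV: "pot_ok \<Omega> V"
  using assms(1) by (auto simp: assumption1_def Cint_def split: if_splits)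
 have S: "\<Omega> \<in> sets borel" using \<Omega> by simp
 have ima: "0 < Im a" using aC by (simp add: Cset_def)
 obtain V' \<kappa> where V': "V' \<in> bm" "morrey (%x. ennreal \<bar>V' x\<bar>) \<kappa>"
  "rep \<Omega> (%x. cor (V x)) (%x. cor (V' x))" by (rule pot_rep[OF S pV])
 have jf: "jmeas \<Omega> f" using assms(2) by (simp add: L1_L2_def)
 obtain f' where f': "jrep \<Omega> f f'" by (rule ex_jrep[OF S jf])
 define g where "g t = nrm (f' t)" for t
 have mg [measurable]: "g \<in> bm"
  unfolding g_def[abs_def] by (rule nrm_measurable[OF jrep_measurable[OF f']])
 have g0: "0 <= g t" for t by (simp add: g_def)
 have gz: "g t = 0" if "t <= 0" for t
 proof -
  have "f' t = (%x. 0)" using jrep_0[OF f'] that by auto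
  then show ?thesis by (simp add: g_def nrm_0)
 qed
 have aef: "AE t in lborel. 0 < t --> rep \<Omega> (f t) (f' t) & memLp 2 \<Omega> (f t)"
 proof -
  have "AE t in lebesgue_on {0<..}. memLp 2 \<Omega> (f t)" using assms(2) by (simp add: L1_L2_def)
  then have "AE t in lborel. t \<in> {0<..} --> memLp 2 \<Omega> (f t)" by (subst (asm) AE_lebesgue_on) auto
  then show ?thesis using jrep_AE[OF f'] by eventually_elim auto
 qed
 have ig: "intl g"
 proof (rule integrableI_bounded)
  have "(nint (%t. ennreal (norm (g t)))) = (nint (%t. ennreal (Lpn 2 \<Omega> (f t)) * indicator {0<..} t))"
  proof (rule nn_integral_cong_AE)
   show "AE t in lborel. ennreal (norm (g t)) = ennreal (Lpn 2 \<Omega> (f t)) * indicator {0<..} t"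
    using aef
   proof eventually_elim
    case (elim t)
    show ?case
    proof (cases "0 < t")
     case True
     then have "Lpn 2 \<Omega> (f t) = g t" using elim rep_Lpn[OF S] by (simp add: g_def)
     then show ?thesis using True g0[of t] by simp
    qed (simp add: gz)
   qed
  qed
  also have "... = (\<integral>\<^sup>+t. ennreal (Lpn 2 \<Omega> (f t)) \<partial>lebesgue_on {0<..})"
   by (subst nn_integral_restrict_space) (auto simp: nn_integral_completion)
  also have "... < \<infinity>" using assms(2) by (simp add: L1_L2_def)
  finally show "(nint (%t. ennreal (norm (g t)))) < \<infinity>" .
 qed measurable
 define X where "X s = (lint (%t. indicator {s<..} t * g t))" for s :: real
 have iX: "intl (%t. indicator {s<..} t * g t)" for s :: real
  by (rule BI_integrable_bound[OF ig]) (auto simp: indicator_def)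
 have Xmono: "X s <= X s'" if "s' <= s" for s s'
  unfolding X_def by (rule integral_mono[OF iX iX], rule mult_right_mono) (use that g0 in \<open>auto simp: indicator_def\<close>)
 have X0: "0 <= X s" for s unfolding X_def by (rule BI_integral_nonneg) (use g0 in auto)
 define j0 where "j0 = X 0"
 have Xlim: "(%n. X (real n)) \<longlonglongrightarrow> 0"
 proof -
  have "(%n. lint (%t. indicator {real n<..} t * g t)) \<longlonglongrightarrow> (\<integral>t. 0 \<partial>(lborel :: real measure))"
  proof (rule integral_dominated_convergence[OF _ _ ig])
   show "AE t in lborel. (%n. indicator {real n<..} t * g t) \<longlonglongrightarrow> 0"
   proof (rule AE_I2, rule tendsto_eventually)
    fix t :: real
    obtain k :: nat where "t <= real k" using real_arch_simple by blast
    then show "eventually (%n. indicator {real n<..} t * g t = 0) sequentially"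
     by (intro eventually_sequentiallyI[of k]) (auto simp: indicator_def)
   qed
   show "AE t in lborel. norm (indicator {real n<..} t * g t) <= g t" for n
    using g0 by (auto simp: indicator_def)
  qed measurable
  then show ?thesis by (simp add: X_def)
 qed
 have uC: "C_L2 \<Omega> u" using assms(4) by (simp add: weak_sol_def)
 have "\<exists>us fs. (\<forall>n. H2sol \<Omega> m V a (fs n) (us n) & L1loc_L2 \<Omega> (fs n) & C_L2 \<Omega> (us n)) &
    (\<forall>T>0. ((%n. \<integral>\<^sup>+ t. ennreal (Lpn 2 \<Omega> (%x. fs n t x - f t x)) \<partial>(lebesgue_on {0<..<T})) \<longlongrightarrow> 0) sequentially) &
    (\<forall>T>0. ((%n. SUP t\<in>{0..T}. ennreal (Lpn 2 \<Omega> (%x. us n t x - u t x))) \<longlongrightarrow> 0) sequentially)"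
  using assms(4) by (simp only: weak_sol_def)
 then obtain us fs where w: "\<forall>n. H2sol \<Omega> m V a (fs n) (us n) & L1loc_L2 \<Omega> (fs n) & C_L2 \<Omega> (us n)"
  and fl: "!!T. T > 0 ==> (%n. \<integral>\<^sup>+ t. ennreal (Lpn 2 \<Omega> (%x. fs n t x - f t x)) \<partial>(lebesgue_on {0<..<T})) \<longlonglongrightarrow> 0"
  and ul: "!!T. T > 0 ==> (%n. SUP t\<in>{0..T}. ennreal (Lpn 2 \<Omega> (%x. us n t x - u t x))) \<longlonglongrightarrow> 0"
  by auto
 then have us: "!!n. H2sol \<Omega> m V a (fs n) (us n)" "!!n. L1loc_L2 \<Omega> (fs n)" "!!n. C_L2 \<Omega> (us n)" by auto
 have mu: "memLp 2 \<Omega> (u t)" if "0 <= t" for t using uC that by (simp add: C_L2_def)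
 have mus: "memLp 2 \<Omega> (us n t)" if "0 <= t" for t n using us(3)[of n] that by (simp add: C_L2_def)
 have L0: "0 <= Lpn p \<Omega> q" for p q by (simp add: Lpn_def)
 \<comment> \<open>A bound for the approximating solutions used below: the norm of u(0), plus 1 for
   continuity near time 0 and 1 for the approximation error, plus twice the total forcing, to which
   f contributes j0 and the approximation error at most 1.\<close>
 define M where "M = Lpn 2 \<Omega> (u 0) + 2 + 2 * (j0 + 1)"
 have M: "0 < M" "j0 + 1 <= M / 2" using L0[of 2 "u 0"] X0[of 0] by (auto simp: M_def j0_def field_simps)
 have main: "\<exists>T0. \<forall>T\<ge>T0. Lpn 2 \<Omega> (u T) < \<epsilon>" if \<epsilon>: "0 < \<epsilon>" for \<epsilon>
 proof -
  \<comment> \<open>The third bound makes (3 e1)^2 + 8 M (2 e1) at most (\<epsilon> / 8)^2, which is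
    the oscillation estimate for an initial increment 3 e1 and forcing 2 e1.\<close>
  define e1 where "e1 = min 1 (min (\<epsilon> / 8) (\<epsilon>\<^sup>2 / (64 * (9 + 16 * M))))"
  have e1: "0 < e1" "e1 <= 1" "e1 <= \<epsilon> / 8"
  proof -
   have "0 < \<epsilon>\<^sup>2 / (64 * (9 + 16 * M))" by (rule divide_pos_pos) (use \<epsilon> M in auto)
   then show "0 < e1" using \<epsilon> unfolding e1_def by (simp only: min_less_iff_conj zero_less_one) simp
   show "e1 <= 1" unfolding e1_def by (rule min.cobounded1)
   show "e1 <= \<epsilon> / 8" unfolding e1_def by (rule min.coboundedI2[OF min.cobounded1])
  qed
  have "e1 <= \<epsilon>\<^sup>2 / (64 * (9 + 16 * M))" unfolding e1_def by (rule min.coboundedI2[OF min.cobounded2])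
  then have e1': "64 * (9 * e1 + 16 * (M * e1)) <= \<epsilon>\<^sup>2" using M by (simp add: pos_le_divide_eq algebra_simps)
  have Me1: "0 <= M * e1" using M e1 by simp
  have "eventually (%n. X (real (Suc n)) < e1) sequentially"
   by (rule order_tendstoD(2)[OF LIMSEQ_Suc[OF Xlim] e1(1)])
  then obtain n0 where n0: "X (real (Suc n0)) < e1" by (auto simp: eventually_sequentially)
  define \<sigma>0 where "\<sigma>0 = real (Suc n0)"
  have \<sigma>0: "0 < \<sigma>0" "X \<sigma>0 <= e1" using n0 by (auto simp: \<sigma>0_def)
  \<comment> \<open>The range up to \<sigma>0 + 3 suffices because the starting times lie below
    \<sigma>0 + h and their translates below \<sigma>0 + 2 h, with h <= 1.\<close>
  obtain d where d: "d > 0" "!!s t. 0 <= s ==> s <= \<sigma>0 + 3 ==> 0 <= t ==> t <= \<sigma>0 + 3 ==> \<bar>s - t\<bar> <= d ==> Lpn 2 \<Omega> (%x. u s x - u t x) <= e1"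
   using C_L2_uniform[OF S uC e1(1), where T = "\<sigma>0 + 3"] by auto
  define h where "h = min d 1"
  have h: "0 < h" "h <= 1" "h <= d" using d(1) by (auto simp: h_def)
  define \<Lambda> where "\<Lambda> = 2 * (2 * M / h * M + evo.CV V' * M\<^sup>2 + 2 * cmod a + M / h * M)"
  \<comment> \<open>\<open>evo.CV V'\<close> is known to be nonnegative for an actual evolution,
    none of which is at hand yet; the maximum supplies the sign required of the parameter.\<close>
  define \<Lambda>' where "\<Lambda>' = max 0 \<Lambda>"
  obtain \<delta> k :: real and K :: nat where par: "0 < \<delta>" "\<delta> <= 1" "0 < k" "0 < K" "2 * M\<^sup>2 / (Im a * h * real K) <= 1"
   "(1 + 2 * k) * (2 * M\<^sup>2 / (Im a * h * real K)) + 2 * M ^ 4 / (\<delta> ^ DIM('a) * k\<^sup>2) / bvol TYPE('a) + 8 * \<delta>\<^sup>2 * \<Lambda>' <= (\<epsilon> / 8)\<^sup>2"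
   by (rule choose_parameters[of M \<Lambda>' "\<epsilon> / 8" "Im a * h" "bvol TYPE('a)" "DIM('a)"])
    (use M \<epsilon> ima h bvol_pos[where 'a = 'a] in \<open>auto simp: \<Lambda>'_def\<close>)
  have "8 * \<delta>\<^sup>2 * \<Lambda> <= 8 * \<delta>\<^sup>2 * \<Lambda>'" by (intro mult_left_mono) (auto simp: \<Lambda>'_def)
  then have num: "(1 + 2 * k) * (2 * M\<^sup>2 / (Im a * h * real K)) + 2 * M ^ 4 / (\<delta> ^ DIM('a) * k\<^sup>2) / bvol TYPE('a) + 8 * \<delta>\<^sup>2 * \<Lambda> <= (\<epsilon> / 8)\<^sup>2"
   using par(6) by linarith
  have Kh: "0 <= real K * h" using h by simp
  have "Lpn 2 \<Omega> (u T) < \<epsilon>" if T: "\<sigma>0 + 4 + real K * h <= T" for T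
  proof -
   \<comment> \<open>A margin beyond T: the energy inequality is applied at a time T1 < T + 1 and
     asks for bounds at later times as well.\<close>
   define Tm where "Tm = T + 3"
   have Tm: "\<sigma>0 + 7 + real K * h <= Tm" "0 < Tm" using T \<sigma>0 Kh by (auto simp: Tm_def)
   have "\<sigma>0 + 7 <= Tm" using Tm(1) Kh by linarith
   moreover have "\<sigma>0 + 4 <= T" using T Kh by linarith
   ultimately have Tm3: "\<sigma>0 + 7 <= Tm" "\<sigma>0 + 4 <= T" by simp_all
   obtain d0 where d0: "d0 > 0" "!!s t. 0 <= s ==> s <= 1 ==> 0 <= t ==> t <= 1 ==> \<bar>s - t\<bar> <= d0 ==> Lpn 2 \<Omega> (%x. u s x - u t x) <= 1"
    using C_L2_uniform[OF S uC zero_less_one, where T = 1] by auto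
   obtain d1 where d1: "d1 > 0" "!!s t. 0 <= s ==> s <= T + 1 ==> 0 <= t ==> t <= T + 1 ==> \<bar>s - t\<bar> <= d1 ==> Lpn 2 \<Omega> (%x. u s x - u t x) <= e1"
    using C_L2_uniform[OF S uC e1(1), where T = "T + 1"] by auto
   have e1e: "0 < ennreal e1" using e1 by simp
   \<comment> \<open>One index n serves both convergences. The forcing is controlled up to Tm + 1,
     so that the open interval contains Tm itself.\<close>
   have ev: "eventually (%n. (\<integral>\<^sup>+ t. ennreal (Lpn 2 \<Omega> (%x. fs n t x - f t x)) \<partial>(lebesgue_on {0<..<Tm + 1})) < ennreal e1 &
     (SUP t\<in>{0..Tm}. ennreal (Lpn 2 \<Omega> (%x. us n t x - u t x))) < ennreal e1) sequentially"
    by (intro eventually_conj order_tendstoD(2)[OF _ e1e] fl ul) (use Tm in auto)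
   obtain n where n: "(\<integral>\<^sup>+ t. ennreal (Lpn 2 \<Omega> (%x. fs n t x - f t x)) \<partial>(lebesgue_on {0<..<Tm + 1})) < ennreal e1"
     "(SUP t\<in>{0..Tm}. ennreal (Lpn 2 \<Omega> (%x. us n t x - u t x))) < ennreal e1"
    using eventually_happens[OF ev] by auto
   have un: "Lpn 2 \<Omega> (%x. us n t x - u t x) <= e1" if "0 <= t" "t <= Tm" for t
   proof -
    have "ennreal (Lpn 2 \<Omega> (%x. us n t x - u t x)) <= (SUP t\<in>{0..Tm}. ennreal (Lpn 2 \<Omega> (%x. us n t x - u t x)))"
     by (rule SUP_upper) (use that in auto)
    also note n(2)
    finally show ?thesis using L0 by (simp add: ennreal_less_iff)
   qed
   have "\<exists>A H N F. evo \<Omega> V' \<kappa> A H (%t x. a * N t x) F & (\<forall>t x. NL m (H 0 t x) (N t x)) &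
    (\<forall>t\<in>A. rep \<Omega> (us n t) (H 0 t)) & (\<forall>t\<in>A. rep \<Omega> (fs n t) (F t))"
   proof (rule H2sol_evo[OF \<Omega> m V' us(1)[of n] us(2)[of n] us(3)[of n]])
    fix A H N F
    assume h: "evo \<Omega> V' \<kappa> A H (%t x. a * N t x) F" "!!t x. NL m (H 0 t x) (N t x)"
     "!!t. t \<in> A ==> rep \<Omega> (us n t) (H 0 t)" "!!t. t \<in> A ==> rep \<Omega> (fs n t) (F t)"
    show ?thesis by (intro exI conjI allI ballI) (fact h(1), rule h(2), erule h(3), erule h(4))
   qed
   then obtain A H N F where E: "evo \<Omega> V' \<kappa> A H (%t x. a * N t x) F" and NL: "!!t x. NL m (H 0 t x) (N t x)"
    and rH: "!!t. t \<in> A ==> rep \<Omega> (us n t) (H 0 t)" and rF: "!!t. t \<in> A ==> rep \<Omega> (fs n t) (F t)"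
    by (elim exE conjE) simp
   interpret E: evo \<Omega> V' \<kappa> A H "%t x. a * N t x" F by (rule E)
   have A0: "0 < t" if "t \<in> A" for t using that E.A_pos by auto
   have y: "nrm (H 0 t) = Lpn 2 \<Omega> (us n t)" if "t \<in> A" for t by (rule rep_Lpn[OF S rH[OF that], symmetric])
   have yd: "nrm (%x. H 0 s x - H 0 t x) = Lpn 2 \<Omega> (%x. us n s x - us n t x)" if "s \<in> A" "t \<in> A" for s t
    by (rule rep_Lpn[OF S rep_diff[OF rH[OF that(1)] rH[OF that(2)]], symmetric])
   have yu: "nrm (H 0 t) <= Lpn 2 \<Omega> (u t) + e1" "Lpn 2 \<Omega> (u t) <= nrm (H 0 t) + e1" if t: "t \<in> A" "t <= Tm" for t
   proof -
    have t0: "0 <= t" using A0[OF t(1)] by simp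
    show "nrm (H 0 t) <= Lpn 2 \<Omega> (u t) + e1"
     using Lpn_diff_le[OF S mus[OF t0, of n] mu[OF t0]] un[OF t0 t(2)] y[OF t(1)] by simp
    show "Lpn 2 \<Omega> (u t) <= nrm (H 0 t) + e1"
     using Lpn_diff_le[OF S mu[OF t0] mus[OF t0, of n]] un[OF t0 t(2)] y[OF t(1)] Lpn_minus_commute[of 2 \<Omega> "u t" "us n t"] by simp
   qed
   \<comment> \<open>The forcing of the approximation is at most the tail of f plus its L^1 distance
     to f; beyond \<sigma>0 both are at most e1.\<close>
   have force: "(lint (%r. indicator {s<..T1} r * nrm (F r))) <= X s + e1" if s: "0 <= s" "T1 <= Tm" for s T1
   proof -
    define G where "G r = nrm (%x. F r x - f' r x)" for r
    have mFf: "(%(r, x). F r x - f' r x) \<in> bm"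
     using borel_measurable_diff[OF E.F_meas jrep_measurable[OF f']] by (simp add: case_prod_beta')
    have [measurable]: "G \<in> bm" unfolding G_def[abs_def] by (rule nrm_measurable[OF mFf])
    have [measurable]: "(%r. nrm (F r)) \<in> bm" by (rule nrm_measurable[OF E.F_meas])
    have G: "AE r in lborel. 0 < r --> G r = Lpn 2 \<Omega> (%x. fs n r x - f r x) & nrm (F r) <= g r + G r"
     using aef E.A_AE
    proof eventually_elim
     case (elim r)
     show ?case
     proof
      assume "0 < r"
      then have r: "rep \<Omega> (f r) (f' r)" "memLp 2 \<Omega> (f r)" "r \<in> A" using elim by auto
      show "G r = Lpn 2 \<Omega> (%x. fs n r x - f r x) & nrm (F r) <= g r + G r"
       unfolding G_def g_def rep_Lpn[OF S rep_diff[OF rF[OF r(3)] r(1)]]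
       using nrm_diff_le[OF E.F_sqi[OF r(3)] rep_sqi[OF S r(1,2)]] by simp
     qed
    qed
    have "(nint (%r. ennreal (indicator {s<..T1} r * nrm (F r)))) <=
     (nint (%r. ennreal (indicator {s<..} r * g r) + ennreal (G r) * indicator {0<..<Tm + 1} r))"
    proof (rule nn_integral_mono_AE)
     show "AE r in lborel. ennreal (indicator {s<..T1} r * nrm (F r)) <=
      ennreal (indicator {s<..} r * g r) + ennreal (G r) * indicator {0<..<Tm + 1} r"
      using G
     proof eventually_elim
      case (elim r)
      show ?case
      proof (cases "r \<in> {s<..T1}")
       case True
       then have "ennreal (nrm (F r)) <= ennreal (g r + G r)" using elim s by (intro ennreal_leI) auto
       then show ?thesis using True s g0[of r] by (simp add: ennreal_plus G_def)
      qed simp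
     qed
    qed
    also have "... = (nint (%r. ennreal (indicator {s<..} r * g r))) + (nint (%r. ennreal (G r) * indicator {0<..<Tm + 1} r))"
     by (rule nn_integral_add) measurable
    also have "(nint (%r. ennreal (indicator {s<..} r * g r))) = ennreal (X s)"
     unfolding X_def by (rule nn_integral_eq_integral[OF iX]) (use g0 in auto)
    also have "(nint (%r. ennreal (G r) * indicator {0<..<Tm + 1} r)) =
     (nint (%r. ennreal (Lpn 2 \<Omega> (%x. fs n r x - f r x)) * indicator {0<..<Tm + 1} r))"
     by (rule nn_integral_cong_AE) (use G in \<open>auto simp: indicator_def elim!: eventually_mono\<close>)
    also have "... = (\<integral>\<^sup>+ t. ennreal (Lpn 2 \<Omega> (%x. fs n t x - f t x)) \<partial>(lebesgue_on {0<..<Tm + 1}))"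
     by (subst nn_integral_restrict_space) (auto simp: nn_integral_completion)
    also have "ennreal (X s) + ... <= ennreal (X s) + ennreal e1" by (intro add_left_mono less_imp_le n(1))
    also have "... = ennreal (X s + e1)" using X0 e1 by (intro ennreal_plus[symmetric]) auto
    finally have le: "(nint (%r. ennreal (indicator {s<..T1} r * nrm (F r)))) <= ennreal (X s + e1)" .
    have "(lint (%r. indicator {s<..T1} r * nrm (F r))) = enn2real (nint (%r. ennreal (indicator {s<..T1} r * nrm (F r))))"
     by (rule integral_eq_nn_integral) auto
    also have "... <= X s + e1" by (rule enn2real_leI[OF _ le]) (use X0[of s] e1 in auto)
    finally show ?thesis .
   qed
   have force0: "(lint (%r. indicator {s<..T1} r * nrm (F r))) <= j0 + 1" if "0 <= s" "T1 <= Tm" for s T1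
    using force[OF that] Xmono[of 0 s] that e1 by (simp add: j0_def)
   have force1: "(lint (%r. indicator {s<..T1} r * nrm (F r))) <= 2 * e1" if "\<sigma>0 <= s" "T1 <= Tm" for s T1
    using force[of s T1] Xmono[of \<sigma>0 s] that \<sigma>0 by simp
   have pos: "0 <= Im (a * N r x * cnj (H 0 r x))" for r x
    unfolding mult.assoc NL_mult_cnj[OF NL] using ima by simp
   obtain M0 where M0: "!!t. 0 <= t ==> t <= Tm ==> Lpn 2 \<Omega> (us n t) <= M0"
    using C_L2_bounded[OF S us(3)[of n], where T = Tm] by auto
   obtain s where s: "0 < s" "s < min d0 1" "s \<in> A"
    by (rule E.A_AE_ex[OF E.A_AE, of 0 "min d0 1"]) (use d0(1) in auto)
   have yM: "nrm (H 0 r) <= M" if r: "r \<in> A" "r <= Tm" for r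
    unfolding M_def
   proof (rule E.energy_global[OF pos s(3) _ _ _ _ _ r])
    show "s < Tm" using s Tm \<sigma>0 Kh by linarith
    show "nrm (H 0 r) <= Lpn 2 \<Omega> (u 0) + 2" if r: "r \<in> A" "r <= s" for r
    proof -
     have r0: "0 <= r" "r <= 1" "r <= d0" "r <= Tm" using A0[OF r(1)] r s Tm3 \<sigma>0(1) by auto
     have "Lpn 2 \<Omega> (u r) <= Lpn 2 \<Omega> (u 0) + 1"
      using Lpn_diff_le[OF S mu[OF r0(1)] mu[OF order_refl]] d0(2)[of r 0] r0 by simp
     then show ?thesis using yu(1)[OF r(1) r0(4)] e1 by simp
    qed
    show "(lint (%r. indicator {s<..Tm} r * nrm (F r))) <= j0 + 1" by (rule force0) (use s in auto)
    show "0 <= j0 + 1" using X0[of 0] by (simp add: j0_def)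
    show "nrm (H 0 r) <= M0" if "r \<in> A" "r <= Tm" for r using M0[of r] A0[of r] y[of r] that by simp
   qed
   obtain \<sigma> where \<sigma>: "\<sigma>0 < \<sigma>" "\<sigma> < \<sigma>0 + h" "\<sigma> \<in> A"
    by (rule E.A_AE_ex[OF E.A_AE, of \<sigma>0 "\<sigma>0 + h"]) (use \<sigma>0 h in auto)
   \<comment> \<open>The increments near \<sigma>0 are inherited from u: e1 for its modulus of
     continuity and e1 for the comparison at each of the two times.\<close>
   have ini: "nrm (%x. H 0 q x - H 0 r x) <= 3 * e1"
    if rq: "r \<in> A" "q \<in> A" "\<sigma>0 < r" "r < \<sigma>" "r <= q" "q <= r + h" for r q
   proof -
    have q0: "0 <= r" "0 <= q" "r <= Tm" "q <= Tm" "q <= \<sigma>0 + 3" "r <= \<sigma>0 + 3" "\<bar>q - r\<bar> <= d"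
     using rq \<sigma>0(1) \<sigma>(1,2) h Tm3 by auto
    have "Lpn 2 \<Omega> (%x. us n q x - us n r x) <= Lpn 2 \<Omega> (%x. us n q x - u q x) + Lpn 2 \<Omega> (%x. u q x - us n r x)"
     by (rule Lpn_triangle[OF S mus[OF q0(2)] mu[OF q0(2)] mus[OF q0(1)]])
    moreover have "Lpn 2 \<Omega> (%x. u q x - us n r x) <= Lpn 2 \<Omega> (%x. u q x - u r x) + Lpn 2 \<Omega> (%x. u r x - us n r x)"
     by (rule Lpn_triangle[OF S mu[OF q0(2)] mu[OF q0(1)] mus[OF q0(1)]])
    ultimately show ?thesis
     unfolding yd[OF rq(2,1)] using un[OF q0(2,4)] un[OF q0(1,3)] d(2)[OF q0(2,5,1,6,7)] Lpn_minus_commute[of 2 \<Omega> "u r" "us n r"] by simp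
   qed
   have osc: "nrm (%x. H 0 q x - H 0 r x) <= \<epsilon> / 8"
    if rq: "r \<in> A" "q \<in> A" "\<sigma> < r" "r <= q" "q <= r + h" "q <= \<sigma> + 2 + real K * h" for r q
   proof -
    have bd: "nrm (H 0 u) <= M" if "u \<in> A" "u <= (Tm - 1) + h" for u using yM that h by simp
    have J: "(lint (%r. indicator {\<sigma>0<..(Tm - 1) + h} r * nrm (F r))) <= 2 * e1" by (rule force1) (use h in auto)
    have "(nrm (%x. H 0 q x - H 0 r x))\<^sup>2 <= (3 * e1)\<^sup>2 + 8 * M * (2 * e1)"
     by (rule osc_bound[OF E NL m aC _ \<sigma>(1) bd J ini rq(1,2) _ rq(4,5)]) (use \<sigma>0 \<sigma> rq h Tm in auto)
    also have "... <= 9 * e1 + 16 * (M * e1)"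
     using mult_left_le[OF e1(2), of e1] e1(1) by (simp add: power2_eq_square)
    also have "... <= (\<epsilon> / 8)\<^sup>2" using e1' by (simp add: power_divide)
    finally show ?thesis by (rule power2_le_imp_le) (use \<epsilon> in simp)
   qed
   have TT: "\<sigma> + 2 + real K * h <= Tm" "\<sigma> + 2 + real K * h <= T - 1" using \<sigma> h Tm T by auto
   have bd: "nrm (H 0 r) <= M" if "r \<in> A" "r <= \<sigma> + 2 + real K * h" for r using yM that TT by simp
   have I: "(lint (%r. indicator {\<sigma><..\<sigma> + 2 + real K * h} r * nrm (F r))) <= M / 2"
    using force0[of \<sigma> "\<sigma> + 2 + real K * h"] TT \<sigma> \<sigma>0 M(2) by simp
   obtain t where t: "t \<in> A" "\<sigma> < t" "t <= \<sigma> + 2 + real K * h" "nrm (H 0 t) <= \<epsilon> / 8 + \<epsilon> / 8"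
    by (rule small_time[OF E NL m ima \<sigma>(3) h(1) par(4) M(1) refl bd I osc refl par(5) \<Lambda>_def par(1-3) num]) (use \<epsilon> in auto)
   \<comment> \<open>The energy inequality is available at good times only. A good time T1 just
     after T is used, and u(T) is reached by continuity of u.\<close>
   obtain T1 where T1: "T < T1" "T1 < T + min d1 1" "T1 \<in> A"
    by (rule E.A_AE_ex[OF E.A_AE, of T "T + min d1 1"]) (use Tm3 \<sigma>0(1) d1(1) in auto)
   have "(nrm (H 0 T1))\<^sup>2 / 2 <= (nrm (H 0 t))\<^sup>2 / 2 + M * (lint (%r. indicator {t<..Tm} r * nrm (F r)))"
    by (rule E.energy(1)[OF t(1) T1(3) _ _ zero_less_one yM pos]) (use t T1 TT in \<open>auto simp: Tm_def\<close>)
   moreover have "M * (lint (%r. indicator {t<..Tm} r * nrm (F r))) <= M * (2 * e1)"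
    by (rule mult_left_mono[OF force1]) (use t \<sigma> M in auto)
   moreover have "(nrm (H 0 t))\<^sup>2 <= (\<epsilon> / 4)\<^sup>2" using t(4) by (intro power_mono) auto
   ultimately have yy: "(nrm (H 0 T1))\<^sup>2 <= \<epsilon>\<^sup>2 / 16 + 4 * (M * e1)" by (simp add: power_divide)
   \<comment> \<open>Applied with p = M e1 and q = \<epsilon>^2: the choice of e1 gives 1024 M e1 <=
     \<epsilon>^2, so the forcing term 4 M e1 fits into the gap between \<epsilon>^2 / 16 and
     \<epsilon>^2 / 4.\<close>
   have gen: "q / 16 + 4 * p <= q / 4" if "64 * (9 * e + 16 * p) <= q" "0 <= p" "0 <= e" for p q e :: real
   proof -
    have "1024 * p <= q" using that(1,3) by simp
    then show ?thesis using that(2) by simp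
   qed
   have "(nrm (H 0 T1))\<^sup>2 <= \<epsilon>\<^sup>2 / 4"
    by (rule order_trans[OF yy gen[OF e1' Me1 less_imp_le[OF e1(1)]]])
   then have "(nrm (H 0 T1))\<^sup>2 <= (\<epsilon> / 2)\<^sup>2" by (simp add: power_divide)
   then have yT: "nrm (H 0 T1) <= \<epsilon> / 2" by (rule power2_le_imp_le) (use \<epsilon> in simp)
   have T0: "0 <= T" "0 <= T1" "T1 <= Tm" "T1 <= T + 1" "\<bar>T - T1\<bar> <= d1" using Tm3 T1 \<sigma>0(1) by (auto simp: Tm_def)
   have "Lpn 2 \<Omega> (u T) <= Lpn 2 \<Omega> (u T1) + e1"
    using Lpn_diff_le[OF S mu[OF T0(1)] mu[OF T0(2)]] d1(2)[of T T1] T0 by simp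
   then show ?thesis using yu(2)[OF T1(3) T0(3)] yT e1 \<epsilon> by simp
  qed
  then show ?thesis by blast
 qed
 show ?thesis
 proof (rule tendstoI)
  fix \<epsilon> :: real assume "0 < \<epsilon>"
  from main[OF this] obtain T0 where "\<forall>T\<ge>T0. Lpn 2 \<Omega> (u T) < \<epsilon>" ..
  then show "eventually (%t. dist (Lpn 2 \<Omega> (u t)) 0 < \<epsilon>) at_top"
   unfolding eventually_at_top_linorder using L0 by (intro exI[of _ T0]) simp
 qed
qed

end
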